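(* There exist an absolute constant $d_*>1$ and constants $C>0$, $\vartheta\in(0,1)$ such that the following holds. Let $V\in L^\infty(\mathbb R;\mathbb R)$, let $u\in L^\infty(\mathbb R)\cap H^{1/4}_{\mathrm{loc}}(\mathbb R)$ be a distributional solution of $(-\Delta)^{1/4}u+Vu=0$ in $\mathbb R$, let $U$ be the Caffarelli--Silvestre extension of $u$ and $W(x,z)=U(x,z^2/2)$. For every $\rho_0>0$, \[ \mathscr H_{\rho_0}(W)\le C\exp\left[C\left(1+\rho_0^2\|V\|_{L^\infty(\mathcal A_{\rho_0})}^2\right)\right]\mathscr M_{\rho_0}(W)^{2(1-\vartheta)}\left(\int_{\mathcal A_{\rho_0}}\frac{|u(x)|^2}{|x|}\,dx\right)^{\vartheta}. \]
   Context: $(-\Delta)^{1/4}$ has Fourier multiplier $|\xi|^{1/2}$ and is defined on bounded functions by duality with Schwartz functions. The Caffarelli--Silvestre (Poisson) extension is $U(x,y)=\int_{\mathbb R}P_y(h)u(x-h)\,dh$, $y>0$, with $P_y(h)=c_*\,y^{1/2}(h^2+y^2)^{-3/4}$, $\int P_y=1$. Let $\mathcal H=L^2((0,\pi),(\sin\varphi)^{1/2}d\varphi)$ and $J_{d_*}=(-d_*,1+d_* )$. For $\rho_0>0$: \[ \mathscr H_{\rho_0}(W)=\int_0^\pi\left|W\!\left(\tfrac{\rho_0^2}{2}\cos\varphi,\rho_0\sqrt{\sin\varphi}\right)\right|^2(\sin\varphi)^{1/2}\,d\varphi, \] \[ \mathscr M_{\rho_0}(W)=\sup_{\tau\in J_{d_*}}\left\|W\!\left(\tfrac{\rho_0^2e^{2\tau}}2\cos\varphi,\rho_0e^\tau\sqrt{\sin\varphi}\right)\right\|_{\mathcal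 H}\quad(\text{norm in }\varphi), \] \[ \mathcal A_{\rho_0}=\left\{x\in\mathbb R:\tfrac{\rho_0^2}{2}e^{-2d_*}<|x|<\tfrac{\rho_0^2}{2}e^{2(1+d_* )}\right\}. \] *)

theory Defs
  imports "HOL-Probability.Probability"
begin

text \<open>Essentially bounded functions. Elements of \<open>L\<^sup>\<infinity>\<close> are handled through representatives; every
  notion below depends only on the almost-everywhere class.\<close>

definition Linf_norm :: "real set \<Rightarrow> (real \<Rightarrow> 'a::real_normed_vector) \<Rightarrow> real" where
  "Linf_norm A f = real_of_ereal (esssup (lebesgue_on A) (\<lambda>x. ereal (norm (f x))))"

definition in_Linf :: "(real \<Rightarrow> 'a::real_normed_vector) \<Rightarrow> bool" where
  "in_Linf f \<longleftrightarrow> f \<in> borel_measurable lebesgue \<and> esssup lebesgue (\<lambda>x. ereal (norm (f x))) < \<infinity>"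

text \<open>\<open>H\<^sup>s\<close> on all bounded open intervals, \<open>0 < s < 1\<close>, via the Gagliardo (Sobolev--Slobodeckij)
  seminorm.\<close>

definition in_Hs_loc :: "real \<Rightarrow> (real \<Rightarrow> complex) \<Rightarrow> bool" where
  "in_Hs_loc s f \<longleftrightarrow> f \<in> borel_measurable lebesgue \<and>
    (\<forall>a b. a < b \<longrightarrow>
      (\<integral>\<^sup>+x\<in>{a<..<b}. ennreal ((cmod (f x))\<^sup>2) \<partial>lebesgue) < \<infinity> \<and>
      (\<integral>\<^sup>+x\<in>{a<..<b}. (\<integral>\<^sup>+y\<in>{a<..<b}.
          ennreal ((cmod (f x - f y))\<^sup>2 / \<bar>x - y\<bar> powr (1 + 2 * s)) \<partial>lebesgue) \<partial>lebesgue) < \<infinity>)"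

definition iter_deriv :: "nat \<Rightarrow> (real \<Rightarrow> complex) \<Rightarrow> real \<Rightarrow> complex" where
  "iter_deriv n f = ((\<lambda>g x. vector_derivative g (at x)) ^^ n) f"

definition schwartz :: "(real \<Rightarrow> complex) \<Rightarrow> bool" where
  "schwartz f \<longleftrightarrow> (\<forall>n x. iter_deriv n f differentiable at x) \<and>
    (\<forall>m n. bounded (range (\<lambda>x. x ^ m *\<^sub>R iter_deriv n f x)))"

definition fourier :: "(real \<Rightarrow> complex) \<Rightarrow> real \<Rightarrow> complex" where
  "fourier f \<xi> = (LINT x|lebesgue. exp (- (\<i> * of_real (x * \<xi>))) * f x)"

definition inv_fourier :: "(real \<Rightarrow> complex) \<Rightarrow> real \<Rightarrow> complex" where
  "inv_fourier g x = of_real (1 / (2 * pi)) * (LINT \<xi>|lebesgue. exp (\<i> * of_real (x * \<xi>)) * g \<xi>)"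

text \<open>\<open>(-\<Delta>)\<^sup>s\<close> on Schwartz functions, the Fourier multiplier \<open>\<bar>\<xi>\<bar>\<close> to the power \<open>2 s\<close>.\<close>

definition frac_laplacian :: "real \<Rightarrow> (real \<Rightarrow> complex) \<Rightarrow> real \<Rightarrow> complex" where
  "frac_laplacian s \<phi> = inv_fourier (\<lambda>\<xi>. of_real (\<bar>\<xi>\<bar> powr (2 * s)) * fourier \<phi> \<xi>)"

text \<open>\<open>(-\<Delta>)\<close> to the power \<open>1/4\<close> of a bounded \<open>u\<close> is the tempered distribution
  \<open>\<phi> \<mapsto> \<integral> u (-\<Delta>)\<^sup>s \<phi>\<close> with \<open>s = 1/4\<close> (bilinear pairing); for Schwartz \<open>\<phi>\<close> the function
  \<open>(-\<Delta>)\<^sup>s \<phi>\<close> is integrable.\<close>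

definition distributional_solution :: "(real \<Rightarrow> real) \<Rightarrow> (real \<Rightarrow> complex) \<Rightarrow> bool" where
  "distributional_solution V u \<longleftrightarrow>
    (\<forall>\<phi>. schwartz \<phi> \<longrightarrow>
      (LINT x|lebesgue. u x * frac_laplacian (1/4) \<phi> x)
        + (LINT x|lebesgue. of_real (V x) * u x * \<phi> x) = 0)"

text \<open>The value of the constant is forced by \<open>\<integral> P\<^sub>y = 1\<close>; see \<open>poisson_kernel_normalised\<close>.\<close>

definition poisson_const :: real where
  "poisson_const = 1 / (LINT h|lebesgue. (h\<^sup>2 + 1) powr (-3/4))"

definition poisson_kernel :: "real \<Rightarrow> real \<Rightarrow> real" where
  "poisson_kernel y h = poisson_const * y powr (1/2) * (h\<^sup>2 + y\<^sup>2) powr (-3/4)"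

definition cs_extension :: "(real \<Rightarrow> complex) \<Rightarrow> real \<Rightarrow> real \<Rightarrow> complex" where
  "cs_extension u x y = (LINT h|lebesgue. of_real (poisson_kernel y h) * u (x - h))"

definition sq_lift :: "(real \<Rightarrow> real \<Rightarrow> complex) \<Rightarrow> real \<Rightarrow> real \<Rightarrow> complex" where
  "sq_lift U x z = U x (z\<^sup>2 / 2)"

text \<open>The norm of \<open>L\<^sup>2((0,\<pi>), (sin \<phi>)\<close> to the power \<open>1/2\<close> \<open>d\<phi>)\<close>.\<close>

definition angular_norm :: "(real \<Rightarrow> complex) \<Rightarrow> real" where
  "angular_norm f = sqrt (LINT \<phi>:{0<..<pi}|lebesgue. (cmod (f \<phi>))\<^sup>2 * sin \<phi> powr (1/2))"

definition H_fun :: "real \<Rightarrow> (real \<Rightarrow> real \<Rightarrow> complex) \<Rightarrow> real" where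
  "H_fun \<rho> W = (LINT \<phi>:{0<..<pi}|lebesgue.
      (cmod (W (\<rho>\<^sup>2 / 2 * cos \<phi>) (\<rho> * sqrt (sin \<phi>))))\<^sup>2 * sin \<phi> powr (1/2))"

text \<open>The supremum is over a bounded set whenever \<open>W\<close> is bounded, as it is for the lift of the
  extension of an essentially bounded function.\<close>

definition M_fun :: "real \<Rightarrow> real \<Rightarrow> (real \<Rightarrow> real \<Rightarrow> complex) \<Rightarrow> real" where
  "M_fun d \<rho> W = (SUP \<tau>\<in>{-d<..<1 + d}.
      angular_norm (\<lambda>\<phi>. W (\<rho>\<^sup>2 * exp (2 * \<tau>) / 2 * cos \<phi>) (\<rho> * exp \<tau> * sqrt (sin \<phi>))))"

definition boundary_annulus :: "real \<Rightarrow> real \<Rightarrow> real set" where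
  "boundary_annulus d \<rho> =
    {x. \<rho>\<^sup>2 / 2 * exp (- 2 * d) < \<bar>x\<bar> \<and> \<bar>x\<bar> < \<rho>\<^sup>2 / 2 * exp (2 * (1 + d))}"

lemma poisson_profile_integrable:
  "integrable lborel (\<lambda>h::real. (h\<^sup>2 + 1) powr (-3/4))"
proof -
  let ?p = "\<lambda>t::real. indicator {1..} t *\<^sub>R t powr (-3/2)"
  have "(\<lambda>x::real. x powr (-3/2)) integrable_on {1..}"
    using has_integral_powr_to_inf[of "-3/2" 1] by (auto simp: integrable_on_def)
  then have "(\<lambda>x::real. x powr (-3/2)) absolutely_integrable_on {1..}"
    by (intro nonnegative_absolutely_integrable_1) auto
  then have p: "integrable lborel ?p"
    unfolding set_integrable_def by (subst integrable_completion[symmetric]) auto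
  have q: "integrable lborel (\<lambda>t. ?p (0 + (-1) * t))"
    by (rule lborel_integrable_real_affine[OF p]) simp
  have r: "integrable lborel (indicator {-1..1::real} :: real \<Rightarrow> real)"
    by (rule integrable_real_indicator) auto
  show ?thesis
  proof (rule Bochner_Integration.integrable_bound
      [OF Bochner_Integration.integrable_add[OF r Bochner_Integration.integrable_add[OF p q]]])
    show "AE h in lborel. norm ((h\<^sup>2 + 1) powr (-3/4))
        \<le> norm (indicator {-1..1} h + (?p h + ?p (0 + (-1) * h)))"
    proof (rule AE_I2)
      fix h :: real
      have le1: "(h\<^sup>2 + 1) powr (-3/4) \<le> 1"
        using powr_mono2'[of "-3/4" 1 "h\<^sup>2 + 1"] by simp
      have le2: "(h\<^sup>2 + 1) powr (-3/4) \<le> \<bar>h\<bar> powr (-3/2)" if "\<bar>h\<bar> \<ge> 1"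
      proof -
        have "(h\<^sup>2 + 1) powr (-3/4) \<le> (\<bar>h\<bar> powr 2) powr (-3/4)"
          using that by (intro powr_mono2') auto
        also have "\<dots> = \<bar>h\<bar> powr (-3/2)" by (subst powr_powr) simp
        finally show ?thesis .
      qed
      have "(h\<^sup>2 + 1) powr (-3/4) \<le> indicator {-1..1} h + (?p h + ?p (0 + (-1) * h))"
      proof (cases "\<bar>h\<bar> \<le> 1")
        case True
        then show ?thesis using le1
          by (auto simp: indicator_def intro: order_trans)
      next
        case False
        then show ?thesis using le2
          by (cases "h \<ge> 0") (auto simp: indicator_def)
      qed
      then show "norm ((h\<^sup>2 + 1) powr (-3/4))
        \<le> norm (indicator {-1..1} h + (?p h + ?p (0 + (-1) * h)))" by simp
    qed
  qed simp
qed

lemma poisson_kernel_normalised: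
  assumes "y > 0"
  shows "integrable lebesgue (poisson_kernel y)" "(LINT h|lebesgue. poisson_kernel y h) = 1"
proof -
  let ?f = "\<lambda>h::real. (h\<^sup>2 + 1) powr (-3/4)"
  let ?I = "integral\<^sup>L lborel ?f"
  have c: "poisson_const = 1 / ?I"
    unfolding poisson_const_def by (subst integral_completion) auto
  have meas: "poisson_kernel y \<in> borel_measurable lborel"
    unfolding poisson_kernel_def by measurable
  have "?I \<noteq> 0"
  proof
    assume "?I = 0"
    then have "AE h in lborel. ?f h = 0"
      by (subst (asm) integral_nonneg_eq_0_iff_AE[OF poisson_profile_integrable]) auto
    moreover have "?f h \<noteq> 0" for h using zero_le_power2[of h] by (simp add: add_nonneg_eq_0_iff)
    ultimately have "AE h in (lborel :: real measure). False" by simp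
    then show False by (simp add: eventually_False trivial_limit_def[symmetric] ae_filter_eq_bot_iff)
  qed
  have scale: "poisson_kernel y (0 + y * t) = poisson_const / y * ?f t" for t
  proof -
    have "((y * t)\<^sup>2 + y\<^sup>2) = y powr 2 * (t\<^sup>2 + 1)"
      using assms by (simp add: algebra_simps power_mult_distrib)
    then have e1: "((y * t)\<^sup>2 + y\<^sup>2) powr (-3/4) = y powr (-3/2) * ?f t"
      by (simp add: powr_mult powr_powr)
    have "y powr (1/2) * y powr (-3/2) = y powr (1/2 + -3/2)"
      by (rule powr_add[symmetric])
    also have "\<dots> = y powr (-1)" by simp
    also have "\<dots> = 1 / y" using assms by (simp only: powr_minus_divide powr_one)
    finally have e2: "y powr (1/2) * y powr (-3/2) = 1 / y" .
    have "poisson_kernel y (0 + y * t)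
        = poisson_const * y powr (1/2) * ((y * t)\<^sup>2 + y\<^sup>2) powr (-3/4)"
      by (simp add: poisson_kernel_def)
    also have "\<dots> = poisson_const * (y powr (1/2) * y powr (-3/2)) * ?f t"
      unfolding e1 by (simp only: mult.assoc)
    also have "\<dots> = poisson_const / y * ?f t"
      unfolding e2 by simp
    finally show ?thesis .
  qed
  have "integrable lborel (\<lambda>t. poisson_kernel y (0 + y * t))"
    unfolding scale using poisson_profile_integrable by simp
  then have "integrable lborel (poisson_kernel y)"
    using lborel_integrable_real_affine_iff[of y "poisson_kernel y" 0] assms by simp
  then show "integrable lebesgue (poisson_kernel y)"
    using meas by (subst integrable_completion) auto
  have "(LINT h|lborel. poisson_kernel y h) = \<bar>y\<bar> *\<^sub>R (LINT t|lborel. poisson_kernel y (0 + y * t))"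
    using assms by (intro lborel_integral_real_affine) simp
  also have "\<dots> = 1"
    unfolding scale using assms \<open>?I \<noteq> 0\<close> by (simp add: c)
  finally show "(LINT h|lebesgue. poisson_kernel y h) = 1"
    using meas by (subst integral_completion) auto
qed

end

theory Submission
  imports Defs "HOL-Complex_Analysis.Complex_Analysis"
begin

text \<open>
  Up to a scaling, the claim concerns the extension \<open>U\<close> of \<open>u\<close> on the
  half plane, in half annuli around the half circle of radius one. \<open>U\<close> solves a
  degenerate elliptic equation whose fundamental solution, with pole \<open>t\<close> on the
  boundary, is the kernel \<open>((x - t)\<^sup>2 + y\<^sup>2) powr (-1/4)\<close>, and the
  equation for \<open>u\<close> says that the conormal derivative of \<open>U\<close> at the
  boundary is a multiple of \<open>V u\<close>. Hence \<open>U\<close> is a constant plus a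
  renormalised potential of the bounded density \<open>f\<close>, a constant multiple of
  \<open>V u\<close> (lemma \<open>boundary_trace\<close>). This formula replaces all regularity
  theory: everything else is an estimate of this potential.

  Split \<open>f\<close> into its part on the boundary annulus and the rest. The potential of the
  first part is bounded pointwise by the \<open>L\<^sup>1\<close> norm of \<open>f\<close> on
  the annulus, hence by \<open>\<rho> * \<parallel>V\<parallel>\<close> times the data term. The
  potential of the rest has no sources inside the half annulus. There both expansions of the
  kernel are generating functions of the Gegenbauer functions \<open>geg n\<close> of parameter
  \<open>1/4\<close>, so that this part is a two sided series with terms \<open>(\<alpha> n * r
  ^ n + \<beta> n * r powr (- n - 1/2)) * geg n \<phi>\<close> (lemma
  \<open>exterior_expansion\<close>). The functions \<open>geg n\<close> are orthogonal for the
  weight \<open>(sin \<phi>) powr (1/2)\<close> and maximal at \<open>\<phi> = 0\<close>. The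
  first fact bounds the coefficients by the norms of \<open>U\<close> on a very small and a very
  large half circle; the second says that the norm of the series on the unit half circle is
  controlled once the series of absolute values at \<open>\<phi> = 0\<close> is.

  At \<open>\<phi> = 0\<close> and \<open>r = exp \<sigma>\<close> the series is \<open>\<Phi>
  \<sigma> = p (exp \<sigma>) + exp (- \<sigma>/2) * q (exp (- \<sigma>))\<close> with power
  series \<open>p\<close> and \<open>q\<close>. It extends holomorphically to a wide vertical
  strip, is bounded there by \<open>M\<close>, the supremum of the norms of \<open>U\<close> on
  the half circles, and on a real segment it has an \<open>L\<^sup>1\<close> norm bounded by the
  trace of \<open>u\<close> and by the local potential. The two constants theorem turns this
  into a bound by the geometric mean of \<open>M\<close> and the data on a square of side
  \<open>14\<close> about the origin (lemma \<open>small_from_L1_segment\<close>). The square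
  contains a period of \<open>exp\<close>, and the translation by \<open>2 * pi * \<i>\<close>
  preserves \<open>exp z\<close> but changes the sign of \<open>exp (- z/2)\<close>; so
  \<open>p\<close> and \<open>q\<close> are separately small on a circle, and Cauchy estimates
  make all coefficients small (lemma \<open>analytic_core\<close>). This is how the trace on the
  positive half line alone controls both kinds of modes, and it gives the exponent
  \<open>\<vartheta> = 1/2\<close> with a constant that grows only linearly in \<open>\<rho> *
  \<parallel>V\<parallel>\<close>, which the exponential of the claim absorbs.

  The potential formula itself comes from testing the equation with heat kernels. Integrating the
  heat kernel in time against a suitable weight produces the kernel above, and integrating its
  image under \<open>(-\<Delta>) powr (1/4)\<close> against the same weight produces the Poisson
  kernel of the extension; so the tested equation becomes an identity for vertical differences
  of \<open>U\<close> (lemma \<open>vertical_representation\<close>). Horizontal differences of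
  both sides vanish as the height tends to infinity, which fixes the formula up to one constant,
  and letting the height tend to zero identifies the boundary values.
\<close>

section \<open>Gegenbauer functions of parameter one quarter\<close>

text \<open>
  Taylor coefficients of \<open>(1 - z) powr (-1/4)\<close>.
\<close>

definition bcoef :: "nat \<Rightarrow> real" where
  "bcoef k = pochhammer (1/4) k / fact k"

text \<open>
  The Gegenbauer polynomial of degree \<open>n\<close> and parameter \<open>1/4\<close> at
  \<open>cos \<phi>\<close>, as a cosine sum: this form is what multiplying the binomial series
  of the two factors of \<open>1 - 2 * w * cos \<phi> + w\<^sup>2\<close> produces. The
  positivity of the coefficients makes \<open>\<phi> = 0\<close> the maximum and gives all
  bounds below without any theory of orthogonal polynomials.
\<close>

definition geg :: "nat \<Rightarrow> real \<Rightarrow> real" where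
  "geg n \<phi> = (\<Sum>k\<le>n. bcoef k * bcoef (n - k) * cos ((real n - 2 * real k) * \<phi>))"

lemma bcoef_pos: "bcoef k > 0"
  unfolding bcoef_def by (intro divide_pos_pos pochhammer_pos) auto

lemma bcoef_Suc: "real (Suc k) * bcoef (Suc k) = (real k + 1/4) * bcoef k"
proof -
  have "bcoef (Suc k) = (real k + 1/4) * bcoef k / real (Suc k)"
    unfolding bcoef_def pochhammer_Suc fact_Suc of_nat_mult by (simp add: mult_ac del: of_nat_Suc)
  then show ?thesis by simp
qed

lemma bcoef_le_1: "bcoef k \<le> 1"
proof (induction k)
  case (Suc k)
  have "(real k + 1/4) * bcoef k \<le> real (Suc k) * 1"
    using Suc bcoef_pos[of k] by (intro mult_mono) auto
  then have "real (Suc k) * bcoef (Suc k) \<le> real (Suc k) * 1"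
    unfolding bcoef_Suc .
  then show ?case by (simp del: of_nat_Suc)
qed (simp add: bcoef_def)

lemma geg_zero_pos: "geg n 0 > 0"
  unfolding geg_def by (intro sum_pos) (auto intro!: mult_pos_pos bcoef_pos)

lemma geg_zero_le: "geg n 0 \<le> real n + 1"
proof -
  have "geg n 0 \<le> (\<Sum>k\<le>n. 1)"
    unfolding geg_def
    by (intro sum_mono) (simp add: mult_le_one less_imp_le[OF bcoef_pos] bcoef_le_1)
  then show ?thesis by simp
qed

lemma abs_geg_le: "\<bar>geg n \<phi>\<bar> \<le> geg n 0"
proof -
  have "\<bar>geg n \<phi>\<bar> \<le> (\<Sum>k\<le>n. \<bar>bcoef k * bcoef (n - k) * cos ((real n - 2 * real k) * \<phi>)\<bar>)"
    unfolding geg_def by (rule sum_abs)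
  also have "\<dots> \<le> geg n 0"
    unfolding geg_def
  proof (intro sum_mono)
    fix k
    have "\<bar>bcoef k * bcoef (n - k) * cos ((real n - 2 * real k) * \<phi>)\<bar>
        = (bcoef k * bcoef (n - k)) * \<bar>cos ((real n - 2 * real k) * \<phi>)\<bar>"
      using bcoef_pos[of k] bcoef_pos[of "n - k"] by (simp add: abs_mult)
    also have "\<dots> \<le> (bcoef k * bcoef (n - k)) * 1"
      using bcoef_pos[of k] bcoef_pos[of "n - k"] by (intro mult_left_mono) auto
    finally show "\<bar>bcoef k * bcoef (n - k) * cos ((real n - 2 * real k) * \<phi>)\<bar>
        \<le> bcoef k * bcoef (n - k) * cos ((real n - 2 * real k) * 0)" by simp
  qed
  finally show ?thesis .
qed

lemma continuous_on_geg [continuous_intros]: "continuous_on S (geg n)"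
  unfolding geg_def by (intro continuous_intros)

lemma borel_measurable_geg [measurable]: "geg n \<in> borel_measurable borel"
  by (intro borel_measurable_continuous_onI continuous_on_geg)

text \<open>
  Each frequency in the sum is at most \<open>n\<close> and the cosine has Lipschitz constant one.
\<close>

lemma geg_lower: 
  assumes "\<phi> \<ge> 0"
  shows "geg n \<phi> \<ge> geg n 0 * (1 - real n * \<phi>)"
proof -
  have c: "cos x \<ge> 1 - \<bar>x\<bar>" for x :: real
  proof -
    have "\<bar>cos x - cos 0\<bar> \<le> 1 * \<bar>x - 0\<bar>"
      using field_differentiable_bound[of UNIV cos "\<lambda>x. - sin x" 1 0 x]
      by (auto simp: DERIV_cos intro!: DERIV_cos)
    then show ?thesis by auto
  qed
  have "geg n 0 * (1 - real n * \<phi>) = (\<Sum>k\<le>n. bcoef k * bcoef (n - k) * (1 - real n * \<phi>))"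
    by (simp add: geg_def sum_distrib_right)
  also have "\<dots> \<le> geg n \<phi>"
    unfolding geg_def
  proof (intro sum_mono mult_left_mono)
    fix k assume "k \<in> {..n}"
    then have "\<bar>real n - 2 * real k\<bar> \<le> real n" by auto
    then have "\<bar>(real n - 2 * real k) * \<phi>\<bar> \<le> real n * \<phi>"
      unfolding abs_mult using assms by (intro mult_mono) auto
    with c[of "(real n - 2 * real k) * \<phi>"] show "1 - real n * \<phi> \<le> cos ((real n - 2 * real k) * \<phi>)"
      by linarith
  qed (auto intro!: mult_nonneg_nonneg less_imp_le[OF bcoef_pos])
  finally show ?thesis .
qed

lemma bcoef_gchoose: "((-1/4 :: complex) gchoose k) * (-1) ^ k = of_real (bcoef k)"
proof -
  have "(-(1/4) :: complex) gchoose k = (-1) ^ k * pochhammer (1/4) k / fact k"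
    by (subst gbinomial_pochhammer) simp
  moreover have "pochhammer (1/4 :: complex) k = of_real (pochhammer (1/4) k)"
    using pochhammer_of_real[of "1/4" k, where 'a=complex] by simp
  ultimately show ?thesis
    by (simp add: bcoef_def flip: power_add mult_2)
qed

text \<open>
  For \<open>z = w * cis \<phi>\<close> the right hand side is \<open>(1 - z) powr (-1/4) * (1 -
  cnj z) powr (-1/4)\<close>, and the left hand side is the Cauchy product of the two binomial
  series.
\<close>

lemma geg_generating:
  fixes w \<phi> :: real
  assumes "\<bar>w\<bar> < 1"
  shows "(\<lambda>n. geg n \<phi> * w ^ n) sums ((1 - 2 * w * cos \<phi> + w\<^sup>2) powr (-1/4))"
proof -
  have Rec: "Re (of_real c * cis x) = c * cos x" for c x by simp
  define z where "z = of_real w * cis \<phi>"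
  have nz: "norm z < 1" "norm (cnj z) < 1" using assms by (auto simp: z_def norm_mult)
  have s: "(\<lambda>k. of_real (bcoef k) * x ^ k) sums (1 - x) powr (-1/4)" if "norm x < 1" for x :: complex
  proof -
    have "(\<lambda>n. ((-1/4) gchoose n) * (-x) ^ n) sums (1 + - x) powr (-1/4)"
      using that by (intro gen_binomial_complex) simp
    moreover have "((-1/4) gchoose n) * (-x) ^ n = of_real (bcoef n) * x ^ n" for n
      unfolding bcoef_gchoose[symmetric] by (subst power_minus) (simp add: mult_ac)
    ultimately show ?thesis by simp
  qed
  have ns: "summable (\<lambda>k. norm (of_real (bcoef k) * x ^ k :: complex))" if "norm x < 1" for x :: complex
  proof (rule summable_comparison_test'[where N=0])
    show "summable (\<lambda>k. norm x ^ k)" using that by (intro summable_geometric) auto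
    show "norm (norm (of_real (bcoef k) * x ^ k)) \<le> norm x ^ k" for k
      using bcoef_pos[of k] bcoef_le_1[of k] by (simp add: norm_mult norm_power mult_left_le_one_le)
  qed
  have "(\<lambda>n. \<Sum>k\<le>n. (of_real (bcoef k) * z ^ k) * (of_real (bcoef (n - k)) * cnj z ^ (n - k)))
      sums ((\<Sum>k. of_real (bcoef k) * z ^ k) * (\<Sum>k. of_real (bcoef k) * cnj z ^ k))"
    by (intro Cauchy_product_sums ns nz)
  then have S: "(\<lambda>n. \<Sum>k\<le>n. (of_real (bcoef k) * z ^ k) * (of_real (bcoef (n - k)) * cnj z ^ (n - k)))
      sums ((1 - z) powr (-1/4) * (1 - cnj z) powr (-1/4))"
    using s[OF nz(1)] s[OF nz(2)] by (simp add: sums_iff)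
  have Re1: "Re (1 - z) > 0"
    using nz(1) complex_Re_le_cmod[of z] by simp
  have "(1 - cnj z) powr (-1/4) = cnj ((1 - z) powr (-1/4))"
    using cnj_powr[of "1 - z" "-1/4"] Re1 by auto
  then have "(1 - z) powr (-1/4) * (1 - cnj z) powr (-1/4) = of_real ((norm ((1 - z) powr (-1/4)))\<^sup>2)"
    by (simp add: complex_norm_square[symmetric])
  also have "norm ((1 - z) powr (-1/4)) = norm (1 - z) powr (-1/4)"
    using norm_powr_real_powr'[of "of_real (-1/4)" "1 - z"] by simp
  also have "(norm (1 - z) powr (-1/4))\<^sup>2 = ((norm (1 - z))\<^sup>2) powr (-1/4)"
    using Re1 by (subst powr_power) (auto simp: powr_powr simp flip: powr_numeral)
  also have "(norm (1 - z))\<^sup>2 = 1 - 2 * w * cos \<phi> + w\<^sup>2"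
  proof -
    have "(norm (1 - z))\<^sup>2 = (1 - w * cos \<phi>)\<^sup>2 + (w * sin \<phi>)\<^sup>2"
      by (simp add: z_def cmod_power2)
    also have "\<dots> = 1 - 2 * w * cos \<phi> + w\<^sup>2 * ((sin \<phi>)\<^sup>2 + (cos \<phi>)\<^sup>2)"
      unfolding power2_eq_square by algebra
    finally show ?thesis by simp
  qed
  finally have S': "(\<lambda>n. Re (\<Sum>k\<le>n. (of_real (bcoef k) * z ^ k) * (of_real (bcoef (n - k)) * cnj z ^ (n - k))))
     sums ((1 - 2 * w * cos \<phi> + w\<^sup>2) powr (-1/4))"
    using sums_Re[OF S] by simp
  have "Re (\<Sum>k\<le>n. (of_real (bcoef k) * z ^ k) * (of_real (bcoef (n - k)) * cnj z ^ (n - k))) = geg n \<phi> * w ^ n"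
    for n
    unfolding geg_def Re_sum sum_distrib_right
  proof (intro sum.cong refl)
    fix k assume k: "k \<in> {..n}"
    have "z ^ k * cnj z ^ (n - k) = of_real (w ^ n) * cis ((real n - 2 * real k) * (- \<phi>))"
    proof -
      have "z ^ k * cnj z ^ (n - k) = of_real (w ^ k * w ^ (n - k)) * (cis (real k * \<phi>) * cis (real (n - k) * (- \<phi>)))"
        by (simp add: z_def power_mult_distrib Complex.DeMoivre cis_cnj)
      also have "w ^ k * w ^ (n - k) = w ^ n" using k by (simp flip: power_add)
      also have "cis (real k * \<phi>) * cis (real (n - k) * (- \<phi>)) = cis ((real n - 2 * real k) * (- \<phi>))"
        unfolding cis_mult using k by (intro arg_cong[where f=cis]) (auto simp: of_nat_diff algebra_simps)
      finally show ?thesis .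
    qed
    then have "(of_real (bcoef k) * z ^ k) * (of_real (bcoef (n - k)) * cnj z ^ (n - k)) =
      of_real (bcoef k * bcoef (n - k) * w ^ n) * cis ((real n - 2 * real k) * (- \<phi>))"
      by (simp add: mult_ac)
    then have "Re ((of_real (bcoef k) * z ^ k) * (of_real (bcoef (n - k)) * cnj z ^ (n - k))) =
      Re (of_real (bcoef k * bcoef (n - k) * w ^ n) * cis ((real n - 2 * real k) * (- \<phi>)))" by (rule arg_cong)
    also have "\<dots> = bcoef k * bcoef (n - k) * w ^ n * cos ((real n - 2 * real k) * \<phi>)"
      unfolding Rec by simp
    finally show "Re ((of_real (bcoef k) * z ^ k) * (of_real (bcoef (n - k)) * cnj z ^ (n - k)))
        = bcoef k * bcoef (n - k) * cos ((real n - 2 * real k) * \<phi>) * w ^ n"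
      by (simp only: mult_ac)
  qed
  with S' show ?thesis by simp
qed

definition geg' :: "nat \<Rightarrow> real \<Rightarrow> real" where
  "geg' n \<phi> = (\<Sum>k\<le>n. - (bcoef k * bcoef (n - k) * (real n - 2 * real k) * sin ((real n - 2 * real k) * \<phi>)))"

definition geg'' :: "nat \<Rightarrow> real \<Rightarrow> real" where
  "geg'' n \<phi> = (\<Sum>k\<le>n. - (bcoef k * bcoef (n - k) * (real n - 2 * real k)\<^sup>2 * cos ((real n - 2 * real k) * \<phi>)))"

lemma geg_deriv: "(geg n has_real_derivative geg' n \<phi>) (at \<phi>)"
  unfolding geg_def geg'_def by (auto intro!: derivative_eq_intros sum.cong)

lemma geg'_deriv: "(geg' n has_real_derivative geg'' n \<phi>) (at \<phi>)"
  unfolding geg'_def geg''_def by (auto intro!: derivative_eq_intros sum.cong simp: power2_eq_square)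

text \<open>
  The separated form, in polar coordinates, of the equation solved by the boundary kernel. Writing
  the products of trigonometric functions as sines of \<open>(m + 1) * \<phi>\<close> and
  \<open>(m - 1) * \<phi>\<close> turns the sum into a telescoping one, because of the
  recurrence \<open>bcoef_Suc\<close>.
\<close>

lemma geg_ode:
  "sin \<phi> * geg'' n \<phi> + cos \<phi> * geg' n \<phi> / 2 + real n * (real n + 1/2) * sin \<phi> * geg n \<phi> = 0"
proof -
  (* With m = n - 2 * k, the numbers A k and B k are the factors of sin ((m + 1) * phi) and sin ((m -
     1) * phi) in the k-th summand. The B-term of k cancels the A-term of k + 1; A 0 = 0 and B n
     = 0 close the sum. *)
  define A where "A k = 2 * real k * (2 * real n - 2 * real k + 1/2)" for k
  define B where "B k = (2 * real n - 2 * real k) * (2 * real k + 1/2)" for k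
  define c where "c k = bcoef k * bcoef (n - k)" for k
  define T where "T k = (if k \<le> n then c k * A k * sin ((real n - 2 * real k + 1) * \<phi>) else 0)" for k
  have step: "c k * B k = c (Suc k) * A (Suc k)" if "k < n" for k
  proof -
    obtain m where m: "n - k = Suc m" "n = k + Suc m"
      using \<open>k < n\<close> by (metis Suc_diff_Suc add_diff_inverse_nat not_less_iff_gr_or_eq)
    have "n - Suc k = m" using m by auto
    have "c k * B k = 2 * (bcoef k * (2 * real k + 1/2)) * (real (Suc m) * bcoef (Suc m))"
      using m by (simp add: c_def B_def algebra_simps)
    also have "\<dots> = 4 * ((real k + 1/4) * bcoef k) * (real m + 1/4) * bcoef m"
      unfolding bcoef_Suc by (simp add: algebra_simps)
    also have "\<dots> = 4 * (real (Suc k) * bcoef (Suc k)) * (real m + 1/4) * bcoef m"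
      unfolding bcoef_Suc ..
    also have "\<dots> = c (Suc k) * A (Suc k)"
      using m \<open>n - Suc k = m\<close> by (simp add: c_def A_def algebra_simps)
    finally show ?thesis .
  qed
  have "sin \<phi> * geg'' n \<phi> + cos \<phi> * geg' n \<phi> / 2 + real n * (real n + 1/2) * sin \<phi> * geg n \<phi>
    = (\<Sum>k\<le>n. 1/2 * (T k - T (Suc k)))"
    unfolding geg_def geg'_def geg''_def sum_distrib_left sum_divide_distrib sum.distrib[symmetric]
  proof (intro sum.cong refl)
    fix k assume k: "k \<in> {..n}"
    define m where "m = real n - 2 * real k"
    have e1: "cos (m * \<phi>) * sin \<phi> = (sin ((m + 1) * \<phi>) - sin ((m - 1) * \<phi>)) / 2"
      by (simp add: ring_distribs sin_add sin_diff)
    have e2: "sin (m * \<phi>) * cos \<phi> = (sin ((m + 1) * \<phi>) + sin ((m - 1) * \<phi>)) / 2"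
      by (simp add: ring_distribs sin_add sin_diff)
    have AB: "A k = real n * (real n + 1/2) - m\<^sup>2 - m / 2" "B k = real n * (real n + 1/2) - m\<^sup>2 + m / 2"
      unfolding A_def B_def m_def power2_eq_square by (simp_all add: field_simps)
    have "sin \<phi> * - (c k * m\<^sup>2 * cos (m * \<phi>)) + cos \<phi> * - (c k * m * sin (m * \<phi>)) / 2
       + real n * (real n + 1/2) * sin \<phi> * (c k * cos (m * \<phi>))
       = c k * ((real n * (real n + 1/2) - m\<^sup>2) * (cos (m * \<phi>) * sin \<phi>) - m / 2 * (sin (m * \<phi>) * cos \<phi>))"
      by (simp add: algebra_simps)
    also have "\<dots> = 1/2 * (c k * A k * sin ((m + 1) * \<phi>) - c k * B k * sin ((m - 1) * \<phi>))"
      unfolding e1 e2 AB by (simp add: field_simps)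
    also have "c k * B k * sin ((m - 1) * \<phi>) = T (Suc k)"
    proof (cases "k < n")
      case True
      then show ?thesis using step[OF True] by (simp add: T_def m_def algebra_simps)
    next
      case False
      then show ?thesis using k by (simp add: T_def B_def)
    qed
    also have "c k * A k * sin ((m + 1) * \<phi>) = T k" using k by (simp add: T_def m_def)
    finally show "sin \<phi> * - (bcoef k * bcoef (n - k) * (real n - 2 * real k)\<^sup>2 * cos ((real n - 2 * real k) * \<phi>)) +
         cos \<phi> * - (bcoef k * bcoef (n - k) * (real n - 2 * real k) * sin ((real n - 2 * real k) * \<phi>)) / 2 +
         real n * (real n + 1 / 2) * sin \<phi> * (bcoef k * bcoef (n - k) * cos ((real n - 2 * real k) * \<phi>)) =
         1/2 * (T k - T (Suc k))"
      unfolding m_def c_def by simp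
  qed
  also have "\<dots> = 1/2 * (T 0 - T (Suc n))"
    unfolding sum_distrib_left[symmetric] sum_telescope ..
  also have "\<dots> = 0" by (simp add: T_def A_def)
  finally show ?thesis .
qed

lemma sin_ge_half:
  assumes "0 \<le> x" "x \<le> pi / 2"
  shows "x / 2 \<le> sin x"
proof (cases "x \<le> pi / 3")
  case True
  have "sin 0 - 0 / 2 \<le> sin x - x / 2"
  proof (rule DERIV_nonneg_imp_nondecreasing[OF assms(1)])
    fix t assume t: "0 \<le> t" "t \<le> x"
    have "cos t \<ge> cos (pi / 3)" using t True by (intro cos_monotone_0_pi_le) auto
    then show "\<exists>y. ((\<lambda>x. sin x - x / 2) has_real_derivative y) (at t) \<and> 0 \<le> y"
      by (intro exI[of _ "cos t - 1/2"]) (auto intro!: derivative_eq_intros simp: cos_60)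
  qed
  then show ?thesis by simp
next
  case False
  have "sin x \<ge> sin (pi / 3)" using assms False by (intro sin_monotone_2pi_le) auto
  moreover have "x \<le> 8/5" using assms pi_less_4 pi_approx by simp
  moreover have "sqrt 3 \<ge> 17/10" by (rule real_le_rsqrt) (simp add: power2_eq_square)
  ultimately show ?thesis by (simp add: sin_60)
qed

text \<open>
  The angular part of the weight of the equation; in self-adjoint form \<open>geg_ode\<close> is a
  Sturm--Liouville equation with this weight.
\<close>

definition sin_weight :: "real \<Rightarrow> real" where "sin_weight \<phi> = sin \<phi> powr (1/2)"

lemma sin_weight_nonneg [simp]: "sin_weight \<phi> \<ge> 0" by (simp add: sin_weight_def)
lemma sin_weight_le_1: "\<phi> \<in> {0..pi} \<Longrightarrow> sin_weight \<phi> \<le> 1"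
  unfolding sin_weight_def using powr_mono2[of "1/2" "sin \<phi>" 1] by (auto simp: sin_ge_zero)
lemma sin_weight_measurable [measurable]: "sin_weight \<in> borel_measurable borel"
  unfolding sin_weight_def by measurable
lemma continuous_on_sin_weight: "continuous_on {0..pi} sin_weight"
  unfolding sin_weight_def by (intro continuous_intros continuous_on_powr') (auto simp: sin_ge_zero)

lemma geg_sin_weight_integrable:
  "set_integrable lborel {0..pi} (\<lambda>\<phi>. geg n \<phi> * geg m \<phi> * sin_weight \<phi>)"
  by (intro borel_integrable_atLeastAtMost' continuous_intros continuous_on_sin_weight)

text \<open>
  Sturm--Liouville theory by hand: the weighted Wronskian vanishes at both ends since the weight
  does, and its derivative is the difference of the eigenvalues \<open>n * (n + 1/2)\<close>
  times the weighted product.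
\<close>

lemma geg_orthogonal:
  assumes "n \<noteq> m"
  shows "(LBINT \<phi>:{0..pi}. geg n \<phi> * geg m \<phi> * sin_weight \<phi>) = 0"
proof -
  define L where "L k = real k * (real k + 1/2)" for k
  have Lne: "L n \<noteq> L m"
  proof -
    have "L n - L m = (real n - real m) * (real n + real m + 1/2)" by (simp add: L_def field_simps)
    moreover have "real n - real m \<noteq> 0" "real n + real m + 1/2 > 0" using assms by auto
    ultimately have "L n - L m \<noteq> 0" by simp
    then show ?thesis by simp
  qed
  define F where "F \<phi> = sin_weight \<phi> * (geg' n \<phi> * geg m \<phi> - geg n \<phi> * geg' m \<phi>)" for \<phi>
  have "((\<lambda>\<phi>. (L m - L n) * (geg n \<phi> * geg m \<phi> * sin_weight \<phi>)) has_integral (F pi - F 0)) {0..pi}"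
  proof (rule fundamental_theorem_of_calculus_interior)
    show "continuous_on {0..pi} F"
      unfolding F_def geg'_def by (intro continuous_intros continuous_on_sin_weight)
    fix \<phi> assume \<phi>: "\<phi> \<in> {0<..<pi}"
    then have s: "sin \<phi> > 0" by (auto intro: sin_gt_zero)
    have w: "(sin_weight has_real_derivative (sin_weight \<phi> * cos \<phi> / (2 * sin \<phi>))) (at \<phi>)"
    proof -
      have "sin \<phi> powr (1/2 - 1) = sin \<phi> powr (1/2) / sin \<phi>" using s by (simp only: powr_diff powr_one)
      then show ?thesis
        unfolding sin_weight_def using s by (auto intro!: derivative_eq_intros simp: field_simps)
    qed
    have "(F has_real_derivative (sin_weight \<phi> * cos \<phi> / (2 * sin \<phi>) * (geg' n \<phi> * geg m \<phi> - geg n \<phi> * geg' m \<phi>)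
       + sin_weight \<phi> * (geg'' n \<phi> * geg m \<phi> - geg n \<phi> * geg'' m \<phi>))) (at \<phi>)"
      unfolding F_def by (rule derivative_eq_intros w geg_deriv geg'_deriv refl)+ (simp add: algebra_simps)
    moreover have "sin_weight \<phi> * cos \<phi> / (2 * sin \<phi>) * (geg' n \<phi> * geg m \<phi> - geg n \<phi> * geg' m \<phi>)
       + sin_weight \<phi> * (geg'' n \<phi> * geg m \<phi> - geg n \<phi> * geg'' m \<phi>) = (L m - L n) * (geg n \<phi> * geg m \<phi> * sin_weight \<phi>)"
    proof -
      have o: "geg'' k \<phi> = - (cos \<phi> * geg' k \<phi> / (2 * sin \<phi>)) - L k * geg k \<phi>" for k
        using geg_ode[of \<phi> k] s unfolding L_def by (simp add: field_simps)
      show ?thesis unfolding o using s by (simp add: field_simps)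
    qed
    ultimately show "(F has_vector_derivative (L m - L n) * (geg n \<phi> * geg m \<phi> * sin_weight \<phi>)) (at \<phi>)"
      by (simp add: has_real_derivative_iff_has_vector_derivative)
  qed simp
  moreover have "F pi = 0" "F 0 = 0" by (auto simp: F_def sin_weight_def)
  ultimately have "((\<lambda>\<phi>. (L m - L n) * (geg n \<phi> * geg m \<phi> * sin_weight \<phi>)) has_integral 0) {0..pi}" by simp
  then have "(L m - L n) * integral {0..pi} (\<lambda>\<phi>. geg n \<phi> * geg m \<phi> * sin_weight \<phi>) = 0"
    by (metis integral_mult_right integral_unique)
  then have "integral {0..pi} (\<lambda>\<phi>. geg n \<phi> * geg m \<phi> * sin_weight \<phi>) = 0" using Lne by simp
  then show ?thesis using set_borel_integral_eq_integral(2)[OF geg_sin_weight_integrable, of n m] by simp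
qed

text \<open>
  A crude bound, which loses only a power of \<open>n\<close>; every power of \<open>n\<close> is
  later beaten by exponential factors. It uses only a short interval near \<open>\<phi> =
  0\<close>, where the function is at least half of its maximum.
\<close>

lemma geg_norm_lower:
  "(LBINT \<phi>:{0..pi}. geg n \<phi> * geg n \<phi> * sin_weight \<phi>) \<ge> (geg n 0)\<^sup>2 / (128 * (real n + 1)\<^sup>2)"
proof -
  (* On the interval from delta/2 to delta the function is at least half of its maximum and the
     weight is at least delta/4. *)
  define \<delta> where "\<delta> = 1 / (2 * (real n + 1))"
  have \<delta>: "0 < \<delta>" "\<delta> \<le> 1/2" "real n * \<delta> \<le> 1/2" by (auto simp: \<delta>_def field_simps)
  have pi: "pi > 3" using pi_gt3 .
  have "(LBINT \<phi>:{\<delta>/2..\<delta>}. (geg n 0)\<^sup>2 * \<delta> / 16) \<le> (LBINT \<phi>:{\<delta>/2..\<delta>}. geg n \<phi> * geg n \<phi> * sin_weight \<phi>)"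
  proof (rule set_integral_mono)
    show "set_integrable lborel {\<delta>/2..\<delta>} (\<lambda>\<phi>. (geg n 0)\<^sup>2 * \<delta> / 16)"
      by (intro borel_integrable_atLeastAtMost' continuous_intros)
    show "set_integrable lborel {\<delta>/2..\<delta>} (\<lambda>\<phi>. geg n \<phi> * geg n \<phi> * sin_weight \<phi>)"
      using \<delta> pi by (intro set_integrable_subset[OF geg_sin_weight_integrable]) auto
    fix \<phi> assume \<phi>: "\<phi> \<in> {\<delta>/2..\<delta>}"
    have "real n * \<phi> \<le> real n * \<delta>" using \<phi> by (intro mult_left_mono) auto
    then have "real n * \<phi> \<le> 1/2" using \<delta> by linarith
    then have "geg n 0 * (1/2) \<le> geg n 0 * (1 - real n * \<phi>)"
      using geg_zero_pos[of n] by (intro mult_left_mono) auto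
    then have g: "geg n 0 / 2 \<le> geg n \<phi>" using geg_lower[of \<phi> n] \<phi> \<delta> by simp
    have "sin \<phi> \<ge> \<phi> / 2"
      using \<phi> \<delta> pi by (intro sin_ge_half) auto
    then have s: "sin \<phi> \<ge> \<delta> / 4" using \<phi> by auto
    have "\<delta> / 4 \<le> sin \<phi> powr 1" using s \<delta> by simp
    also have "sin \<phi> powr 1 \<le> sin_weight \<phi>"
      unfolding sin_weight_def using s \<delta> by (intro powr_mono') auto
    finally have w: "\<delta> / 4 \<le> sin_weight \<phi>" .
    have "(geg n 0)\<^sup>2 * \<delta> / 16 = (geg n 0 / 2) * (geg n 0 / 2) * (\<delta> / 4)" by (simp add: power2_eq_square)
    also have "\<dots> \<le> geg n \<phi> * geg n \<phi> * sin_weight \<phi>"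
      using g w \<delta> geg_zero_pos[of n] by (intro mult_mono) auto
    finally show "(geg n 0)\<^sup>2 * \<delta> / 16 \<le> geg n \<phi> * geg n \<phi> * sin_weight \<phi>" .
  qed
  also have "\<dots> \<le> (LBINT \<phi>:{0..pi}. geg n \<phi> * geg n \<phi> * sin_weight \<phi>)"
    unfolding set_lebesgue_integral_def
  proof (rule integral_mono)
    show "integrable lborel (\<lambda>\<phi>. indicator {\<delta>/2..\<delta>} \<phi> *\<^sub>R (geg n \<phi> * geg n \<phi> * sin_weight \<phi>))"
      using set_integrable_subset[OF geg_sin_weight_integrable, of "{\<delta>/2..\<delta>}" n n] \<delta> pi by (simp add: set_integrable_def)
  qed (use \<delta> pi geg_sin_weight_integrable[of n n] in \<open>auto simp: set_integrable_def split: split_indicator\<close>)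
  also have "(LBINT \<phi>:{\<delta>/2..\<delta>}. (geg n 0)\<^sup>2 * \<delta> / 16) = (geg n 0)\<^sup>2 / (128 * (real n + 1)\<^sup>2)"
    using \<delta> by (simp add: set_lebesgue_integral_def) (simp add: \<delta>_def field_simps power2_eq_square)
  finally show ?thesis .
qed

section \<open>A two constants theorem and the separation of two exponential modes\<close>

text \<open>
  The classical proof uses the harmonic measure of the bottom side. Here it is replaced by the
  explicit harmonic function \<open>\<omega> z = (1 - Im z / L)\<^sup>2 - (Re z /
  L)\<^sup>2\<close>, the real part of \<open>(1 + \<i> * z / L)\<^sup>2\<close>: it is at most
  one on the bottom side, at most zero on the other three sides of the rectangle, and at least
  one half on the inner part. Multiplying \<open>\<Theta>\<close> by \<open>exp (l * (1 + \<i> *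
  z / L)\<^sup>2)\<close>, with \<open>l = ln (B / e)\<close>, and applying the maximum
  principle gives the bound.
\<close>

lemma two_constants_upper:
  fixes \<Theta> :: "complex \<Rightarrow> complex"
  assumes hol: "\<Theta> holomorphic_on S" "open S" and L: "L > 0" and eB: "0 < e" "e \<le> B"
    and S: "\<And>z. \<bar>Re z\<bar> \<le> L \<Longrightarrow> 0 \<le> Im z \<Longrightarrow> Im z \<le> L \<Longrightarrow> z \<in> S \<and> norm (\<Theta> z) \<le> B"
    and real: "\<And>x. \<bar>x\<bar> \<le> L \<Longrightarrow> norm (\<Theta> (of_real x)) \<le> e"
    and z: "\<bar>Re z\<bar> \<le> L / 4" "0 \<le> Im z" "Im z \<le> L / 4"
  shows "norm (\<Theta> z) \<le> sqrt (e * B)"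
proof -
  define K where "K = cbox (Complex (-L) 0) (Complex L L)"
  define l where "l = ln (B / e)"
  have B: "B > 0" using eB by simp
  have l: "l \<ge> 0" using eB by (simp add: l_def)
  have el: "exp l = B / e" using eB by (simp add: l_def)
  define \<omega> where "\<omega> z = (1 - Im z / L)\<^sup>2 - (Re z / L)\<^sup>2" for z
  define H where "H z = \<Theta> z * exp (of_real l * (1 + \<i> * z / of_real L)\<^sup>2)" for z
  have inK: "z \<in> K \<longleftrightarrow> \<bar>Re z\<bar> \<le> L \<and> 0 \<le> Im z \<and> Im z \<le> L" for z
    by (auto simp: K_def in_cbox_complex_iff)
  have KS: "K \<subseteq> S" using S by (auto simp: inK)
  have normH: "norm (H z) = norm (\<Theta> z) * exp (l * \<omega> z)" for z
  proof -
    have "Re ((1 + \<i> * z / of_real L)\<^sup>2) = \<omega> z"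
      by (simp add: \<omega>_def power2_eq_square)
    then have "Re (of_real l * (1 + \<i> * z / of_real L)\<^sup>2) = l * \<omega> z" by simp
    then show ?thesis by (simp add: H_def norm_mult norm_exp_eq_Re del: Re_complex_of_real)
  qed
  have "norm (H z) \<le> B"
  proof (rule maximum_modulus_frontier[of H K])
    show "H holomorphic_on interior K" "continuous_on (closure K) H"
    proof -
      have "H holomorphic_on S" unfolding H_def by (intro holomorphic_intros hol) (use L in auto)
      then show "H holomorphic_on interior K" "continuous_on (closure K) H"
        using KS interior_subset[of K] closed_cbox[of "Complex (-L) 0" "Complex L L"]
        by (auto intro: holomorphic_on_subset continuous_on_subset holomorphic_on_imp_continuous_on simp: K_def)
    qed
    show "bounded K" by (simp add: K_def)
    show "z \<in> K" using z L by (auto simp: inK)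
    fix w assume "w \<in> frontier K"
    then have w: "w \<in> K" "w \<notin> box (Complex (-L) 0) (Complex L L)"
      by (auto simp: frontier_def K_def)
    then have wK: "\<bar>Re w\<bar> \<le> L" "0 \<le> Im w" "Im w \<le> L" by (auto simp: inK)
    have nB: "norm (\<Theta> w) \<le> B" using S wK by auto
    have y: "0 \<le> 1 - Im w / L" "1 - Im w / L \<le> 1" using wK L by auto
    consider "Im w = 0" | "Im w = L" | "\<bar>Re w\<bar> = L" 
      using w(2) wK by (auto simp: in_box_complex_iff abs_if split: if_splits)
    (* Bottom side: the bound e is multiplied by at most exp l = B / e. Other sides: the exponent is
       not positive. *)
    then show "norm (H w) \<le> B"
    proof cases
      case 1
      then have "w = of_real (Re w)" by (simp add: complex_eq_iff)
      then have t: "norm (\<Theta> w) \<le> e" using real[of "Re w"] wK by metis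
      have "\<omega> w \<le> 1" using 1 by (simp add: \<omega>_def)
      then have "l * \<omega> w \<le> l" using l by (simp add: mult_left_le)
      then have "norm (H w) \<le> e * exp l" unfolding normH using eB by (intro mult_mono t) auto
      then show ?thesis using eB by (simp add: el)
    next
      case 2
      then have "\<omega> w \<le> 0" using L by (simp add: \<omega>_def)
      then have "exp (l * \<omega> w) \<le> 1" using l by (simp add: mult_nonneg_nonpos)
      then show ?thesis unfolding normH using mult_mono[OF nB, of "exp (l * \<omega> w)" 1] B by simp
    next
      case 3
      then have "(Re w / L)\<^sup>2 = 1" using L by (metis abs_of_pos abs_divide divide_self less_irrefl one_power2 power2_abs)
      moreover have "(1 - Im w / L)\<^sup>2 \<le> 1" using y by (simp add: power_le_one)
      ultimately have "\<omega> w \<le> 0" by (simp add: \<omega>_def)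
      then have "exp (l * \<omega> w) \<le> 1" using l by (simp add: mult_nonneg_nonpos)
      then show ?thesis unfolding normH using mult_mono[OF nB, of "exp (l * \<omega> w)" 1] B by simp
    qed
  qed
  moreover have "\<omega> z \<ge> 1/2"
  proof -
    have "(3/4)\<^sup>2 \<le> (1 - Im z / L)\<^sup>2" using z L by (intro power_mono) (auto simp: field_simps)
    moreover have "(Re z / L)\<^sup>2 \<le> (1/4)\<^sup>2" using z L unfolding abs_le_square_iff[symmetric] by (simp add: abs_divide field_simps)
    ultimately have "(3/4)\<^sup>2 - (1/4)\<^sup>2 \<le> \<omega> z" unfolding \<omega>_def by linarith
    then show ?thesis by (simp add: power2_eq_square)
  qed
  then have "exp (l / 2) \<le> exp (l * \<omega> z)" using mult_left_mono[of "1/2" "\<omega> z" l] l by simp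
  ultimately have "norm (\<Theta> z) * exp (l / 2) \<le> B"
    unfolding normH by (meson mult_left_mono norm_ge_zero order_trans)
  moreover have "exp (l / 2) = sqrt (B / e)"
    using el by (metis exp_ge_zero real_sqrt_unique power2_eq_square exp_add field_sum_of_halves)
  ultimately have "norm (\<Theta> z) * (sqrt B / sqrt e) \<le> B" by (simp add: real_sqrt_divide)
  then have "norm (\<Theta> z) \<le> B * sqrt e / sqrt B" using eB B by (simp add: field_simps)
  also have "\<dots> = sqrt (e * B)"
    using B by (simp add: real_sqrt_mult) (metis mult.commute nonzero_mult_div_cancel_left real_div_sqrt less_imp_le times_divide_eq_right)
  finally show ?thesis .
qed

text \<open>
  The lower half follows from the upper half by the reflection \<open>z \<mapsto> - z\<close>.
\<close>

lemma two_constants: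
  fixes \<Theta> :: "complex \<Rightarrow> complex"
  assumes hol: "\<Theta> holomorphic_on S" "open S" and L: "L > 0" and eB: "0 < e" "e \<le> B"
    and S: "\<And>z. \<bar>Re z\<bar> \<le> L \<Longrightarrow> \<bar>Im z\<bar> \<le> L \<Longrightarrow> z \<in> S \<and> norm (\<Theta> z) \<le> B"
    and real: "\<And>x. \<bar>x\<bar> \<le> L \<Longrightarrow> norm (\<Theta> (of_real x)) \<le> e"
    and z: "\<bar>Re z\<bar> \<le> L / 4" "\<bar>Im z\<bar> \<le> L / 4"
  shows "norm (\<Theta> z) \<le> sqrt (e * B)"
proof (cases "Im z \<ge> 0")
  case True
  then show ?thesis
    using z S by (intro two_constants_upper[OF hol L eB _ real]) auto
next
  case False
  have "norm (\<Theta> (- (- z))) \<le> sqrt (e * B)"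
  proof (rule two_constants_upper[where \<Theta> = "\<lambda>z. \<Theta> (- z)" and S = "uminus ` S", OF _ _ L eB])
    show "(\<lambda>z. \<Theta> (- z)) holomorphic_on uminus ` S"
    proof -
      have "(\<Theta> \<circ> uminus) holomorphic_on uminus ` S"
        by (rule holomorphic_on_compose) (auto intro!: holomorphic_intros simp: image_image hol)
      then show ?thesis by (simp add: o_def)
    qed
    show "open (uminus ` S)" using hol(2) by (rule open_negations)
    show "w \<in> uminus ` S \<and> cmod (\<Theta> (- w)) \<le> B" if "\<bar>Re w\<bar> \<le> L" "0 \<le> Im w" "Im w \<le> L" for w
      using S[of "- w"] that by (auto intro: image_eqI[where x="-w"])
    show "cmod (\<Theta> (- of_real x)) \<le> e" if "\<bar>x\<bar> \<le> L" for x
      using real[of "-x"] that by simp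
  qed (use z False in auto)
  then show ?thesis by simp
qed

text \<open>
  The primitive \<open>\<Theta>\<close> of \<open>\<Phi>\<close> that vanishes at the origin is
  pointwise small on the real segment, by the smallness of \<open>\<Phi>\<close> in the mean.
  The two constants theorem applies to \<open>\<Theta>\<close>, and a Cauchy estimate on unit
  discs returns to \<open>\<Phi>\<close>; this is why the final square has half side
  \<open>7\<close> and not \<open>8 = 32 / 4\<close>.
\<close>

lemma small_from_L1_segment:
  fixes \<Phi> :: "complex \<Rightarrow> complex"
  assumes hol: "\<Phi> holomorphic_on {z. \<bar>Re z\<bar> < 33}"
    and bnd: "\<And>z. \<bar>Re z\<bar> < 33 \<Longrightarrow> norm (\<Phi> z) \<le> B" and B: "B > 0"
    and E: "(\<integral>\<^sup>+x\<in>{-32..32}. ennreal (norm (\<Phi> (of_real x))) \<partial>lborel) \<le> ennreal E" "E > 0"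
    and z: "\<bar>Re z\<bar> \<le> 7" "\<bar>Im z\<bar> \<le> 7"
  shows "norm (\<Phi> z) \<le> 8 * sqrt (E * B)"
proof -
  define S where "S = {z. \<bar>Re z\<bar> < 33}"
  have Seq: "S = {z. Re z < 33} \<inter> {z. Re z > -33}" by (auto simp: S_def)
  have S: "open S" "convex S"
    unfolding Seq by (auto intro!: open_Int open_halfspace_Re_lt open_halfspace_Re_gt convex_Int
       convex_halfspace_Re_lt convex_halfspace_Re_gt)
  have hol: "\<Phi> holomorphic_on S" using hol by (simp add: S_def)
  obtain g where g: "\<And>x. x \<in> S \<Longrightarrow> (g has_field_derivative \<Phi> x) (at x within S)"
    using holomorphic_convex_primitive'[OF S(2) S(1) hol] by blast
  have g: "(g has_field_derivative \<Phi> x) (at x)" if "x \<in> S" for x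
    using g[OF that] at_within_open[OF that S(1)] by simp
  define \<Theta> where "\<Theta> z = g z - g 0" for z
  have d\<Theta>: "(\<Theta> has_field_derivative \<Phi> x) (at x)" if "x \<in> S" for x
    unfolding \<Theta>_def using g[OF that] by (auto intro!: derivative_eq_intros)
  have hol\<Theta>: "\<Theta> holomorphic_on S"
    using d\<Theta> S(1) by (auto simp: holomorphic_on_open)
  have 0: "0 \<in> S" by (simp add: S_def)
  have \<Theta>B: "norm (\<Theta> z) \<le> B * norm z" if "z \<in> S" for z
  proof -
    have "norm (g z - g 0) \<le> B * norm (z - 0)"
    proof (rule field_differentiable_bound[OF S(2) _ _ that 0])
      show "(g has_field_derivative \<Phi> w) (at w within S)" if "w \<in> S" for w
        using g[OF that] by (rule has_field_derivative_at_within)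
      show "norm (\<Phi> w) \<le> B" if "w \<in> S" for w using bnd that by (auto simp: S_def)
    qed
    then show ?thesis by (simp add: \<Theta>_def)
  qed
  have contN: "continuous_on {-32..32} (\<lambda>x. norm (\<Phi> (of_real x)))"
    by (intro continuous_intros continuous_on_compose2[OF holomorphic_on_imp_continuous_on[OF hol]])
       (auto simp: S_def)
  have intE: "integral {-32..32} (\<lambda>x. norm (\<Phi> (of_real x))) \<le> E"
  proof -
    have si: "set_integrable lborel {-32..32} (\<lambda>x. norm (\<Phi> (of_real x)))"
      by (rule borel_integrable_atLeastAtMost'[OF contN])
    have "ennreal (LBINT x:{-32..32}. norm (\<Phi> (of_real x)))
        = (\<integral>\<^sup>+x. ennreal (indicator {-32..32} x *\<^sub>R norm (\<Phi> (of_real x))) \<partial>lborel)"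
      using si unfolding set_lebesgue_integral_def set_integrable_def
      by (intro nn_integral_eq_integral[symmetric]) auto
    also have "\<dots> = (\<integral>\<^sup>+x\<in>{-32..32}. ennreal (norm (\<Phi> (of_real x))) \<partial>lborel)"
      by (intro nn_integral_cong) (auto split: split_indicator)
    also have "\<dots> \<le> ennreal E" by (rule E(1))
    finally have "(LBINT x:{-32..32}. norm (\<Phi> (of_real x))) \<le> E"
      using E(2) by (simp add: ennreal_le_iff)
    then show ?thesis using set_borel_integral_eq_integral(2)[OF si] by simp
  qed
  have \<Theta>real: "norm (\<Theta> (of_real x)) \<le> E" if x: "\<bar>x\<bar> \<le> 32" for x
  proof -
    have vd: "((\<lambda>t. \<Theta> (of_real t)) has_vector_derivative \<Phi> (of_real t)) (at t within T)"
      if "\<bar>t\<bar> \<le> 32" for t T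
      using has_vector_derivative_real_field[OF d\<Theta>[of "of_real t"]] that by (simp add: S_def o_def has_vector_derivative_at_within)
    have gen: "norm (\<Theta> (of_real b) - \<Theta> (of_real a)) \<le> E" if "a \<le> b" "-32 \<le> a" "b \<le> 32" for a b
    proof -
      have i: "((\<lambda>t. \<Phi> (of_real t)) has_integral (\<Theta> (of_real b) - \<Theta> (of_real a))) {a..b}"
        using that by (intro fundamental_theorem_of_calculus vd) auto
      have n: "(\<lambda>x. norm (\<Phi> (of_real x))) integrable_on {a..b}"
        using that by (intro integrable_continuous_real continuous_on_subset[OF contN]) auto
      have "norm (integral {a..b} (\<lambda>t. \<Phi> (of_real t))) \<le> integral {a..b} (\<lambda>x. norm (\<Phi> (of_real x)))"
        using i n by (intro integral_norm_bound_integral) auto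
      also have "\<dots> \<le> integral {-32..32} (\<lambda>x. norm (\<Phi> (of_real x)))"
        using that by (intro integral_subset_le n integrable_continuous_real contN) auto
      also have "\<dots> \<le> E" by (rule intE)
      finally show ?thesis using integral_unique[OF i] by simp
    qed
    have "\<Theta> 0 = 0" by (simp add: \<Theta>_def)
    then show ?thesis using gen[of 0 x] gen[of x 0] x by (cases "x \<ge> 0") auto
  qed
  have zS: "z \<in> S" using z by (auto simp: S_def)
  show ?thesis
  (* On the square of half side 32 the primitive is at most 64 * B, and the two constants theorem
     needs E below this bound. Otherwise the bound B for the function itself is enough. *)
  proof (cases "E \<le> 64 * B")
    case True
    have small: "norm (\<Theta> w) \<le> sqrt (E * (64 * B))" if w: "\<bar>Re w\<bar> \<le> 8" "\<bar>Im w\<bar> \<le> 8" for w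
    proof (rule two_constants[OF hol\<Theta> S(1), where L = 32])
      fix v assume v: "\<bar>Re v\<bar> \<le> 32" "\<bar>Im v\<bar> \<le> 32"
      then have "norm v \<le> 64" using cmod_le[of v] by simp
      then have "B * norm v \<le> 64 * B" using B by simp
      then show "v \<in> S \<and> norm (\<Theta> v) \<le> 64 * B"
        using \<Theta>B[of v] v by (auto simp: S_def intro: order_trans)
    qed (use w True E \<Theta>real in auto)
    have "norm ((deriv ^^ 1) \<Theta> z) \<le> fact 1 * sqrt (E * (64 * B)) / 1 ^ 1"
    proof (rule Cauchy_inequality)
      have sub: "cball z 1 \<subseteq> S"
      proof
        fix w assume "w \<in> cball z 1"
        then have "\<bar>Re (w - z)\<bar> \<le> 1" 
          using abs_Re_le_cmod[of "w - z"] by (simp add: dist_norm norm_minus_commute)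
        then show "w \<in> S" using z by (auto simp: S_def)
      qed
      show "\<Theta> holomorphic_on ball z 1" "continuous_on (cball z 1) \<Theta>"
        using holomorphic_on_subset[OF hol\<Theta> order_trans[OF ball_subset_cball sub]]
          continuous_on_subset[OF holomorphic_on_imp_continuous_on[OF hol\<Theta>] sub] by auto
      fix w assume "norm (z - w) = 1"
      then have "\<bar>Re (z - w)\<bar> \<le> 1" "\<bar>Im (z - w)\<bar> \<le> 1"
        using abs_Re_le_cmod[of "z - w"] abs_Im_le_cmod[of "z - w"] by auto
      then show "norm (\<Theta> w) \<le> sqrt (E * (64 * B))" using z by (intro small) auto
    qed auto
    moreover have "deriv \<Theta> z = \<Phi> z" using d\<Theta>[OF zS] by (rule DERIV_imp_deriv)
    ultimately have "norm (\<Phi> z) \<le> sqrt (64 * (E * B))" by (simp add: mult_ac)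
    then show ?thesis by (subst (asm) real_sqrt_mult) (simp add: real_sqrt_eq_iff)
  next
    case False
    have "B\<^sup>2 \<le> E * B" unfolding power2_eq_square using False B by (intro mult_right_mono) auto
    then have "B \<le> sqrt (E * B)" by (rule real_le_rsqrt)
    then show ?thesis using bnd[of z] z B E 
      by (auto intro: order_trans)
  qed
qed

text \<open>
  The modes \<open>exp (n * \<sigma>)\<close> and \<open>exp (- (n + 1/2) * \<sigma>)\<close> are
  separated by their values at \<open>\<sigma> = L\<close> and \<open>\<sigma> = - L\<close>:
  the linear system for \<open>\<alpha>\<close> and \<open>\<beta>\<close> has a determinant of
  size \<open>exp ((2 * n + 1/2) * L)\<close>. The decay of both coefficients in
  \<open>n\<close> is the point.
\<close>

lemma two_mode_coefficients:
  fixes \<alpha> \<beta> :: complex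
  assumes "norm (\<alpha> * exp (of_real (n * L)) + \<beta> * exp (of_real (- ((n + 1/2) * L)))) \<le> V"
    and "norm (\<alpha> * exp (of_real (n * (- L))) + \<beta> * exp (of_real (- ((n + 1/2) * (- L))))) \<le> V"
    and n: "n \<ge> 0" and L: "L \<ge> 2"
  shows "norm \<alpha> \<le> 4 * V * exp (- (n * L))" "norm \<beta> \<le> 4 * V * exp (- (n * L))"
proof -
  define P where "P = \<alpha> * exp (of_real (n * L)) + \<beta> * exp (of_real (- ((n + 1/2) * L)))"
  define Q where "Q = \<alpha> * exp (of_real (n * (- L))) + \<beta> * exp (of_real (- ((n + 1/2) * (- L))))"
  have PQ: "norm P \<le> V" "norm Q \<le> V" using assms by (auto simp: P_def Q_def)
  have V: "V \<ge> 0" using norm_ge_zero PQ(1) by (rule order_trans)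
  define D where "D = exp ((2*n + 1/2) * L) - exp (- ((2*n + 1/2) * L))"
  have nL: "n * L \<ge> 0" using n L by simp
  have D: "D \<ge> exp ((2*n + 1/2) * L) / 2"
  proof -
    have l: "(2*n + 1/2) * L \<ge> 1" using nL L by (simp add: algebra_simps)
    have "exp (- ((2*n + 1/2) * L)) * 2 \<le> 1 * exp 1"
      using l exp_ge_add_one_self[of 1] by (intro mult_mono) auto
    also have "\<dots> \<le> exp ((2*n + 1/2) * L)" using l by simp
    finally show ?thesis by (simp add: D_def)
  qed
  have D0: "D > 0" using D by (rule less_le_trans[rotated]) simp
  define X Y :: complex where "X = exp (of_real (n * L))" and "Y = exp (of_real ((n + 1/2) * L))"
  have XY: "X \<noteq> 0" "Y \<noteq> 0" by (auto simp: X_def Y_def)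
  have inv: "exp (of_real (- (n * L))) = 1 / X" "exp (of_real (n * (- L))) = 1 / X"
    "exp (of_real (- ((n + 1/2) * L))) = 1 / Y" "exp (of_real (- ((n + 1/2) * (- L)))) = Y"
    unfolding X_def Y_def mult_minus_right of_real_minus exp_minus minus_minus inverse_eq_divide by (rule refl)+
  have "X * Y = exp (of_real (n * L) + of_real ((n + 1/2) * L))"
    unfolding X_def Y_def exp_add ..
  also have "of_real (n * L) + of_real ((n + 1/2) * L) = (of_real ((2*n + 1/2) * L) :: complex)"
    by (simp add: algebra_simps)
  finally have eXY: "of_real (exp ((2*n + 1/2) * L)) = X * Y" by (simp only: exp_of_real)
  have Dc: "of_real D = X * Y - 1 / (X * Y)"
  proof -
    have "of_real D = (of_real (exp ((2*n + 1/2) * L)) - inverse (of_real (exp ((2*n + 1/2) * L))) :: complex)"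
      unfolding D_def by (simp only: exp_minus of_real_diff of_real_inverse)
    then show ?thesis unfolding eXY by (simp only: inverse_eq_divide)
  qed
  have ea: "\<alpha> * of_real D = P * Y - Q / Y"
    unfolding Dc P_def Q_def inv X_def[symmetric] using XY by (simp add: field_simps)
  have eb: "\<beta> * of_real D = Q * X - P / X"
    unfolding Dc P_def Q_def inv X_def[symmetric] using XY by (simp add: field_simps)
  have nX: "norm X = exp (n * L)" "norm Y = exp ((n + 1/2) * L)" by (simp_all add: X_def Y_def)
  have fin: "norm c \<le> 4 * V * exp (- (n * L))" 
    if "norm (c * of_real D) \<le> 2 * V * exp ((n + 1/2) * L)" for c :: complex
  proof -
    have "norm c * (exp ((2*n + 1/2) * L) / 2) \<le> norm c * D" using D by (intro mult_left_mono) auto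
    also have "\<dots> \<le> 2 * V * exp ((n + 1/2) * L)" using that D0 by (simp add: norm_mult)
    finally have "norm c * exp ((2*n + 1/2) * L) \<le> 4 * V * exp ((n + 1/2) * L)" by simp
    then have "norm c \<le> 4 * V * (exp ((n + 1/2) * L) / exp ((2*n + 1/2) * L))"
      by (simp add: pos_le_divide_eq)
    also have "exp ((n + 1/2) * L) / exp ((2*n + 1/2) * L) = exp ((n + 1/2) * L - (2*n + 1/2) * L)"
      by (simp only: exp_diff)
    also have "(n + 1/2) * L - (2*n + 1/2) * L = - (n * L)" by (simp add: algebra_simps)
    finally show ?thesis .
  qed
  have "norm (\<alpha> * of_real D) \<le> V * exp ((n + 1/2) * L) + V * exp (- ((n + 1/2) * L))"
  proof -
    have "norm (\<alpha> * of_real D) \<le> norm P * norm Y + norm Q / norm Y"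
      unfolding ea by (metis norm_triangle_ineq4 norm_mult norm_divide)
    also have "\<dots> \<le> V * norm Y + V / norm Y"
      using PQ by (intro add_mono mult_right_mono divide_right_mono) auto
    finally show ?thesis unfolding nX exp_minus by (simp only: divide_inverse)
  qed
  also have "\<dots> \<le> V * exp ((n + 1/2) * L) + V * exp ((n + 1/2) * L)"
    using V nL L by (intro add_mono mult_left_mono) (auto simp: algebra_simps)
  finally show "norm \<alpha> \<le> 4 * V * exp (- (n * L))" by (intro fin, linarith)
  have "norm (\<beta> * of_real D) \<le> V * exp (n * L) + V * exp (- (n * L))"
  proof -
    have "norm (\<beta> * of_real D) \<le> norm Q * norm X + norm P / norm X"
      unfolding eb by (metis norm_triangle_ineq4 norm_mult norm_divide)
    also have "\<dots> \<le> V * norm X + V / norm X"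
      using PQ by (intro add_mono mult_right_mono divide_right_mono) auto
    finally show ?thesis unfolding nX exp_minus by (simp only: divide_inverse)
  qed
  also have "\<dots> \<le> V * exp ((n + 1/2) * L) + V * exp ((n + 1/2) * L)"
    using V nL L by (intro add_mono mult_left_mono) (auto simp: algebra_simps)
  finally show "norm \<beta> \<le> 4 * V * exp (- (n * L))" by (intro fin, linarith)
qed

lemma power_series_cauchy_bound:
  fixes a :: "nat \<Rightarrow> complex"
  assumes "summable (\<lambda>n. norm (a n) * R ^ n)" "0 < r" "r < R"
    and "\<And>z. norm z = r \<Longrightarrow> norm (\<Sum>n. a n * z ^ n) \<le> Q"
  shows "norm (a n) \<le> Q / r ^ n"
proof -
  define F where "F = Abs_fps a"
  have "summable (\<lambda>n. norm (a n * of_real R ^ n))"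
    using assms by (simp add: norm_mult norm_power)
  then have "summable (\<lambda>n. a n * of_real R ^ n)" by (rule summable_norm_cancel)
  then have cr: "fps_conv_radius F \<ge> R"
    using conv_radius_geI[of a "of_real R"] assms by (simp add: F_def fps_conv_radius_def)
  have "ereal 0 < ereal R" using assms by simp
  then have fe: "eval_fps F has_fps_expansion F"
    using less_le_trans[OF _ cr, of 0] unfolding has_fps_expansion_def by (simp add: zero_ereal_def)
  have sub: "cball (0::complex) r \<subseteq> eball 0 (fps_conv_radius F)"
  proof
    fix x :: complex assume "x \<in> cball 0 r"
    then have "ereal (norm x) < ereal R" using assms by simp
    from less_le_trans[OF this cr] show "x \<in> eball 0 (fps_conv_radius F)" by (simp add: in_eball_iff)
  qed
  have "norm ((deriv ^^ n) (eval_fps F) 0) \<le> fact n * Q / r ^ n"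
  proof (rule Cauchy_inequality)
    show "eval_fps F holomorphic_on ball 0 r" by (rule holomorphic_on_eval_fps[OF order_trans[OF ball_subset_cball sub]])
    show "continuous_on (cball 0 r) (eval_fps F)" by (rule holomorphic_on_imp_continuous_on[OF holomorphic_on_eval_fps[OF sub]])
    show "cmod (eval_fps F x) \<le> Q" if "cmod (0 - x) = r" for x :: complex
      using assms(4)[of x] that by (simp add: eval_fps_def F_def)
  qed (use assms in auto)
  moreover have "a n = (deriv ^^ n) (eval_fps F) 0 / fact n"
    using fps_nth_fps_expansion[OF fe, of n] by (simp add: F_def)
  ultimately have "norm (a n) \<le> fact n * Q / r ^ n / fact n"
    by (simp only: norm_divide norm_fact) (rule divide_right_mono, auto)
  then show ?thesis by simp
qed

lemma summable_poly_exp: "summable (\<lambda>n. (real n + 1)\<^sup>2 * exp (- real n))"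
proof (rule summable_comparison_test'[where N = 0])
  show "summable (\<lambda>n. 16 * exp (1/2) * exp (-1/2) ^ n :: real)"
    by (intro summable_mult summable_geometric) simp
  fix n :: nat
  have "(real n + 1) / 4 \<le> exp ((real n + 1) / 4)" using exp_ge_add_one_self[of "(real n + 1) / 4"] by linarith
  then have "((real n + 1) / 4)\<^sup>2 \<le> (exp ((real n + 1) / 4))\<^sup>2" by (intro power_mono) auto
  also have "\<dots> = exp ((real n + 1) / 2)" by (simp add: power2_eq_square flip: exp_add)
  finally have "(real n + 1)\<^sup>2 * exp (- real n) \<le> 16 * exp ((real n + 1) / 2) * exp (- real n)"
    by (intro mult_right_mono) (simp_all add: power_divide)
  also have "\<dots> = 16 * exp (1/2) * exp (-1/2) ^ n"
    by (simp add: exp_of_nat_mult[symmetric] mult.assoc field_simps flip: exp_add)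
  finally show "norm ((real n + 1)\<^sup>2 * exp (- real n)) \<le> 16 * exp (1/2) * exp (-1/2) ^ n" by simp
qed

text \<open>
  Here \<open>\<sigma>\<close> is the logarithm of the radius. The sizes at \<open>\<sigma> =
  \<plusminus>34\<close> make the two power series \<open>p\<close> and \<open>q\<close>
  converge in the disc of radius \<open>exp 34\<close>, with bounds in the disc of radius
  \<open>exp 33\<close>, so that \<open>\<Phi> z = p (exp z) + exp (- z / 2) * q (exp (-
  z))\<close> is bounded in the strip of half width \<open>33\<close>; smallness in the mean on
  a real segment then spreads to a square that contains a full period of \<open>exp\<close>.

  Moving \<open>z\<close> by \<open>2 * pi * \<i>\<close> replaces \<open>\<Phi>\<close> by
  \<open>p (exp z) - exp (- z / 2) * q (exp (- z))\<close>. Hence half the sum and half the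
  difference of two values of \<open>\<Phi>\<close> recover \<open>p\<close> and
  \<open>q\<close> on the circle of radius \<open>exp 1\<close>, and Cauchy estimates give
  coefficients that decay geometrically.
\<close>

lemma analytic_core:
  "\<exists>C>0. \<forall>(a :: nat \<Rightarrow> complex) b M E.
     0 < M \<longrightarrow> 0 < E \<longrightarrow>
     (\<forall>n. \<forall>\<sigma>\<in>{-34, 34}. norm (a n * exp (of_real (real n * \<sigma>)) + b n * exp (of_real (- ((real n + 1/2) * \<sigma>)))) \<le> M * (real n + 1)\<^sup>2) \<longrightarrow>
     (\<integral>\<^sup>+\<sigma>\<in>{-32..32}. ennreal (norm (\<Sum>n. a n * exp (of_real (real n * \<sigma>)) + b n * exp (of_real (- ((real n + 1/2) * \<sigma>))))) \<partial>lborel) \<le> ennreal E \<longrightarrow>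
     (\<Sum>n. norm (a n) + norm (b n)) \<le> C * sqrt (E * M) \<and> summable (\<lambda>n. norm (a n) + norm (b n))"
proof -
  define c1 where "c1 = (\<Sum>n. (real n + 1)\<^sup>2 * exp (- real n))"
  have c1: "c1 \<ge> 0" unfolding c1_def by (intro suminf_nonneg summable_poly_exp) auto
  define k where "k = 4 * c1 * (1 + exp 17) + 1"
  have k: "k > 0" using c1 by (simp add: k_def add_nonneg_pos)
  define g where "g = (\<Sum>n. exp (-1) ^ n :: real)"
  have sg: "summable (\<lambda>n. exp (-1) ^ n :: real)" by (intro summable_geometric) simp
  have g: "g > 0" unfolding g_def using sg by (intro suminf_pos) auto
  define C where "C = 16 * g * sqrt k"
  have "C > 0" using k g by (simp add: C_def)
  moreover have "(\<Sum>n. norm (a n) + norm (b n)) \<le> C * sqrt (E * M) \<and> summable (\<lambda>n. norm (a n) + norm (b n))"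
    if M: "0 < M" and E0: "0 < E"
      and V: "\<forall>n. \<forall>\<sigma>\<in>{-34, 34}. norm (a n * exp (of_real (real n * \<sigma>)) + b n * exp (of_real (- ((real n + 1/2) * \<sigma>)))) \<le> M * (real n + 1)\<^sup>2"
      and E: "(\<integral>\<^sup>+\<sigma>\<in>{-32..32}. ennreal (norm (\<Sum>n. a n * exp (of_real (real n * \<sigma>)) + b n * exp (of_real (- ((real n + 1/2) * \<sigma>))))) \<partial>lborel) \<le> ennreal E"
    for a b :: "nat \<Rightarrow> complex" and M E :: real
  proof -
    have ab: "norm (a n) \<le> 4 * (M * (real n + 1)\<^sup>2) * exp (- (real n * 34))"
             "norm (b n) \<le> 4 * (M * (real n + 1)\<^sup>2) * exp (- (real n * 34))" for n
      using two_mode_coefficients[of "a n" "real n" 34 "b n" "M * (real n + 1)\<^sup>2"] V by simp_all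
    define T where "T n = (real n + 1)\<^sup>2 * exp (- real n)" for n
    have T: "summable T" unfolding T_def by (rule summable_poly_exp)
    (* The polynomial factor is paid for by passing from radius exp 34 to radius exp 33. *)
    have R: "norm (a n) * exp 33 ^ n \<le> 4 * M * T n" "norm (b n) * exp 33 ^ n \<le> 4 * M * T n" for n
    proof -
      have e: "4 * (M * (real n + 1)\<^sup>2) * exp (- (real n * 34)) * exp 33 ^ n = 4 * M * T n"
        by (simp add: T_def exp_of_nat_mult[symmetric] mult.assoc flip: exp_add)
      show "norm (a n) * exp 33 ^ n \<le> 4 * M * T n" "norm (b n) * exp 33 ^ n \<le> 4 * M * T n"
        unfolding e[symmetric] using ab[of n] by (auto intro: mult_right_mono)
    qed
    have sR: "summable (\<lambda>n. norm (a n) * exp 33 ^ n)" "summable (\<lambda>n. norm (b n) * exp 33 ^ n)"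
      by (rule summable_comparison_test'[OF summable_mult[OF T, of "4 * M"], of 0]; use R in simp)+
    have nle: "norm (c n * z ^ n) \<le> norm (c n) * exp 33 ^ n" if "norm z \<le> exp 33" for c :: "nat \<Rightarrow> complex" and z n
      using that by (auto simp: norm_mult norm_power intro!: mult_left_mono power_mono)
    have sn: "summable (\<lambda>n. norm (a n * z ^ n))" "summable (\<lambda>n. norm (b n * z ^ n))" if "norm z \<le> exp 33" for z
      by (rule summable_comparison_test'[OF sR(1), of 0] summable_comparison_test'[OF sR(2), of 0]; use nle[OF that] in simp)+
    note s = sn[THEN summable_norm_cancel]
    define p where "p z = (\<Sum>n. a n * z ^ n)" for z
    define q where "q z = (\<Sum>n. b n * z ^ n)" for z
    have pq: "norm (p z) \<le> 4 * M * c1" "norm (q z) \<le> 4 * M * c1" if "norm z \<le> exp 33" for z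
    proof -
      have c: "(\<Sum>n. 4 * M * T n) = 4 * M * c1" using suminf_mult[OF T, of "4 * M"] by (simp add: c1_def T_def[abs_def])
      have "norm (p z) \<le> (\<Sum>n. 4 * M * T n)" unfolding p_def
        using nle[OF that, of a] R(1) by (intro norm_suminf_le summable_mult T) (meson order_trans)
      then show "norm (p z) \<le> 4 * M * c1" using c by simp
      have "norm (q z) \<le> (\<Sum>n. 4 * M * T n)" unfolding q_def
        using nle[OF that, of b] R(2) by (intro norm_suminf_le summable_mult T) (meson order_trans)
      then show "norm (q z) \<le> 4 * M * c1" using c by simp
    qed
    have hpq: "p holomorphic_on ball 0 (exp 33)" "q holomorphic_on ball 0 (exp 33)"
      unfolding p_def q_def by (rule power_series_holomorphic[of 0]; use s in \<open>auto intro!: summable_sums\<close>)+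
    define \<Phi> where "\<Phi> z = p (exp z) + exp (- z / 2) * q (exp (- z))" for z
    have \<Phi>bd: "norm (\<Phi> z) \<le> 8 * sqrt (E * (M * k))" if z: "\<bar>Re z\<bar> \<le> 7" "\<bar>Im z\<bar> \<le> 7" for z
    proof (rule small_from_L1_segment[OF _ _ _ _ E0 z])
      show "\<Phi> holomorphic_on {z. \<bar>Re z\<bar> < 33}"
      proof -
        have "(\<lambda>z. p (exp z)) holomorphic_on {z. \<bar>Re z\<bar> < 33}" "(\<lambda>z. q (exp (- z))) holomorphic_on {z. \<bar>Re z\<bar> < 33}"
          by (rule holomorphic_on_compose_gen[OF _ hpq(1), unfolded o_def] holomorphic_on_compose_gen[OF _ hpq(2), unfolded o_def];
             auto intro!: holomorphic_intros simp: norm_exp_eq_Re)+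
        then show ?thesis unfolding \<Phi>_def by (intro holomorphic_intros) auto
      qed
      show "norm (\<Phi> w) \<le> M * k" if w: "\<bar>Re w\<bar> < 33" for w
      proof -
        have "norm (\<Phi> w) \<le> norm (p (exp w)) + norm (exp (- w / 2)) * norm (q (exp (- w)))"
          unfolding \<Phi>_def using norm_triangle_ineq by (metis norm_mult)
        also have "\<dots> \<le> 4 * M * c1 + exp 17 * (4 * M * c1)"
          using w M c1 by (intro add_mono mult_mono pq) (auto simp: norm_exp_eq_Re)
        also have "\<dots> \<le> M * k" using M by (simp add: k_def algebra_simps)
        finally show ?thesis .
      qed
      show "M * k > 0" using M k by simp
      have Peq: "\<Phi> (of_real \<sigma>) = (\<Sum>n. a n * exp (of_real (real n * \<sigma>)) + b n * exp (of_real (- ((real n + 1/2) * \<sigma>))))"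
        if "\<sigma> \<in> {-32..32}" for \<sigma>
      proof -
        have 1: "summable (\<lambda>n. a n * exp (of_real \<sigma>) ^ n)" "summable (\<lambda>n. b n * exp (- of_real \<sigma>) ^ n)"
          using that by (auto intro!: s simp: norm_exp_eq_Re)
        have "\<Phi> (of_real \<sigma>) = (\<Sum>n. a n * exp (of_real \<sigma>) ^ n + exp (- of_real \<sigma> / 2) * (b n * exp (- of_real \<sigma>) ^ n))"
          unfolding \<Phi>_def p_def q_def
          using suminf_add[OF 1(1) summable_mult[OF 1(2), of "exp (- of_real \<sigma> / 2)"]]
          by (simp only: suminf_mult[OF 1(2)])
        also have "\<dots> = (\<Sum>n. a n * exp (of_real (real n * \<sigma>)) + b n * exp (of_real (- ((real n + 1/2) * \<sigma>))))"
        proof (intro suminf_cong)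
          fix n
          have "exp (of_real \<sigma>) ^ n = (exp (of_real (real n * \<sigma>)) :: complex)"
            by (simp add: exp_of_nat_mult[symmetric])
          moreover have "exp (- of_real \<sigma> / 2) * (exp (- of_real \<sigma>) ^ n) = (exp (of_real (- ((real n + 1/2) * \<sigma>))) :: complex)"
            by (simp add: exp_of_nat_mult[symmetric] algebra_simps flip: exp_add)
          ultimately show "a n * exp (of_real \<sigma>) ^ n + exp (- of_real \<sigma> / 2) * (b n * exp (- of_real \<sigma>) ^ n) =
             a n * exp (of_real (real n * \<sigma>)) + b n * exp (of_real (- ((real n + 1/2) * \<sigma>)))"
            by (simp add: mult_ac)
        qed
        finally show ?thesis .
      qed
      have "(\<integral>\<^sup>+x\<in>{-32..32}. ennreal (norm (\<Phi> (of_real x))) \<partial>lborel) = (\<integral>\<^sup>+\<sigma>\<in>{-32..32}. ennreal (norm (\<Sum>n. a n * exp (of_real (real n * \<sigma>)) + b n * exp (of_real (- ((real n + 1/2) * \<sigma>))))) \<partial>lborel)"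
      proof (intro nn_integral_cong)
        fix x :: real
        show "ennreal (norm (\<Phi> (of_real x))) * indicator {-32..32} x = ennreal (norm (\<Sum>n. a n * exp (of_real (real n * x)) + b n * exp (of_real (- ((real n + 1/2) * x))))) * indicator {-32..32} x"
        proof (cases "x \<in> {-32..32}")
          case True
          then show ?thesis by (simp only: Peq)
        next
          case False
          then have "indicator {-32..32} x = (0 :: ennreal)" by (rule indicator_simps(2))
          then show ?thesis by (simp only: mult_zero_right)
        qed
      qed
      with E show "(\<integral>\<^sup>+x\<in>{-32..32}. ennreal (norm (\<Phi> (of_real x))) \<partial>lborel) \<le> ennreal E"
        by (simp only:)
    qed
    define Q where "Q = 8 * sqrt (E * (M * k))"
    have \<Phi>Q: "norm (\<Phi> z) \<le> Q" if z: "\<bar>Re z\<bar> \<le> 7" "\<bar>Im z\<bar> \<le> 7" for z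
      unfolding Q_def using z by (rule \<Phi>bd)
    (* The translation goes towards the real axis, so the imaginary part stays below 2 * pi < 7. *)
    have shift: "\<exists>w. \<bar>Re w\<bar> \<le> 7 \<and> \<bar>Im w\<bar> \<le> 7 \<and> \<Phi> w = p (exp z) - exp (- z / 2) * q (exp (- z))"
      if z: "\<bar>Re z\<bar> \<le> 7" "- pi \<le> Im z" "Im z \<le> pi" for z
    proof -
      have pi: "pi < 3.5" using pi_approx by simp
      define w where "w = (if Im z > 0 then z - 2 * of_real pi * \<i> else z + 2 * of_real pi * \<i>)"
      have "exp w = exp z" "exp (- w) = exp (- z)"
        by (auto simp: w_def exp_diff exp_add exp_minus)
      have half: "exp (c + of_real pi * \<i>) = - exp c" "exp (c - of_real pi * \<i>) = - exp c" for c
        by (simp_all add: exp_add exp_diff)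
      have "exp (- w / 2) = - exp (- z / 2)"
      proof -
        have "- w / 2 = - z / 2 + of_real pi * \<i> \<or> - w / 2 = - z / 2 - of_real pi * \<i>"
          by (auto simp: w_def field_simps)
        then show ?thesis by (metis half)
      qed
      moreover have "\<bar>Re w\<bar> \<le> 7" "\<bar>Im w\<bar> \<le> 7" using z pi by (auto simp: w_def)
      ultimately show ?thesis using \<open>exp w = exp z\<close> \<open>exp (- w) = exp (- z)\<close> by (intro exI[of _ w]) (auto simp: \<Phi>_def)
    qed
    have pQ: "norm (p x) \<le> Q" "norm (q x) \<le> Q" if x: "norm x = exp 1" for x
    proof -
      have x0: "x \<noteq> 0" using x by auto
      define z where "z = Ln x"
      have z: "exp z = x" "Re z = 1" "- pi \<le> Im z" "Im z \<le> pi"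
        using x0 x mpi_less_Im_Ln[OF x0] Im_Ln_le_pi[OF x0] by (auto simp: z_def)
      have "pi < 3.5" using pi_approx by simp
      then have Iz: "\<bar>Im z\<bar> \<le> 7" using z by linarith
      obtain w where w: "\<bar>Re w\<bar> \<le> 7" "\<bar>Im w\<bar> \<le> 7" "\<Phi> w = p (exp z) - exp (- z / 2) * q (exp (- z))"
        using shift[of z] z by auto
      have "2 * p x = \<Phi> z + \<Phi> w" unfolding w by (simp add: \<Phi>_def z)
      then have "norm (2 * p x) \<le> Q + Q"
        using \<Phi>Q[of z] \<Phi>Q[OF w(1,2)] z Iz by (simp only:) (rule norm_triangle_le, simp)
      then show "norm (p x) \<le> Q" by (simp add: norm_mult)
      obtain w where w: "\<bar>Re w\<bar> \<le> 7" "\<bar>Im w\<bar> \<le> 7" "\<Phi> w = p (exp (-z)) - exp (- (-z) / 2) * q (exp (- (-z)))"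
        using shift[of "-z"] z by auto
      have "2 * (exp (z / 2) * q x) = \<Phi> (-z) - \<Phi> w" unfolding w by (simp add: \<Phi>_def z)
      then have "norm (2 * (exp (z / 2) * q x)) \<le> Q + Q"
        using \<Phi>Q[of "-z"] \<Phi>Q[OF w(1,2)] z Iz by (simp only:) (rule order_trans[OF norm_triangle_ineq4], simp)
      then have "exp (1/2) * norm (q x) \<le> Q" by (simp add: norm_mult norm_exp_eq_Re z)
      moreover have "1 * norm (q x) \<le> exp (1/2) * norm (q x)" by (intro mult_right_mono) auto
      ultimately show "norm (q x) \<le> Q" by simp
    qed
    have aQ: "norm (a n) \<le> Q * exp (-1) ^ n" for n
      using power_series_cauchy_bound[OF sR(1), of "exp 1" Q n] pQ(1)
      by (simp add: p_def exp_minus power_inverse divide_inverse)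
    have bQ: "norm (b n) \<le> Q * exp (-1) ^ n" for n
      using power_series_cauchy_bound[OF sR(2), of "exp 1" Q n] pQ(2)
      by (simp add: q_def exp_minus power_inverse divide_inverse)
    have abQ: "norm (a n) + norm (b n) \<le> 2 * Q * exp (-1) ^ n" for n using aQ[of n] bQ[of n] by simp
    have sab: "summable (\<lambda>n. norm (a n) + norm (b n))"
      by (rule summable_comparison_test'[OF summable_mult[OF sg, of "2 * Q"], of 0]) (use abQ in simp)
    have "(\<Sum>n. norm (a n) + norm (b n)) \<le> (\<Sum>n. 2 * Q * exp (-1) ^ n)"
      by (intro suminf_le abQ sab summable_mult sg)
    also have "\<dots> = 2 * Q * g" unfolding g_def by (rule suminf_mult[OF sg])
    also have "\<dots> = C * sqrt (E * M)" by (simp add: Q_def C_def real_sqrt_mult)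
    finally have "(\<Sum>n. norm (a n) + norm (b n)) \<le> C * sqrt (E * M)" .
    with sab show ?thesis by simp
  qed
  ultimately show ?thesis by (intro exI[of _ C] conjI allI impI) simp_all
qed

section \<open>The boundary kernel and its differences\<close>

text \<open>
  A constant multiple of the fundamental solution of the extension equation, with pole at the
  boundary point \<open>(t, 0)\<close>, evaluated at \<open>(x, y)\<close>. It decays only like
  \<open>\<bar>t\<bar> powr (-1/2)\<close> and is not integrable in \<open>t\<close>: only
  differences can be integrated against a bounded density.
\<close>

definition riesz_kernel :: "real \<Rightarrow> real \<Rightarrow> real \<Rightarrow> real" where
  "riesz_kernel t x y = ((x - t)\<^sup>2 + y\<^sup>2) powr (-1/4)"

lemma riesz_kernel_nonneg [simp]: "riesz_kernel t x y \<ge> 0" by (simp add: riesz_kernel_def)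

lemma riesz_kernel_measurable [measurable (raw)]:
  assumes [measurable]: "t \<in> borel_measurable M" "x \<in> borel_measurable M" "y \<in> borel_measurable M"
  shows "(\<lambda>w. riesz_kernel (t w) (x w) (y w)) \<in> borel_measurable M"
  unfolding riesz_kernel_def by measurable

lemma riesz_kernel_at_0: "riesz_kernel t x 0 = \<bar>x - t\<bar> powr (-1/2)"
proof -
  have "((x - t)\<^sup>2) powr (-1/4) = (\<bar>x - t\<bar> powr 2) powr (-1/4)" by simp
  then show ?thesis unfolding riesz_kernel_def powr_powr by simp
qed

lemma riesz_kernel_antimono:
  assumes "0 \<le> y" "y \<le> y'" "x \<noteq> t \<or> y > 0"
  shows "riesz_kernel t x y' \<le> riesz_kernel t x y"
proof -
  have "(x - t)\<^sup>2 + y\<^sup>2 > 0"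
    using assms by (auto simp: sum_power2_gt_zero_iff)
  then show ?thesis unfolding riesz_kernel_def using assms by (intro powr_mono2') (auto intro: power_mono)
qed

text \<open>
  The mean value inequality for the convex function \<open>a powr (-1/4)\<close>, obtained from
  \<open>a / b \<le> (a / b) powr (1/4)\<close>.
\<close>

lemma bernoulli_quarter:
  fixes a b :: real assumes "0 < a" "a \<le> b"
  shows "a powr (-1/4) - b powr (-1/4) \<le> a powr (-5/4) * (b - a)"
proof -
  have "a / b \<le> 1" using assms by simp
  have "a / b = (a / b) powr 1" using assms by simp
  also have "\<dots> \<le> (a / b) powr (1/4)" using assms by (intro powr_mono') auto
  also have "\<dots> = a powr (1/4) * b powr (-1/4)" using assms by (simp add: powr_divide powr_minus field_simps)
  finally have 1: "a powr (-1/4) * (a / b) \<le> b powr (-1/4)"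
    using assms mult_left_mono[of "a / b" "a powr (1/4) * b powr (-1/4)" "a powr (-1/4)"]
    by (simp add: mult.assoc[symmetric] flip: powr_add)
  have "1 - (b - a) / a \<le> a / b"
  proof -
    have "2 - b / a \<le> a / b" using assms sum_squares_bound[of a b]
      by (simp add: field_simps power2_eq_square)
    then show ?thesis using assms by (simp add: diff_divide_distrib)
  qed
  then have "a powr (-1/4) * (1 - (b - a) / a) \<le> a powr (-1/4) * (a / b)" by (intro mult_left_mono) auto
  with 1 have "a powr (-1/4) - b powr (-1/4) \<le> a powr (-1/4) / a * (b - a)" by (simp add: algebra_simps)
  also have "a powr (-1/4) / a = a powr (-1/4 - 1)" using assms by (simp only: powr_diff powr_one)
  finally show ?thesis by simp
qed

lemma integrable_powr_tail:
  assumes "a > 0" "p < -1"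
  shows "integrable lborel (\<lambda>t::real. indicator {t. a \<le> \<bar>t\<bar>} t * \<bar>t\<bar> powr p)"
proof -
  let ?p = "\<lambda>t::real. indicator {a..} t *\<^sub>R t powr p"
  have "(\<lambda>x::real. x powr p) integrable_on {a..}"
    using has_integral_powr_to_inf[of p a] assms by (auto simp: integrable_on_def)
  then have "(\<lambda>x::real. x powr p) absolutely_integrable_on {a..}"
    by (intro nonnegative_absolutely_integrable_1) auto
  then have p: "integrable lborel ?p"
    unfolding set_integrable_def by (subst integrable_completion[symmetric]) auto
  have q: "integrable lborel (\<lambda>t. ?p (0 + (-1) * t))"
    by (rule lborel_integrable_real_affine[OF p]) simp
  have "(\<lambda>t::real. indicator {t. a \<le> \<bar>t\<bar>} t * \<bar>t\<bar> powr p) = (\<lambda>t. ?p t + ?p (0 + (-1) * t))"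
    using assms by (auto simp: fun_eq_iff split: split_indicator)
  then show ?thesis using Bochner_Integration.integrable_add[OF p q] by simp
qed

lemma integrable_inv_sqrt_near_0:
  assumes "a \<ge> 0"
  shows "integrable lborel (\<lambda>t::real. indicator {-a..a} t * \<bar>t\<bar> powr (-1/2))"
    "(LBINT t. indicator {-a..a} t * \<bar>t\<bar> powr (-1/2)) = 4 * sqrt a"
proof -
  let ?p = "\<lambda>t::real. indicator {0..a} t *\<^sub>R t powr (-1/2)"
  have hi: "((\<lambda>x::real. x powr (-1/2)) has_integral (2 * sqrt a)) {0..a}"
    using has_integral_powr_from_0[of "-1/2" a] assms by (simp add: powr_half_sqrt mult.commute)
  then have ai: "(\<lambda>x::real. x powr (-1/2)) absolutely_integrable_on {0..a}"
    by (intro nonnegative_absolutely_integrable_1) (auto simp: integrable_on_def)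
  then have p: "integrable lborel ?p"
    unfolding set_integrable_def by (subst integrable_completion[symmetric]) auto
  then have vp: "integral\<^sup>L lborel ?p = 2 * sqrt a"
    using set_borel_integral_eq_integral(2)[of "{0..a}" "\<lambda>x. x powr (-1/2)"] integral_unique[OF hi]
    by (simp add: set_lebesgue_integral_def set_integrable_def)
  have q: "integrable lborel (\<lambda>t. ?p (0 + (-1) * t))"
    by (rule lborel_integrable_real_affine[OF p]) simp
  have vq: "(LBINT t. ?p (0 + (-1) * t)) = 2 * sqrt a"
    using lborel_integral_real_affine[of "-1" ?p 0] vp by simp
  have e: "(\<lambda>t::real. indicator {-a..a} t * \<bar>t\<bar> powr (-1/2)) = (\<lambda>t. ?p t + ?p (0 + (-1) * t))"
    using assms by (auto simp: fun_eq_iff split: split_indicator)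
  show "integrable lborel (\<lambda>t::real. indicator {-a..a} t * \<bar>t\<bar> powr (-1/2))"
    unfolding e by (rule Bochner_Integration.integrable_add[OF p q])
  show "(LBINT t. indicator {-a..a} t * \<bar>t\<bar> powr (-1/2)) = 4 * sqrt a"
    unfolding e Bochner_Integration.integral_add[OF p q] vp vq by simp
qed

lemma lborel_integrable_reflect:
  fixes k :: "real \<Rightarrow> 'a::{banach, second_countable_topology}"
  assumes "integrable lborel k"
  shows "integrable lborel (\<lambda>t. k (x - t))"
  using lborel_integrable_real_affine[OF assms, of "-1" x] by simp

lemma lborel_integral_reflect:
  fixes k :: "real \<Rightarrow> 'a::{banach, second_countable_topology}"
  shows "(LBINT t. k (x - t)) = (LBINT t. k t)"
  using lborel_integral_real_affine[of "-1" k x] by simp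

text \<open>
  The singularity \<open>\<bar>h\<bar> powr (-1/2)\<close> at the pole is integrable, and at
  infinity the difference gains two powers.
\<close>

lemma riesz_kernel_vertical_integrable_1: "integrable lborel (\<lambda>h::real. riesz_kernel 0 h 0 - riesz_kernel 0 h 1)"
proof (rule Bochner_Integration.integrable_bound)
  show "integrable lborel (\<lambda>t::real. indicator {-1..1} t * \<bar>t\<bar> powr (-1/2) + indicator {t. 1 \<le> \<bar>t\<bar>} t * \<bar>t\<bar> powr (-5/2))"
    by (intro Bochner_Integration.integrable_add integrable_inv_sqrt_near_0 integrable_powr_tail) auto
  show "AE h in lborel. norm (riesz_kernel 0 h 0 - riesz_kernel 0 h 1)
    \<le> norm (indicator {-1..1} h * \<bar>h\<bar> powr (-1/2) + indicator {t. 1 \<le> \<bar>t\<bar>} h * \<bar>h\<bar> powr (-5/2))"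
    using AE_lborel_singleton[of 0]
  proof eventually_elim
    case (elim h)
    have n: "0 \<le> riesz_kernel 0 h 0 - riesz_kernel 0 h 1" using riesz_kernel_antimono[of 0 1 h 0] elim by simp
    show ?case
    proof (cases "\<bar>h\<bar> < 1")
      case True
      then show ?thesis using n by (auto simp: riesz_kernel_at_0 split: split_indicator)
    next
      case False
      have "riesz_kernel 0 h 0 - riesz_kernel 0 h 1 \<le> (h\<^sup>2) powr (-5/4) * ((h\<^sup>2 + 1) - h\<^sup>2)"
        unfolding riesz_kernel_def using elim bernoulli_quarter[of "h\<^sup>2" "h\<^sup>2 + 1"] by simp
      also have "\<dots> = (\<bar>h\<bar> powr 2) powr (-5/4)" by simp
      also have "\<dots> = \<bar>h\<bar> powr (-5/2)" unfolding powr_powr by simp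
      also have "\<dots> \<le> indicator {-1..1} h * \<bar>h\<bar> powr (-1/2) + indicator {t. 1 \<le> \<bar>t\<bar>} h * \<bar>h\<bar> powr (-5/2)"
        using False by (simp add: indicator_def)
      finally show ?thesis using n by simp
    qed
  qed
qed measurable

lemma riesz_kernel_scale:
  assumes "r > 0"
  shows "riesz_kernel (r * t) (r * x) (r * y) = r powr (-1/2) * riesz_kernel t x y"
proof -
  have "(r * x - r * t)\<^sup>2 + (r * y)\<^sup>2 = (r powr 2) * ((x - t)\<^sup>2 + y\<^sup>2)"
    using assms by (simp add: algebra_simps power2_eq_square)
  then show ?thesis unfolding riesz_kernel_def by (simp add: powr_mult powr_powr)
qed

lemma riesz_kernel_vertical_integrable_0:
  assumes "Y > 0"
  shows "integrable lborel (\<lambda>t. riesz_kernel t x 0 - riesz_kernel t x Y)"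
proof -
  have "integrable lborel (\<lambda>h. riesz_kernel 0 (0 + (1/Y) * h) 0 - riesz_kernel 0 (0 + (1/Y) * h) 1)"
    using assms by (intro lborel_integrable_real_affine[OF riesz_kernel_vertical_integrable_1]) auto
  then have "integrable lborel (\<lambda>h. Y powr (-1/2) * (riesz_kernel 0 (0 + (1/Y) * h) 0 - riesz_kernel 0 (0 + (1/Y) * h) 1))"
    by (intro integrable_mult_right)
  also have "(\<lambda>h. Y powr (-1/2) * (riesz_kernel 0 (0 + (1/Y) * h) 0 - riesz_kernel 0 (0 + (1/Y) * h) 1)) = (\<lambda>h. riesz_kernel 0 h 0 - riesz_kernel 0 h Y)"
  proof
    fix h
    have "riesz_kernel 0 h (Y * v) = Y powr (-1/2) * riesz_kernel 0 (0 + (1/Y) * h) v" for v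
      using riesz_kernel_scale[of Y 0 "(1/Y) * h" v] assms by simp
    from this[of 0] this[of 1]
    show "Y powr (-1/2) * (riesz_kernel 0 (0 + (1/Y) * h) 0 - riesz_kernel 0 (0 + (1/Y) * h) 1) = riesz_kernel 0 h 0 - riesz_kernel 0 h Y"
      by (simp only: right_diff_distrib mult_zero_right mult_1_right)
  qed
  finally have "integrable lborel (\<lambda>h. riesz_kernel 0 h 0 - riesz_kernel 0 h Y)" .
  from lborel_integrable_reflect[OF this, of x] show ?thesis by (simp add: riesz_kernel_def)
qed

text \<open>
  The kernel decreases in the height, so the difference of two heights is dominated by the
  difference with height zero, which is a rescaling of
  \<open>riesz_kernel_vertical_integrable_1\<close>.
\<close>

lemma riesz_kernel_vertical_integrable:
  assumes "y \<ge> 0" "y' \<ge> 0"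
  shows "integrable lborel (\<lambda>t. riesz_kernel t x y - riesz_kernel t x y')"
proof -
  define Y where "Y = y + y' + 1"
  have *: "integrable lborel (\<lambda>t. riesz_kernel t x v - riesz_kernel t x Y)" if "0 \<le> v" "v \<le> Y" for v
  proof (rule Bochner_Integration.integrable_bound[OF riesz_kernel_vertical_integrable_0[of Y x]])
    show "AE t in lborel. norm (riesz_kernel t x v - riesz_kernel t x Y) \<le> norm (riesz_kernel t x 0 - riesz_kernel t x Y)"
      using AE_lborel_singleton[of x]
    proof eventually_elim
      case (elim t)
      then show ?case
        using riesz_kernel_antimono[of 0 v x t] riesz_kernel_antimono[of v Y x t] that by auto
    qed
  qed (use assms in \<open>auto simp: Y_def\<close>)
  have "integrable lborel (\<lambda>t. (riesz_kernel t x y - riesz_kernel t x Y) - (riesz_kernel t x y' - riesz_kernel t x Y))"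
    using assms by (intro Bochner_Integration.integrable_diff *) (auto simp: Y_def)
  then show ?thesis by simp
qed

text \<open>
  A horizontal displacement gains one power of decay, uniformly in the height \<open>Y\<close>;
  the right hand side is integrable in \<open>t\<close>. Uniformity in \<open>Y\<close> is
  needed for the limit \<open>Y \<rightarrow> \<infinity>\<close>.
\<close>

lemma riesz_kernel_horizontal_bound:
  assumes "Y \<ge> 1"
  shows "\<bar>riesz_kernel t x Y - riesz_kernel t x' Y\<bar> \<le> 2 * \<bar>x - x'\<bar> * sqrt (2 + 2 * (x - x')\<^sup>2) *
     (((x - t)\<^sup>2 + 1) powr (-3/4) + ((x' - t)\<^sup>2 + 1) powr (-3/4))"
proof -
  have *: "riesz_kernel t x Y - riesz_kernel t x' Y \<le> 2 * \<bar>x - x'\<bar> * sqrt (2 + 2 * (x - x')\<^sup>2) * ((x - t)\<^sup>2 + 1) powr (-3/4)"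
    if AB: "(x - t)\<^sup>2 \<le> (x' - t)\<^sup>2" for x x' :: real
  proof -
    define A B where "A = (x - t)\<^sup>2 + Y\<^sup>2" and "B = (x' - t)\<^sup>2 + Y\<^sup>2"
    have Y2: "Y\<^sup>2 \<ge> 1" using assms by simp
    then have A: "A \<ge> 1" "A \<le> B" using AB by (auto simp: A_def B_def intro: add_increasing)
    have BA: "B \<le> (2 + 2 * (x - x')\<^sup>2) * A"
    proof -
      have "(x' - t)\<^sup>2 \<le> 2 * (x - t)\<^sup>2 + 2 * (x - x')\<^sup>2"
        using sum_squares_bound[of "x - t" "x' - x"] by (simp add: power2_eq_square algebra_simps)
      moreover have "(x - x')\<^sup>2 * 1 \<le> (x - x')\<^sup>2 * A" using A by (intro mult_left_mono) auto
      moreover have "2 * A = 2 * (x - t)\<^sup>2 + 2 * Y\<^sup>2" by (simp add: A_def)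
      moreover have "(2 + 2 * (x - x')\<^sup>2) * A = 2 * A + 2 * ((x - x')\<^sup>2 * A)" by (simp add: algebra_simps)
      ultimately show ?thesis unfolding B_def using Y2 by linarith
    qed
    have sq: "\<bar>x - t\<bar> \<le> sqrt B" "\<bar>x' - t\<bar> \<le> sqrt B"
      using real_sqrt_le_mono[of "(x - t)\<^sup>2" B] real_sqrt_le_mono[of "(x' - t)\<^sup>2" B] AB Y2 by (auto simp: B_def)
    have "B - A = (x' - x) * ((x' - t) + (x - t))" by (simp add: A_def B_def power2_eq_square algebra_simps)
    also have "\<dots> \<le> \<bar>x' - x\<bar> * \<bar>(x' - t) + (x - t)\<bar>" by (simp flip: abs_mult)
    also have "\<dots> \<le> \<bar>x - x'\<bar> * (2 * sqrt B)" using sq by (subst abs_minus_commute, intro mult_left_mono) auto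
    also have "\<dots> \<le> \<bar>x - x'\<bar> * (2 * (sqrt (2 + 2 * (x - x')\<^sup>2) * sqrt A))"
      using BA by (intro mult_left_mono) (auto simp flip: real_sqrt_mult)
    finally have BA': "B - A \<le> 2 * \<bar>x - x'\<bar> * sqrt (2 + 2 * (x - x')\<^sup>2) * A powr (1/2)"
      using A by (simp add: powr_half_sqrt mult_ac)
    have "riesz_kernel t x Y - riesz_kernel t x' Y \<le> A powr (-5/4) * (B - A)"
      unfolding riesz_kernel_def A_def[symmetric] B_def[symmetric] using A by (intro bernoulli_quarter) auto
    also have "\<dots> \<le> A powr (-5/4) * (2 * \<bar>x - x'\<bar> * sqrt (2 + 2 * (x - x')\<^sup>2) * A powr (1/2))"
      by (intro mult_left_mono BA') auto
    also have "\<dots> = 2 * \<bar>x - x'\<bar> * sqrt (2 + 2 * (x - x')\<^sup>2) * (A powr (-5/4) * A powr (1/2))" by (simp only: mult_ac)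
    also have "A powr (-5/4) * A powr (1/2) = A powr (-3/4)" by (simp flip: powr_add)
    also have "2 * \<bar>x - x'\<bar> * sqrt (2 + 2 * (x - x')\<^sup>2) * A powr (-3/4)
       \<le> 2 * \<bar>x - x'\<bar> * sqrt (2 + 2 * (x - x')\<^sup>2) * ((x - t)\<^sup>2 + 1) powr (-3/4)"
      using Y2 by (intro mult_left_mono powr_mono2') (auto simp: A_def add_nonneg_pos)
    finally show ?thesis .
  qed
  let ?c = "2 * \<bar>x - x'\<bar> * sqrt (2 + 2 * (x - x')\<^sup>2)"
  have c: "2 * \<bar>x' - x\<bar> * sqrt (2 + 2 * (x' - x)\<^sup>2) = ?c" by (simp add: power2_commute abs_minus_commute)
  have mono: "riesz_kernel t v' Y \<le> riesz_kernel t v Y" if "(v - t)\<^sup>2 \<le> (v' - t)\<^sup>2" for v v'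
    unfolding riesz_kernel_def using assms that by (intro powr_mono2') (auto intro!: add_nonneg_pos)
  have p: "0 \<le> ?c * ((x - t)\<^sup>2 + 1) powr (-3/4)" "0 \<le> ?c * ((x' - t)\<^sup>2 + 1) powr (-3/4)" by auto
  show ?thesis
  proof (cases "(x - t)\<^sup>2 \<le> (x' - t)\<^sup>2")
    case True
    from *[OF this] mono[OF this] p show ?thesis unfolding distrib_left abs_le_iff by linarith
  next
    case False
    then have F: "(x' - t)\<^sup>2 \<le> (x - t)\<^sup>2" by simp
    from *[OF F, unfolded c] mono[OF F] p show ?thesis unfolding distrib_left abs_le_iff by linarith
  qed
qed

lemma profile_shift_integrable: "integrable lborel (\<lambda>t::real. ((x - t)\<^sup>2 + 1) powr (-3/4))"
  by (rule lborel_integrable_reflect[OF poisson_profile_integrable])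

lemma riesz_kernel_diff_integrable:
  assumes "y \<ge> 0" "y' \<ge> 0"
  shows "integrable lborel (\<lambda>t. riesz_kernel t x y - riesz_kernel t x' y')"
proof -
  have "integrable lborel (\<lambda>t. riesz_kernel t x 1 - riesz_kernel t x' 1)"
  proof (rule Bochner_Integration.integrable_bound)
    show "integrable lborel (\<lambda>t. 2 * \<bar>x - x'\<bar> * sqrt (2 + 2 * (x - x')\<^sup>2) *
     (((x - t)\<^sup>2 + 1) powr (-3/4) + ((x' - t)\<^sup>2 + 1) powr (-3/4)))"
      by (intro integrable_mult_right Bochner_Integration.integrable_add profile_shift_integrable)
    show "AE t in lborel. norm (riesz_kernel t x 1 - riesz_kernel t x' 1) \<le> norm (2 * \<bar>x - x'\<bar> * sqrt (2 + 2 * (x - x')\<^sup>2) *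
     (((x - t)\<^sup>2 + 1) powr (-3/4) + ((x' - t)\<^sup>2 + 1) powr (-3/4)))"
      using riesz_kernel_horizontal_bound[of 1] by (intro AE_I2) (auto intro: order_trans)
  qed measurable
  then have "integrable lborel (\<lambda>t. (riesz_kernel t x y - riesz_kernel t x 1) + (riesz_kernel t x 1 - riesz_kernel t x' 1) + (riesz_kernel t x' 1 - riesz_kernel t x' y'))"
    using assms by (intro Bochner_Integration.integrable_add riesz_kernel_vertical_integrable) auto
  then show ?thesis by simp
qed

lemma integrable_mult_bounded:
  fixes f :: "real \<Rightarrow> complex" and k :: "real \<Rightarrow> real"
  assumes "integrable lborel k" and [measurable]: "f \<in> borel_measurable borel" and "\<And>t. norm (f t) \<le> F"
  shows "integrable lborel (\<lambda>t. of_real (k t) * f t)"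
proof (rule Bochner_Integration.integrable_bound)
  show "integrable lborel (\<lambda>t. F * \<bar>k t\<bar>)" using assms(1) by simp
  have [measurable]: "k \<in> borel_measurable borel" using borel_measurable_integrable[OF assms(1)] by simp
  show "(\<lambda>t. of_real (k t) * f t) \<in> borel_measurable lborel" by measurable
  show "AE t in lborel. norm (of_real (k t) * f t) \<le> norm (F * \<bar>k t\<bar>)"
  proof (intro AE_I2)
    fix t
    have "norm (of_real (k t) * f t) = \<bar>k t\<bar> * norm (f t)" by (simp add: norm_mult)
    also have "\<dots> \<le> \<bar>k t\<bar> * F" by (intro mult_left_mono assms(3)) auto
    also have "\<dots> = F * \<bar>k t\<bar>" by (rule mult.commute)
    also have "\<dots> \<le> norm (F * \<bar>k t\<bar>)" unfolding real_norm_def by (rule abs_ge_self)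
    finally show "norm (of_real (k t) * f t) \<le> norm (F * \<bar>k t\<bar>)" .
  qed
qed

section \<open>Expansions of the kernel in a half annulus\<close>

text \<open>
  The boundary annulus at unit scale for \<open>d = 20\<close>: the radii \<open>exp (2 *
  \<tau>)\<close> with \<open>-20 < \<tau> < 21\<close>. The margins are consumed by the later
  steps, at logarithmic radii \<open>\<plusminus>34\<close>, \<open>\<plusminus>33\<close> and
  \<open>\<plusminus>32\<close>.
\<close>

definition unit_annulus :: "real set" where
  "unit_annulus = {t. exp (-40) < \<bar>t\<bar> \<and> \<bar>t\<bar> < exp 42}"

lemma unit_annulus_measurable [measurable]: "unit_annulus \<in> sets borel"
  unfolding unit_annulus_def by measurable

lemma integrable_const_Icc: "integrable lborel (\<lambda>t::real. F * indicator {a..b} t :: real)"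
  by (intro integrable_mult_right integrable_real_indicator) (auto simp: emeasure_lborel_Icc_eq)

lemma riesz_kernel_polar:
  "riesz_kernel t (r * cos \<phi>) (r * sin \<phi>) = (r\<^sup>2 - 2 * r * t * cos \<phi> + t\<^sup>2) powr (-1/4)"
proof -
  have "(r * cos \<phi> - t)\<^sup>2 + (r * sin \<phi>)\<^sup>2 = r\<^sup>2 * ((sin \<phi>)\<^sup>2 + (cos \<phi>)\<^sup>2) - 2 * r * t * cos \<phi> + t\<^sup>2"
    unfolding power2_eq_square by algebra
  then show ?thesis by (simp add: riesz_kernel_def)
qed

text \<open>
  A pole inside the circle produces the decaying modes \<open>r powr (-1/2) / r ^ n\<close>, by
  the generating function with \<open>w = t / r\<close>.
\<close>

lemma riesz_kernel_inner_expansion: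
  assumes "\<bar>t\<bar> < r"
  shows "(\<lambda>n. r powr (-1/2) * geg n \<phi> * (t / r) ^ n) sums riesz_kernel t (r * cos \<phi>) (r * sin \<phi>)"
proof -
  have r: "r > 0" using assms by linarith
  have "(\<lambda>n. geg n \<phi> * (t / r) ^ n) sums ((1 - 2 * (t / r) * cos \<phi> + (t / r)\<^sup>2) powr (-1/4))"
    using assms r by (intro geg_generating) (simp add: abs_divide)
  then have "(\<lambda>n. r powr (-1/2) * (geg n \<phi> * (t / r) ^ n)) sums
      (r powr (-1/2) * (1 - 2 * (t / r) * cos \<phi> + (t / r)\<^sup>2) powr (-1/4))" by (rule sums_mult)
  also have "r powr (-1/2) = (r\<^sup>2) powr (-1/4)"
  proof -
    have "(r\<^sup>2) powr (-1/4) = (r powr 2) powr (-1/4)" using r by simp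
    then show ?thesis unfolding powr_powr by simp
  qed
  also have "(r\<^sup>2) powr (-1/4) * (1 - 2 * (t / r) * cos \<phi> + (t / r)\<^sup>2) powr (-1/4)
      = riesz_kernel t (r * cos \<phi>) (r * sin \<phi>)"
  proof -
    have "r\<^sup>2 * (1 - 2 * (t / r) * cos \<phi> + (t / r)\<^sup>2) = r\<^sup>2 - 2 * r * t * cos \<phi> + t\<^sup>2"
      using r by (simp add: field_simps power2_eq_square)
    then show ?thesis unfolding riesz_kernel_polar by (metis powr_mult)
  qed
  finally show ?thesis
    using \<open>r powr (-1/2) = (r\<^sup>2) powr (-1/4)\<close> by (simp only: mult.assoc)
qed

text \<open>
  A pole outside the circle produces the growing modes \<open>r ^ n\<close>, by the generating
  function with \<open>w = r / t\<close>.
\<close>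

lemma riesz_kernel_outer_expansion:
  assumes "0 < r" "r < \<bar>t\<bar>"
  shows "(\<lambda>n. \<bar>t\<bar> powr (-1/2) * geg n \<phi> * (r / t) ^ n) sums riesz_kernel t (r * cos \<phi>) (r * sin \<phi>)"
proof -
  have t: "t \<noteq> 0" using assms by auto
  have "(\<lambda>n. geg n \<phi> * (r / t) ^ n) sums ((1 - 2 * (r / t) * cos \<phi> + (r / t)\<^sup>2) powr (-1/4))"
    using assms by (intro geg_generating) (simp add: abs_divide)
  then have "(\<lambda>n. \<bar>t\<bar> powr (-1/2) * (geg n \<phi> * (r / t) ^ n)) sums
      (\<bar>t\<bar> powr (-1/2) * (1 - 2 * (r / t) * cos \<phi> + (r / t)\<^sup>2) powr (-1/4))" by (rule sums_mult)
  also have e: "\<bar>t\<bar> powr (-1/2) = (t\<^sup>2) powr (-1/4)"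
  proof -
    have "(t\<^sup>2) powr (-1/4) = (\<bar>t\<bar> powr 2) powr (-1/4)" by simp
    then show ?thesis unfolding powr_powr by simp
  qed
  also have "(t\<^sup>2) powr (-1/4) * (1 - 2 * (r / t) * cos \<phi> + (r / t)\<^sup>2) powr (-1/4)
      = riesz_kernel t (r * cos \<phi>) (r * sin \<phi>)"
  proof -
    have "t\<^sup>2 * (1 - 2 * (r / t) * cos \<phi> + (r / t)\<^sup>2) = r\<^sup>2 - 2 * r * t * cos \<phi> + t\<^sup>2"
      using t by (simp add: field_simps power2_eq_square)
    then show ?thesis unfolding riesz_kernel_polar by (metis powr_mult)
  qed
  finally show ?thesis using e by (simp only: mult.assoc)
qed

text \<open>
  Termwise integration when the terms have a common integrable profile \<open>G\<close> with
  summable factors.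
\<close>

lemma sums_integral_dominated:
  fixes f :: "nat \<Rightarrow> 'a \<Rightarrow> 'b::{banach, second_countable_topology}"
  assumes [measurable]: "\<And>n. f n \<in> borel_measurable M"
    and G: "integrable M G" "\<And>x. x \<in> space M \<Longrightarrow> 0 \<le> G x"
    and B: "summable B" "\<And>n. 0 \<le> B n"
    and b: "\<And>n x. x \<in> space M \<Longrightarrow> norm (f n x) \<le> B n * G x"
    and s: "\<And>x. x \<in> space M \<Longrightarrow> (\<lambda>n. f n x) sums F x"
  shows "(\<lambda>n. integral\<^sup>L M (f n)) sums integral\<^sup>L M F"
    and "\<And>n. norm (integral\<^sup>L M (f n)) \<le> B n * integral\<^sup>L M G"
proof -
  have i: "integrable M (f n)" for n
    by (rule Bochner_Integration.integrable_bound[OF integrable_mult_right[OF G(1), of "B n"]])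
       (use b G B in \<open>auto intro!: AE_I2 simp: abs_mult\<close>)
  have bn: "(\<integral>x. norm (f n x) \<partial>M) \<le> B n * integral\<^sup>L M G" for n
  proof -
    have "(\<integral>x. norm (f n x) \<partial>M) \<le> (\<integral>x. B n * G x \<partial>M)"
      using i b G by (intro integral_mono integrable_norm) auto
    then show ?thesis by simp
  qed
  then show "norm (integral\<^sup>L M (f n)) \<le> B n * integral\<^sup>L M G" for n
    using integral_norm_bound[of M "f n"] by (rule order_trans[rotated])
  have sn: "summable (\<lambda>n. norm (f n x))" if "x \<in> space M" for x
    using b[OF that] by (intro summable_comparison_test'[OF summable_mult2[OF B(1), of "G x"], of 0]) auto
  have si: "summable (\<lambda>n. \<integral>x. norm (f n x) \<partial>M)"
    using bn by (intro summable_comparison_test'[OF summable_mult2[OF B(1), of "integral\<^sup>L M G"], of 0]) auto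
  have "(\<lambda>n. integral\<^sup>L M (f n)) sums (\<integral>x. (\<Sum>n. f n x) \<partial>M)"
    using summable_integral[OF i AE_I2 si] integral_suminf[OF i AE_I2 si] sn
    by (auto simp: sums_iff)
  also have "(\<integral>x. (\<Sum>n. f n x) \<partial>M) = integral\<^sup>L M F"
    using s by (intro Bochner_Integration.integral_cong) (auto simp: sums_iff)
  finally show "(\<lambda>n. integral\<^sup>L M (f n)) sums integral\<^sup>L M F" .
qed

lemma summable_linear_geometric:
  fixes q :: real assumes "0 \<le> q" "q < 1"
  shows "summable (\<lambda>n. (real n + 2) * q ^ n)"
proof -
  have "summable (\<lambda>n. of_nat (Suc n) * q ^ n)" using geometric_deriv_sums[of q] assms by (auto simp: sums_iff)
  moreover have "summable (\<lambda>n. q ^ n)" using assms by (intro summable_geometric) auto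
  ultimately have "summable (\<lambda>n. of_nat (Suc n) * q ^ n + q ^ n)" by (rule summable_add)
  then show ?thesis by (simp add: algebra_simps)
qed

lemma potential_inner_series:
  fixes f :: "real \<Rightarrow> complex"
  assumes [measurable]: "f \<in> borel_measurable borel" and F: "\<And>t. norm (f t) \<le> F"
    and supp: "\<And>t. a < \<bar>t\<bar> \<Longrightarrow> f t = 0" and a: "0 < a" "a < r"
  shows "(\<lambda>n. (LBINT t. f t * of_real (t ^ n)) * of_real (r powr (-1/2) / r ^ n * geg n \<phi>)) sums
      (LBINT t. of_real (riesz_kernel t (r * cos \<phi>) (r * sin \<phi>)) * f t)"
    and "norm (LBINT t. f t * of_real (t ^ n)) \<le> 2 * a * F * a ^ n"
proof -
  have r: "r > 0" using a by simp
  have F0: "F \<ge> 0" using norm_ge_zero F by (rule order_trans)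
  have G: "integrable lborel (\<lambda>t. F * indicator {-a..a} t)"
    by (rule integrable_const_Icc)
  have "(\<lambda>n. LBINT t. of_real (r powr (-1/2) * geg n \<phi> * (t / r) ^ n) * f t) sums
      (LBINT t. of_real (riesz_kernel t (r * cos \<phi>) (r * sin \<phi>)) * f t)"
  proof (rule sums_integral_dominated(1)[OF _ G])
    show "summable (\<lambda>n. r powr (-1/2) * ((real n + 2) * (a / r) ^ n))"
      using a r by (intro summable_mult summable_linear_geometric) auto
    show "norm (of_real (r powr (-1/2) * geg n \<phi> * (t / r) ^ n) * f t)
        \<le> r powr (-1/2) * ((real n + 2) * (a / r) ^ n) * (F * indicator {-a..a} t)" for n t
    proof (cases "\<bar>t\<bar> \<le> a")
      case True
      have "norm (of_real (r powr (-1/2) * geg n \<phi> * (t / r) ^ n) * f t) = r powr (-1/2) * (\<bar>geg n \<phi>\<bar> * (\<bar>t\<bar> / r) ^ n) * norm (f t)"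
        using r by (simp add: norm_mult abs_mult power_abs abs_divide norm_power norm_divide)
      also have "\<dots> \<le> r powr (-1/2) * ((real n + 2) * (a / r) ^ n) * F"
        using True r F F0 abs_geg_le[of n \<phi>] geg_zero_le[of n]
        by (intro mult_mono mult_left_mono power_mono divide_right_mono mult_nonneg_nonneg) (auto intro: divide_nonneg_pos)
      finally show ?thesis using True by (simp add: indicator_def abs_le_iff)
    next
      case False
      then show ?thesis using supp[of t] by (auto simp: indicator_def)
    qed
    show "(\<lambda>n. of_real (r powr (-1/2) * geg n \<phi> * (t / r) ^ n) * f t) sums (of_real (riesz_kernel t (r * cos \<phi>) (r * sin \<phi>)) * f t)" for t
    proof (cases "\<bar>t\<bar> < r")
      case True
      then show ?thesis by (intro sums_mult2) (subst sums_of_real_iff, rule riesz_kernel_inner_expansion)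
    next
      case False
      then show ?thesis using supp[of t] a by simp
    qed
  qed (use r a F0 in auto)
  moreover have "(LBINT t. of_real (r powr (-1/2) * geg n \<phi> * (t / r) ^ n) * f t)
     = (LBINT t. f t * of_real (t ^ n)) * of_real (r powr (-1/2) / r ^ n * geg n \<phi>)" (is "_ = ?rhs") for n
  proof -
    have "(LBINT t. of_real (r powr (-1/2) * geg n \<phi> * (t / r) ^ n) * f t)
       = (LBINT t. of_real (r powr (-1/2) / r ^ n * geg n \<phi>) * (f t * of_real (t ^ n)))"
      by (intro Bochner_Integration.integral_cong) (auto simp: power_divide mult_ac)
    also have "\<dots> = ?rhs"
      by (subst integral_mult_right_zero) (rule mult.commute)
    finally show ?thesis .
  qed
  ultimately show "(\<lambda>n. (LBINT t. f t * of_real (t ^ n)) * of_real (r powr (-1/2) / r ^ n * geg n \<phi>)) sums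
      (LBINT t. of_real (riesz_kernel t (r * cos \<phi>) (r * sin \<phi>)) * f t)" by simp
  have b: "norm (f t * of_real (t ^ n)) \<le> a ^ n * (F * indicator {-a..a} t)" for t
  proof (cases "\<bar>t\<bar> \<le> a")
    case True
    have "norm (f t) * \<bar>t\<bar> ^ n \<le> F * a ^ n" using True F F0 by (intro mult_mono power_mono) auto
    then show ?thesis using True by (simp add: norm_mult norm_power indicator_def abs_le_iff mult.commute)
  next
    case False
    then show ?thesis using supp[of t] by (auto simp: indicator_def)
  qed
  have "norm (LBINT t. f t * of_real (t ^ n)) \<le> (LBINT t. norm (f t * of_real (t ^ n)))" by (rule integral_norm_bound)
  also have "\<dots> \<le> (LBINT t. a ^ n * (F * indicator {-a..a} t))"
  proof (rule integral_mono)
    show "integrable lborel (\<lambda>t. norm (f t * of_real (t ^ n)))"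
      by (rule Bochner_Integration.integrable_bound[of _ "\<lambda>t. a ^ n * (F * indicator {-a..a} t)"])
         (use b a F0 integrable_mult_right[OF G, of "a ^ n"] in \<open>auto intro!: AE_I2 intro: order_trans simp: abs_mult\<close>)
  qed (use b integrable_mult_right[OF G, of "a ^ n"] in auto)
  also have "\<dots> = 2 * a * F * a ^ n" using a by simp
  finally show "norm (LBINT t. f t * of_real (t ^ n)) \<le> 2 * a * F * a ^ n" .
qed

text \<open>
  The term \<open>n = 0\<close> of the outer expansion is \<open>\<bar>t\<bar> powr
  (-1/2)\<close>, which is not integrable at infinity; it is subtracted, and the series starts
  with the first power of \<open>r\<close>.
\<close>

lemma potential_outer_series:
  fixes f :: "real \<Rightarrow> complex"
  assumes [measurable]: "f \<in> borel_measurable borel" and F: "\<And>t. norm (f t) \<le> F"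
    and supp: "\<And>t. \<bar>t\<bar> < b \<Longrightarrow> f t = 0" and r: "0 < r" "r < b"
  defines "J \<equiv> \<lambda>t. indicator {t. b \<le> \<bar>t\<bar>} t * \<bar>t\<bar> powr (-3/2)"
  shows "(\<lambda>n. (LBINT t. f t * of_real (\<bar>t\<bar> powr (-1/2) / t ^ Suc n)) * of_real (r ^ Suc n * geg (Suc n) \<phi>)) sums
      (LBINT t. of_real (riesz_kernel t (r * cos \<phi>) (r * sin \<phi>) - \<bar>t\<bar> powr (-1/2)) * f t)"
    and "norm (LBINT t. f t * of_real (\<bar>t\<bar> powr (-1/2) / t ^ Suc n)) \<le> F * integral\<^sup>L lborel J / b ^ n"
proof -
  have b: "b > 0" using r by simp
  have F0: "F \<ge> 0" using norm_ge_zero F by (rule order_trans)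
  have J: "integrable lborel J" unfolding J_def using b by (intro integrable_powr_tail) auto
  have J0: "J t \<ge> 0" for t by (simp add: J_def)
  have [measurable]: "J \<in> borel_measurable borel" using borel_measurable_integrable[OF J] by simp
  have tp: "\<bar>t\<bar> powr (-1/2) / \<bar>t\<bar> ^ Suc n \<le> \<bar>t\<bar> powr (-3/2) / b ^ n" if "b \<le> \<bar>t\<bar>" for t n
  proof -
    have t: "\<bar>t\<bar> > 0" using that b by simp
    have "\<bar>t\<bar> powr (-3/2) = \<bar>t\<bar> powr (-1/2 - 1)" by simp
    also have "\<dots> = \<bar>t\<bar> powr (-1/2) / \<bar>t\<bar>" using t by (simp only: powr_diff powr_one)
    finally have "\<bar>t\<bar> powr (-1/2) / \<bar>t\<bar> ^ Suc n = \<bar>t\<bar> powr (-3/2) / \<bar>t\<bar> ^ n" by simp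
    also have "\<dots> \<le> \<bar>t\<bar> powr (-3/2) / b ^ n" using that b t by (intro divide_left_mono power_mono) auto
    finally show ?thesis .
  qed
  have "(\<lambda>n. LBINT t. of_real (\<bar>t\<bar> powr (-1/2) * geg (Suc n) \<phi> * (r / t) ^ Suc n) * f t) sums
      (LBINT t. of_real (riesz_kernel t (r * cos \<phi>) (r * sin \<phi>) - \<bar>t\<bar> powr (-1/2)) * f t)"
  proof (rule sums_integral_dominated(1)[where G = "\<lambda>t. F * J t"])
    show "integrable lborel (\<lambda>t. F * J t)" using J by simp
    show "summable (\<lambda>n. r * ((real n + 2) * (r / b) ^ n))"
      using r by (intro summable_mult summable_linear_geometric) auto
    show "norm (of_real (\<bar>t\<bar> powr (-1/2) * geg (Suc n) \<phi> * (r / t) ^ Suc n) * f t)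
        \<le> r * ((real n + 2) * (r / b) ^ n) * (F * J t)" for n t
    proof (cases "b \<le> \<bar>t\<bar>")
      case True
      have g: "\<bar>geg (Suc n) \<phi>\<bar> \<le> real n + 2"
        using abs_geg_le[of "Suc n" \<phi>] geg_zero_le[of "Suc n"] by simp
      have "norm (of_real (\<bar>t\<bar> powr (-1/2) * geg (Suc n) \<phi> * (r / t) ^ Suc n) * f t)
         = (\<bar>geg (Suc n) \<phi>\<bar> * r ^ Suc n) * (\<bar>t\<bar> powr (-1/2) / \<bar>t\<bar> ^ Suc n) * norm (f t)"
        using r by (simp add: norm_mult abs_mult power_abs abs_divide norm_power norm_divide power_divide)
      also have "\<dots> \<le> ((real n + 2) * r ^ Suc n) * (\<bar>t\<bar> powr (-3/2) / b ^ n) * F"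
        using g r b F F0 tp[OF True] by (intro mult_mono) auto
      also have "\<dots> = r * ((real n + 2) * (r / b) ^ n) * (F * J t)"
        using True by (simp add: J_def power_divide)
      finally show ?thesis .
    next
      case False
      then show ?thesis using supp[of t] by (auto simp: J_def)
    qed
    show "(\<lambda>n. of_real (\<bar>t\<bar> powr (-1/2) * geg (Suc n) \<phi> * (r / t) ^ Suc n) * f t) sums
        (of_real (riesz_kernel t (r * cos \<phi>) (r * sin \<phi>) - \<bar>t\<bar> powr (-1/2)) * f t)" for t
    proof (cases "b \<le> \<bar>t\<bar>")
      case True
      then have "(\<lambda>n. \<bar>t\<bar> powr (-1/2) * geg n \<phi> * (r / t) ^ n) sums riesz_kernel t (r * cos \<phi>) (r * sin \<phi>)"
        using r by (intro riesz_kernel_outer_expansion) auto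
      then have "(\<lambda>n. \<bar>t\<bar> powr (-1/2) * geg (Suc n) \<phi> * (r / t) ^ Suc n) sums (riesz_kernel t (r * cos \<phi>) (r * sin \<phi>) - \<bar>t\<bar> powr (-1/2))"
        by (subst sums_Suc_iff) (simp add: geg_def bcoef_def)
      then show ?thesis by (intro sums_mult2) (subst sums_of_real_iff)
    next
      case False
      then show ?thesis using supp[of t] by simp
    qed
  qed (use r b F0 J0 in \<open>auto intro!: mult_nonneg_nonneg\<close>)
  moreover have "(LBINT t. of_real (\<bar>t\<bar> powr (-1/2) * geg (Suc n) \<phi> * (r / t) ^ Suc n) * f t)
     = (LBINT t. f t * of_real (\<bar>t\<bar> powr (-1/2) / t ^ Suc n)) * of_real (r ^ Suc n * geg (Suc n) \<phi>)" (is "_ = ?rhs") for n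
  proof -
    have "(LBINT t. of_real (\<bar>t\<bar> powr (-1/2) * geg (Suc n) \<phi> * (r / t) ^ Suc n) * f t)
       = (LBINT t. of_real (r ^ Suc n * geg (Suc n) \<phi>) * (f t * of_real (\<bar>t\<bar> powr (-1/2) / t ^ Suc n)))"
      by (intro Bochner_Integration.integral_cong) (auto simp: power_divide mult_ac)
    also have "\<dots> = ?rhs"
      by (subst integral_mult_right_zero) (rule mult.commute)
    finally show ?thesis .
  qed
  ultimately show "(\<lambda>n. (LBINT t. f t * of_real (\<bar>t\<bar> powr (-1/2) / t ^ Suc n)) * of_real (r ^ Suc n * geg (Suc n) \<phi>)) sums
      (LBINT t. of_real (riesz_kernel t (r * cos \<phi>) (r * sin \<phi>) - \<bar>t\<bar> powr (-1/2)) * f t)" by simp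
  have b': "norm (f t * of_real (\<bar>t\<bar> powr (-1/2) / t ^ Suc n)) \<le> 1 / b ^ n * (F * J t)" for t
  proof (cases "b \<le> \<bar>t\<bar>")
    case True
    have "norm (f t * of_real (\<bar>t\<bar> powr (-1/2) / t ^ Suc n)) = norm (f t) * (\<bar>t\<bar> powr (-1/2) / \<bar>t\<bar> ^ Suc n)"
      by (simp add: norm_mult norm_divide norm_power abs_mult power_abs)
    also have "\<dots> \<le> F * (\<bar>t\<bar> powr (-3/2) / b ^ n)"
      using F F0 tp[OF True] by (intro mult_mono) auto
    finally show ?thesis using True by (simp add: J_def)
  next
    case False
    then show ?thesis using supp[of t] by (auto simp: J_def)
  qed
  have "norm (LBINT t. f t * of_real (\<bar>t\<bar> powr (-1/2) / t ^ Suc n)) \<le> (LBINT t. norm (f t * of_real (\<bar>t\<bar> powr (-1/2) / t ^ Suc n)))"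
    by (rule integral_norm_bound)
  also have "\<dots> \<le> (LBINT t. 1 / b ^ n * (F * J t))"
  proof (rule integral_mono)
    show "integrable lborel (\<lambda>t. norm (f t * of_real (\<bar>t\<bar> powr (-1/2) / t ^ Suc n)))"
    proof (rule Bochner_Integration.integrable_bound[of _ "\<lambda>t. 1 / b ^ n * (F * J t)"])
      show "AE t in lborel. norm (norm (f t * of_real (\<bar>t\<bar> powr (-1/2) / t ^ Suc n))) \<le> norm (1 / b ^ n * (F * J t))"
        using b' by (intro AE_I2) (simp only: real_norm_def abs_norm_cancel, meson abs_ge_self order_trans)
    qed (use J in auto)
  qed (use b' J in auto)
  also have "\<dots> = F * integral\<^sup>L lborel J / b ^ n" by simp
  finally show "norm (LBINT t. f t * of_real (\<bar>t\<bar> powr (-1/2) / t ^ Suc n)) \<le> F * integral\<^sup>L lborel J / b ^ n" .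
qed

section \<open>Renormalised potentials\<close>

text \<open>
  The kernel is normalised to vanish at the point \<open>(0, 1)\<close>, which makes the integral
  converge for bounded \<open>f\<close>; \<open>c\<close> is the value at that point.
\<close>

definition potential :: "complex \<Rightarrow> (real \<Rightarrow> complex) \<Rightarrow> real \<Rightarrow> real \<Rightarrow> complex" where
  "potential c f x y = c + (LBINT t. of_real (riesz_kernel t x y - riesz_kernel t 0 1) * f t)"

lemma potential_integrable:
  fixes f :: "real \<Rightarrow> complex"
  assumes "f \<in> borel_measurable borel" "\<And>t. norm (f t) \<le> F" "y \<ge> 0" "y' \<ge> 0"
  shows "integrable lborel (\<lambda>t. of_real (riesz_kernel t x y - riesz_kernel t x' y') * f t)"
  using assms by (intro integrable_mult_bounded[where F = F] riesz_kernel_diff_integrable) auto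

lemma potential_measurable [measurable (raw)]:
  fixes f :: "real \<Rightarrow> complex"
  assumes [measurable]: "f \<in> borel_measurable borel" "X \<in> borel_measurable M" "Y \<in> borel_measurable M"
  shows "(\<lambda>w. potential c f (X w) (Y w)) \<in> borel_measurable M"
  unfolding potential_def by measurable

definition local_part :: "(real \<Rightarrow> complex) \<Rightarrow> real \<Rightarrow> complex" where
  "local_part f t = (if t \<in> unit_annulus then f t else 0)"

definition local_potential :: "(real \<Rightarrow> complex) \<Rightarrow> real \<Rightarrow> real \<Rightarrow> complex" where
  "local_potential f x y = (LBINT t. of_real (riesz_kernel t x y) * local_part f t)"

lemma local_part_measurable [measurable]:
  "f \<in> borel_measurable borel \<Longrightarrow> local_part f \<in> borel_measurable borel"
  unfolding local_part_def[abs_def] by (rule measurable_If_set) auto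

lemma local_potential_measurable [measurable (raw)]:
  fixes f :: "real \<Rightarrow> complex"
  assumes [measurable]: "f \<in> borel_measurable borel" "X \<in> borel_measurable M" "Y \<in> borel_measurable M"
  shows "(\<lambda>w. local_potential f (X w) (Y w)) \<in> borel_measurable M"
  unfolding local_potential_def by measurable

lemma riesz_kernel_01_le_1: "riesz_kernel t 0 1 \<le> 1"
  unfolding riesz_kernel_def using powr_mono2'[of "-1/4" 1 "(0 - t)\<^sup>2 + 1\<^sup>2"] by simp

lemma integrable_riesz_kernel_01_cutoff:
  fixes f :: "real \<Rightarrow> complex"
  assumes [measurable]: "f \<in> borel_measurable borel" and F: "\<And>t. norm (f t) \<le> F"
    and supp: "\<And>t. a < \<bar>t\<bar> \<Longrightarrow> f t = 0"
  shows "integrable lborel (\<lambda>t. of_real (riesz_kernel t 0 1) * f t)"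
proof (rule Bochner_Integration.integrable_bound)
  show "integrable lborel (\<lambda>t. F * indicator {-a..a} t)"
    by (rule integrable_const_Icc)
  have F0: "F \<ge> 0" using norm_ge_zero F by (rule order_trans)
  show "AE t in lborel. norm (of_real (riesz_kernel t 0 1) * f t) \<le> norm (F * indicator {-a..a} t)"
  proof (rule AE_I2)
    fix t
    show "norm (of_real (riesz_kernel t 0 1) * f t) \<le> norm (F * indicator {-a..a} t)"
    proof (cases "\<bar>t\<bar> \<le> a")
      case True
      have "riesz_kernel t 0 1 * norm (f t) \<le> 1 * F" using F F0 by (intro mult_mono riesz_kernel_01_le_1) auto
      then show ?thesis using True F0 by (simp add: norm_mult indicator_def abs_le_iff)
    next
      case False then show ?thesis using supp[of t] by simp
    qed
  qed
qed measurable

lemma integrable_local_potential: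
  fixes f :: "real \<Rightarrow> complex"
  assumes [measurable]: "f \<in> borel_measurable borel" and F: "\<And>t. norm (f t) \<le> F" and y: "y \<ge> 0"
  shows "integrable lborel (\<lambda>t. of_real (riesz_kernel t x y) * local_part f t)"
proof -
  have F0: "F \<ge> 0" using norm_ge_zero F by (rule order_trans)
  have lF: "norm (local_part f t) \<le> F" for t using F F0 by (simp add: local_part_def)
  have "integrable lborel (\<lambda>t. of_real (riesz_kernel t x y - riesz_kernel t 0 1) * local_part f t + of_real (riesz_kernel t 0 1) * local_part f t)"
    using y lF by (intro Bochner_Integration.integrable_add potential_integrable[where F = F]
        integrable_riesz_kernel_01_cutoff[where F = F and a = "exp 42"]) (auto simp: local_part_def unit_annulus_def)
  then show ?thesis by (simp add: algebra_simps)
qed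

text \<open>
  After the local sources are removed, the poles lie either inside all half circles with radius in
  the range considered or outside all of them, and the two expansions apply to the two groups.
  The bounds on the coefficients involve the sup norm of \<open>f\<close> and serve only to make
  the series converge; quantitative bounds come from orthogonality.
\<close>

lemma exterior_expansion:
  fixes f :: "real \<Rightarrow> complex"
  assumes [measurable]: "f \<in> borel_measurable borel" and F: "\<And>t. norm (f t) \<le> F"
  obtains \<alpha> \<beta> D where 
    "\<And>n. norm (\<alpha> n) \<le> D / exp 42 ^ n" "\<And>n. norm (\<beta> n) \<le> D * exp (-40) ^ n"
    "\<And>r \<phi>. exp (-40) < r \<Longrightarrow> r < exp 42 \<Longrightarrow> 0 \<le> \<phi> \<Longrightarrow> \<phi> \<le> pi \<Longrightarrow>
       (\<lambda>n. (\<alpha> n * of_real (r ^ n) + \<beta> n * of_real (r powr (-1/2) / r ^ n)) * of_real (geg n \<phi>)) sums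
       (potential c f (r * cos \<phi>) (r * sin \<phi>) - local_potential f (r * cos \<phi>) (r * sin \<phi>))"
proof -
  have F0: "F \<ge> 0" using norm_ge_zero F by (rule order_trans)
  define fA where "fA = local_part f"
  define fI where "fI t = (if \<bar>t\<bar> \<le> exp (-40) then f t else 0)" for t
  define fO where "fO t = (if exp 42 \<le> \<bar>t\<bar> then f t else 0)" for t
  have [measurable]: "fA \<in> borel_measurable borel" "fI \<in> borel_measurable borel" "fO \<in> borel_measurable borel"
    unfolding fA_def fI_def[abs_def] fO_def[abs_def] by measurable
  have b: "norm (fA t) \<le> F" "norm (fI t) \<le> F" "norm (fO t) \<le> F" for t
    using F F0 by (auto simp: fA_def local_part_def fI_def fO_def)
  have lt: "exp (-40) < (exp 42 :: real)" by simp
  have split: "f t = fA t + fI t + fO t" for t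
  proof -
    have "\<not> (\<bar>t\<bar> \<le> exp (-40) \<and> exp 42 \<le> \<bar>t\<bar>)" using lt by linarith
    then show ?thesis
    by (auto simp: fA_def local_part_def fI_def fO_def unit_annulus_def)
  qed
  define J where "J = (\<lambda>t. indicator {t. exp 42 \<le> \<bar>t\<bar>} t * \<bar>t\<bar> powr (-3/2) :: real)"
  define cO where "cO n = (LBINT t. fO t * of_real (\<bar>t\<bar> powr (-1/2) / t ^ Suc n))" for n
  define \<beta> where "\<beta> n = (LBINT t. fI t * of_real (t ^ n))" for n
  (* The constant mode collects c, the normalisation of the kernel at (0, 1) and the subtracted
     zeroth term of the outer expansion, which is the kernel at (0, 0). *)
  define \<alpha>0 where "\<alpha>0 = c - (LBINT t. of_real (riesz_kernel t 0 1) * fA t) - (LBINT t. of_real (riesz_kernel t 0 1) * fI t)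
     + (LBINT t. of_real (riesz_kernel t 0 0 - riesz_kernel t 0 1) * fO t)"
  define \<alpha> where "\<alpha> n = (case n of 0 \<Rightarrow> \<alpha>0 | Suc m \<Rightarrow> cO m)" for n
  define D where "D = norm \<alpha>0 + F * integral\<^sup>L lborel J * exp 42 + 2 * exp (-40) * F"
  have Jnn: "integral\<^sup>L lborel J \<ge> 0" by (intro Bochner_Integration.integral_nonneg) (auto simp: J_def)
  have cO: "norm (cO n) \<le> F * integral\<^sup>L lborel J / exp 42 ^ n" for n
    unfolding cO_def J_def by (rule potential_outer_series(2)[where r = 1]) (use b in \<open>auto simp: fO_def\<close>)
  have \<alpha>: "norm (\<alpha> n) \<le> D / exp 42 ^ n" for n
  proof (cases n)
    case 0
    then show ?thesis using F0 Jnn by (simp add: \<alpha>_def D_def)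
  next
    case (Suc m)
    have "norm (\<alpha> n) \<le> F * integral\<^sup>L lborel J / exp 42 ^ m" using cO[of m] by (simp add: \<alpha>_def Suc)
    also have "\<dots> = F * integral\<^sup>L lborel J * exp 42 / exp 42 ^ n" by (simp add: Suc)
    also have "\<dots> \<le> D / exp 42 ^ n" using F0 by (intro divide_right_mono) (auto simp: D_def)
    finally show ?thesis .
  qed
  have \<beta>: "norm (\<beta> n) \<le> D * exp (-40) ^ n" for n
  proof -
    have "norm (\<beta> n) \<le> 2 * exp (-40) * F * exp (-40) ^ n"
      unfolding \<beta>_def by (rule potential_inner_series(2)[where r = 1]) (use b in \<open>auto simp: fI_def\<close>)
    also have "\<dots> \<le> D * exp (-40) ^ n" using F0 Jnn by (intro mult_right_mono) (auto simp: D_def)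
    finally show ?thesis .
  qed
  have main: "(\<lambda>n. (\<alpha> n * of_real (r ^ n) + \<beta> n * of_real (r powr (-1/2) / r ^ n)) * of_real (geg n \<phi>)) sums
       (potential c f (r * cos \<phi>) (r * sin \<phi>) - local_potential f (r * cos \<phi>) (r * sin \<phi>))"
    if r: "exp (-40) < r" "r < exp 42" and \<phi>: "0 \<le> \<phi>" "\<phi> \<le> pi" for r \<phi>
  proof -
    have r0: "r > 0" using less_trans[OF exp_gt_zero r(1)] .
    define x y where "x = r * cos \<phi>" and "y = r * sin \<phi>"
    have y: "y \<ge> 0" using r0 \<phi> by (simp add: y_def sin_ge_zero)
    have sI: "(\<lambda>n. \<beta> n * of_real (r powr (-1/2) / r ^ n * geg n \<phi>)) sums (LBINT t. of_real (riesz_kernel t x y) * fI t)"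
      unfolding \<beta>_def x_def y_def
      by (rule potential_inner_series(1)[where a = "exp (-40)" and F = F]) (use b r in \<open>auto simp: fI_def\<close>)
    have sO: "(\<lambda>n. cO n * of_real (r ^ Suc n * geg (Suc n) \<phi>)) sums
        (LBINT t. of_real (riesz_kernel t x y - \<bar>t\<bar> powr (-1/2)) * fO t)"
      unfolding cO_def x_def y_def
      by (rule potential_outer_series(1)[where b = "exp 42" and F = F]) (use b r r0 in \<open>auto simp: fO_def\<close>)
    have "(\<lambda>n. \<alpha> (Suc n) * of_real (r ^ Suc n) * of_real (geg (Suc n) \<phi>)) sums
        (LBINT t. of_real (riesz_kernel t x y - \<bar>t\<bar> powr (-1/2)) * fO t)"
      using sO by (simp add: \<alpha>_def mult_ac)
    then have "(\<lambda>n. \<alpha> n * of_real (r ^ n) * of_real (geg n \<phi>)) sums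
        ((LBINT t. of_real (riesz_kernel t x y - \<bar>t\<bar> powr (-1/2)) * fO t) + \<alpha> 0 * of_real (r ^ 0) * of_real (geg 0 \<phi>))"
      by (rule sums_Suc)
    also have "\<alpha> 0 * of_real (r ^ 0) * of_real (geg 0 \<phi>) = \<alpha>0" by (simp add: \<alpha>_def geg_def bcoef_def)
    finally have "(\<lambda>n. \<alpha> n * of_real (r ^ n) * of_real (geg n \<phi>) + \<beta> n * of_real (r powr (-1/2) / r ^ n * geg n \<phi>)) sums
       ((LBINT t. of_real (riesz_kernel t x y - \<bar>t\<bar> powr (-1/2)) * fO t) + \<alpha>0 + (LBINT t. of_real (riesz_kernel t x y) * fI t))"
      using sI by (rule sums_add)
    moreover have "(LBINT t. of_real (riesz_kernel t x y - \<bar>t\<bar> powr (-1/2)) * fO t) + \<alpha>0 + (LBINT t. of_real (riesz_kernel t x y) * fI t)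
       = potential c f x y - local_potential f x y"
    proof -
      have iA: "integrable lborel (\<lambda>t. of_real (riesz_kernel t 0 1) * fA t)"
        using b by (intro integrable_riesz_kernel_01_cutoff[where F = F and a = "exp 42"]) (auto simp: fA_def local_part_def unit_annulus_def)
      have iI: "integrable lborel (\<lambda>t. of_real (riesz_kernel t 0 1) * fI t)"
        using b by (intro integrable_riesz_kernel_01_cutoff[where F = F and a = "exp (-40)"]) (auto simp: fI_def)
      note di = potential_integrable[where F = F, OF _ _ y]
      have dA: "integrable lborel (\<lambda>t. of_real (riesz_kernel t x y - riesz_kernel t 0 1) * fA t)"
        and dI: "integrable lborel (\<lambda>t. of_real (riesz_kernel t x y - riesz_kernel t 0 1) * fI t)"
        and dO: "integrable lborel (\<lambda>t. of_real (riesz_kernel t x y - riesz_kernel t 0 1) * fO t)"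
        and dO1: "integrable lborel (\<lambda>t. of_real (riesz_kernel t x y - riesz_kernel t 0 0) * fO t)"
        and dO2: "integrable lborel (\<lambda>t. of_real (riesz_kernel t 0 0 - riesz_kernel t 0 1) * fO t)"
        by (rule potential_integrable[where F = F]; (use b y in simp))+
      have 1: "(LBINT t. of_real (riesz_kernel t x y - riesz_kernel t 0 1) * f t) =
         (LBINT t. of_real (riesz_kernel t x y - riesz_kernel t 0 1) * fA t) + (LBINT t. of_real (riesz_kernel t x y - riesz_kernel t 0 1) * fI t)
         + (LBINT t. of_real (riesz_kernel t x y - riesz_kernel t 0 1) * fO t)"
        unfolding split distrib_left
        by (simp only: Bochner_Integration.integral_add dA dI dO Bochner_Integration.integrable_add)
      have eA: "local_potential f x y = (LBINT t. of_real (riesz_kernel t x y - riesz_kernel t 0 1) * fA t) + (LBINT t. of_real (riesz_kernel t 0 1) * fA t)"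
        unfolding local_potential_def fA_def[symmetric] Bochner_Integration.integral_add[OF dA iA, symmetric]
        by (intro Bochner_Integration.integral_cong) (auto simp: algebra_simps)
      have eI: "(LBINT t. of_real (riesz_kernel t x y) * fI t) = (LBINT t. of_real (riesz_kernel t x y - riesz_kernel t 0 1) * fI t) + (LBINT t. of_real (riesz_kernel t 0 1) * fI t)"
        unfolding Bochner_Integration.integral_add[OF dI iI, symmetric]
        by (intro Bochner_Integration.integral_cong) (auto simp: algebra_simps)
      have eO: "(LBINT t. of_real (riesz_kernel t x y - riesz_kernel t 0 1) * fO t) = (LBINT t. of_real (riesz_kernel t x y - riesz_kernel t 0 0) * fO t)
         + (LBINT t. of_real (riesz_kernel t 0 0 - riesz_kernel t 0 1) * fO t)"
        unfolding Bochner_Integration.integral_add[OF dO1 dO2, symmetric]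
        by (intro Bochner_Integration.integral_cong) (auto simp: algebra_simps)
      have r0: "riesz_kernel t 0 0 = \<bar>t\<bar> powr (-1/2)" for t by (simp add: riesz_kernel_at_0)
      show ?thesis unfolding potential_def 1 eA eI eO \<alpha>0_def r0 by simp
    qed
    ultimately have "(\<lambda>n. \<alpha> n * of_real (r ^ n) * of_real (geg n \<phi>) + \<beta> n * of_real (r powr (-1/2) / r ^ n * geg n \<phi>)) sums
       (potential c f x y - local_potential f x y)" by (simp only:)
    moreover have "(\<lambda>n. \<alpha> n * of_real (r ^ n) * of_real (geg n \<phi>) + \<beta> n * of_real (r powr (-1/2) / r ^ n * geg n \<phi>))
       = (\<lambda>n. (\<alpha> n * of_real (r ^ n) + \<beta> n * of_real (r powr (-1/2) / r ^ n)) * of_real (geg n \<phi>))"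
      by (simp add: fun_eq_iff algebra_simps)
    ultimately show ?thesis unfolding x_def y_def by (simp only:)
  qed
  show ?thesis by (rule that[of \<alpha> D \<beta>]) (use \<alpha> \<beta> main in auto)
qed

text \<open>
  The series may be integrated term by term since the functions grow at most linearly in
  \<open>n\<close>.
\<close>

lemma geg_series_coefficient:
  fixes v :: "nat \<Rightarrow> complex"
  assumes s: "summable (\<lambda>n. norm (v n) * (real n + 1))"
    and N: "\<And>\<phi>. 0 \<le> \<phi> \<Longrightarrow> \<phi> \<le> pi \<Longrightarrow> (\<lambda>n. v n * of_real (geg n \<phi>)) sums N \<phi>"
  shows "(LBINT \<phi>:{0..pi}. N \<phi> * of_real (geg m \<phi> * sin_weight \<phi>)) = v m * of_real (LBINT \<phi>:{0..pi}. geg m \<phi> * geg m \<phi> * sin_weight \<phi>)"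
proof -
  define G where "G \<phi> = geg m 0 * indicator {0..pi} \<phi>" for \<phi> :: real
  have "(\<lambda>n. LBINT \<phi>. indicator {0..pi} \<phi> *\<^sub>R (v n * of_real (geg n \<phi> * geg m \<phi> * sin_weight \<phi>))) sums
     (LBINT \<phi>. indicator {0..pi} \<phi> *\<^sub>R (N \<phi> * of_real (geg m \<phi> * sin_weight \<phi>)))"
  proof (rule sums_integral_dominated(1)[OF _ _ _ s, where G = G])
    show "integrable lborel G" unfolding G_def by (rule integrable_const_Icc)
    fix n \<phi>
    show "norm (indicator {0..pi} \<phi> *\<^sub>R (v n * of_real (geg n \<phi> * geg m \<phi> * sin_weight \<phi>))) \<le> norm (v n) * (real n + 1) * G \<phi>"
    proof (cases "\<phi> \<in> {0..pi}")
      case True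
      have "\<bar>geg n \<phi>\<bar> * \<bar>geg m \<phi>\<bar> * sin_weight \<phi> \<le> (real n + 1) * geg m 0 * 1"
        using True abs_geg_le[of m \<phi>] order_trans[OF abs_geg_le[of n \<phi>] geg_zero_le[of n]] geg_zero_pos[of m]
        by (intro mult_mono sin_weight_le_1) auto
      then have "norm (v n) * (\<bar>geg n \<phi>\<bar> * \<bar>geg m \<phi>\<bar> * sin_weight \<phi>) \<le> norm (v n) * ((real n + 1) * geg m 0 * 1)"
        by (intro mult_left_mono) auto
      then show ?thesis using True by (simp add: G_def norm_mult abs_mult mult.assoc)
    qed (simp add: G_def)
  next
    fix \<phi> :: real
    show "(\<lambda>n. indicator {0..pi} \<phi> *\<^sub>R (v n * of_real (geg n \<phi> * geg m \<phi> * sin_weight \<phi>))) sums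
       (indicator {0..pi} \<phi> *\<^sub>R (N \<phi> * of_real (geg m \<phi> * sin_weight \<phi>)))"
    proof (cases "\<phi> \<in> {0..pi}")
      case True
      then have "(\<lambda>n. v n * of_real (geg n \<phi>) * of_real (geg m \<phi> * sin_weight \<phi>)) sums (N \<phi> * of_real (geg m \<phi> * sin_weight \<phi>))"
        by (intro sums_mult2 N) auto
      then show ?thesis using True by (simp add: mult_ac)
    qed simp
    show "0 \<le> G \<phi>" using geg_zero_pos[of m] by (simp add: G_def)
  qed auto
  moreover have "(LBINT \<phi>. indicator {0..pi} \<phi> *\<^sub>R (v n * of_real (geg n \<phi> * geg m \<phi> * sin_weight \<phi>)))
      = (if n = m then v m * of_real (LBINT \<phi>:{0..pi}. geg m \<phi> * geg m \<phi> * sin_weight \<phi>) else 0)" for n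
  proof -
    have "(LBINT \<phi>. indicator {0..pi} \<phi> *\<^sub>R (v n * of_real (geg n \<phi> * geg m \<phi> * sin_weight \<phi>)))
       = (LBINT \<phi>. v n * of_real (indicator {0..pi} \<phi> *\<^sub>R (geg n \<phi> * geg m \<phi> * sin_weight \<phi>)))"
      by (intro Bochner_Integration.integral_cong) (auto split: split_indicator)
    also have "\<dots> = v n * of_real (LBINT \<phi>:{0..pi}. geg n \<phi> * geg m \<phi> * sin_weight \<phi>)"
      by (simp only: integral_mult_right_zero integral_complex_of_real set_lebesgue_integral_def)
    finally show ?thesis using geg_orthogonal[of n m] by auto
  qed
  ultimately have "(\<lambda>n. if n = m then v m * of_real (LBINT \<phi>:{0..pi}. geg m \<phi> * geg m \<phi> * sin_weight \<phi>) else 0) sums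
    (LBINT \<phi>:{0..pi}. N \<phi> * of_real (geg m \<phi> * sin_weight \<phi>))"
    by (simp only: set_lebesgue_integral_def)
  moreover have "(\<lambda>n. if n = m then v m * of_real (LBINT \<phi>:{0..pi}. geg m \<phi> * geg m \<phi> * sin_weight \<phi>) else 0) sums
      (v m * of_real (LBINT \<phi>:{0..pi}. geg m \<phi> * geg m \<phi> * sin_weight \<phi>))"
    by (rule sums_single)
  ultimately show ?thesis by (rule sums_unique2)
qed

section \<open>Bounds for the local potential\<close>

lemma sin_weight_0_pi [simp]: "sin_weight 0 = 0" "sin_weight pi = 0" by (auto simp: sin_weight_def)

lemma set_integrable_bounded_Icc:
  fixes h :: "real \<Rightarrow> 'a::{banach, second_countable_topology}"
  assumes [measurable]: "h \<in> borel_measurable borel" and b: "\<And>x. x \<in> {a..b} \<Longrightarrow> norm (h x) \<le> B"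
  shows "set_integrable lborel {a..b} h"
  unfolding set_integrable_def
proof (rule Bochner_Integration.integrable_bound[OF integrable_const_Icc[of B a b]])
  show "AE x in lborel. norm (indicator {a..b} x *\<^sub>R h x) \<le> norm (B * indicator {a..b} x)"
    using b order_trans[OF b abs_ge_self[of B]] by (intro AE_I2) (auto simp: indicator_def)
qed measurable

text \<open>
  This integral bounds the contribution of the local potential to the norm on the unit half
  circle.
\<close>

lemma inv_sqrt_sin_integrable: "set_integrable lborel {0..pi} (\<lambda>\<phi>. sin \<phi> powr (-1/2))"
proof -
  let ?k = "\<lambda>t::real. indicator {-pi..pi} t * \<bar>t\<bar> powr (-1/2)"
  have i: "integrable lborel ?k" by (rule integrable_inv_sqrt_near_0) simp
  have "integrable lborel (\<lambda>t. 2 * (?k t + ?k (pi - t)))"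
    using i lborel_integrable_reflect[OF i, of pi] by (intro integrable_mult_right Bochner_Integration.integrable_add)
  then show ?thesis unfolding set_integrable_def
  proof (rule Bochner_Integration.integrable_bound)
    have *: "sin \<phi> powr (-1/2) \<le> 2 * \<phi> powr (-1/2)" if "0 < \<phi>" "\<phi> \<le> pi / 2" for \<phi>
    proof -
      have "sin \<phi> powr (-1/2) \<le> (\<phi> / 2) powr (-1/2)"
        using sin_ge_half[of \<phi>] that by (intro powr_mono2') auto
      also have "\<dots> = 2 powr (1/2) * \<phi> powr (-1/2)" using that by (simp add: powr_divide powr_minus field_simps)
      also have "\<dots> \<le> 2 * \<phi> powr (-1/2)" using powr_mono[of "1/2" 1 2] by (intro mult_right_mono) auto
      finally show ?thesis .
    qed
    show "AE \<phi> in lborel. norm (indicator {0..pi} \<phi> *\<^sub>R sin \<phi> powr (-1/2)) \<le> norm (2 * (?k \<phi> + ?k (pi - \<phi>)))"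
    proof (rule AE_I2)
      fix \<phi> :: real
      have k0: "?k \<phi> \<ge> 0" "?k (pi - \<phi>) \<ge> 0" by auto
      have nk: "norm (2 * (?k \<phi> + ?k (pi - \<phi>))) = 2 * ?k \<phi> + 2 * ?k (pi - \<phi>)" using k0 by simp
      consider "\<phi> \<notin> {0<..<pi}" | "0 < \<phi>" "\<phi> \<le> pi / 2" | "pi / 2 \<le> \<phi>" "\<phi> < pi" by fastforce
      then show "norm (indicator {0..pi} \<phi> *\<^sub>R sin \<phi> powr (-1/2)) \<le> norm (2 * (?k \<phi> + ?k (pi - \<phi>)))"
      proof cases
        case 1
        then have "indicator {0..pi} \<phi> *\<^sub>R sin \<phi> powr (-1/2) = 0" by (auto simp: indicator_def)
        then show ?thesis unfolding nk using k0 by (simp only: norm_zero)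
      next
        case 2
        then show ?thesis unfolding nk using *[of \<phi>] by (simp add: indicator_def add_increasing2)
      next
        case 3
        then show ?thesis unfolding nk using *[of "pi - \<phi>"] by (simp add: indicator_def add_increasing)
      qed
    qed
  qed measurable
qed

text \<open>
  On the half circle the kernel is at most \<open>y powr (-1/2)\<close> with \<open>y = r * sin
  \<phi>\<close>. The loss at the end points is compensated by the weight.
\<close>

lemma local_potential_circle_bound:
  fixes f :: "real \<Rightarrow> complex"
  assumes [measurable]: "f \<in> borel_measurable borel" and F: "\<And>t. norm (f t) \<le> F"
    and \<delta>: "(\<integral>\<^sup>+t\<in>unit_annulus. ennreal (norm (f t)) \<partial>lborel) \<le> ennreal \<delta>" "\<delta> \<ge> 0"
    and r: "r > 0" and \<phi>: "0 < \<phi>" "\<phi> < pi"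
  shows "norm (local_potential f (r * cos \<phi>) (r * sin \<phi>)) \<le> r powr (-1/2) * sin \<phi> powr (-1/2) * \<delta>"
proof -
  have s: "sin \<phi> > 0" using \<phi> by (intro sin_gt_zero)
  define k where "k = r powr (-1/2) * sin \<phi> powr (-1/2)"
  have k: "riesz_kernel t (r * cos \<phi>) (r * sin \<phi>) \<le> k" for t
  proof -
    have "((r * cos \<phi> - t)\<^sup>2 + (r * sin \<phi>)\<^sup>2) powr (-1/4) \<le> ((r * sin \<phi>)\<^sup>2) powr (-1/4)"
      using r s by (intro powr_mono2') (auto simp: zero_less_mult_iff)
    also have "\<dots> = ((r * sin \<phi>) powr 2) powr (-1/4)" using r s by simp
    also have "\<dots> = k" unfolding powr_powr k_def using r s by (simp add: powr_mult)
    finally show ?thesis by (simp add: riesz_kernel_def)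
  qed
  have i: "integrable lborel (\<lambda>t. of_real (riesz_kernel t (r * cos \<phi>) (r * sin \<phi>)) * local_part f t)"
    by (rule integrable_local_potential[where F = F]) (use F r s in auto)
  have "ennreal (norm (local_potential f (r * cos \<phi>) (r * sin \<phi>))) \<le> (\<integral>\<^sup>+t. ennreal (norm (of_real (riesz_kernel t (r * cos \<phi>) (r * sin \<phi>)) * local_part f t)) \<partial>lborel)"
    unfolding local_potential_def using i by (rule integral_norm_bound_ennreal)
  also have "\<dots> \<le> (\<integral>\<^sup>+t. ennreal k * (ennreal (norm (f t)) * indicator unit_annulus t) \<partial>lborel)"
  proof (rule nn_integral_mono)
    fix t
    show "ennreal (norm (of_real (riesz_kernel t (r * cos \<phi>) (r * sin \<phi>)) * local_part f t)) \<le> ennreal k * (ennreal (norm (f t)) * indicator unit_annulus t)"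
      using mult_right_mono[OF k, of "norm (f t)" t] r s
      by (auto simp: local_part_def norm_mult k_def simp flip: ennreal_mult intro!: ennreal_leI)
  qed
  also have "\<dots> = ennreal k * (\<integral>\<^sup>+t\<in>unit_annulus. ennreal (norm (f t)) \<partial>lborel)" by (rule nn_integral_cmult) measurable
  also have "\<dots> \<le> ennreal k * ennreal \<delta>" using \<delta> by (intro mult_left_mono) auto
  also have "\<dots> = ennreal (k * \<delta>)" using \<delta> by (simp add: ennreal_mult k_def)
  finally show ?thesis using \<delta> by (subst (asm) ennreal_le_iff) (auto simp: k_def)
qed

text \<open>
  Young inequality: \<open>\<bar>x\<bar> powr (-1/2)\<close> is integrable over bounded sets, so
  the trace of the potential is bounded in \<open>L\<^sup>1\<close> of the annulus by the
  density.
\<close>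

lemma local_potential_boundary_bound:
  fixes f :: "real \<Rightarrow> complex"
  assumes [measurable]: "f \<in> borel_measurable borel" and F: "\<And>t. norm (f t) \<le> F"
    and \<delta>: "(\<integral>\<^sup>+t\<in>unit_annulus. ennreal (norm (f t)) \<partial>lborel) \<le> ennreal \<delta>" "\<delta> \<ge> 0"
  shows "(\<integral>\<^sup>+x\<in>unit_annulus. ennreal (norm (local_potential f x 0)) \<partial>lborel) \<le> ennreal (8 * exp 21 * \<delta>)"
proof -
  define L where "L = 2 * exp (42 :: real)"
  let ?k = "\<lambda>t::real. indicator {-L..L} t * \<bar>t\<bar> powr (-1/2)"
  have L: "L \<ge> 0" by (simp add: L_def)
  have ki: "integrable lborel ?k" "(LBINT t. ?k t) = 4 * sqrt L"
    by (rule integrable_inv_sqrt_near_0[OF L])+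
  have sqL: "4 * sqrt L \<le> 8 * exp 21"
  proof -
    have "L \<le> (2 * exp 21)\<^sup>2" by (simp add: L_def power2_eq_square flip: exp_add)
    then have "sqrt L \<le> 2 * exp 21" by (intro real_le_lsqrt) auto
    then show ?thesis by simp
  qed
  have inner: "(\<integral>\<^sup>+x. ennreal (indicator unit_annulus x * riesz_kernel t x 0) \<partial>lborel) \<le> ennreal (8 * exp 21)" if t: "t \<in> unit_annulus" for t
  proof -
    have i: "integrable lborel (\<lambda>x. ?k (t - x))" by (rule lborel_integrable_reflect[OF ki(1)])
    have "(\<integral>\<^sup>+x. ennreal (indicator unit_annulus x * riesz_kernel t x 0) \<partial>lborel) \<le> (\<integral>\<^sup>+x. ennreal (?k (t - x)) \<partial>lborel)"
    proof (intro nn_integral_mono ennreal_leI)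
      fix x :: real
      show "indicator unit_annulus x * riesz_kernel t x 0 \<le> ?k (t - x)"
        using t by (auto simp: indicator_def riesz_kernel_at_0 unit_annulus_def L_def abs_minus_commute)
    qed
    also have "\<dots> = ennreal (LBINT x. ?k (t - x))" using i by (intro nn_integral_eq_integral) auto
    also have "(LBINT x. ?k (t - x)) = 4 * sqrt L" using lborel_integral_reflect[of ?k t] ki(2) by simp
    also have "ennreal (4 * sqrt L) \<le> ennreal (8 * exp 21)" by (intro ennreal_leI sqL)
    finally show ?thesis .
  qed
  have "(\<integral>\<^sup>+x\<in>unit_annulus. ennreal (norm (local_potential f x 0)) \<partial>lborel)
     \<le> (\<integral>\<^sup>+x. (\<integral>\<^sup>+t. ennreal (indicator unit_annulus x * riesz_kernel t x 0 * norm (local_part f t)) \<partial>lborel) \<partial>lborel)"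
  proof (rule nn_integral_mono)
    fix x :: real
    have "ennreal (norm (local_potential f x 0)) \<le> (\<integral>\<^sup>+t. ennreal (norm (of_real (riesz_kernel t x 0) * local_part f t)) \<partial>lborel)"
      unfolding local_potential_def
      by (intro integral_norm_bound_ennreal integrable_local_potential[where F = F]) (use F in auto)
    then show "ennreal (norm (local_potential f x 0)) * indicator unit_annulus x \<le> (\<integral>\<^sup>+t. ennreal (indicator unit_annulus x * riesz_kernel t x 0 * norm (local_part f t)) \<partial>lborel)"
      by (cases "x \<in> unit_annulus") (auto simp: norm_mult)
  qed
  also have "\<dots> = (\<integral>\<^sup>+t. (\<integral>\<^sup>+x. ennreal (indicator unit_annulus x * riesz_kernel t x 0 * norm (local_part f t)) \<partial>lborel) \<partial>lborel)"
    by (rule lborel_pair.Fubini') measurable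
  also have "\<dots> \<le> (\<integral>\<^sup>+t. ennreal (8 * exp 21) * (ennreal (norm (f t)) * indicator unit_annulus t) \<partial>lborel)"
  proof (rule nn_integral_mono)
    fix t :: real
    show "(\<integral>\<^sup>+x. ennreal (indicator unit_annulus x * riesz_kernel t x 0 * norm (local_part f t)) \<partial>lborel) \<le> ennreal (8 * exp 21) * (ennreal (norm (f t)) * indicator unit_annulus t)"
    proof (cases "t \<in> unit_annulus")
      case True
      have "(\<integral>\<^sup>+x. ennreal (indicator unit_annulus x * riesz_kernel t x 0 * norm (local_part f t)) \<partial>lborel)
         = (\<integral>\<^sup>+x. ennreal (indicator unit_annulus x * riesz_kernel t x 0) * ennreal (norm (f t)) \<partial>lborel)"
        using True by (intro nn_integral_cong) (simp add: local_part_def ennreal_mult)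
      also have "\<dots> = (\<integral>\<^sup>+x. ennreal (indicator unit_annulus x * riesz_kernel t x 0) \<partial>lborel) * ennreal (norm (f t))"
        by (rule nn_integral_multc) measurable
      also have "\<dots> \<le> ennreal (8 * exp 21) * ennreal (norm (f t))" by (intro mult_right_mono inner True) auto
      finally show ?thesis using True by simp
    qed (simp add: local_part_def)
  qed
  also have "\<dots> = ennreal (8 * exp 21) * (\<integral>\<^sup>+t\<in>unit_annulus. ennreal (norm (f t)) \<partial>lborel)" by (rule nn_integral_cmult) measurable
  also have "\<dots> \<le> ennreal (8 * exp 21) * ennreal \<delta>" using \<delta> by (intro mult_left_mono) auto
  also have "\<dots> = ennreal (8 * exp 21 * \<delta>)" using \<delta> by (simp add: ennreal_mult)
  finally show ?thesis .
qed

text \<open>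
  Change of variables \<open>x = exp \<sigma>\<close> on the positive half of the annulus. The
  Jacobian is at least \<open>exp (-32)\<close>.
\<close>

lemma nn_integral_exp_subst:
  assumes [measurable]: "h \<in> borel_measurable borel"
  shows "(\<integral>\<^sup>+\<sigma>\<in>{-32..32}. h (exp \<sigma>) \<partial>lborel) \<le> ennreal (exp 32) * (\<integral>\<^sup>+x\<in>unit_annulus. h x \<partial>lborel)"
proof -
  have "(\<integral>\<^sup>+\<sigma>\<in>{-32..32}. h (exp \<sigma>) \<partial>lborel) \<le> (\<integral>\<^sup>+\<sigma>. ennreal (exp 32) * (h (exp \<sigma>) * ennreal (exp \<sigma>) * indicator {-32..32} \<sigma>) \<partial>lborel)"
  proof (rule nn_integral_mono)
    fix \<sigma> :: real
    show "h (exp \<sigma>) * indicator {-32..32} \<sigma> \<le> ennreal (exp 32) * (h (exp \<sigma>) * ennreal (exp \<sigma>) * indicator {-32..32} \<sigma>)"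
    proof (cases "\<sigma> \<in> {-32..32}")
      case True
      have "(1::ennreal) \<le> ennreal (exp 32 * exp \<sigma>)" using True by (simp flip: exp_add)
      then have "h (exp \<sigma>) * 1 \<le> h (exp \<sigma>) * ennreal (exp 32 * exp \<sigma>)" by (intro mult_left_mono) auto
      then show ?thesis using True by (simp add: ennreal_mult mult_ac)
    qed simp
  qed
  also have "\<dots> = ennreal (exp 32) * (\<integral>\<^sup>+\<sigma>. h (exp \<sigma>) * ennreal (exp \<sigma>) * indicator {-32..32} \<sigma> \<partial>lborel)"
    by (rule nn_integral_cmult) measurable
  also have "(\<integral>\<^sup>+\<sigma>. h (exp \<sigma>) * ennreal (exp \<sigma>) * indicator {-32..32} \<sigma> \<partial>lborel) = (\<integral>\<^sup>+x. h x * indicator {exp (-32)..exp 32} x \<partial>lborel)"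
    by (rule nn_integral_substitution_aux[symmetric]) (auto intro!: derivative_eq_intros continuous_intros)
  also have "\<dots> \<le> (\<integral>\<^sup>+x\<in>unit_annulus. h x \<partial>lborel)"
  proof (intro nn_integral_mono mult_left_mono)
    fix x :: real
    have "x \<in> unit_annulus" if "exp (-32) \<le> x" "x \<le> exp 32"
    proof -
      have "exp (-40) < exp (-32::real)" "exp 32 < exp (42::real)" by auto
      then have "exp (-40) < x" "x < exp 42" using that by linarith+
      moreover have "\<bar>x\<bar> = x" using that exp_gt_zero[of "-32::real"] by linarith
      ultimately show ?thesis by (simp add: unit_annulus_def)
    qed
    then show "indicator {exp (-32)..exp 32} x \<le> (indicator unit_annulus x :: ennreal)" by (auto simp: indicator_def)
  qed auto
  finally show ?thesis by (simp add: mult_left_mono)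
qed

section \<open>The estimate at unit scale\<close>

lemma set_integrable_const_Icc: "set_integrable lborel {a..b::real} (\<lambda>_. k :: real)"
  by (rule set_integrable_bounded_Icc[where B = "\<bar>k\<bar>"]) auto

lemma sin_weight_integral_le:
  assumes [measurable]: "h \<in> borel_measurable borel" and "\<And>\<phi>. \<phi> \<in> {0..pi} \<Longrightarrow> h \<phi> \<le> B" "\<And>\<phi>. \<phi> \<in> {0..pi} \<Longrightarrow> 0 \<le> h \<phi>"
  shows "(LBINT \<phi>:{0..pi}. h \<phi>) \<le> B * pi" "set_integrable lborel {0..pi} h"
proof -
  show i: "set_integrable lborel {0..pi} h"
    by (rule set_integrable_bounded_Icc[where B = B]) (use assms in auto)
  have "set_integrable lborel {0..pi} (\<lambda>_::real. B)" by (rule set_integrable_const_Icc)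
  then have "(LBINT \<phi>:{0..pi}. h \<phi>) \<le> (LBINT \<phi>:{0..pi}. B)"
    by (intro set_integral_mono i) (use assms in auto)
  also have "\<dots> = B * pi" by (simp add: set_lebesgue_integral_def)
  finally show "(LBINT \<phi>:{0..pi}. h \<phi>) \<le> B * pi" .
qed

lemma potential_circle_integrable:
  fixes f :: "real \<Rightarrow> complex"
  assumes [measurable]: "f \<in> borel_measurable borel"
    and B: "\<And>x y. y > 0 \<Longrightarrow> norm (potential c f x y) \<le> B0" and r: "r > 0"
  shows "set_integrable lborel {0..pi} (\<lambda>\<phi>. norm (potential c f (r * cos \<phi>) (r * sin \<phi>)) * sin_weight \<phi>)"
    and "set_integrable lborel {0..pi} (\<lambda>\<phi>. (norm (potential c f (r * cos \<phi>) (r * sin \<phi>)))\<^sup>2 * sin_weight \<phi>)"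
proof -
  have B0: "B0 \<ge> 0" using norm_ge_zero B[of 1 0] by (rule order_trans) simp
  have int: "0 < r * sin \<phi>" if "\<phi> \<in> {0..pi}" "\<phi> \<noteq> 0" "\<phi> \<noteq> pi" for \<phi>
    using that r by (intro mult_pos_pos sin_gt_zero) auto
  have b: "norm (potential c f (r * cos \<phi>) (r * sin \<phi>)) ^ k * sin_weight \<phi> \<le> B0 ^ k" if "\<phi> \<in> {0..pi}" for \<phi> k
  proof (cases "\<phi> = 0 \<or> \<phi> = pi")
    case True then show ?thesis using B0 by auto
  next
    case False
    then have "norm (potential c f (r * cos \<phi>) (r * sin \<phi>)) ^ k * sin_weight \<phi> \<le> B0 ^ k * 1"
      using that int[OF that] B by (intro mult_mono power_mono sin_weight_le_1) (auto simp: B0)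
    then show ?thesis by simp
  qed
  show "set_integrable lborel {0..pi} (\<lambda>\<phi>. norm (potential c f (r * cos \<phi>) (r * sin \<phi>)) * sin_weight \<phi>)"
    by (rule sin_weight_integral_le(2)[where B = "B0 ^ 1"]) (use b[of _ 1] in auto)
  show "set_integrable lborel {0..pi} (\<lambda>\<phi>. (norm (potential c f (r * cos \<phi>) (r * sin \<phi>)))\<^sup>2 * sin_weight \<phi>)"
    by (rule sin_weight_integral_le(2)[where B = "B0 ^ 2"]) (use b[of _ 2] in auto)
qed

text \<open>
  Cauchy--Schwarz, in the form \<open>2 * P * M \<le> P\<^sup>2 + M\<^sup>2\<close>; the weight
  has mass at most \<open>pi\<close>.
\<close>

lemma potential_circle_L1:
  fixes f :: "real \<Rightarrow> complex"
  assumes [measurable]: "f \<in> borel_measurable borel"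
    and B: "\<And>x y. y > 0 \<Longrightarrow> norm (potential c f x y) \<le> B0" and r: "r > 0" and M: "M > 0"
    and L2: "(LBINT \<phi>:{0..pi}. (norm (potential c f (r * cos \<phi>) (r * sin \<phi>)))\<^sup>2 * sin_weight \<phi>) \<le> M\<^sup>2"
  shows "(LBINT \<phi>:{0..pi}. norm (potential c f (r * cos \<phi>) (r * sin \<phi>)) * sin_weight \<phi>) \<le> 3 * M"
proof -
  let ?P = "\<lambda>\<phi>. norm (potential c f (r * cos \<phi>) (r * sin \<phi>))"
  note i = potential_circle_integrable[OF assms(1) B r]
  have iw: "set_integrable lborel {0..pi} sin_weight" "(LBINT \<phi>:{0..pi}. sin_weight \<phi>) \<le> 1 * pi"
    by (rule sin_weight_integral_le[where B = 1]; simp add: sin_weight_le_1)+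
  have i2: "set_integrable lborel {0..pi} (\<lambda>\<phi>. (1 / (2 * M)) * (?P \<phi> ^ 2 * sin_weight \<phi>))" "set_integrable lborel {0..pi} (\<lambda>\<phi>. M / 2 * sin_weight \<phi>)"
    using i(2) iw by (auto intro!: set_integrable_mult_right)
  have "(LBINT \<phi>:{0..pi}. ?P \<phi> * sin_weight \<phi>) \<le> (LBINT \<phi>:{0..pi}. (1 / (2 * M)) * (?P \<phi> ^ 2 * sin_weight \<phi>) + M / 2 * sin_weight \<phi>)"
  proof (rule set_integral_mono[OF i(1) set_integral_add(1)[OF i2]])
    fix \<phi>
    have "?P \<phi> \<le> (1 / (2 * M)) * ?P \<phi> ^ 2 + M / 2"
      using sum_squares_bound[of "?P \<phi>" M] M by (simp add: field_simps power2_eq_square)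
    then have "?P \<phi> * sin_weight \<phi> \<le> ((1 / (2 * M)) * ?P \<phi> ^ 2 + M / 2) * sin_weight \<phi>" by (intro mult_right_mono) auto
    then show "?P \<phi> * sin_weight \<phi> \<le> (1 / (2 * M)) * (?P \<phi> ^ 2 * sin_weight \<phi>) + M / 2 * sin_weight \<phi>" by (simp add: algebra_simps)
  qed
  also have "\<dots> = (1 / (2 * M)) * (LBINT \<phi>:{0..pi}. ?P \<phi> ^ 2 * sin_weight \<phi>) + M / 2 * (LBINT \<phi>:{0..pi}. sin_weight \<phi>)"
    unfolding set_integral_add(2)[OF i2] by simp
  also have "\<dots> \<le> (1 / (2 * M)) * M\<^sup>2 + M / 2 * (1 * pi)"
    using M by (intro add_mono mult_left_mono L2 iw) auto
  also have "\<dots> \<le> 3 * M" using M pi_less_4 by (simp add: power2_eq_square field_simps)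
  finally show ?thesis .
qed

text \<open>
  Here \<open>M\<close> is the growth, that is, the norm on all half circles with radius in the
  annulus, and \<open>\<delta>\<close> bounds the data: the \<open>L\<^sup>1\<close> norms over
  the annulus of the trace and of the density. The density is split into its local part and the
  rest. The coefficients of the series of the rest are bounded by \<open>M\<close> at the two
  logarithmic radii \<open>\<plusminus>34\<close>; at \<open>\<phi> = 0\<close> the series is
  the difference of the two traces, which is small by \<open>\<delta>\<close>. Then
  \<open>analytic_core\<close> bounds the series of absolute values by a multiple of \<open>sqrt
  (\<delta> * M)\<close>, and the square of this is the claimed product.
\<close>

lemma unit_scale_estimate:
  "\<exists>C>0. \<forall>(f :: real \<Rightarrow> complex) c F B0 M \<delta>.
     f \<in> borel_measurable borel \<longrightarrow> (\<forall>t. norm (f t) \<le> F) \<longrightarrow>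
     (\<forall>x y. y > 0 \<longrightarrow> norm (potential c f x y) \<le> B0) \<longrightarrow> M > 0 \<longrightarrow> \<delta> > 0 \<longrightarrow>
     (\<forall>r. exp (-40) < r \<longrightarrow> r < exp 42 \<longrightarrow> (LBINT \<phi>:{0..pi}. (norm (potential c f (r * cos \<phi>) (r * sin \<phi>)))\<^sup>2 * sin_weight \<phi>) \<le> M\<^sup>2) \<longrightarrow>
     (\<integral>\<^sup>+x\<in>unit_annulus. ennreal (norm (potential c f x 0)) \<partial>lborel) \<le> ennreal \<delta> \<longrightarrow>
     (\<integral>\<^sup>+x\<in>unit_annulus. ennreal (norm (f x)) \<partial>lborel) \<le> ennreal \<delta> \<longrightarrow>
     (LBINT \<phi>:{0..pi}. (norm (potential c f (cos \<phi>) (sin \<phi>)))\<^sup>2 * sin_weight \<phi>) \<le> C * M * \<delta>"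
proof -
  obtain C0 where C0: "C0 > 0" and core: "\<forall>(a :: nat \<Rightarrow> complex) b M E.
     0 < M \<longrightarrow> 0 < E \<longrightarrow>
     (\<forall>n. \<forall>\<sigma>\<in>{-34, 34}. norm (a n * exp (of_real (real n * \<sigma>)) + b n * exp (of_real (- ((real n + 1/2) * \<sigma>)))) \<le> M * (real n + 1)\<^sup>2) \<longrightarrow>
     (\<integral>\<^sup>+\<sigma>\<in>{-32..32}. ennreal (norm (\<Sum>n. a n * exp (of_real (real n * \<sigma>)) + b n * exp (of_real (- ((real n + 1/2) * \<sigma>))))) \<partial>lborel) \<le> ennreal E \<longrightarrow>
     (\<Sum>n. norm (a n) + norm (b n)) \<le> C0 * sqrt (E * M) \<and> summable (\<lambda>n. norm (a n) + norm (b n))"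
    using analytic_core by (elim exE conjE) (rule that)
  define S where "S = (LBINT \<phi>:{0..pi}. sin \<phi> powr (-1/2))"
  have S0: "S \<ge> 0" unfolding S_def set_lebesgue_integral_def by (intro Bochner_Integration.integral_nonneg) auto
  define k1 where "k1 = 128 * (3 + pi * exp 17)"
  define k2 where "k2 = exp 32 * (1 + 8 * exp 21 :: real)"
  have k: "k1 > 0" "k2 > 0" by (auto simp: k1_def k2_def add_pos_pos)
  define C where "C = 2 * C0\<^sup>2 * k2 * k1 * pi + 2 * S + 1"
  have C1: "C \<ge> 1" using k C0 S0 by (simp add: C_def)
  have "(LBINT \<phi>:{0..pi}. (norm (potential c f (cos \<phi>) (sin \<phi>)))\<^sup>2 * sin_weight \<phi>) \<le> C * M * \<delta>"
    if [measurable]: "f \<in> borel_measurable borel" and F: "\<forall>t. norm (f t) \<le> F"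
      and B: "\<forall>x y. y > 0 \<longrightarrow> norm (potential c f x y) \<le> B0" and M: "M > 0" and \<delta>: "\<delta> > 0"
      and L2: "\<forall>r. exp (-40) < r \<longrightarrow> r < exp 42 \<longrightarrow> (LBINT \<phi>:{0..pi}. (norm (potential c f (r * cos \<phi>) (r * sin \<phi>)))\<^sup>2 * sin_weight \<phi>) \<le> M\<^sup>2"
      and D: "(\<integral>\<^sup>+x\<in>unit_annulus. ennreal (norm (potential c f x 0)) \<partial>lborel) \<le> ennreal \<delta>"
      and N: "(\<integral>\<^sup>+x\<in>unit_annulus. ennreal (norm (f x)) \<partial>lborel) \<le> ennreal \<delta>"
    for f :: "real \<Rightarrow> complex" and c F B0 M \<delta>
  (* If delta exceeds M, the growth bound at radius one already gives the claim. Otherwise delta may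
     be absorbed into M wherever this helps. *)
  proof (cases "\<delta> \<le> M")
    case False
    have "(LBINT \<phi>:{0..pi}. (norm (potential c f (cos \<phi>) (sin \<phi>)))\<^sup>2 * sin_weight \<phi>) \<le> M\<^sup>2"
      using L2[rule_format, of 1] by simp
    also have "\<dots> \<le> 1 * M * \<delta>" using False M by (simp add: power2_eq_square)
    also have "\<dots> \<le> C * M * \<delta>" using C1 M \<delta> by (intro mult_right_mono) auto
    finally show ?thesis .
  next
    case \<delta>M: True
    note F = F[rule_format] and B = B[rule_format]
    obtain \<alpha> \<beta> Dc where \<alpha>: "\<And>n. norm (\<alpha> n) \<le> Dc / exp 42 ^ n" and \<beta>: "\<And>n. norm (\<beta> n) \<le> Dc * exp (-40) ^ n"
      and ser: "\<And>r \<phi>. exp (-40) < r \<Longrightarrow> r < exp 42 \<Longrightarrow> 0 \<le> \<phi> \<Longrightarrow> \<phi> \<le> pi \<Longrightarrow>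
       (\<lambda>n. (\<alpha> n * of_real (r ^ n) + \<beta> n * of_real (r powr (-1/2) / r ^ n)) * of_real (geg n \<phi>)) sums
       (potential c f (r * cos \<phi>) (r * sin \<phi>) - local_potential f (r * cos \<phi>) (r * sin \<phi>))"
      by (rule exterior_expansion[OF \<open>f \<in> borel_measurable borel\<close> F, of c]) (rule that, assumption+)
    define v where "v r n = \<alpha> n * of_real (r ^ n) + \<beta> n * of_real (r powr (-1/2) / r ^ n)" for r n
    have Dc: "Dc \<ge> 0" using order_trans[OF norm_ge_zero \<beta>[of 0]] by simp
    define Nf where "Nf r \<phi> = potential c f (r * cos \<phi>) (r * sin \<phi>) - local_potential f (r * cos \<phi>) (r * sin \<phi>)" for r \<phi>
    have [measurable]: "Nf r \<in> borel_measurable borel" for r unfolding Nf_def by measurable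
    have vsum: "summable (\<lambda>n. norm (v r n) * (real n + 1))" if r: "exp (-40) < r" "r < exp 42" for r
    proof (rule summable_comparison_test'[where N = 0])
      have r0: "r > 0" using less_trans[OF exp_gt_zero r(1)] .
      have q: "0 \<le> r / exp 42" "r / exp 42 < 1" "0 \<le> exp (-40) / r" "exp (-40) / r < 1" using r r0 by auto
      show "summable (\<lambda>n. Dc * ((real n + 2) * (r / exp 42) ^ n) + Dc * r powr (-1/2) * ((real n + 2) * (exp (-40) / r) ^ n))"
        by (intro summable_add summable_mult summable_linear_geometric q)
      fix n
      have "norm (v r n) \<le> norm (\<alpha> n) * r ^ n + norm (\<beta> n) * (r powr (-1/2) / r ^ n)"
        unfolding v_def using r0 by (intro order_trans[OF norm_triangle_ineq]) (simp add: norm_mult norm_power norm_divide)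
      also have "\<dots> \<le> Dc / exp 42 ^ n * r ^ n + Dc * exp (-40) ^ n * (r powr (-1/2) / r ^ n)"
        using r0 by (intro add_mono mult_right_mono \<alpha> \<beta>) auto
      also have "\<dots> = Dc * (r / exp 42) ^ n + Dc * r powr (-1/2) * (exp (-40) / r) ^ n" by (simp add: power_divide)
      finally have "norm (v r n) * (real n + 1) \<le> (Dc * (r / exp 42) ^ n + Dc * r powr (-1/2) * (exp (-40) / r) ^ n) * (real n + 2)"
        using Dc q by (intro mult_mono) auto
      then show "norm (norm (v r n) * (real n + 1)) \<le> Dc * ((real n + 2) * (r / exp 42) ^ n) + Dc * r powr (-1/2) * ((real n + 2) * (exp (-40) / r) ^ n)"
        by (simp add: algebra_simps)
    qed
    (* The local potential is subtracted from the full one, both bounded in the weighted L1 norm of the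
       half circle, and the coefficient is read off by orthogonality. *)
    have vbound: "norm (v r n) * geg n 0 \<le> 128 * (3 * M + pi * (r powr (-1/2) * \<delta>)) * (real n + 1)\<^sup>2"
      if r: "exp (-40) < r" "r < exp 42" for r n
    proof -
      have r0: "r > 0" using less_trans[OF exp_gt_zero r(1)] .
      define h where "h = (LBINT \<phi>:{0..pi}. geg n \<phi> * geg n \<phi> * sin_weight \<phi>)"
      have h: "h \<ge> (geg n 0)\<^sup>2 / (128 * (real n + 1)\<^sup>2)" unfolding h_def by (rule geg_norm_lower)
      have g0: "geg n 0 > 0" by (rule geg_zero_pos)
      have h0: "h > 0" by (rule less_le_trans[OF _ h]) (use g0 in auto)
      have "(LBINT \<phi>:{0..pi}. Nf r \<phi> * of_real (geg n \<phi> * sin_weight \<phi>)) = v r n * of_real h"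
        unfolding h_def by (rule geg_series_coefficient[OF vsum[OF r]]) (use ser[OF r] in \<open>auto simp: v_def Nf_def\<close>)
      then have "norm (v r n) * h = norm (LBINT \<phi>:{0..pi}. Nf r \<phi> * of_real (geg n \<phi> * sin_weight \<phi>))"
        using h0 by (simp add: norm_mult)
      also have "\<dots> \<le> (LBINT \<phi>. norm (indicator {0..pi} \<phi> *\<^sub>R (Nf r \<phi> * of_real (geg n \<phi> * sin_weight \<phi>))))"
        unfolding set_lebesgue_integral_def by (rule integral_norm_bound)
      also have "\<dots> \<le> (LBINT \<phi>:{0..pi}. geg n 0 * (norm (potential c f (r * cos \<phi>) (r * sin \<phi>)) * sin_weight \<phi>) + geg n 0 * (r powr (-1/2) * \<delta>))"
      proof -
        let ?P = "\<lambda>\<phi>. norm (potential c f (r * cos \<phi>) (r * sin \<phi>))"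
        have iR: "set_integrable lborel {0..pi} (\<lambda>\<phi>. geg n 0 * (?P \<phi> * sin_weight \<phi>) + geg n 0 * (r powr (-1/2) * \<delta>))"
          by (intro set_integral_add(1) set_integrable_mult_right set_integrable_const_Icc
                potential_circle_integrable(1)[OF \<open>f \<in> borel_measurable borel\<close> B r0])
        have pt: "norm (Nf r \<phi> * of_real (geg n \<phi> * sin_weight \<phi>)) \<le> geg n 0 * (?P \<phi> * sin_weight \<phi>) + geg n 0 * (r powr (-1/2) * \<delta>)"
          if \<phi>: "\<phi> \<in> {0..pi}" for \<phi>
        proof (cases "\<phi> = 0 \<or> \<phi> = pi")
          case True
          then show ?thesis using g0 \<delta> by auto
        next
          case False
          then have \<phi>': "0 < \<phi>" "\<phi> < pi" using \<phi> by auto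
          have s: "sin \<phi> > 0" using \<phi>' by (intro sin_gt_zero)
          have "norm (local_potential f (r * cos \<phi>) (r * sin \<phi>)) * sin_weight \<phi> \<le> r powr (-1/2) * sin \<phi> powr (-1/2) * \<delta> * sin_weight \<phi>"
            by (intro mult_right_mono local_potential_circle_bound[where F = F] F N r0 \<phi>') (use \<delta> in auto)
          also have "\<dots> = r powr (-1/2) * \<delta> * (sin \<phi> powr (-1/2) * sin \<phi> powr (1/2))" by (simp add: sin_weight_def)
          also have "sin \<phi> powr (-1/2) * sin \<phi> powr (1/2) = 1" using s by (simp flip: powr_add)
          finally have 1: "norm (local_potential f (r * cos \<phi>) (r * sin \<phi>)) * sin_weight \<phi> \<le> r powr (-1/2) * \<delta>" by simp
          have "norm (Nf r \<phi>) * sin_weight \<phi> \<le> (?P \<phi> + norm (local_potential f (r * cos \<phi>) (r * sin \<phi>))) * sin_weight \<phi>"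
            unfolding Nf_def by (intro mult_right_mono norm_triangle_ineq4) auto
          with 1 have 2: "norm (Nf r \<phi>) * sin_weight \<phi> \<le> ?P \<phi> * sin_weight \<phi> + r powr (-1/2) * \<delta>" by (simp add: distrib_right)
          have "norm (Nf r \<phi> * of_real (geg n \<phi> * sin_weight \<phi>)) = \<bar>geg n \<phi>\<bar> * (norm (Nf r \<phi>) * sin_weight \<phi>)"
            by (simp add: norm_mult abs_mult)
          also have "\<dots> \<le> geg n 0 * (?P \<phi> * sin_weight \<phi> + r powr (-1/2) * \<delta>)"
            using 2 g0 by (intro mult_mono abs_geg_le) auto
          finally show ?thesis by (simp add: distrib_left)
        qed
        show ?thesis unfolding set_lebesgue_integral_def
        proof (rule integral_mono')
          show "integrable lborel (\<lambda>\<phi>. indicator {0..pi} \<phi> *\<^sub>R (geg n 0 * (?P \<phi> * sin_weight \<phi>) + geg n 0 * (r powr (-1/2) * \<delta>)))"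
            using iR by (simp add: set_integrable_def)
        next
          fix \<phi> :: real
          show 2: "norm (indicator {0..pi} \<phi> *\<^sub>R (Nf r \<phi> * of_real (geg n \<phi> * sin_weight \<phi>)))
             \<le> indicator {0..pi} \<phi> *\<^sub>R (geg n 0 * (?P \<phi> * sin_weight \<phi>) + geg n 0 * (r powr (-1/2) * \<delta>))"
          proof (cases "\<phi> \<in> {0..pi}")
            case True
            then show ?thesis unfolding indicator_simps(1)[OF True] by (simp only: scaleR_one pt)
          next
            case False
            show ?thesis unfolding indicator_simps(2)[OF False] by (simp only: scaleR_zero_left norm_zero order_refl)
          qed
          show "0 \<le> indicator {0..pi} \<phi> *\<^sub>R (geg n 0 * (?P \<phi> * sin_weight \<phi>) + geg n 0 * (r powr (-1/2) * \<delta>))"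
            using norm_ge_zero 2 by (rule order_trans)
        qed
      qed
      also have "\<dots> = geg n 0 * (LBINT \<phi>:{0..pi}. norm (potential c f (r * cos \<phi>) (r * sin \<phi>)) * sin_weight \<phi>) + geg n 0 * (r powr (-1/2) * \<delta>) * pi"
        by (subst set_integral_add(2)[OF set_integrable_mult_right[OF potential_circle_integrable(1)[where ?B0.0 = B0]] set_integrable_const_Icc])
           (use B r0 in \<open>auto simp: set_lebesgue_integral_def\<close>)
      also have "\<dots> \<le> geg n 0 * (3 * M) + geg n 0 * (r powr (-1/2) * \<delta>) * pi"
        using g0 by (intro add_mono mult_left_mono order_refl potential_circle_L1[where ?B0.0 = B0] B r0 M L2[rule_format] r) auto
      finally have "norm (v r n) * h \<le> geg n 0 * (3 * M + pi * (r powr (-1/2) * \<delta>))" by (simp add: algebra_simps)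
      then have "norm (v r n) * ((geg n 0)\<^sup>2 / (128 * (real n + 1)\<^sup>2)) \<le> geg n 0 * (3 * M + pi * (r powr (-1/2) * \<delta>))"
        using mult_left_mono[OF h, of "norm (v r n)"] by simp
      then have "geg n 0 * (norm (v r n) * geg n 0) / (128 * (real n + 1)\<^sup>2) \<le> geg n 0 * (3 * M + pi * (r powr (-1/2) * \<delta>))"
        by (simp only: power2_eq_square[of "geg n 0"] times_divide_eq_right mult_ac)
      then have "geg n 0 * (norm (v r n) * geg n 0) \<le> geg n 0 * (3 * M + pi * (r powr (-1/2) * \<delta>)) * (128 * (real n + 1)\<^sup>2)"
        by (subst (asm) pos_divide_le_eq) auto
      then have "geg n 0 * (norm (v r n) * geg n 0) \<le> geg n 0 * ((3 * M + pi * (r powr (-1/2) * \<delta>)) * (128 * (real n + 1)\<^sup>2))"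
        by (simp only: mult.assoc)
      then have "norm (v r n) * geg n 0 \<le> (3 * M + pi * (r powr (-1/2) * \<delta>)) * (128 * (real n + 1)\<^sup>2)"
        using g0 by (simp add: mult_le_cancel_left_pos)
      then show ?thesis by (simp add: mult_ac)
    qed
    define a where "a n = \<alpha> n * of_real (geg n 0)" for n
    define b where "b n = \<beta> n * of_real (geg n 0)" for n
    (* At phi = 0 and logarithmic radius sigma the n-th term is a combination of two exponentials, as
       required by the analytic lemma. *)
    have vexp: "v (exp \<sigma>) n * of_real (geg n 0) = a n * exp (of_real (real n * \<sigma>)) + b n * exp (of_real (- ((real n + 1/2) * \<sigma>)))" for \<sigma> n
    proof -
      have "exp \<sigma> ^ n = exp (real n * \<sigma>)" by (simp add: exp_of_nat_mult)
      moreover have "exp \<sigma> powr (-1/2) / exp \<sigma> ^ n = exp (- ((real n + 1/2) * \<sigma>))"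
        by (simp add: powr_def exp_of_nat_mult[symmetric] algebra_simps flip: exp_diff)
      ultimately show ?thesis
        unfolding v_def a_def b_def by (simp add: algebra_simps flip: exp_of_real)
    qed
    define E where "E = k2 * \<delta>"
    have E0: "E > 0" using k \<delta> by (simp add: E_def)
    have k1M: "k1 * M > 0" using k M by simp
    have ab: "(\<Sum>n. norm (a n) + norm (b n)) \<le> C0 * sqrt (E * (k1 * M)) \<and> summable (\<lambda>n. norm (a n) + norm (b n))"
    proof (rule core[THEN spec, THEN spec, THEN spec, THEN spec, THEN mp, THEN mp, THEN mp, THEN mp, OF k1M E0])
      show "\<forall>n. \<forall>\<sigma>\<in>{-34, 34}. norm (a n * exp (of_real (real n * \<sigma>)) + b n * exp (of_real (- ((real n + 1/2) * \<sigma>)))) \<le> k1 * M * (real n + 1)\<^sup>2"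
      proof (intro allI ballI)
        fix n and \<sigma> :: real assume \<sigma>: "\<sigma> \<in> {-34, 34}"
        have g0: "geg n 0 > 0" by (rule geg_zero_pos)
        have "norm (a n * exp (of_real (real n * \<sigma>)) + b n * exp (of_real (- ((real n + 1/2) * \<sigma>)))) = norm (v (exp \<sigma>) n) * geg n 0"
          unfolding vexp[symmetric] using g0 by (simp add: norm_mult)
        also have "\<dots> \<le> 128 * (3 * M + pi * (exp \<sigma> powr (-1/2) * \<delta>)) * (real n + 1)\<^sup>2"
          by (rule vbound) (use \<sigma> in auto)
        also have "\<dots> \<le> 128 * (3 * M + pi * (exp 17 * M)) * (real n + 1)\<^sup>2"
          using \<sigma> \<delta> \<delta>M M by (intro mult_right_mono mult_left_mono add_mono order_refl mult_mono) (auto simp: powr_def)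
        also have "\<dots> = k1 * M * (real n + 1)\<^sup>2" by (simp add: k1_def algebra_simps)
        finally show "norm (a n * exp (of_real (real n * \<sigma>)) + b n * exp (of_real (- ((real n + 1/2) * \<sigma>)))) \<le> k1 * M * (real n + 1)\<^sup>2" .
      qed
      have eq: "(\<Sum>n. a n * exp (of_real (real n * \<sigma>)) + b n * exp (of_real (- ((real n + 1/2) * \<sigma>)))) = potential c f (exp \<sigma>) 0 - local_potential f (exp \<sigma>) 0"
        if "\<sigma> \<in> {-32..32}" for \<sigma>
        using ser[of "exp \<sigma>" 0] that unfolding vexp[symmetric] v_def[symmetric] by (simp add: sums_iff)
      have "(\<integral>\<^sup>+\<sigma>\<in>{-32..32}. ennreal (norm (\<Sum>n. a n * exp (of_real (real n * \<sigma>)) + b n * exp (of_real (- ((real n + 1/2) * \<sigma>))))) \<partial>lborel)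
         = (\<integral>\<^sup>+\<sigma>\<in>{-32..32}. ennreal (norm (potential c f (exp \<sigma>) 0 - local_potential f (exp \<sigma>) 0)) \<partial>lborel)"
      proof (rule nn_integral_cong)
        fix \<sigma> :: real
        show "ennreal (norm (\<Sum>n. a n * exp (of_real (real n * \<sigma>)) + b n * exp (of_real (- ((real n + 1/2) * \<sigma>))))) * indicator {-32..32} \<sigma>
           = ennreal (norm (potential c f (exp \<sigma>) 0 - local_potential f (exp \<sigma>) 0)) * indicator {-32..32} \<sigma>"
        proof (cases "\<sigma> \<in> {-32..32}")
          case True
          show ?thesis unfolding eq[OF True] ..
        next
          case False
          then have "indicator {-32..32} \<sigma> = (0 :: ennreal)" by (rule indicator_simps(2))
          then show ?thesis by (simp only: mult_zero_right)
        qed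
      qed
      also have "\<dots> \<le> ennreal (exp 32) * (\<integral>\<^sup>+x\<in>unit_annulus. ennreal (norm (potential c f x 0 - local_potential f x 0)) \<partial>lborel)"
        by (rule nn_integral_exp_subst) measurable
      also have "(\<integral>\<^sup>+x\<in>unit_annulus. ennreal (norm (potential c f x 0 - local_potential f x 0)) \<partial>lborel) \<le>
         (\<integral>\<^sup>+x. ennreal (norm (potential c f x 0)) * indicator unit_annulus x + ennreal (norm (local_potential f x 0)) * indicator unit_annulus x \<partial>lborel)"
      proof (rule nn_integral_mono)
        fix x :: real
        have "ennreal (norm (potential c f x 0 - local_potential f x 0)) \<le> ennreal (norm (potential c f x 0)) + ennreal (norm (local_potential f x 0))"
          by (simp add: norm_triangle_ineq4 flip: ennreal_plus)
        then show "ennreal (norm (potential c f x 0 - local_potential f x 0)) * indicator unit_annulus x \<le> ennreal (norm (potential c f x 0)) * indicator unit_annulus x + ennreal (norm (local_potential f x 0)) * indicator unit_annulus x"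
          by (simp add: indicator_def)
      qed
      also have "\<dots> = (\<integral>\<^sup>+x\<in>unit_annulus. ennreal (norm (potential c f x 0)) \<partial>lborel) + (\<integral>\<^sup>+x\<in>unit_annulus. ennreal (norm (local_potential f x 0)) \<partial>lborel)"
        by (rule nn_integral_add) measurable
      also have "\<dots> \<le> ennreal \<delta> + ennreal (8 * exp 21 * \<delta>)"
        by (intro add_mono D local_potential_boundary_bound[where F = F] F N) (use \<delta> in auto)
      also have "ennreal (exp 32) * (ennreal \<delta> + ennreal (8 * exp 21 * \<delta>)) = ennreal E"
        using \<delta> by (simp add: E_def k2_def algebra_simps flip: ennreal_plus ennreal_mult)
      finally show "(\<integral>\<^sup>+\<sigma>\<in>{-32..32}. ennreal (norm (\<Sum>n. a n * exp (of_real (real n * \<sigma>)) + b n * exp (of_real (- ((real n + 1/2) * \<sigma>))))) \<partial>lborel) \<le> ennreal E"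
        by (simp add: mult_left_mono)
    qed
    (* All Gegenbauer functions are maximal at 0, so the sum of absolute values at sigma = 0 bounds the
       series on the whole unit half circle. *)
    have Nb: "norm (Nf 1 \<phi>) \<le> C0 * sqrt (E * (k1 * M))" if \<phi>: "\<phi> \<in> {0..pi}" for \<phi>
    proof -
      have s1: "(\<lambda>n. v 1 n * of_real (geg n \<phi>)) sums Nf 1 \<phi>"
        using ser[of 1 \<phi>] \<phi> by (simp add: v_def Nf_def)
      have "norm (\<Sum>n. v 1 n * of_real (geg n \<phi>)) \<le> (\<Sum>n. norm (a n) + norm (b n))"
      proof (rule norm_suminf_le)
        fix n
        have "norm (v 1 n * of_real (geg n \<phi>)) \<le> norm (v 1 n) * geg n 0"
          unfolding norm_mult using abs_geg_le[of n \<phi>] by (intro mult_left_mono) auto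
        also have "\<dots> = norm (v (exp 0) n * of_real (geg n 0))" using geg_zero_pos[of n] by (simp add: norm_mult)
        also have "\<dots> \<le> norm (a n) + norm (b n)" unfolding vexp by (simp add: norm_triangle_ineq)
        finally show "norm (v 1 n * of_real (geg n \<phi>)) \<le> norm (a n) + norm (b n)" .
      qed (use ab in auto)
      with ab s1 show ?thesis by (auto simp: sums_iff)
    qed
    define Q where "Q = 2 * (C0 * sqrt (E * (k1 * M)))\<^sup>2"
    have Q: "Q = 2 * C0\<^sup>2 * k2 * k1 * M * \<delta>" using k M \<delta> by (simp add: Q_def E_def power_mult_distrib)
    have "(LBINT \<phi>:{0..pi}. (norm (potential c f (1 * cos \<phi>) (1 * sin \<phi>)))\<^sup>2 * sin_weight \<phi>) \<le> (LBINT \<phi>:{0..pi}. Q + 2 * \<delta>\<^sup>2 * sin \<phi> powr (-1/2))"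
    proof (rule set_integral_mono)
      show "set_integrable lborel {0..pi} (\<lambda>\<phi>. (norm (potential c f (1 * cos \<phi>) (1 * sin \<phi>)))\<^sup>2 * sin_weight \<phi>)"
        by (rule potential_circle_integrable(2)[where ?B0.0 = B0]) (use B in auto)
      show "set_integrable lborel {0..pi} (\<lambda>\<phi>. Q + 2 * \<delta>\<^sup>2 * sin \<phi> powr (-1/2))"
        by (intro set_integral_add set_integrable_mult_right inv_sqrt_sin_integrable set_integrable_const_Icc)
      fix \<phi> assume \<phi>: "\<phi> \<in> {0..pi}"
      show "(norm (potential c f (1 * cos \<phi>) (1 * sin \<phi>)))\<^sup>2 * sin_weight \<phi> \<le> Q + 2 * \<delta>\<^sup>2 * sin \<phi> powr (-1/2)"
      proof (cases "\<phi> = 0 \<or> \<phi> = pi")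
        case True
        then show ?thesis by (auto simp: Q_def)
      next
        case False
        then have \<phi>': "0 < \<phi>" "\<phi> < pi" using \<phi> by auto
        have s: "sin \<phi> > 0" using \<phi>' by (intro sin_gt_zero)
        define R where "R = norm (local_potential f (1 * cos \<phi>) (1 * sin \<phi>))"
        have R: "R \<le> sin \<phi> powr (-1/2) * \<delta>" "R \<ge> 0"
          using local_potential_circle_bound[of f F \<delta> 1 \<phi>] F N \<delta> \<phi>' by (auto simp: R_def)
        have "norm (potential c f (1 * cos \<phi>) (1 * sin \<phi>)) \<le> norm (Nf 1 \<phi>) + R"
          unfolding R_def Nf_def by (subst add.commute) (rule norm_triangle_sub)
        then have "(norm (potential c f (1 * cos \<phi>) (1 * sin \<phi>)))\<^sup>2 \<le> (norm (Nf 1 \<phi>) + R)\<^sup>2" by (intro power_mono) auto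
        also have "\<dots> \<le> 2 * (norm (Nf 1 \<phi>))\<^sup>2 + 2 * R\<^sup>2"
          using sum_squares_bound[of "norm (Nf 1 \<phi>)" R] by (simp add: power2_sum)
        also have "\<dots> \<le> Q + 2 * (sin \<phi> powr (-1/2) * \<delta>)\<^sup>2"
          unfolding Q_def using Nb[OF \<phi>] R by (intro add_mono mult_left_mono power_mono) auto
        finally have "(norm (potential c f (1 * cos \<phi>) (1 * sin \<phi>)))\<^sup>2 * sin_weight \<phi> \<le> (Q + 2 * (sin \<phi> powr (-1/2) * \<delta>)\<^sup>2) * sin_weight \<phi>"
          by (intro mult_right_mono) auto
        also have "\<dots> = Q * sin_weight \<phi> + 2 * \<delta>\<^sup>2 * ((sin \<phi> powr (-1/2))\<^sup>2 * sin_weight \<phi>)" by (simp add: algebra_simps power_mult_distrib)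
        also have "(sin \<phi> powr (-1/2))\<^sup>2 * sin_weight \<phi> = sin \<phi> powr (-1/2)"
          unfolding power2_eq_square sin_weight_def powr_add[symmetric] by simp
        also have "Q * sin_weight \<phi> \<le> Q * 1" using sin_weight_le_1[OF \<phi>] by (intro mult_left_mono) (auto simp: Q_def)
        finally show ?thesis by simp
      qed
    qed
    also have "\<dots> = Q * pi + 2 * \<delta>\<^sup>2 * S"
      by (subst set_integral_add(2)[OF set_integrable_const_Icc set_integrable_mult_right[OF inv_sqrt_sin_integrable]])
         (auto simp: S_def set_lebesgue_integral_def)
    also have "\<dots> \<le> Q * pi + 2 * (M * \<delta>) * S"
      using \<delta>M \<delta> S0 by (intro add_mono mult_right_mono order_refl) (auto simp: power2_eq_square)
    also have "\<dots> \<le> C * M * \<delta>" unfolding Q C_def using M \<delta> by (simp add: algebra_simps)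
    finally show ?thesis by simp
  qed
  with C1 show ?thesis by (intro exI[of _ C]) auto
qed

section \<open>Heat kernels as test functions\<close>

definition heat_kernel :: "real \<Rightarrow> real \<Rightarrow> real" where
  "heat_kernel s h = exp (- (h\<^sup>2 / (4 * s))) / sqrt (4 * pi * s)"

lemma heat_kernel_measurable [measurable (raw)]:
  assumes [measurable]: "s \<in> borel_measurable M" "h \<in> borel_measurable M"
  shows "(\<lambda>w. heat_kernel (s w) (h w)) \<in> borel_measurable M"
  unfolding heat_kernel_def by measurable

lemma heat_kernel_pos: "s > 0 \<Longrightarrow> heat_kernel s h > 0"
  by (simp add: heat_kernel_def)

lemma heat_kernel_normal: "s > 0 \<Longrightarrow> heat_kernel s h = normal_density 0 (sqrt (2 * s)) h"
  by (simp add: heat_kernel_def normal_density_def mult_ac)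

lemma heat_kernel_integral:
  assumes "s > 0" shows "integrable lborel (heat_kernel s)" "(LBINT h. heat_kernel s h) = 1"
proof -
  have e: "heat_kernel s = normal_density 0 (sqrt (2 * s))" using heat_kernel_normal[OF assms] by (rule ext)
  show "integrable lborel (heat_kernel s)" "(LBINT h. heat_kernel s h) = 1"
    unfolding e using assms by (auto intro!: integrable_normal_density integral_normal_density)
qed

lemma std_normal_fourier:
  "(LBINT x. exp (\<i> * of_real (t * x)) * of_real (std_normal_density x)) = of_real (exp (- t\<^sup>2 / 2))"
proof -
  have "char std_normal_distribution t = (LBINT x. std_normal_density x *\<^sub>R exp (\<i> * of_real (t * x)))"
    unfolding char_def by (subst integral_density) (auto simp: mult_ac)
  then show ?thesis unfolding char_std_normal_distribution by (simp add: scaleR_conv_of_real mult_ac)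
qed

lemma heat_kernel_fourier:
  assumes s: "s > 0"
  shows "(LBINT h. exp (\<i> * of_real (t * h)) * of_real (heat_kernel s h)) = of_real (exp (- (s * t\<^sup>2)))"
proof -
  define c where "c = sqrt (2 * s)"
  have c: "c > 0" "c\<^sup>2 = 2 * s" using s by (auto simp: c_def)
  have g: "heat_kernel s (0 + c * x) = std_normal_density x / c" for x
  proof -
    have "(c * x)\<^sup>2 / (4 * s) = x\<^sup>2 / 2" using s c(2) by (simp add: power_mult_distrib)
    moreover have "sqrt (4 * pi * s) = sqrt (2 * pi) * c"
      unfolding c_def real_sqrt_mult[symmetric] by (simp add: mult_ac)
    ultimately show ?thesis by (simp add: heat_kernel_def std_normal_density_def)
  qed
  have "(LBINT h. exp (\<i> * of_real (t * h)) * of_real (heat_kernel s h))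
     = c *\<^sub>R (LBINT x. exp (\<i> * of_real (t * (0 + c * x))) * of_real (heat_kernel s (0 + c * x)))"
    using lborel_integral_real_affine[of c "\<lambda>h. exp (\<i> * of_real (t * h)) * of_real (heat_kernel s h)" 0] c by simp
  also have "\<dots> = (LBINT x. c *\<^sub>R (exp (\<i> * of_real (t * (0 + c * x))) * of_real (heat_kernel s (0 + c * x))))" by simp
  also have "\<dots> = (LBINT x. exp (\<i> * of_real ((t * c) * x)) * of_real (std_normal_density x))"
    unfolding g using c by (intro Bochner_Integration.integral_cong) (auto simp: scaleR_conv_of_real mult_ac)
  also have "\<dots> = of_real (exp (- (t * c)\<^sup>2 / 2))" by (rule std_normal_fourier)
  also have "- (t * c)\<^sup>2 / 2 = - (s * t\<^sup>2)" unfolding power_mult_distrib c(2) by simp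
  finally show ?thesis .
qed

lemma exp_neg_square_heat_kernel:
  assumes "s > 0"
  shows "exp (- (s * \<xi>\<^sup>2)) = sqrt (pi / s) * heat_kernel (1 / (4 * s)) \<xi>"
proof -
  have "\<xi>\<^sup>2 / (4 * (1 / (4 * s))) = s * \<xi>\<^sup>2" using assms by (simp add: field_simps)
  moreover have "sqrt (4 * pi * (1 / (4 * s))) = sqrt (pi / s)" using assms by (simp add: field_simps)
  moreover have "sqrt (pi / s) \<noteq> 0" using assms by simp
  ultimately show ?thesis unfolding heat_kernel_def by (simp only: times_divide_eq_right nonzero_mult_div_cancel_left not_False_eq_True)
qed

lemma heat_kernel_fourier_inversion:
  assumes s: "s > 0"
  shows "integrable lborel (\<lambda>\<xi>. exp (- (s * \<xi>\<^sup>2)))" "(LBINT \<xi>. cos (h * \<xi>) * exp (- (s * \<xi>\<^sup>2))) = 2 * pi * heat_kernel s h"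
proof -
  define r where "r = 1 / (4 * s)"
  have r: "r > 0" using s by (simp add: r_def)
  have e: "exp (- (s * \<xi>\<^sup>2)) = sqrt (pi / s) * heat_kernel r \<xi>" for \<xi>
    unfolding r_def by (rule exp_neg_square_heat_kernel[OF s])
  show "integrable lborel (\<lambda>\<xi>. exp (- (s * \<xi>\<^sup>2)))"
    unfolding e using heat_kernel_integral(1)[OF r] by simp
  have i: "integrable lborel (\<lambda>\<xi>. exp (\<i> * of_real (h * \<xi>)) * of_real (heat_kernel r \<xi>))"
    by (rule Bochner_Integration.integrable_bound[OF heat_kernel_integral(1)[OF r]]) (auto simp: norm_mult)
  have "(LBINT \<xi>. cos (h * \<xi>) * heat_kernel r \<xi>) = Re (LBINT \<xi>. exp (\<i> * of_real (h * \<xi>)) * of_real (heat_kernel r \<xi>))"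
    unfolding integral_Re[OF i, symmetric] by (intro Bochner_Integration.integral_cong) (auto simp: Re_exp)
  also have "\<dots> = exp (- (r * h\<^sup>2))" unfolding heat_kernel_fourier[OF r] by simp
  finally have "(LBINT \<xi>. cos (h * \<xi>) * heat_kernel r \<xi>) = exp (- (r * h\<^sup>2))" .
  moreover have "(LBINT \<xi>. cos (h * \<xi>) * exp (- (s * \<xi>\<^sup>2))) = (LBINT \<xi>. sqrt (pi / s) * (cos (h * \<xi>) * heat_kernel r \<xi>))"
    unfolding e by (simp only: mult_ac)
  ultimately have "(LBINT \<xi>. cos (h * \<xi>) * exp (- (s * \<xi>\<^sup>2))) = sqrt (pi / s) * exp (- (r * h\<^sup>2))" by simp
  also have "r * h\<^sup>2 = h\<^sup>2 / (4 * s)" by (simp add: r_def)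
  also have "sqrt (pi / s) = 2 * pi / sqrt (4 * pi * s)"
  proof -
    have "sqrt (pi / s) * sqrt (4 * pi * s) = sqrt ((2 * pi)\<^sup>2)"
      using s by (simp add: real_sqrt_mult[symmetric] power2_eq_square field_simps)
    also have "\<dots> = 2 * pi" by (simp only: real_sqrt_abs abs_of_pos pi_gt_zero mult_pos_pos zero_less_numeral)
    finally have "sqrt (pi / s) * sqrt (4 * pi * s) = 2 * pi" .
    moreover have "sqrt (4 * pi * s) > 0" using s by simp
    ultimately show ?thesis by (simp only: eq_divide_eq) auto
  qed
  finally show "(LBINT \<xi>. cos (h * \<xi>) * exp (- (s * \<xi>\<^sup>2))) = 2 * pi * heat_kernel s h"
    by (simp add: heat_kernel_def)
qed

text \<open>
  The Fourier symbol of \<open>frac_heat s\<close>.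
\<close>

definition frac_heat_symbol :: "real \<Rightarrow> real \<Rightarrow> real" where
  "frac_heat_symbol s \<xi> = \<bar>\<xi>\<bar> powr (1/2) * exp (- (s * \<xi>\<^sup>2))"

text \<open>
  The image of the heat kernel at time \<open>s\<close> under \<open>(-\<Delta>) powr
  (1/4)\<close>, written as an inverse cosine transform.
\<close>

definition frac_heat :: "real \<Rightarrow> real \<Rightarrow> real" where
  "frac_heat s h = (LBINT \<xi>. cos (h * \<xi>) * frac_heat_symbol s \<xi>) / (2 * pi)"

lemma frac_heat_symbol_measurable [measurable (raw)]:
  assumes [measurable]: "s \<in> borel_measurable M" "h \<in> borel_measurable M"
  shows "(\<lambda>w. frac_heat_symbol (s w) (h w)) \<in> borel_measurable M"
  unfolding frac_heat_symbol_def by measurable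

lemma frac_heat_symbol_integrable:
  assumes s: "s > 0" shows "integrable lborel (frac_heat_symbol s)"
proof -
  define r where "r = 1 / (4 * s)"
  have r: "r > 0" using s by (simp add: r_def)
  have e: "exp (- (s * \<xi>\<^sup>2)) = sqrt (pi / s) * heat_kernel r \<xi>" for \<xi>
    unfolding r_def by (rule exp_neg_square_heat_kernel[OF s])
  have 1: "integrable lborel (\<lambda>\<xi>. heat_kernel r \<xi> * \<bar>\<xi>\<bar>)"
    using integrable_normal_moment_abs[where \<mu> = 0 and \<sigma> = "sqrt (2 * r)" and k = 1] r by (simp add: heat_kernel_normal)
  have "integrable lborel (\<lambda>\<xi>. sqrt (pi / s) * (heat_kernel r \<xi> + heat_kernel r \<xi> * \<bar>\<xi>\<bar>))"
    using 1 heat_kernel_integral(1)[OF r] by simp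
  then show ?thesis
  proof (rule Bochner_Integration.integrable_bound)
    show "AE \<xi> in lborel. norm (frac_heat_symbol s \<xi>) \<le> norm (sqrt (pi / s) * (heat_kernel r \<xi> + heat_kernel r \<xi> * \<bar>\<xi>\<bar>))"
    proof (rule AE_I2)
      fix \<xi> :: real
      have "\<bar>\<xi>\<bar> powr (1/2) \<le> 1 + \<bar>\<xi>\<bar>"
      proof (cases "\<bar>\<xi>\<bar> \<le> 1")
        case True
        then have "\<bar>\<xi>\<bar> powr (1/2) \<le> 1" by (simp add: powr_le1)
        then show ?thesis by simp
      next
        case False
        then have "\<bar>\<xi>\<bar> powr (1/2) \<le> \<bar>\<xi>\<bar> powr 1" by (intro powr_mono) auto
        then show ?thesis by simp
      qed
      then have "frac_heat_symbol s \<xi> \<le> (1 + \<bar>\<xi>\<bar>) * (sqrt (pi / s) * heat_kernel r \<xi>)"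
        unfolding frac_heat_symbol_def e using heat_kernel_pos[OF r, of \<xi>] s by (intro mult_right_mono) auto
      also have "\<dots> = sqrt (pi / s) * (heat_kernel r \<xi> + heat_kernel r \<xi> * \<bar>\<xi>\<bar>)" by (simp add: algebra_simps)
      finally have "frac_heat_symbol s \<xi> \<le> norm (sqrt (pi / s) * (heat_kernel r \<xi> + heat_kernel r \<xi> * \<bar>\<xi>\<bar>))" by simp
      moreover have "frac_heat_symbol s \<xi> \<ge> 0" by (simp add: frac_heat_symbol_def)
      ultimately show "norm (frac_heat_symbol s \<xi>) \<le> norm (sqrt (pi / s) * (heat_kernel r \<xi> + heat_kernel r \<xi> * \<bar>\<xi>\<bar>))" by simp
    qed
  qed measurable
qed

text \<open>
  The symbol is even, so that the inverse Fourier integral is a cosine integral.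
\<close>

lemma frac_laplacian_heat_kernel:
  assumes s: "s > 0"
  shows "frac_laplacian (1/4) (\<lambda>\<tau>. of_real (heat_kernel s (\<tau> - x))) t = of_real (frac_heat s (t - x))"
proof -
  have F: "fourier (\<lambda>\<tau>. of_real (heat_kernel s (\<tau> - x))) \<xi> = exp (- (\<i> * of_real (x * \<xi>))) * of_real (exp (- (s * \<xi>\<^sup>2)))" for \<xi>
  proof -
    have "fourier (\<lambda>\<tau>. of_real (heat_kernel s (\<tau> - x))) \<xi> = (LBINT \<tau>. exp (- (\<i> * of_real (\<tau> * \<xi>))) * of_real (heat_kernel s (\<tau> - x)))"
      unfolding fourier_def by (rule integral_completion) measurable
    also have "\<dots> = (LBINT h. exp (- (\<i> * of_real ((x + 1 * h) * \<xi>))) * of_real (heat_kernel s (x + 1 * h - x)))"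
      using lborel_integral_real_affine[of 1 "\<lambda>\<tau>. exp (- (\<i> * of_real (\<tau> * \<xi>))) * of_real (heat_kernel s (\<tau> - x))" x] by simp
    also have "\<dots> = (LBINT h. exp (- (\<i> * of_real (x * \<xi>))) * (exp (\<i> * of_real ((- \<xi>) * h)) * of_real (heat_kernel s h)))"
    proof (intro Bochner_Integration.integral_cong refl)
      fix h :: real
      have "exp (- (\<i> * of_real ((x + 1 * h) * \<xi>))) = exp (- (\<i> * of_real (x * \<xi>)) + \<i> * of_real ((- \<xi>) * h))"
        by (intro arg_cong[where f = exp]) (simp add: algebra_simps)
      also have "\<dots> = exp (- (\<i> * of_real (x * \<xi>))) * exp (\<i> * of_real ((- \<xi>) * h))" by (rule exp_add)
      finally show "exp (- (\<i> * of_real ((x + 1 * h) * \<xi>))) * of_real (heat_kernel s (x + 1 * h - x))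
         = exp (- (\<i> * of_real (x * \<xi>))) * (exp (\<i> * of_real ((- \<xi>) * h)) * of_real (heat_kernel s h))"
        by (simp add: mult.assoc)
    qed
    also have "\<dots> = exp (- (\<i> * of_real (x * \<xi>))) * of_real (exp (- (s * (- \<xi>)\<^sup>2)))"
      by (simp only: integral_mult_right_zero heat_kernel_fourier[OF s])
    finally show ?thesis by simp
  qed
  define \<theta> where "\<theta> = t - x"
  define I where "I = (LBINT \<xi>. exp (\<i> * of_real (\<theta> * \<xi>)) * of_real (frac_heat_symbol s \<xi>))"
  have i: "integrable lborel (\<lambda>\<xi>. exp (\<i> * of_real (\<theta> * \<xi>)) * of_real (frac_heat_symbol s \<xi>))" for \<theta>
    by (rule Bochner_Integration.integrable_bound[OF frac_heat_symbol_integrable[OF s]]) (auto simp: norm_mult)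
  have "I = (LBINT \<xi>. exp (\<i> * of_real ((- \<theta>) * \<xi>)) * of_real (frac_heat_symbol s \<xi>))"
    unfolding I_def using lborel_integral_reflect[of "\<lambda>\<xi>. exp (\<i> * of_real (\<theta> * \<xi>)) * of_real (frac_heat_symbol s \<xi>)" 0]
    by (simp add: frac_heat_symbol_def)
  (* Averaging with the reflected integral leaves the cosine. *)
  then have "2 * I = (LBINT \<xi>. exp (\<i> * of_real (\<theta> * \<xi>)) * of_real (frac_heat_symbol s \<xi>) + exp (\<i> * of_real ((- \<theta>) * \<xi>)) * of_real (frac_heat_symbol s \<xi>))"
    unfolding Bochner_Integration.integral_add[OF i i] by (simp add: I_def)
  also have "\<dots> = (LBINT \<xi>. 2 * of_real (cos (\<theta> * \<xi>) * frac_heat_symbol s \<xi>))"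
  proof (intro Bochner_Integration.integral_cong refl)
    fix \<xi> :: real
    have "exp (\<i> * of_real (\<theta> * \<xi>)) + exp (\<i> * of_real ((- \<theta>) * \<xi>)) = 2 * of_real (cos (\<theta> * \<xi>))"
      by (simp add: complex_eq_iff Re_exp Im_exp)
    then show "exp (\<i> * of_real (\<theta> * \<xi>)) * of_real (frac_heat_symbol s \<xi>) + exp (\<i> * of_real ((- \<theta>) * \<xi>)) * of_real (frac_heat_symbol s \<xi>) = 2 * of_real (cos (\<theta> * \<xi>) * frac_heat_symbol s \<xi>)"
      by (simp only: distrib_right[symmetric] of_real_mult mult.assoc)
  qed
  also have "\<dots> = 2 * of_real (LBINT \<xi>. cos (\<theta> * \<xi>) * frac_heat_symbol s \<xi>)"
    by (simp only: integral_mult_right_zero integral_complex_of_real)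
  finally have I: "I = of_real (LBINT \<xi>. cos (\<theta> * \<xi>) * frac_heat_symbol s \<xi>)" by simp
  have "frac_laplacian (1/4) (\<lambda>\<tau>. of_real (heat_kernel s (\<tau> - x))) t = of_real (1 / (2 * pi)) *
     (LINT \<xi>|lebesgue. exp (\<i> * of_real (t * \<xi>)) * (of_real (\<bar>\<xi>\<bar> powr (2 * (1/4))) * (exp (- (\<i> * of_real (x * \<xi>))) * of_real (exp (- (s * \<xi>\<^sup>2))))))"
    unfolding frac_laplacian_def inv_fourier_def F ..
  also have "(LINT \<xi>|lebesgue. exp (\<i> * of_real (t * \<xi>)) * (of_real (\<bar>\<xi>\<bar> powr (2 * (1/4))) * (exp (- (\<i> * of_real (x * \<xi>))) * of_real (exp (- (s * \<xi>\<^sup>2))))))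
     = (LBINT \<xi>. exp (\<i> * of_real (t * \<xi>)) * (of_real (\<bar>\<xi>\<bar> powr (2 * (1/4))) * (exp (- (\<i> * of_real (x * \<xi>))) * of_real (exp (- (s * \<xi>\<^sup>2))))))"
    by (rule integral_completion) measurable
  also have "\<dots> = I"
    unfolding I_def
  proof (intro Bochner_Integration.integral_cong refl)
    fix \<xi> :: real
    have "exp (\<i> * of_real (\<theta> * \<xi>)) = exp (\<i> * of_real (t * \<xi>) + - (\<i> * of_real (x * \<xi>)))"
      by (intro arg_cong[where f = exp]) (simp add: \<theta>_def algebra_simps)
    also have "\<dots> = exp (\<i> * of_real (t * \<xi>)) * exp (- (\<i> * of_real (x * \<xi>)))" by (rule exp_add)
    finally show "exp (\<i> * of_real (t * \<xi>)) * (of_real (\<bar>\<xi>\<bar> powr (2 * (1/4))) * (exp (- (\<i> * of_real (x * \<xi>))) * of_real (exp (- (s * \<xi>\<^sup>2)))))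
       = exp (\<i> * of_real (\<theta> * \<xi>)) * of_real (frac_heat_symbol s \<xi>)"
      by (simp add: frac_heat_symbol_def mult_ac)
  qed
  finally show ?thesis unfolding I frac_heat_def \<theta>_def by simp
qed

lemma poly_heat_kernel_bounded:
  fixes p :: "real poly"
  assumes "s > 0"
  shows "\<exists>B. \<forall>t. \<bar>poly p t * exp (- ((t - x)\<^sup>2 / (4 * s)))\<bar> \<le> B"
  using assms
proof (induction p arbitrary: s)
  case 0
  then show ?case by (intro exI[of _ 0]) simp
next
  case (pCons a p)
  (* Half of the Gaussian controls the polynomial p, by the induction hypothesis at time 2 * s, and
     the other half controls the additional factor t. *)
  obtain B where B: "\<bar>poly p t * exp (- ((t - x)\<^sup>2 / (4 * (2 * s))))\<bar> \<le> B" for t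
    using pCons.IH[of "2 * s"] pCons.prems by auto
  define e where "e t = exp (- ((t - x)\<^sup>2 / (4 * (2 * s))))" for t
  have e: "0 < e t" "e t \<le> 1" for t using pCons.prems by (auto simp: e_def)
  have ee: "exp (- ((t - x)\<^sup>2 / (4 * s))) = e t * e t" for t
    by (simp add: e_def flip: exp_add)
  have te: "\<bar>t\<bar> * e t \<le> \<bar>x\<bar> + 1 + 8 * s" for t
  proof -
    define h where "h = t - x"
    have "\<bar>h\<bar> \<le> 1 + h\<^sup>2"
      using sum_squares_bound[of "\<bar>h\<bar>" 1] zero_le_power2[of h] by (simp add: power2_eq_square)
    have "h\<^sup>2 / (8 * s) \<le> exp (h\<^sup>2 / (8 * s))" using exp_ge_add_one_self[of "h\<^sup>2 / (8 * s)"] by linarith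
    then have "h\<^sup>2 / (8 * s) * e t \<le> exp (h\<^sup>2 / (8 * s)) * e t" using e[of t] by (intro mult_right_mono) auto
    also have "\<dots> = 1" by (simp add: e_def h_def flip: exp_add)
    finally have h2: "h\<^sup>2 * e t \<le> 8 * s" using pCons.prems by (simp add: field_simps)
    have "\<bar>t\<bar> * e t \<le> (\<bar>x\<bar> + (1 + h\<^sup>2)) * e t"
      using \<open>\<bar>h\<bar> \<le> 1 + h\<^sup>2\<close> e[of t] by (intro mult_right_mono) (auto simp: h_def)
    also have "\<dots> = (\<bar>x\<bar> + 1) * e t + h\<^sup>2 * e t" by (simp add: algebra_simps)
    also have "\<dots> \<le> (\<bar>x\<bar> + 1) * 1 + 8 * s" using h2 e[of t] by (intro add_mono mult_left_mono) auto
    finally show ?thesis by simp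
  qed
  have B0: "B \<ge> 0" using B[of 0] by (meson abs_ge_zero order_trans)
  show ?case
  proof (intro exI allI)
    fix t
    have "\<bar>poly (pCons a p) t * exp (- ((t - x)\<^sup>2 / (4 * s)))\<bar> \<le> \<bar>a\<bar> * (e t * e t) + (\<bar>t\<bar> * e t) * \<bar>poly p t * e t\<bar>"
    proof -
      have "poly (pCons a p) t * exp (- ((t - x)\<^sup>2 / (4 * s))) = a * (e t * e t) + (t * e t) * (poly p t * e t)"
        unfolding ee by (simp add: algebra_simps)
      also have "\<bar>\<dots>\<bar> \<le> \<bar>a * (e t * e t)\<bar> + \<bar>(t * e t) * (poly p t * e t)\<bar>" by (rule abs_triangle_ineq)
      finally show ?thesis using e[of t] by (simp add: abs_mult)
    qed
    also have "\<dots> \<le> \<bar>a\<bar> * (1 * 1) + (\<bar>x\<bar> + 1 + 8 * s) * B"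
      using e[of t] te[of t] B[of t] B0 pCons.prems unfolding e_def[symmetric]
      by (intro add_mono mult_mono) auto
    finally show "\<bar>poly (pCons a p) t * exp (- ((t - x)\<^sup>2 / (4 * s)))\<bar> \<le> \<bar>a\<bar> * (1 * 1) + (\<bar>x\<bar> + 1 + 8 * s) * B" .
  qed
qed

text \<open>
  By induction every derivative is a polynomial times the Gaussian, and these are bounded by
  \<open>poly_heat_kernel_bounded\<close>.
\<close>

lemma schwartz_heat_kernel:
  assumes s: "s > 0"
  shows "schwartz (\<lambda>t. of_real (heat_kernel s (t - x)))"
proof -
  define \<phi> :: "real \<Rightarrow> complex" where "\<phi> t = of_real (heat_kernel s (t - x))" for t
  define e where "e t = exp (- ((t - x)\<^sup>2 / (4 * s)))" for t
  have de: "(e has_real_derivative (- ((t - x) / (2 * s)) * e t)) (at t)" for t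
    unfolding e_def using s by (auto intro!: derivative_eq_intros simp: field_simps)
  have d: "((\<lambda>t. of_real (poly p t * e t) :: complex) has_vector_derivative
     of_real (poly (pderiv p - smult (1 / (2 * s)) ([:- x, 1:] * p)) t * e t)) (at t)" for p t
  proof -
    have "((\<lambda>t. poly p t * e t) has_real_derivative (poly (pderiv p - smult (1 / (2 * s)) ([:- x, 1:] * p)) t * e t)) (at t)"
      by (auto intro!: derivative_eq_intros poly_DERIV de simp: algebra_simps add_divide_distrib diff_divide_distrib)
    then show ?thesis
      by (intro has_vector_derivative_of_real) (simp add: has_real_derivative_iff_has_vector_derivative)
  qed
  have it: "\<exists>p. iter_deriv n \<phi> = (\<lambda>t. of_real (poly p t * e t))" for n
  proof (induction n)
    case 0
    show ?case
      by (intro exI[of _ "[:1 / sqrt (4 * pi * s):]"]) (auto simp: iter_deriv_def \<phi>_def heat_kernel_def e_def)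
  next
    case (Suc n)
    then obtain p where p: "iter_deriv n \<phi> = (\<lambda>t. of_real (poly p t * e t))" by blast
    have "iter_deriv (Suc n) \<phi> = (\<lambda>t. vector_derivative (iter_deriv n \<phi>) (at t))"
      by (simp add: iter_deriv_def)
    also have "\<dots> = (\<lambda>t. of_real (poly (pderiv p - smult (1 / (2 * s)) ([:- x, 1:] * p)) t * e t))"
      unfolding p using vector_derivative_at[OF d] by blast
    finally show ?case by blast
  qed
  have "schwartz \<phi>" unfolding schwartz_def
  proof (intro conjI allI)
    fix n t
    obtain p where p: "iter_deriv n \<phi> = (\<lambda>t. of_real (poly p t * e t))" using it by blast
    show "iter_deriv n \<phi> differentiable at t" unfolding p using d by (rule differentiableI_vector)
  next
    fix m n
    obtain p where p: "iter_deriv n \<phi> = (\<lambda>t. of_real (poly p t * e t))" using it by blast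
    obtain B where B: "\<bar>poly (monom 1 m * p) t * e t\<bar> \<le> B" for t
      using poly_heat_kernel_bounded[OF s, of "monom 1 m * p" x] unfolding e_def by blast
    have eq: "norm (t ^ m *\<^sub>R iter_deriv n \<phi> t) = \<bar>poly (monom 1 m * p) t * e t\<bar>" for t
      unfolding p by (simp add: poly_monom norm_mult abs_mult norm_power power_abs)
    show "bounded (range (\<lambda>t. t ^ m *\<^sub>R iter_deriv n \<phi> t))"
      unfolding bounded_iff using B eq by (intro exI[of _ B]) auto
  qed
  then show ?thesis by (simp add: \<phi>_def[abs_def])
qed

text \<open>
  The weak equation is used only through heat kernels as test functions.
\<close>

lemma distributional_solution_heat_kernel:
  assumes "distributional_solution V u" "s > 0"
  shows "(LINT t|lebesgue. u t * of_real (frac_heat s (t - x))) = - (LINT t|lebesgue. of_real (V t) * u t * of_real (heat_kernel s (t - x)))"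
proof -
  have "(LINT t|lebesgue. u t * frac_laplacian (1/4) (\<lambda>t. of_real (heat_kernel s (t - x))) t)
        + (LINT t|lebesgue. of_real (V t) * u t * of_real (heat_kernel s (t - x))) = 0"
    using assms(1)[unfolded distributional_solution_def] schwartz_heat_kernel[OF assms(2)] by blast
  then show ?thesis unfolding frac_laplacian_heat_kernel[OF assms(2)] by (simp add: eq_neg_iff_add_eq_0)
qed

section \<open>Subordination of the fractional Laplacian to the heat semigroup\<close>

lemma exp_ge_quarter_square:
  fixes z :: real assumes "z \<ge> 0" shows "z\<^sup>2 / 4 \<le> exp z"
proof -
  have "(z / 2)\<^sup>2 \<le> (exp (z / 2))\<^sup>2"
    using exp_ge_add_one_self[of "z / 2"] assms by (intro power_mono) linarith+
  also have "\<dots> = exp z" by (simp add: power2_eq_square flip: exp_add)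
  finally show ?thesis by (simp add: power_divide)
qed

text \<open>
  The times are written as \<open>exp v\<close> throughout, so that scaling in time is a
  translation and inversion in time is a reflection; all weights in time are then dominated by
  such two sided exponentials.
\<close>

lemma integrable_exp_neg_abs:
  fixes p :: real assumes p: "p > 0"
  shows "integrable lborel (\<lambda>v::real. exp (- (p * \<bar>v\<bar>)))"
proof (rule Bochner_Integration.integrable_bound[OF integrable_mult_right[OF poisson_profile_integrable, of "1 + 4 / p\<^sup>2"]])
  show "AE v in lborel. norm (exp (- (p * \<bar>v\<bar>))) \<le> norm ((1 + 4 / p\<^sup>2) * ((v\<^sup>2 + 1) powr (-3/4)))"
  proof (rule AE_I2)
    fix v :: real
    have "v\<^sup>2 \<le> 4 / p\<^sup>2 * exp (p * \<bar>v\<bar>)"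
      using exp_ge_quarter_square[of "p * \<bar>v\<bar>"] p by (simp add: field_simps)
    moreover have "1 \<le> exp (p * \<bar>v\<bar>)" using p by simp
    ultimately have "v\<^sup>2 + 1 \<le> 4 / p\<^sup>2 * exp (p * \<bar>v\<bar>) + exp (p * \<bar>v\<bar>)" by linarith
    then have "v\<^sup>2 + 1 \<le> (1 + 4 / p\<^sup>2) * exp (p * \<bar>v\<bar>)" by (simp add: distrib_right add.commute)
    then have "exp (- (p * \<bar>v\<bar>)) \<le> (1 + 4 / p\<^sup>2) * (1 / (v\<^sup>2 + 1))"
      by (simp add: exp_minus divide_inverse[symmetric] field_simps add_pos_nonneg)
    also have "1 / (v\<^sup>2 + 1) = (v\<^sup>2 + 1) powr (-1)" by (simp add: powr_minus_divide add_nonneg_pos)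
    also have "\<dots> \<le> (v\<^sup>2 + 1) powr (-3/4)" by (intro powr_mono) auto
    finally show "norm (exp (- (p * \<bar>v\<bar>))) \<le> norm ((1 + 4 / p\<^sup>2) * ((v\<^sup>2 + 1) powr (-3/4)))"
      using p by (simp add: mult_left_mono abs_mult add_nonneg_nonneg)
  qed
qed measurable

text \<open>
  The value of the Gamma function at \<open>p\<close>, after the substitution \<open>exp (-
  v)\<close> of the integration variable.
\<close>

definition gamma_exp :: "real \<Rightarrow> real" where
  "gamma_exp p = (LBINT v. exp (- (p * v)) * exp (- exp (- v)))"

lemma gamma_exp_integrable:
  fixes p :: real assumes p: "0 < p" "p \<le> 1"
  shows "integrable lborel (\<lambda>v::real. exp (- (p * v)) * exp (- exp (- v)))" "gamma_exp p > 0"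
proof -
  show i: "integrable lborel (\<lambda>v::real. exp (- (p * v)) * exp (- exp (- v)))"
  proof (rule Bochner_Integration.integrable_bound[OF integrable_mult_right[OF integrable_exp_neg_abs[OF p(1)], of 4]])
    show "AE v in lborel. norm (exp (- (p * v)) * exp (- exp (- v))) \<le> norm (4 * exp (- (p * \<bar>v\<bar>)))"
    proof (rule AE_I2)
      fix v :: real
      show "norm (exp (- (p * v)) * exp (- exp (- v))) \<le> norm (4 * exp (- (p * \<bar>v\<bar>)))"
      proof (cases "v \<ge> 0")
        case True
        have "exp (- (p * v)) * exp (- exp (- v)) \<le> exp (- (p * v)) * 1" by (intro mult_left_mono) auto
        also have "\<dots> \<le> 4 * exp (- (p * v))" by simp
        finally show ?thesis using True by simp
      next
        case False
        have "exp (- v) ^ 2 / 4 \<le> exp (exp (- v))" by (rule exp_ge_quarter_square) simp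
        then have "exp (- exp (- v)) \<le> 4 * exp (2 * v)"
          by (simp add: exp_minus field_simps power2_eq_square flip: exp_add)
        then have "exp (- (p * v)) * exp (- exp (- v)) \<le> exp (- (p * v)) * (4 * exp (2 * v))" by (intro mult_left_mono) auto
        also have "\<dots> = 4 * exp (2 * v - p * v)" by (simp flip: exp_add)
        also have "\<dots> \<le> 4 * exp (p * v)"
        proof -
          have "(2 - 2 * p) * v \<le> 0" using False p by (intro mult_nonneg_nonpos) auto
          then have "2 * v - p * v \<le> p * v" by (simp add: algebra_simps)
          then show ?thesis by simp
        qed
        finally show ?thesis using False by simp
      qed
    qed
  qed measurable
  show "gamma_exp p > 0"
  proof (rule ccontr)
    assume "\<not> gamma_exp p > 0"
    moreover have "gamma_exp p \<ge> 0" unfolding gamma_exp_def by (intro Bochner_Integration.integral_nonneg) auto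
    ultimately have "gamma_exp p = 0" by simp
    then have "AE v in lborel. exp (- (p * v)) * exp (- exp (- v)) = 0"
      unfolding gamma_exp_def using integral_nonneg_eq_0_iff_AE[OF i] by auto
    then have "AE v in (lborel :: real measure). False" by simp
    then show False by (simp add: eventually_False trivial_limit_def[symmetric] ae_filter_eq_bot_iff)
  qed
qed

lemma gamma_exp_scaled:
  fixes p A :: real assumes p: "0 < p" "p \<le> 1" and A: "A > 0"
  shows "integrable lborel (\<lambda>v. exp (- (p * v)) * exp (- (A * exp (- v))))"
    "(LBINT v. exp (- (p * v)) * exp (- (A * exp (- v)))) = A powr (- p) * gamma_exp p"
proof -
  have e: "exp (- (p * (ln A + 1 * w))) * exp (- (A * exp (- (ln A + 1 * w)))) = A powr (- p) * (exp (- (p * w)) * exp (- exp (- w)))" for w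
  proof -
    have "exp (- (p * (ln A + 1 * w))) = A powr (- p) * exp (- (p * w))"
      using A by (simp add: powr_def algebra_simps flip: exp_add)
    moreover have "A * exp (- (ln A + 1 * w)) = exp (- w)"
      using A by (simp add: exp_diff exp_minus field_simps exp_add)
    ultimately show ?thesis by simp
  qed
  have i: "integrable lborel (\<lambda>w. A powr (- p) * (exp (- (p * w)) * exp (- exp (- w))))"
    using gamma_exp_integrable(1)[OF p] by simp
  show "integrable lborel (\<lambda>v. exp (- (p * v)) * exp (- (A * exp (- v))))"
    using lborel_integrable_real_affine_iff[of 1 "\<lambda>v. exp (- (p * v)) * exp (- (A * exp (- v)))" "ln A"] i
    unfolding e by simp
  show "(LBINT v. exp (- (p * v)) * exp (- (A * exp (- v)))) = A powr (- p) * gamma_exp p"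
    using lborel_integral_real_affine[of 1 "\<lambda>v. exp (- (p * v)) * exp (- (A * exp (- v)))" "ln A"]
    unfolding e gamma_exp_def by simp
qed

definition subordination_const :: real where
  "subordination_const = (LBINT w. exp (- w / 4) * (1 - exp (- exp w)))"

lemma subordination_const_bound:
  fixes w :: real
  shows "\<bar>exp (- w / 4) * (1 - exp (- exp w))\<bar> \<le> exp (- (1/4 * \<bar>w\<bar>))"
proof -
  have n: "0 \<le> 1 - exp (- exp w)" by simp
  show ?thesis
  proof (cases "w \<ge> 0")
    case True
    have "exp (- w / 4) * (1 - exp (- exp w)) \<le> exp (- w / 4) * 1" by (intro mult_left_mono) auto
    then show ?thesis using True n by (simp add: abs_mult)
  next
    case False
    have "1 - exp (- exp w) \<le> exp w" using exp_ge_add_one_self[of "- exp w"] by simp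
    then have "exp (- w / 4) * (1 - exp (- exp w)) \<le> exp (- w / 4) * exp w" by (intro mult_left_mono) auto
    also have "\<dots> = exp (3 / 4 * w)" by (simp flip: exp_add)
    also have "\<dots> \<le> exp (1 / 4 * w)" using False by simp
    finally show ?thesis using False n by (simp add: abs_mult)
  qed
qed

lemma subordination_const_integrable:
  "integrable lborel (\<lambda>w::real. exp (- w / 4) * (1 - exp (- exp w)))" "subordination_const > 0"
proof -
  show i: "integrable lborel (\<lambda>w::real. exp (- w / 4) * (1 - exp (- exp w)))"
    by (rule Bochner_Integration.integrable_bound[OF integrable_exp_neg_abs[of "1/4"]])
       (use subordination_const_bound in \<open>auto intro!: AE_I2\<close>)
  show "subordination_const > 0"
  proof (rule ccontr)
    assume "\<not> subordination_const > 0"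
    moreover have "subordination_const \<ge> 0" unfolding subordination_const_def by (intro Bochner_Integration.integral_nonneg) auto
    ultimately have "subordination_const = 0" by simp
    then have "AE v in lborel. exp (- v / 4) * (1 - exp (- exp v)) = (0::real)"
      unfolding subordination_const_def by (subst (asm) integral_nonneg_eq_0_iff_AE[OF i]) auto
    then have "AE v in (lborel :: real measure). False" by simp
    then show False by (simp add: eventually_False trivial_limit_def[symmetric] ae_filter_eq_bot_iff)
  qed
qed

text \<open>
  The formula \<open>\<bar>\<xi>\<bar> powr (1/2) = C * \<integral> (1 - exp (- \<sigma> *
  \<xi>\<^sup>2)) * \<sigma> powr (-5/4) d\<sigma>\<close>, with \<open>\<sigma> = exp
  w\<close>; the dependence on \<open>\<xi>\<close> is a translation in \<open>w\<close>.
\<close>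

lemma subordination:
  fixes \<xi> :: real
  shows "integrable lborel (\<lambda>w. exp (- w / 4) * (1 - exp (- (exp w * \<xi>\<^sup>2))))"
    "(LBINT w. exp (- w / 4) * (1 - exp (- (exp w * \<xi>\<^sup>2)))) = \<bar>\<xi>\<bar> powr (1/2) * subordination_const"
proof -
  have "integrable lborel (\<lambda>w. exp (- w / 4) * (1 - exp (- (exp w * \<xi>\<^sup>2)))) \<and>
    (LBINT w. exp (- w / 4) * (1 - exp (- (exp w * \<xi>\<^sup>2)))) = \<bar>\<xi>\<bar> powr (1/2) * subordination_const"
  proof (cases "\<xi> = 0")
    case False
    define L where "L = - ln (\<xi>\<^sup>2)"
    have z: "\<xi>\<^sup>2 > 0" using False by simp
    have eL: "exp L * \<xi>\<^sup>2 = 1" using z by (simp add: L_def exp_minus)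
    have "\<bar>\<xi>\<bar> powr (1/2) = (\<xi>\<^sup>2) powr (1/4)"
    proof -
      have "(\<xi>\<^sup>2) powr (1/4) = (\<bar>\<xi>\<bar> powr 2) powr (1/4)" by simp
      then show ?thesis unfolding powr_powr by simp
    qed
    also have "\<dots> = exp (- L / 4)" using False by (simp add: powr_def L_def)
    finally have x: "\<bar>\<xi>\<bar> powr (1/2) = exp (- L / 4)" .
    have e: "exp (- (L + 1 * w) / 4) * (1 - exp (- (exp (L + 1 * w) * \<xi>\<^sup>2))) = \<bar>\<xi>\<bar> powr (1/2) * (exp (- w / 4) * (1 - exp (- exp w)))" for w
    proof -
      have "exp (L + 1 * w) * \<xi>\<^sup>2 = exp w * (exp L * \<xi>\<^sup>2)" by (simp add: exp_add)
      then have "exp (L + 1 * w) * \<xi>\<^sup>2 = exp w" unfolding eL by simp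
      moreover have "exp (- (L + 1 * w) / 4) = exp (- L / 4) * exp (- w / 4)"
        by (simp add: field_simps flip: exp_add)
      ultimately show ?thesis unfolding x by simp
    qed
    have i: "integrable lborel (\<lambda>w. \<bar>\<xi>\<bar> powr (1/2) * (exp (- w / 4) * (1 - exp (- exp w))))"
      using subordination_const_integrable(1) by simp
    show ?thesis
      using lborel_integrable_real_affine_iff[of 1 "\<lambda>w. exp (- w / 4) * (1 - exp (- (exp w * \<xi>\<^sup>2)))" L] i
        lborel_integral_real_affine[of 1 "\<lambda>w. exp (- w / 4) * (1 - exp (- (exp w * \<xi>\<^sup>2)))" L]
      unfolding e subordination_const_def by simp
  qed simp
  then show "integrable lborel (\<lambda>w. exp (- w / 4) * (1 - exp (- (exp w * \<xi>\<^sup>2))))"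
    "(LBINT w. exp (- w / 4) * (1 - exp (- (exp w * \<xi>\<^sup>2)))) = \<bar>\<xi>\<bar> powr (1/2) * subordination_const" by auto
qed

text \<open>
  The theorem of Fubini with integrability of one iterated integral as hypothesis.
\<close>

lemma lborel_swap:
  fixes f :: "real \<Rightarrow> real \<Rightarrow> 'a::{banach, second_countable_topology}"
  assumes m [measurable]: "(\<lambda>(x, y). f x y) \<in> borel_measurable (lborel \<Otimes>\<^sub>M lborel)"
    and i: "AE x in lborel. integrable lborel (f x)" and n: "integrable lborel (\<lambda>x. LBINT y. norm (f x y))"
  shows "(LBINT x. LBINT y. f x y) = (LBINT y. LBINT x. f x y)"
    and "integrable lborel (\<lambda>y. LBINT x. f x y)"
    and "integrable lborel (\<lambda>x. LBINT y. f x y)"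
proof -
  have j: "integrable (lborel \<Otimes>\<^sub>M lborel) (\<lambda>(x, y). f x y)"
    by (rule lborel_pair.Fubini_integrable[OF m]) (use i n in auto)
  show "(LBINT x. LBINT y. f x y) = (LBINT y. LBINT x. f x y)"
    using lborel_pair.Fubini_integral[OF j] by simp
  show "integrable lborel (\<lambda>y. LBINT x. f x y)" using lborel_pair.integrable_snd[OF j] .
  show "integrable lborel (\<lambda>x. LBINT y. f x y)" using lborel_pair.integrable_fst[OF j] .
qed

lemma frac_heat_measurable [measurable (raw)]:
  assumes [measurable]: "s \<in> borel_measurable M" "h \<in> borel_measurable M"
  shows "(\<lambda>w. frac_heat (s w) (h w)) \<in> borel_measurable M"
  unfolding frac_heat_def by measurable

text \<open>
  The formula \<open>subordination\<close> multiplied by the Gaussian and inverted: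
  \<open>frac_heat\<close> is a superposition of differences of heat kernels.
\<close>

lemma frac_heat_subordination:
  assumes s: "s > 0"
  shows "frac_heat s h * subordination_const = (LBINT w. exp (- w / 4) * (heat_kernel s h - heat_kernel (s + exp w) h))"
    and "integrable lborel (\<lambda>w. exp (- w / 4) * (heat_kernel s h - heat_kernel (s + exp w) h))"
proof -
  define f where "f \<xi> w = cos (h * \<xi>) * exp (- (s * \<xi>\<^sup>2)) * (exp (- w / 4) * (1 - exp (- (exp w * \<xi>\<^sup>2))))" for \<xi> w :: real
  have inner: "(LBINT w. f \<xi> w) = subordination_const * (cos (h * \<xi>) * frac_heat_symbol s \<xi>)" for \<xi>
    unfolding f_def frac_heat_symbol_def integral_mult_right_zero subordination(2) by (simp only: mult_ac)
  have inn: "(LBINT w. norm (f \<xi> w)) = subordination_const * \<bar>cos (h * \<xi>)\<bar> * frac_heat_symbol s \<xi>" for \<xi>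
  proof -
    have "norm (f \<xi> w) = \<bar>cos (h * \<xi>)\<bar> * exp (- (s * \<xi>\<^sup>2)) * (exp (- w / 4) * (1 - exp (- (exp w * \<xi>\<^sup>2))))" for w
      by (simp add: f_def abs_mult)
    then show ?thesis unfolding frac_heat_symbol_def by (simp only: integral_mult_right_zero subordination(2)) (simp only: mult_ac)
  qed
  have fi: "integrable lborel (f \<xi>)" for \<xi>
    unfolding f_def by (intro integrable_mult_right subordination(1))
  have ni: "integrable lborel (\<lambda>\<xi>. LBINT w. norm (f \<xi> w))"
    unfolding inn
    by (rule Bochner_Integration.integrable_bound[OF integrable_mult_right[OF frac_heat_symbol_integrable[OF s], of subordination_const]])
       (use subordination_const_integrable(2) in \<open>auto intro!: AE_I2 simp: abs_mult frac_heat_symbol_def mult_left_le_one_le\<close>)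
  have fm: "(\<lambda>(\<xi>, w). f \<xi> w) \<in> borel_measurable (lborel \<Otimes>\<^sub>M lborel)" unfolding f_def by measurable
  note sw = lborel_swap[OF fm AE_I2[OF fi] ni]
  have outer: "(LBINT \<xi>. f \<xi> w) = 2 * pi * (exp (- w / 4) * (heat_kernel s h - heat_kernel (s + exp w) h))" for w
  proof -
    have sp: "s + exp w > 0" using s by (simp add: add_pos_pos)
    have ci: "integrable lborel (\<lambda>\<xi>. cos (h * \<xi>) * exp (- (r * \<xi>\<^sup>2)))" if "r > 0" for r
      by (rule Bochner_Integration.integrable_bound[OF heat_kernel_fourier_inversion(1)[OF that]]) (auto simp: abs_mult)
    have "(LBINT \<xi>. f \<xi> w) = (LBINT \<xi>. exp (- w / 4) * (cos (h * \<xi>) * exp (- (s * \<xi>\<^sup>2)) - cos (h * \<xi>) * exp (- ((s + exp w) * \<xi>\<^sup>2))))"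
    proof (intro Bochner_Integration.integral_cong refl)
      fix \<xi> :: real
      have "exp (- ((s + exp w) * \<xi>\<^sup>2)) = exp (- (s * \<xi>\<^sup>2)) * exp (- (exp w * \<xi>\<^sup>2))"
        by (simp add: distrib_right flip: exp_add)
      then show "f \<xi> w = exp (- w / 4) * (cos (h * \<xi>) * exp (- (s * \<xi>\<^sup>2)) - cos (h * \<xi>) * exp (- ((s + exp w) * \<xi>\<^sup>2)))"
        unfolding f_def by (simp only:) (simp only: ring_distribs mult_1_right mult_ac)
    qed
    also have "\<dots> = exp (- w / 4) * ((LBINT \<xi>. cos (h * \<xi>) * exp (- (s * \<xi>\<^sup>2))) - (LBINT \<xi>. cos (h * \<xi>) * exp (- ((s + exp w) * \<xi>\<^sup>2))))"
      by (simp only: integral_mult_right_zero Bochner_Integration.integral_diff[OF ci[OF s] ci[OF sp]])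
    also have "\<dots> = 2 * pi * (exp (- w / 4) * (heat_kernel s h - heat_kernel (s + exp w) h))"
      unfolding heat_kernel_fourier_inversion(2)[OF s] heat_kernel_fourier_inversion(2)[OF sp] by (simp add: algebra_simps)
    finally show ?thesis .
  qed
  show "frac_heat s h * subordination_const = (LBINT w. exp (- w / 4) * (heat_kernel s h - heat_kernel (s + exp w) h))"
  proof -
    have aux: "a / c * b = d" if "b * a = c * d" "c \<noteq> 0" for a b c d :: real
      using that by (simp add: field_simps)
    show ?thesis unfolding frac_heat_def by (rule aux) (use sw(1) in \<open>simp_all add: inner outer\<close>)
  qed
  show "integrable lborel (\<lambda>w. exp (- w / 4) * (heat_kernel s h - heat_kernel (s + exp w) h))"
    using sw(2) unfolding outer by simp
qed

text \<open>
  With \<open>q = sqrt (s / (s + l))\<close> one has \<open>q * heat_kernel s h \<le> heat_kernel (s + l)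
  h\<close> pointwise, which bounds the overlap of the two densities from below.
\<close>

lemma heat_kernel_L1_difference:
  assumes s: "s > 0" and l: "l > 0"
  shows "(\<integral>\<^sup>+h. ennreal \<bar>heat_kernel s h - heat_kernel (s + l) h\<bar> \<partial>lborel) \<le> ennreal (2 * (l / (s + l)))"
proof -
  define q where "q = sqrt (s / (s + l))"
  have q: "0 \<le> q" "q \<le> 1" using s l by (auto simp: q_def)
  have q2: "q * q = s / (s + l)" using s l by (simp add: q_def)
  have ge: "q * heat_kernel s h \<le> heat_kernel (s + l) h" for h
  proof -
    have "q / sqrt (4 * pi * s) = 1 / sqrt (4 * pi * (s + l))"
      using s l by (simp add: q_def real_sqrt_mult real_sqrt_divide)
    moreover have "exp (- (h\<^sup>2 / (4 * s))) \<le> exp (- (h\<^sup>2 / (4 * (s + l))))"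
      using s l by (simp add: frac_le)
    ultimately have "exp (- (h\<^sup>2 / (4 * s))) * (q / sqrt (4 * pi * s)) \<le> exp (- (h\<^sup>2 / (4 * (s + l)))) * (1 / sqrt (4 * pi * (s + l)))"
      using s l by (simp only:) (intro mult_right_mono, auto)
    then show ?thesis by (simp add: heat_kernel_def mult.commute)
  qed
  have i: "integrable lborel (\<lambda>h. (1 - 2 * q) * heat_kernel s h + heat_kernel (s + l) h)"
    using s l heat_kernel_integral(1)[of s] heat_kernel_integral(1)[of "s + l"] by simp
  have le: "\<bar>heat_kernel s h - heat_kernel (s + l) h\<bar> \<le> (1 - 2 * q) * heat_kernel s h + heat_kernel (s + l) h" for h
  proof -
    have "q * heat_kernel s h \<le> 1 * heat_kernel s h" using q heat_kernel_pos[OF s, of h] by (intro mult_right_mono) auto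
    with ge[of h] show ?thesis by (simp add: algebra_simps)
  qed
  have "(\<integral>\<^sup>+h. ennreal \<bar>heat_kernel s h - heat_kernel (s + l) h\<bar> \<partial>lborel) \<le> (\<integral>\<^sup>+h. ennreal ((1 - 2 * q) * heat_kernel s h + heat_kernel (s + l) h) \<partial>lborel)"
    by (intro nn_integral_mono ennreal_leI le)
  also have "\<dots> = ennreal (LBINT h. (1 - 2 * q) * heat_kernel s h + heat_kernel (s + l) h)"
    by (rule nn_integral_eq_integral[OF i]) (use order_trans[OF abs_ge_zero le] in auto)
  also have "(LBINT h. (1 - 2 * q) * heat_kernel s h + heat_kernel (s + l) h) = 2 * (1 - q)"
    using s l heat_kernel_integral[of s] heat_kernel_integral[of "s + l"] by simp
  also have "ennreal (2 * (1 - q)) \<le> ennreal (2 * (l / (s + l)))"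
  proof (rule ennreal_leI)
    have "q * q \<le> q * 1" using q by (intro mult_left_mono) auto
    moreover have "1 - s / (s + l) = l / (s + l)" using s l by (simp add: field_simps)
    ultimately have "1 - q \<le> l / (s + l)" unfolding q2 by (metis diff_left_mono mult_1_right)
    then show "2 * (1 - q) \<le> 2 * (l / (s + l))" by simp
  qed
  finally show ?thesis .
qed

definition frac_heat_L1_const :: real where
  "frac_heat_L1_const = 2 * (LBINT w. exp (- (1/4 * \<bar>w\<bar>))) / subordination_const"

text \<open>
  An \<open>L\<^sup>1\<close> bound that is integrable against the weights in time used below. It
  follows from subordination and the bound \<open>2 * min 1 (l / s)\<close> for the differences,
  without any pointwise decay of \<open>frac_heat\<close>.
\<close>

lemma frac_heat_L1:
  assumes s: "s > 0"
  shows "(\<integral>\<^sup>+h. ennreal \<bar>frac_heat s h\<bar> \<partial>lborel) \<le> ennreal (frac_heat_L1_const * (1 + 1 / s))"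
proof -
  note c = subordination_const_integrable(2)
  have I: "integrable lborel (\<lambda>w::real. exp (- (1/4 * \<bar>w\<bar>)))" by (rule integrable_exp_neg_abs) simp
  have pt: "ennreal \<bar>frac_heat s h\<bar> \<le> ennreal (1 / subordination_const) * (\<integral>\<^sup>+w. ennreal (exp (- w / 4) * \<bar>heat_kernel s h - heat_kernel (s + exp w) h\<bar>) \<partial>lborel)" for h
  proof -
    have "ennreal (norm (frac_heat s h * subordination_const)) \<le> (\<integral>\<^sup>+w. ennreal (norm (exp (- w / 4) * (heat_kernel s h - heat_kernel (s + exp w) h))) \<partial>lborel)"
      unfolding frac_heat_subordination(1)[OF s] by (rule integral_norm_bound_ennreal[OF frac_heat_subordination(2)[OF s]])
    then have "ennreal (1 / subordination_const) * ennreal (norm (frac_heat s h * subordination_const)) \<le> ennreal (1 / subordination_const) * (\<integral>\<^sup>+w. ennreal (exp (- w / 4) * \<bar>heat_kernel s h - heat_kernel (s + exp w) h\<bar>) \<partial>lborel)"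
      by (intro mult_left_mono) (auto simp: abs_mult)
    also have "ennreal (1 / subordination_const) * ennreal (norm (frac_heat s h * subordination_const)) = ennreal \<bar>frac_heat s h\<bar>"
      using c by (simp add: abs_mult flip: ennreal_mult)
    finally show ?thesis .
  qed
  have "(\<integral>\<^sup>+h. ennreal \<bar>frac_heat s h\<bar> \<partial>lborel) \<le> (\<integral>\<^sup>+h. ennreal (1 / subordination_const) * (\<integral>\<^sup>+w. ennreal (exp (- w / 4) * \<bar>heat_kernel s h - heat_kernel (s + exp w) h\<bar>) \<partial>lborel) \<partial>lborel)"
    by (intro nn_integral_mono pt)
  also have "\<dots> = ennreal (1 / subordination_const) * (\<integral>\<^sup>+h. (\<integral>\<^sup>+w. ennreal (exp (- w / 4) * \<bar>heat_kernel s h - heat_kernel (s + exp w) h\<bar>) \<partial>lborel) \<partial>lborel)"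
    by (rule nn_integral_cmult) measurable
  also have "(\<integral>\<^sup>+h. (\<integral>\<^sup>+w. ennreal (exp (- w / 4) * \<bar>heat_kernel s h - heat_kernel (s + exp w) h\<bar>) \<partial>lborel) \<partial>lborel)
     = (\<integral>\<^sup>+w. (\<integral>\<^sup>+h. ennreal (exp (- w / 4) * \<bar>heat_kernel s h - heat_kernel (s + exp w) h\<bar>) \<partial>lborel) \<partial>lborel)"
    by (rule lborel_pair.Fubini') measurable
  also have "\<dots> \<le> (\<integral>\<^sup>+w. ennreal (2 * (1 + 1 / s) * exp (- (1/4 * \<bar>w\<bar>))) \<partial>lborel)"
  proof (rule nn_integral_mono)
    fix w :: real
    have "(\<integral>\<^sup>+h. ennreal (exp (- w / 4) * \<bar>heat_kernel s h - heat_kernel (s + exp w) h\<bar>) \<partial>lborel)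
       = (\<integral>\<^sup>+h. ennreal (exp (- w / 4)) * ennreal \<bar>heat_kernel s h - heat_kernel (s + exp w) h\<bar> \<partial>lborel)"
      by (intro nn_integral_cong) (simp add: ennreal_mult)
    also have "\<dots> = ennreal (exp (- w / 4)) * (\<integral>\<^sup>+h. ennreal \<bar>heat_kernel s h - heat_kernel (s + exp w) h\<bar> \<partial>lborel)"
      by (rule nn_integral_cmult) measurable
    also have "\<dots> \<le> ennreal (exp (- w / 4)) * ennreal (2 * (exp w / (s + exp w)))"
      by (intro mult_left_mono heat_kernel_L1_difference s) auto
    also have "\<dots> = ennreal (exp (- w / 4) * (2 * (exp w / (s + exp w))))" using s by (intro ennreal_mult[symmetric]) auto
    also have "\<dots> \<le> ennreal (2 * (1 + 1 / s) * exp (- (1/4 * \<bar>w\<bar>)))"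
    proof (rule ennreal_leI)
      have f: "exp w / (s + exp w) \<le> 1" "exp w / (s + exp w) \<le> exp w / s"
        using s by (auto intro!: divide_left_mono mult_pos_pos add_pos_pos simp: divide_le_eq_1 add_pos_pos)
      show "exp (- w / 4) * (2 * (exp w / (s + exp w))) \<le> 2 * (1 + 1 / s) * exp (- (1/4 * \<bar>w\<bar>))"
      proof (cases "w \<ge> 0")
        case True
        have "exp (- w / 4) * (2 * (exp w / (s + exp w))) \<le> exp (- w / 4) * (2 * 1)"
          using f by (intro mult_left_mono) auto
        also have "\<dots> \<le> 2 * (1 + 1 / s) * exp (- w / 4)" using s by (simp add: field_simps)
        finally show ?thesis using True by simp
      next
        case False
        have "exp (- w / 4) * (2 * (exp w / (s + exp w))) \<le> exp (- w / 4) * (2 * (exp w / s))"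
          using f by (intro mult_left_mono) auto
        also have "\<dots> = 2 * (1 / s) * exp (3 / 4 * w)" by (simp flip: exp_add)
        also have "\<dots> \<le> 2 * (1 + 1 / s) * exp (1 / 4 * w)" using False s by (intro mult_mono) auto
        finally show ?thesis using False by simp
      qed
    qed
    finally show "(\<integral>\<^sup>+h. ennreal (exp (- w / 4) * \<bar>heat_kernel s h - heat_kernel (s + exp w) h\<bar>) \<partial>lborel) \<le> ennreal (2 * (1 + 1 / s) * exp (- (1/4 * \<bar>w\<bar>)))" .
  qed
  also have "(\<integral>\<^sup>+w. ennreal (2 * (1 + 1 / s) * exp (- (1/4 * \<bar>w\<bar>))) \<partial>lborel) = ennreal (LBINT w. 2 * (1 + 1 / s) * exp (- (1/4 * \<bar>w\<bar>)))"
    by (rule nn_integral_eq_integral[OF integrable_mult_right[OF I]]) (use s in auto)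
  also have "(LBINT w. 2 * (1 + 1 / s) * exp (- (1/4 * \<bar>w\<bar>))) = 2 * (1 + 1 / s) * (LBINT w. exp (- (1/4 * \<bar>w\<bar>)))"
    by (rule integral_mult_right_zero)
  finally have "(\<integral>\<^sup>+h. ennreal \<bar>frac_heat s h\<bar> \<partial>lborel) \<le> ennreal (1 / subordination_const) * ennreal (2 * (1 + 1 / s) * (LBINT w. exp (- (1/4 * \<bar>w\<bar>))))"
    by (simp add: mult_left_mono)
  also have "\<dots> = ennreal (1 / subordination_const * (2 * (1 + 1 / s) * (LBINT w. exp (- (1/4 * \<bar>w\<bar>)))))"
    using c s by (intro ennreal_mult[symmetric]) (auto intro!: mult_nonneg_nonneg Bochner_Integration.integral_nonneg)
  also have "1 / subordination_const * (2 * (1 + 1 / s) * (LBINT w. exp (- (1/4 * \<bar>w\<bar>)))) = frac_heat_L1_const * (1 + 1 / s)"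
    by (simp add: frac_heat_L1_const_def mult_ac)
  finally show ?thesis .
qed

section \<open>Weights in time that produce the boundary and the Poisson kernel\<close>

text \<open>
  The weight \<open>s powr (1/4) * exp (- y\<^sup>2 / (4 * s))\<close> with respect to \<open>ds /
  s\<close>, for \<open>s = exp v\<close>.
\<close>

definition riesz_weight :: "real \<Rightarrow> real \<Rightarrow> real" where
  "riesz_weight y v = exp (v / 4) * exp (- (y\<^sup>2 / 4 * exp (- v)))"

lemma riesz_weight_measurable [measurable]: "riesz_weight y \<in> borel_measurable borel"
  unfolding riesz_weight_def by measurable

lemma riesz_weight_nonneg [simp]: "riesz_weight y v \<ge> 0" by (simp add: riesz_weight_def)

lemma heat_kernel_exp: "heat_kernel (exp v) h = exp (- v / 2) * exp (- (h\<^sup>2 / 4 * exp (- v))) / sqrt (4 * pi)"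
proof -
  have "sqrt (4 * pi * exp v) = sqrt (4 * pi) * exp (v / 2)"
  proof -
    have "sqrt (exp v) = exp (v / 2)" by (rule real_sqrt_unique) (simp_all add: power2_eq_square flip: exp_add)
    then show ?thesis by (simp add: real_sqrt_mult)
  qed
  moreover have "h\<^sup>2 / (4 * exp v) = h\<^sup>2 / 4 * exp (- v)" by (simp add: exp_minus field_simps)
  ultimately show ?thesis unfolding heat_kernel_def by (simp add: exp_minus field_simps)
qed

lemma square_sum_powr:
  fixes y h p :: real
  assumes "y > 0"
  shows "((y\<^sup>2 + h\<^sup>2) / 4) powr (- p) = 4 powr p * (h\<^sup>2 + y\<^sup>2) powr (- p)"
  using assms by (simp add: powr_divide powr_minus add.commute field_simps)

text \<open>
  The integral over time of the heat kernel with this weight is the boundary kernel: the two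
  Gaussians in \<open>y\<close> and \<open>h\<close> combine to one in \<open>h\<^sup>2 +
  y\<^sup>2\<close>.
\<close>

lemma riesz_weight_heat_kernel_integral:
  assumes y: "y > 0"
  shows "integrable lborel (\<lambda>v. riesz_weight y v * heat_kernel (exp v) h)"
    "(LBINT v. riesz_weight y v * heat_kernel (exp v) h) = 4 powr (1/4) * gamma_exp (1/4) / sqrt (4 * pi) * (h\<^sup>2 + y\<^sup>2) powr (-1/4)"
proof -
  define A where "A = (y\<^sup>2 + h\<^sup>2) / 4"
  have A: "A > 0" using y by (simp add: A_def add_pos_nonneg)
  have e: "riesz_weight y v * heat_kernel (exp v) h = 1 / sqrt (4 * pi) * (exp (- (1/4 * v)) * exp (- (A * exp (- v))))" for v
  proof -
    have "exp (v / 4) * exp (- v / 2) = exp (- (1/4 * v))" by (simp flip: exp_add)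
    moreover have "exp (- (y\<^sup>2 / 4 * exp (- v))) * exp (- (h\<^sup>2 / 4 * exp (- v))) = exp (- (A * exp (- v)))"
      by (simp add: A_def algebra_simps add_divide_distrib flip: exp_add)
    moreover have "riesz_weight y v * heat_kernel (exp v) h = 1 / sqrt (4 * pi) * ((exp (v / 4) * exp (- v / 2)) * (exp (- (y\<^sup>2 / 4 * exp (- v))) * exp (- (h\<^sup>2 / 4 * exp (- v)))))"
      unfolding riesz_weight_def heat_kernel_exp by simp
    ultimately show ?thesis by (simp only:)
  qed
  show "integrable lborel (\<lambda>v. riesz_weight y v * heat_kernel (exp v) h)"
    unfolding e by (intro integrable_mult_right gamma_exp_scaled(1) A) auto
  have "(LBINT v. riesz_weight y v * heat_kernel (exp v) h) = 1 / sqrt (4 * pi) * (A powr (- (1/4)) * gamma_exp (1/4))"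
    unfolding e integral_mult_right_zero using gamma_exp_scaled(2)[of "1/4" A] A by simp
  also have "A powr (- (1/4)) = 4 powr (1/4) * (h\<^sup>2 + y\<^sup>2) powr (- (1/4))"
    unfolding A_def by (rule square_sum_powr[OF y])
  finally show "(LBINT v. riesz_weight y v * heat_kernel (exp v) h) = 4 powr (1/4) * gamma_exp (1/4) / sqrt (4 * pi) * (h\<^sup>2 + y\<^sup>2) powr (-1/4)"
    by simp
qed

text \<open>
  The weight \<open>s powr (-1/4) * exp (- y\<^sup>2 / (4 * s))\<close> with respect to \<open>ds
  / s\<close>, for \<open>s = exp w\<close>.
\<close>

definition poisson_weight :: "real \<Rightarrow> real \<Rightarrow> real" where
  "poisson_weight y w = exp (- (1/4 * w)) * exp (- (y\<^sup>2 / 4 * exp (- w)))"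

lemma poisson_weight_measurable [measurable]: "poisson_weight y \<in> borel_measurable borel"
  unfolding poisson_weight_def by measurable

lemma poisson_weight_integrable:
  assumes y: "y > 0" shows "integrable lborel (poisson_weight y)"
  unfolding poisson_weight_def using gamma_exp_scaled(1)[of "1/4" "y\<^sup>2 / 4"] y by simp

text \<open>
  With the other weight the same computation produces the profile of the Poisson kernel.
\<close>

lemma poisson_weight_heat_kernel_integral:
  assumes y: "y > 0"
  shows "integrable lborel (\<lambda>v. poisson_weight y v * heat_kernel (exp v) h)"
    "(LBINT v. poisson_weight y v * heat_kernel (exp v) h) = 4 powr (3/4) * gamma_exp (3/4) / sqrt (4 * pi) * (h\<^sup>2 + y\<^sup>2) powr (-3/4)"
proof -
  define A where "A = (y\<^sup>2 + h\<^sup>2) / 4"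
  have A: "A > 0" using y by (simp add: A_def add_pos_nonneg)
  have e: "poisson_weight y v * heat_kernel (exp v) h = 1 / sqrt (4 * pi) * (exp (- (3/4 * v)) * exp (- (A * exp (- v))))" for v
  proof -
    have "exp (- (1/4 * v)) * exp (- v / 2) = exp (- (3/4 * v))" by (simp flip: exp_add)
    moreover have "exp (- (y\<^sup>2 / 4 * exp (- v))) * exp (- (h\<^sup>2 / 4 * exp (- v))) = exp (- (A * exp (- v)))"
      by (simp add: A_def algebra_simps add_divide_distrib flip: exp_add)
    moreover have "poisson_weight y v * heat_kernel (exp v) h = 1 / sqrt (4 * pi) * ((exp (- (1/4 * v)) * exp (- v / 2)) * (exp (- (y\<^sup>2 / 4 * exp (- v))) * exp (- (h\<^sup>2 / 4 * exp (- v)))))"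
      unfolding poisson_weight_def heat_kernel_exp by simp
    ultimately show ?thesis by (simp only:)
  qed
  show "integrable lborel (\<lambda>v. poisson_weight y v * heat_kernel (exp v) h)"
    unfolding e by (intro integrable_mult_right gamma_exp_scaled(1) A) auto
  have "(LBINT v. poisson_weight y v * heat_kernel (exp v) h) = 1 / sqrt (4 * pi) * (A powr (- (3/4)) * gamma_exp (3/4))"
    unfolding e integral_mult_right_zero using gamma_exp_scaled(2)[of "3/4" A] A by simp
  also have "A powr (- (3/4)) = 4 powr (3/4) * (h\<^sup>2 + y\<^sup>2) powr (- (3/4))"
    unfolding A_def by (rule square_sum_powr[OF y])
  finally show "(LBINT v. poisson_weight y v * heat_kernel (exp v) h) = 4 powr (3/4) * gamma_exp (3/4) / sqrt (4 * pi) * (h\<^sup>2 + y\<^sup>2) powr (-3/4)"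
    by simp
qed

text \<open>
  The multiplier \<open>\<bar>\<xi>\<bar> powr (1/2)\<close> exchanges the two weights. The reason
  is the inversion \<open>s \<mapsto> c\<^sup>2 / s\<close> with \<open>c = y / (2 *
  \<bar>\<xi>\<bar>)\<close>, which exchanges the exponents \<open>y\<^sup>2 / (4 * s)\<close>
  and \<open>s * \<xi>\<^sup>2\<close> and reverses the power of \<open>s\<close>.
\<close>

lemma riesz_weight_inversion:
  fixes \<xi> :: real
  assumes y: "y > 0" and x: "\<xi> \<noteq> 0"
  shows "integrable lborel (\<lambda>v. riesz_weight y v * exp (- (exp v * \<xi>\<^sup>2)))"
    "\<bar>\<xi>\<bar> powr (1/2) * (LBINT v. riesz_weight y v * exp (- (exp v * \<xi>\<^sup>2))) = (y / 2) powr (1/2) * (LBINT w. poisson_weight y w * exp (- (exp w * \<xi>\<^sup>2)))"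
proof -
  define c where "c = y / (2 * \<bar>\<xi>\<bar>)"
  define L where "L = 2 * ln c"
  have c: "c > 0" using y x by (simp add: c_def)
  have eL: "exp L = c\<^sup>2" unfolding L_def mult_2 exp_add power2_eq_square exp_ln[OF c] ..
  have cx: "c\<^sup>2 * \<xi>\<^sup>2 = y\<^sup>2 / 4" using x by (simp add: c_def power_divide power_mult_distrib)
  have e: "riesz_weight y (L + (-1) * w) * exp (- (exp (L + (-1) * w) * \<xi>\<^sup>2)) = c powr (1/2) * (poisson_weight y w * exp (- (exp w * \<xi>\<^sup>2)))" for w
  proof -
    have 1: "exp ((L + (-1) * w) / 4) = c powr (1/2) * exp (- (1/4 * w))"
    proof -
      have "(L + (-1) * w) / 4 = 1/2 * ln c + - (1/4 * w)" by (simp add: L_def)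
      then have "exp ((L + (-1) * w) / 4) = exp (1/2 * ln c) * exp (- (1/4 * w))" by (simp only: exp_add)
      then show ?thesis using c by (simp add: powr_def)
    qed
    have "exp (- (L + (-1) * w)) = exp w / exp L" by (simp add: exp_diff)
    then have "y\<^sup>2 / 4 * exp (- (L + (-1) * w)) = y\<^sup>2 / 4 / c\<^sup>2 * exp w" unfolding eL by simp
    also have "y\<^sup>2 / 4 / c\<^sup>2 = \<xi>\<^sup>2" using cx c by (simp add: field_simps)
    finally have 2: "y\<^sup>2 / 4 * exp (- (L + (-1) * w)) = exp w * \<xi>\<^sup>2" by simp
    have "exp (L + (-1) * w) * \<xi>\<^sup>2 = (c\<^sup>2 * \<xi>\<^sup>2) * exp (- w)" unfolding exp_add eL by simp
    then have 3: "exp (L + (-1) * w) * \<xi>\<^sup>2 = y\<^sup>2 / 4 * exp (- w)" unfolding cx .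
    show ?thesis unfolding riesz_weight_def poisson_weight_def 1 2 3 by simp
  qed
  have i0: "integrable lborel (\<lambda>w. poisson_weight y w * exp (- (exp w * \<xi>\<^sup>2)))"
    by (rule Bochner_Integration.integrable_bound[OF poisson_weight_integrable[OF y]])
       (auto intro!: AE_I2 simp: abs_mult poisson_weight_def mult_left_le)
  show "integrable lborel (\<lambda>v. riesz_weight y v * exp (- (exp v * \<xi>\<^sup>2)))"
    using lborel_integrable_real_affine_iff[of "-1" "\<lambda>v. riesz_weight y v * exp (- (exp v * \<xi>\<^sup>2))" L]
      integrable_mult_right[OF i0, of "c powr (1/2)"] unfolding e by simp
  have "(LBINT v. riesz_weight y v * exp (- (exp v * \<xi>\<^sup>2))) = c powr (1/2) * (LBINT w. poisson_weight y w * exp (- (exp w * \<xi>\<^sup>2)))"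
    using lborel_integral_real_affine[of "-1" "\<lambda>v. riesz_weight y v * exp (- (exp v * \<xi>\<^sup>2))" L] unfolding e by simp
  moreover have "\<bar>\<xi>\<bar> powr (1/2) * c powr (1/2) = (y / 2) powr (1/2)"
  proof -
    have "\<bar>\<xi>\<bar> * c = y / 2" using x by (simp add: c_def)
    then show ?thesis by (simp only: powr_mult[symmetric])
  qed
  ultimately show "\<bar>\<xi>\<bar> powr (1/2) * (LBINT v. riesz_weight y v * exp (- (exp v * \<xi>\<^sup>2))) = (y / 2) powr (1/2) * (LBINT w. poisson_weight y w * exp (- (exp w * \<xi>\<^sup>2)))"
    by (simp add: mult.assoc[symmetric])
qed

definition poisson_weight_const :: real where
  "poisson_weight_const = 2 powr (-1/2) * (4 powr (3/4) * gamma_exp (3/4) / sqrt (4 * pi))"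

text \<open>
  On the Fourier side the integral of \<open>frac_heat\<close> with the first weight has the symbol of
  \<open>riesz_weight_inversion\<close>, which is the symbol of the heat kernel integrated with the second
  weight. So the same weight that turns heat kernels into the boundary kernel turns their
  fractional Laplacians into the Poisson kernel.
\<close>

lemma riesz_weight_frac_heat_integral:
  assumes y: "y > 0"
  shows "integrable lborel (\<lambda>v. riesz_weight y v * frac_heat (exp v) h)"
    "(LBINT v. riesz_weight y v * frac_heat (exp v) h) = poisson_weight_const * (y powr (1/2) * (h\<^sup>2 + y\<^sup>2) powr (-3/4))"
proof -
  define k where "k = (y / 2) powr (1/2)"
  (* Both iterated integrals compute the same cosine transform: f starts from the heat kernels with
     the second weight, g from the fractional heat kernels with the first one. The value at
     frequency zero, where the inversion fails, is a null set. *)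
  define f where "f w \<xi> = cos (h * \<xi>) * (poisson_weight y w * exp (- (exp w * \<xi>\<^sup>2)))" for w \<xi> :: real
  define g where "g \<xi> v = cos (h * \<xi>) * (\<bar>\<xi>\<bar> powr (1/2) * (riesz_weight y v * exp (- (exp v * \<xi>\<^sup>2))))" for \<xi> v :: real
  define B where "B \<xi> = (LBINT w. poisson_weight y w * exp (- (exp w * \<xi>\<^sup>2)))" for \<xi>
  have gi: "(LBINT \<xi>. exp (- (exp w * \<xi>\<^sup>2))) = 2 * pi * heat_kernel (exp w) 0" for w :: real
    using heat_kernel_fourier_inversion(2)[of "exp w" 0] by simp
  have gint: "integrable lborel (\<lambda>\<xi>::real. exp (- (exp w * \<xi>\<^sup>2)))" for w :: real
    by (rule heat_kernel_fourier_inversion(1)) simp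
  have m0: "(\<lambda>(w, \<xi>). poisson_weight y w * exp (- (exp w * \<xi>\<^sup>2))) \<in> borel_measurable (lborel \<Otimes>\<^sub>M lborel)" by measurable
  have Bint: "integrable lborel B"
    unfolding B_def
  proof (rule lborel_swap(2)[OF m0])
    show "AE w in lborel. integrable lborel (\<lambda>\<xi>. poisson_weight y w * exp (- (exp w * \<xi>\<^sup>2)))"
      by (intro AE_I2 integrable_mult_right gint)
    have "(LBINT \<xi>. norm (poisson_weight y w * exp (- (exp w * \<xi>\<^sup>2)))) = 2 * pi * (poisson_weight y w * heat_kernel (exp w) 0)" for w
    proof -
      have "(LBINT \<xi>. norm (poisson_weight y w * exp (- (exp w * \<xi>\<^sup>2)))) = (LBINT \<xi>. poisson_weight y w * exp (- (exp w * \<xi>\<^sup>2)))"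
        by (intro Bochner_Integration.integral_cong) (auto simp: poisson_weight_def abs_mult)
      then show ?thesis by (simp add: gi)
    qed
    then show "integrable lborel (\<lambda>w. LBINT \<xi>. norm (poisson_weight y w * exp (- (exp w * \<xi>\<^sup>2))))"
      using poisson_weight_heat_kernel_integral(1)[OF y, of 0] by simp
  qed
  have fm: "(\<lambda>(w, \<xi>). f w \<xi>) \<in> borel_measurable (lborel \<Otimes>\<^sub>M lborel)" unfolding f_def by measurable
  have fi: "integrable lborel (f w)" for w
    unfolding f_def
    by (rule Bochner_Integration.integrable_bound[OF integrable_mult_right[OF gint, of "poisson_weight y w" w]])
       (auto intro!: AE_I2 simp: abs_mult poisson_weight_def mult_left_le_one_le)
  have fnorm: "integrable lborel (\<lambda>w. LBINT \<xi>. norm (f w \<xi>))"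
  proof (rule Bochner_Integration.integrable_bound)
    show "integrable lborel (\<lambda>w. 2 * pi * (poisson_weight y w * heat_kernel (exp w) 0))"
      using poisson_weight_heat_kernel_integral(1)[OF y, of 0] by simp
    show "(\<lambda>w. LBINT \<xi>. norm (f w \<xi>)) \<in> borel_measurable lborel" unfolding f_def by measurable
    show "AE w in lborel. norm (LBINT \<xi>. norm (f w \<xi>)) \<le> norm (2 * pi * (poisson_weight y w * heat_kernel (exp w) 0))"
    proof (rule AE_I2)
      fix w
      have "(LBINT \<xi>. norm (f w \<xi>)) \<le> (LBINT \<xi>. poisson_weight y w * exp (- (exp w * \<xi>\<^sup>2)))"
        by (intro integral_mono integrable_norm fi integrable_mult_right gint)
           (auto simp: f_def abs_mult poisson_weight_def mult_left_le_one_le)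
      also have "\<dots> = 2 * pi * (poisson_weight y w * heat_kernel (exp w) 0)" by (simp add: gi)
      finally have "(LBINT \<xi>. norm (f w \<xi>)) \<le> 2 * pi * (poisson_weight y w * heat_kernel (exp w) 0)" .
      moreover have "0 \<le> (LBINT \<xi>. norm (f w \<xi>))" by (intro Bochner_Integration.integral_nonneg) auto
      ultimately show "norm (LBINT \<xi>. norm (f w \<xi>)) \<le> norm (2 * pi * (poisson_weight y w * heat_kernel (exp w) 0))" by simp
    qed
  qed
  have fsw: "(LBINT w. LBINT \<xi>. f w \<xi>) = (LBINT \<xi>. LBINT w. f w \<xi>)"
    by (rule lborel_swap(1)[OF fm AE_I2[OF fi] fnorm])
  have gm: "(\<lambda>(\<xi>, v). g \<xi> v) \<in> borel_measurable (lborel \<Otimes>\<^sub>M lborel)" unfolding g_def by measurable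
  have gI: "integrable lborel (g \<xi>)" for \<xi>
  proof (cases "\<xi> = 0")
    case True
    then show ?thesis by (simp add: g_def[abs_def])
  next
    case False
    then show ?thesis unfolding g_def by (intro integrable_mult_right riesz_weight_inversion(1) y)
  qed
  have gval: "(LBINT v. g \<xi> v) = k * (cos (h * \<xi>) * B \<xi>)" "(LBINT v. norm (g \<xi> v)) = k * (\<bar>cos (h * \<xi>)\<bar> * B \<xi>)" if "\<xi> \<noteq> 0" for \<xi>
  proof -
    have "(LBINT v. g \<xi> v) = cos (h * \<xi>) * (\<bar>\<xi>\<bar> powr (1/2) * (LBINT v. riesz_weight y v * exp (- (exp v * \<xi>\<^sup>2))))"
      unfolding g_def integral_mult_right_zero ..
    then show "(LBINT v. g \<xi> v) = k * (cos (h * \<xi>) * B \<xi>)"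
      unfolding riesz_weight_inversion(2)[OF y that] by (simp add: k_def B_def)
    have "norm (g \<xi> v) = \<bar>cos (h * \<xi>)\<bar> * (\<bar>\<xi>\<bar> powr (1/2) * (riesz_weight y v * exp (- (exp v * \<xi>\<^sup>2))))" for v
      by (simp add: g_def abs_mult)
    then have "(LBINT v. norm (g \<xi> v)) = \<bar>cos (h * \<xi>)\<bar> * (\<bar>\<xi>\<bar> powr (1/2) * (LBINT v. riesz_weight y v * exp (- (exp v * \<xi>\<^sup>2))))"
      by (simp only: integral_mult_right_zero)
    then show "(LBINT v. norm (g \<xi> v)) = k * (\<bar>cos (h * \<xi>)\<bar> * B \<xi>)"
      unfolding riesz_weight_inversion(2)[OF y that] by (simp add: k_def B_def)
  qed
  have [measurable]: "B \<in> borel_measurable borel" using borel_measurable_integrable[OF Bint] by simp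
  have B0: "B \<xi> \<ge> 0" for \<xi> unfolding B_def by (intro Bochner_Integration.integral_nonneg) (auto simp: poisson_weight_def)
  have gnorm: "integrable lborel (\<lambda>\<xi>. LBINT v. norm (g \<xi> v))"
  proof (rule Bochner_Integration.integrable_bound[OF integrable_mult_right[OF Bint, of k]])
    show "(\<lambda>\<xi>. LBINT v. norm (g \<xi> v)) \<in> borel_measurable lborel" unfolding g_def by measurable
    show "AE \<xi> in lborel. norm (LBINT v. norm (g \<xi> v)) \<le> norm (k * B \<xi>)"
      using AE_lborel_singleton[of "0::real"]
    proof eventually_elim
      case (elim \<xi>)
      have "\<bar>cos (h * \<xi>)\<bar> * B \<xi> \<le> 1 * B \<xi>" using B0 by (intro mult_right_mono) auto
      then have le: "k * (\<bar>cos (h * \<xi>)\<bar> * B \<xi>) \<le> k * B \<xi>" by (intro mult_left_mono) (auto simp: k_def)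
      have "0 \<le> k * (\<bar>cos (h * \<xi>)\<bar> * B \<xi>)" using B0 by (intro mult_nonneg_nonneg) (auto simp: k_def)
      with le have "norm (k * (\<bar>cos (h * \<xi>)\<bar> * B \<xi>)) \<le> norm (k * B \<xi>)" by (simp only: real_norm_def)
      then show ?case by (simp only: gval(2)[OF elim])
    qed
  qed
  note gsw = lborel_swap[OF gm AE_I2[OF gI] gnorm]
  have ginner: "(LBINT \<xi>. g \<xi> v) = 2 * pi * (riesz_weight y v * frac_heat (exp v) h)" for v
  proof -
    have "(LBINT \<xi>. g \<xi> v) = (LBINT \<xi>. riesz_weight y v * (cos (h * \<xi>) * frac_heat_symbol (exp v) \<xi>))"
      unfolding g_def frac_heat_symbol_def by (simp only: mult_ac)
    then show ?thesis by (simp add: frac_heat_def)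
  qed
  show "integrable lborel (\<lambda>v. riesz_weight y v * frac_heat (exp v) h)"
    using gsw(2) unfolding ginner by simp
  have "2 * pi * (LBINT v. riesz_weight y v * frac_heat (exp v) h) = (LBINT \<xi>. LBINT v. g \<xi> v)"
    using gsw(1) unfolding ginner by simp
  also have "\<dots> = (LBINT \<xi>. k * (cos (h * \<xi>) * B \<xi>))"
  proof (rule integral_cong_AE)
    show "AE \<xi> in lborel. (LBINT v. g \<xi> v) = k * (cos (h * \<xi>) * B \<xi>)"
      using AE_lborel_singleton[of "0::real"] by eventually_elim (rule gval(1))
    show "(\<lambda>\<xi>. LBINT v. g \<xi> v) \<in> borel_measurable lborel" unfolding g_def by measurable
  qed measurable
  also have "\<dots> = k * (LBINT \<xi>. LBINT w. f w \<xi>)"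
    unfolding f_def B_def by simp
  also have "(LBINT \<xi>. LBINT w. f w \<xi>) = (LBINT w. LBINT \<xi>. f w \<xi>)" by (rule fsw[symmetric])
  also have "\<dots> = (LBINT w. 2 * pi * (poisson_weight y w * heat_kernel (exp w) h))"
  proof (intro Bochner_Integration.integral_cong refl)
    fix w :: real
    have "(LBINT \<xi>. f w \<xi>) = (LBINT \<xi>. poisson_weight y w * (cos (h * \<xi>) * exp (- (exp w * \<xi>\<^sup>2))))"
      unfolding f_def by (simp only: mult_ac)
    then show "(LBINT \<xi>. f w \<xi>) = 2 * pi * (poisson_weight y w * heat_kernel (exp w) h)"
      by (simp add: heat_kernel_fourier_inversion(2))
  qed
  also have "\<dots> = 2 * pi * (4 powr (3/4) * gamma_exp (3/4) / sqrt (4 * pi) * (h\<^sup>2 + y\<^sup>2) powr (-3/4))"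
    by (simp only: integral_mult_right_zero poisson_weight_heat_kernel_integral(2)[OF y])
  also have "k = 2 powr (-1/2) * y powr (1/2)"
    using y by (simp add: k_def powr_divide powr_minus field_simps)
  finally have "2 * pi * (LBINT v. riesz_weight y v * frac_heat (exp v) h) = 2 * pi * (poisson_weight_const * (y powr (1/2) * (h\<^sup>2 + y\<^sup>2) powr (-3/4)))"
    by (simp only: poisson_weight_const_def mult_ac times_divide_eq_left times_divide_eq_right)
  then show "(LBINT v. riesz_weight y v * frac_heat (exp v) h) = poisson_weight_const * (y powr (1/2) * (h\<^sup>2 + y\<^sup>2) powr (-3/4))"
    by simp
qed

section \<open>Potential representation of vertical differences\<close>

text \<open>
  The extension as a Borel integral in the variable of \<open>u\<close>.
\<close>

definition poisson_ext :: "(real \<Rightarrow> complex) \<Rightarrow> real \<Rightarrow> real \<Rightarrow> complex" where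
  "poisson_ext u x y = (LBINT t. of_real (poisson_kernel y (x - t)) * u t)"

definition poisson_profile :: "real \<Rightarrow> real \<Rightarrow> real" where
  "poisson_profile y h = y powr (1/2) * (h\<^sup>2 + y\<^sup>2) powr (-3/4)"

lemma poisson_kernel_poisson_profile: "poisson_kernel y h = poisson_const * poisson_profile y h"
  by (simp add: poisson_kernel_def poisson_profile_def)

lemma poisson_kernel_measurable [measurable (raw)]:
  assumes [measurable]: "s \<in> borel_measurable M" "h \<in> borel_measurable M"
  shows "(\<lambda>w. poisson_kernel (s w) (h w)) \<in> borel_measurable M"
  unfolding poisson_kernel_def by measurable

text \<open>
  Fubini for a bounded function tested against a kernel with parameter \<open>v\<close>, when the
  \<open>L\<^sup>1\<close> norms of the kernel are integrable for the weight.
\<close>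

lemma weighted_swap:
  fixes W N :: "real \<Rightarrow> real" and k :: "real \<Rightarrow> real \<Rightarrow> real" and g :: "real \<Rightarrow> complex"
  assumes [measurable]: "W \<in> borel_measurable borel" "(\<lambda>(v, h). k v h) \<in> borel_measurable (borel \<Otimes>\<^sub>M borel)" "g \<in> borel_measurable borel"
    and W: "\<And>v. W v \<ge> 0" and g: "\<And>t. norm (g t) \<le> F" and N: "\<And>v. N v \<ge> 0"
    and k: "\<And>v. (\<integral>\<^sup>+h. ennreal \<bar>k v h\<bar> \<partial>lborel) \<le> ennreal (N v)"
    and WN: "integrable lborel (\<lambda>v. W v * N v)"
  shows "(LBINT v. of_real (W v) * (LBINT t. g t * of_real (k v (t - x)))) = (LBINT t. g t * of_real (LBINT v. W v * k v (t - x)))"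
proof -
  have F0: "F \<ge> 0" using norm_ge_zero g by (rule order_trans)
  define f where "f v t = of_real (W v) * (g t * of_real (k v (t - x)))" for v t
  have km: "k v \<in> borel_measurable borel" for v
    by measurable
  have ks: "(\<integral>\<^sup>+t. ennreal \<bar>k v (t - x)\<bar> \<partial>lborel) \<le> ennreal (N v)" for v
  proof -
    note [measurable] = km
    have "(\<integral>\<^sup>+h. ennreal \<bar>k v h\<bar> \<partial>lborel) = ennreal \<bar>1\<bar> * (\<integral>\<^sup>+t. ennreal \<bar>k v (- x + 1 * t)\<bar> \<partial>lborel)"
      by (rule nn_integral_real_affine) auto
    then show ?thesis using k[of v] by simp
  qed
  have ki: "integrable lborel (\<lambda>t. k v (t - x))" "(LBINT t. \<bar>k v (t - x)\<bar>) \<le> N v" for v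
  proof -
    note [measurable] = km
    show i: "integrable lborel (\<lambda>t. k v (t - x))"
    proof (rule integrableI_bounded)
      show "(\<integral>\<^sup>+t. ennreal (norm (k v (t - x))) \<partial>lborel) < \<infinity>" using ks[of v] by (simp add: le_less_trans)
    qed measurable
    have e: "ennreal (LBINT t. \<bar>k v (t - x)\<bar>) = (\<integral>\<^sup>+t. ennreal \<bar>k v (t - x)\<bar> \<partial>lborel)"
      using i by (intro nn_integral_eq_integral[symmetric]) auto
    from ks[of v, folded e] show "(LBINT t. \<bar>k v (t - x)\<bar>) \<le> N v" by (simp only: ennreal_le_iff[OF N])
  qed
  have nf: "norm (f v t) \<le> W v * F * \<bar>k v (t - x)\<bar>" for v t
  proof -
    have "norm (f v t) = W v * (norm (g t) * \<bar>k v (t - x)\<bar>)" using W[of v] by (simp add: f_def norm_mult)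
    also have "\<dots> \<le> W v * (F * \<bar>k v (t - x)\<bar>)" using W g by (intro mult_left_mono mult_right_mono) auto
    finally show ?thesis by (simp add: mult.assoc)
  qed
  have fm: "(\<lambda>(v, t). f v t) \<in> borel_measurable (lborel \<Otimes>\<^sub>M lborel)" unfolding f_def by measurable
  have fmv: "f v \<in> borel_measurable borel" for v unfolding f_def using km[of v] by measurable
  have fi: "integrable lborel (f v)" for v
  proof (rule Bochner_Integration.integrable_bound)
    show "integrable lborel (\<lambda>t. W v * F * \<bar>k v (t - x)\<bar>)" using ki(1) by (intro integrable_mult_right integrable_abs)
    show "AE t in lborel. norm (f v t) \<le> norm (W v * F * \<bar>k v (t - x)\<bar>)"
      using nf W F0 by (intro AE_I2) (simp add: abs_mult)
  qed (use fmv in simp)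
  have fn: "integrable lborel (\<lambda>v. LBINT t. norm (f v t))"
  proof (rule Bochner_Integration.integrable_bound)
    show "integrable lborel (\<lambda>v. F * (W v * N v))" using WN by simp
    show "(\<lambda>v. LBINT t. norm (f v t)) \<in> borel_measurable lborel"
      unfolding f_def by measurable
    show "AE v in lborel. norm (LBINT t. norm (f v t)) \<le> norm (F * (W v * N v))"
    proof (rule AE_I2)
      fix v
      have "(LBINT t. norm (f v t)) \<le> (LBINT t. W v * F * \<bar>k v (t - x)\<bar>)"
        by (intro integral_mono integrable_norm fi integrable_mult_right integrable_abs ki(1) nf)
      also have "\<dots> = W v * F * (LBINT t. \<bar>k v (t - x)\<bar>)" by (rule integral_mult_right_zero)
      also have "\<dots> \<le> W v * F * N v" using W F0 by (intro mult_left_mono ki(2)) auto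
      finally have "(LBINT t. norm (f v t)) \<le> F * (W v * N v)" by (simp add: mult_ac)
      moreover have "0 \<le> (LBINT t. norm (f v t))" by (intro Bochner_Integration.integral_nonneg) auto
      ultimately show "norm (LBINT t. norm (f v t)) \<le> norm (F * (W v * N v))" by simp
    qed
  qed
  have "(LBINT v. LBINT t. f v t) = (LBINT t. LBINT v. f v t)"
    by (rule lborel_swap(1)[OF fm AE_I2[OF fi] fn])
  moreover have "(LBINT t. f v t) = of_real (W v) * (LBINT t. g t * of_real (k v (t - x)))" for v
    unfolding f_def by (rule integral_mult_right_zero)
  moreover have "(LBINT v. f v t) = g t * of_real (LBINT v. W v * k v (t - x))" for t
  proof -
    have "(LBINT v. f v t) = (LBINT v. g t * of_real (W v * k v (t - x)))"
      unfolding f_def by (intro Bochner_Integration.integral_cong) (auto simp: mult_ac)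
    then show ?thesis by (simp only: integral_mult_right_zero integral_complex_of_real)
  qed
  ultimately show ?thesis by simp
qed

text \<open>
  A single weight \<open>riesz_weight y\<close> grows like \<open>exp (v / 4)\<close> for large times and
  cannot be integrated against the tested equation, since a bounded function has no decay. The
  difference of two heights decays at both ends, also after multiplication by the bound \<open>1
  + exp (- v)\<close> from \<open>frac_heat_L1\<close>.
\<close>

lemma riesz_weight_difference_bound:
  assumes y: "0 < y" "y \<le> Y"
  shows "0 \<le> riesz_weight y v - riesz_weight Y v"
    "(riesz_weight y v - riesz_weight Y v) * (1 + exp (- v)) \<le> (Y\<^sup>2 / 2 + 128 / y ^ 4) * exp (- (1/4 * \<bar>v\<bar>))"
proof -
  have yY: "y\<^sup>2 \<le> Y\<^sup>2" using y by (intro power_mono) auto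
  have mono: "exp (- (Y\<^sup>2 / 4 * exp (- v))) \<le> exp (- (y\<^sup>2 / 4 * exp (- v)))" using yY by simp
  show n: "0 \<le> riesz_weight y v - riesz_weight Y v" unfolding riesz_weight_def using mono by (simp add: mult_left_mono)
  show "(riesz_weight y v - riesz_weight Y v) * (1 + exp (- v)) \<le> (Y\<^sup>2 / 2 + 128 / y ^ 4) * exp (- (1/4 * \<bar>v\<bar>))"
  proof (cases "v \<ge> 0")
    case True
    have "exp (- (y\<^sup>2 / 4 * exp (- v))) - exp (- (Y\<^sup>2 / 4 * exp (- v))) \<le> 1 - (1 - Y\<^sup>2 / 4 * exp (- v))"
      using exp_ge_add_one_self[of "- (Y\<^sup>2 / 4 * exp (- v))"] by (intro diff_mono) auto
    then have "riesz_weight y v - riesz_weight Y v \<le> exp (v / 4) * (Y\<^sup>2 / 4 * exp (- v))"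
      unfolding riesz_weight_def right_diff_distrib[symmetric] by (intro mult_left_mono) auto
    also have "\<dots> = Y\<^sup>2 / 4 * exp (v / 4 - v)" by (simp flip: exp_add)
    also have "\<dots> \<le> Y\<^sup>2 / 4 * exp (- (1/4 * v))" using True by (intro mult_left_mono) auto
    finally have "riesz_weight y v - riesz_weight Y v \<le> Y\<^sup>2 / 4 * exp (- (1/4 * v))" .
    then have "(riesz_weight y v - riesz_weight Y v) * (1 + exp (- v)) \<le> (Y\<^sup>2 / 4 * exp (- (1/4 * v))) * 2"
      using n True by (intro mult_mono) auto
    also have "\<dots> = Y\<^sup>2 / 2 * exp (- (1/4 * v))" by simp
    also have "\<dots> \<le> (Y\<^sup>2 / 2 + 128 / y ^ 4) * exp (- (1/4 * v))" using y by (intro mult_right_mono) auto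
    finally show ?thesis using True by simp
  next
    case False
    (* For small times the Gaussian factor beats every power of exp (- v). *)
    define z where "z = y\<^sup>2 / 4 * exp (- v)"
    have z: "z > 0" using y by (simp add: z_def)
    have "z\<^sup>2 / 4 \<le> exp z" using z by (intro exp_ge_quarter_square) auto
    then have "exp (- z) \<le> 4 / z\<^sup>2" using z by (simp add: exp_minus field_simps)
    also have "4 / z\<^sup>2 = 64 / y ^ 4 * exp (2 * v)"
    proof -
      have z2: "z\<^sup>2 = y ^ 4 / 16 * exp (- (2 * v))"
        by (simp add: z_def power_mult_distrib power_divide flip: power_mult exp_double)
      show ?thesis unfolding z2 by (simp add: exp_minus field_simps)
    qed
    finally have ez: "exp (- z) \<le> 64 / y ^ 4 * exp (2 * v)" .
    have "riesz_weight y v - riesz_weight Y v \<le> exp (v / 4) * exp (- z)" unfolding riesz_weight_def z_def by simp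
    also have "\<dots> \<le> exp (v / 4) * (64 / y ^ 4 * exp (2 * v))" by (intro mult_left_mono ez) auto
    finally have h: "riesz_weight y v - riesz_weight Y v \<le> exp (v / 4) * (64 / y ^ 4 * exp (2 * v))" .
    have "1 + exp (- v) \<le> 2 * exp (- v)" using False by simp
    then have "(riesz_weight y v - riesz_weight Y v) * (1 + exp (- v)) \<le> (exp (v / 4) * (64 / y ^ 4 * exp (2 * v))) * (2 * exp (- v))"
      using n h y by (intro mult_mono) auto
    also have "\<dots> = 128 / y ^ 4 * (exp (v / 4) * exp (2 * v) * exp (- v))" by simp
    also have "exp (v / 4) * exp (2 * v) * exp (- v) = exp (v / 4 + v)" by (simp flip: exp_add)
    also have "128 / y ^ 4 * exp (v / 4 + v) \<le> (Y\<^sup>2 / 2 + 128 / y ^ 4) * exp (1/4 * v)"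
      using y False by (intro mult_mono) auto
    finally show ?thesis using False by simp
  qed
qed

text \<open>
  The constant between the density of the potential and the right hand side of the equation; it
  comes from the normalisation of the Poisson kernel and the constants of the two integrals over
  time.
\<close>

definition neumann_const :: real where
  "neumann_const = poisson_const * (4 powr (1/4) * gamma_exp (1/4) / sqrt (4 * pi)) / poisson_weight_const"

lemma poisson_weight_const_pos: "poisson_weight_const > 0"
  unfolding poisson_weight_const_def using gamma_exp_integrable(2)[of "3/4"] by simp

text \<open>
  The tested equation is integrated over time with the weight \<open>riesz_weight y - riesz_weight Y\<close>. On the
  left the kernel becomes a difference of Poisson kernels, by \<open>riesz_weight_frac_heat_integral\<close>,
  and on the right a difference of boundary kernels, by \<open>riesz_weight_heat_kernel_integral\<close>.
\<close>

lemma vertical_representation: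
  fixes u f0 :: "real \<Rightarrow> complex"
  assumes [measurable]: "u \<in> borel_measurable borel" "f0 \<in> borel_measurable borel"
    and F: "\<And>t. norm (u t) \<le> F" "\<And>t. norm (f0 t) \<le> F"
    and eq: "\<And>x s. s > 0 \<Longrightarrow> (LBINT t. u t * of_real (frac_heat s (t - x))) = (LBINT t. f0 t * of_real (heat_kernel s (t - x)))"
    and y: "0 < y" "y \<le> Y"
  shows "poisson_ext u x y - poisson_ext u x Y = (LBINT t. of_real (riesz_kernel t x y - riesz_kernel t x Y) * (of_real neumann_const * f0 t))"
proof -
  define W where "W v = riesz_weight y v - riesz_weight Y v" for v
  have [measurable]: "W \<in> borel_measurable borel" unfolding W_def by measurable
  have W0: "W v \<ge> 0" for v unfolding W_def by (rule riesz_weight_difference_bound(1)[OF y])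
  have Y: "Y > 0" using y by simp
  have WN: "integrable lborel (\<lambda>v. W v * (1 + exp (- v)))"
  proof (rule Bochner_Integration.integrable_bound)
    show "integrable lborel (\<lambda>v. (Y\<^sup>2 / 2 + 128 / y ^ 4) * exp (- (1/4 * \<bar>v\<bar>)))"
      by (intro integrable_mult_right integrable_exp_neg_abs) auto
    show "AE v in lborel. norm (W v * (1 + exp (- v))) \<le> norm ((Y\<^sup>2 / 2 + 128 / y ^ 4) * exp (- (1/4 * \<bar>v\<bar>)))"
    proof (rule AE_I2)
      fix v
      have "0 \<le> W v * (1 + exp (- v))" using W0 by (intro mult_nonneg_nonneg add_nonneg_nonneg) auto
      moreover have "W v * (1 + exp (- v)) \<le> (Y\<^sup>2 / 2 + 128 / y ^ 4) * exp (- (1/4 * \<bar>v\<bar>))"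
        unfolding W_def by (rule riesz_weight_difference_bound(2)[OF y])
      ultimately show "norm (W v * (1 + exp (- v))) \<le> norm ((Y\<^sup>2 / 2 + 128 / y ^ 4) * exp (- (1/4 * \<bar>v\<bar>)))"
        unfolding real_norm_def by linarith
    qed
  qed measurable
  have frac_heat_L1_const: "frac_heat_L1_const \<ge> 0" unfolding frac_heat_L1_const_def using subordination_const_integrable(2)
    by (intro divide_nonneg_pos mult_nonneg_nonneg Bochner_Integration.integral_nonneg) auto
  have L: "(LBINT v. of_real (W v) * (LBINT t. u t * of_real (frac_heat (exp v) (t - x)))) = (LBINT t. u t * of_real (LBINT v. W v * frac_heat (exp v) (t - x)))"
  proof (rule weighted_swap[where F = F and N = "\<lambda>v. frac_heat_L1_const * (1 + exp (- v))"])
    show "(\<integral>\<^sup>+h. ennreal \<bar>frac_heat (exp v) h\<bar> \<partial>lborel) \<le> ennreal (frac_heat_L1_const * (1 + exp (- v)))" for v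
      using frac_heat_L1[of "exp v"] by (simp add: exp_minus field_simps)
    show "integrable lborel (\<lambda>v. W v * (frac_heat_L1_const * (1 + exp (- v))))"
      using integrable_mult_right[OF WN, of frac_heat_L1_const] by (simp add: mult_ac)
  qed (use F W0 frac_heat_L1_const in \<open>auto intro!: mult_nonneg_nonneg add_nonneg_nonneg\<close>)
  have R: "(LBINT v. of_real (W v) * (LBINT t. f0 t * of_real (heat_kernel (exp v) (t - x)))) = (LBINT t. f0 t * of_real (LBINT v. W v * heat_kernel (exp v) (t - x)))"
  proof (rule weighted_swap[where F = F and N = "\<lambda>v. 1"])
    show "(\<integral>\<^sup>+h. ennreal \<bar>heat_kernel (exp v) h\<bar> \<partial>lborel) \<le> ennreal 1" for v
    proof -
      have "(\<integral>\<^sup>+h. ennreal \<bar>heat_kernel (exp v) h\<bar> \<partial>lborel) = (\<integral>\<^sup>+h. ennreal (heat_kernel (exp v) h) \<partial>lborel)"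
        by (intro nn_integral_cong) (simp add: heat_kernel_def)
      also have "\<dots> = ennreal (LBINT h. heat_kernel (exp v) h)"
        by (rule nn_integral_eq_integral[OF heat_kernel_integral(1)]) (auto simp: heat_kernel_def)
      finally show ?thesis using heat_kernel_integral(2)[of "exp v"] by simp
    qed
    show "integrable lborel (\<lambda>v. W v * 1)"
    proof (rule Bochner_Integration.integrable_bound[OF WN])
      show "AE v in lborel. norm (W v * 1) \<le> norm (W v * (1 + exp (- v)))"
        using W0 by (intro AE_I2) (simp add: abs_mult mult_le_cancel_left1 less_le_not_le)
    qed measurable
  qed (use F W0 in auto)
  have fl: "(LBINT v. W v * frac_heat (exp v) h) = poisson_weight_const * (poisson_profile y h - poisson_profile Y h)" for h
  proof -
    have "(LBINT v. W v * frac_heat (exp v) h) = (LBINT v. riesz_weight y v * frac_heat (exp v) h - riesz_weight Y v * frac_heat (exp v) h)"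
      unfolding W_def left_diff_distrib ..
    then show ?thesis
      using Bochner_Integration.integral_diff[OF riesz_weight_frac_heat_integral(1)[OF y(1)] riesz_weight_frac_heat_integral(1)[OF Y], of h h]
      by (simp add: riesz_weight_frac_heat_integral(2) y Y poisson_profile_def right_diff_distrib)
  qed
  define c2 where "c2 = 4 powr (1/4) * gamma_exp (1/4) / sqrt (4 * pi)"
  have ga: "(LBINT v. W v * heat_kernel (exp v) (t - x)) = c2 * (riesz_kernel t x y - riesz_kernel t x Y)" for t
  proof -
    have "(LBINT v. W v * heat_kernel (exp v) (t - x)) = (LBINT v. riesz_weight y v * heat_kernel (exp v) (t - x) - riesz_weight Y v * heat_kernel (exp v) (t - x))"
      unfolding W_def left_diff_distrib ..
    also have "\<dots> = c2 * ((t - x)\<^sup>2 + y\<^sup>2) powr (-1/4) - c2 * ((t - x)\<^sup>2 + Y\<^sup>2) powr (-1/4)"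
      unfolding Bochner_Integration.integral_diff[OF riesz_weight_heat_kernel_integral(1)[OF y(1)] riesz_weight_heat_kernel_integral(1)[OF Y]]
      unfolding riesz_weight_heat_kernel_integral(2)[OF y(1)] riesz_weight_heat_kernel_integral(2)[OF Y] c2_def ..
    finally show ?thesis by (simp add: riesz_kernel_def power2_commute right_diff_distrib)
  qed
  have main: "(LBINT t. u t * of_real (poisson_weight_const * (poisson_profile y (t - x) - poisson_profile Y (t - x)))) = (LBINT t. f0 t * of_real (c2 * (riesz_kernel t x y - riesz_kernel t x Y)))"
    using L R unfolding fl ga by (simp add: eq)
  have pp: "integrable lborel (\<lambda>t. of_real (poisson_kernel z (x - t)) * u t)" if "z > 0" for z
  proof (rule integrable_mult_bounded[OF _ _ F(1)])
    have "integrable lborel (poisson_kernel z)"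
      using poisson_kernel_normalised(1)[OF that] by (subst (asm) integrable_completion) auto
    then show "integrable lborel (\<lambda>t. poisson_kernel z (x - t))" by (rule lborel_integrable_reflect)
  qed measurable
  have sym: "poisson_profile z (t - x) = poisson_profile z (x - t)" for z t by (simp add: poisson_profile_def power2_commute)
  have "poisson_ext u x y - poisson_ext u x Y = (LBINT t. of_real (poisson_kernel y (x - t)) * u t - of_real (poisson_kernel Y (x - t)) * u t)"
    unfolding poisson_ext_def by (rule Bochner_Integration.integral_diff[symmetric, OF pp[OF y(1)] pp[OF Y]])
  also have "\<dots> = (LBINT t. of_real (poisson_const / poisson_weight_const) * (u t * of_real (poisson_weight_const * (poisson_profile y (t - x) - poisson_profile Y (t - x)))))"
    using poisson_weight_const_pos by (intro Bochner_Integration.integral_cong) (auto simp: poisson_kernel_poisson_profile sym field_simps)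
  also have "\<dots> = of_real (poisson_const / poisson_weight_const) * (LBINT t. f0 t * of_real (c2 * (riesz_kernel t x y - riesz_kernel t x Y)))"
    unfolding integral_mult_right_zero main ..
  also have "\<dots> = (LBINT t. of_real (poisson_const / poisson_weight_const) * (f0 t * of_real (c2 * (riesz_kernel t x y - riesz_kernel t x Y))))"
    by (rule integral_mult_right_zero[symmetric])
  also have "\<dots> = (LBINT t. of_real (riesz_kernel t x y - riesz_kernel t x Y) * (of_real neumann_const * f0 t))"
  proof (intro Bochner_Integration.integral_cong refl)
    fix t
    have ck: "neumann_const = poisson_const / poisson_weight_const * c2" by (simp add: neumann_const_def c2_def)
    show "of_real (poisson_const / poisson_weight_const) * (f0 t * of_real (c2 * (riesz_kernel t x y - riesz_kernel t x Y))) = of_real (riesz_kernel t x y - riesz_kernel t x Y) * (of_real neumann_const * f0 t)"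
      unfolding ck of_real_mult by (simp only: mult_ac)
  qed
  finally show ?thesis .
qed

section \<open>Potential representation of the extension\<close>

lemma poisson_ext_integrable:
  fixes u :: "real \<Rightarrow> complex"
  assumes "u \<in> borel_measurable borel" "\<And>t. norm (u t) \<le> F" "y > 0"
  shows "integrable lborel (\<lambda>t. of_real (poisson_kernel y (x - t)) * u t)"
proof (rule integrable_mult_bounded[OF _ assms(1,2)])
  have "integrable lborel (poisson_kernel y)"
    using poisson_kernel_normalised(1)[OF assms(3)] by (subst (asm) integrable_completion) auto
  then show "integrable lborel (\<lambda>t. poisson_kernel y (x - t))" by (rule lborel_integrable_reflect)
qed

lemma poisson_const_pos: "poisson_const > 0"
proof -
  have "poisson_const \<ge> 0" unfolding poisson_const_def
    by (intro divide_nonneg_nonneg Bochner_Integration.integral_nonneg) auto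
  moreover have "poisson_const \<noteq> 0"
    using poisson_kernel_normalised(2)[of 1] by (auto simp: poisson_kernel_def)
  ultimately show ?thesis by simp
qed

lemma poisson_kernel_nonneg: "poisson_kernel y h \<ge> 0"
  using poisson_const_pos by (simp add: poisson_kernel_def)

lemma poisson_kernel_integral:
  assumes "y > 0"
  shows "integrable lborel (poisson_kernel y)" "(LBINT h. poisson_kernel y h) = 1"
  using poisson_kernel_normalised[OF assms] by (simp_all add: integrable_completion integral_completion)

lemma poisson_ext_bounded:
  fixes u :: "real \<Rightarrow> complex"
  assumes "u \<in> borel_measurable borel" and F: "\<And>t. norm (u t) \<le> F" and y: "y > 0"
  shows "norm (poisson_ext u x y) \<le> F"
proof -
  have "norm (poisson_ext u x y) \<le> (LBINT t. norm (of_real (poisson_kernel y (x - t)) * u t))"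
    unfolding poisson_ext_def by (rule integral_norm_bound)
  also have "\<dots> \<le> (LBINT t. F * poisson_kernel y (x - t))"
  proof (rule integral_mono)
    show "integrable lborel (\<lambda>t. norm (of_real (poisson_kernel y (x - t)) * u t))"
      by (rule integrable_norm[OF poisson_ext_integrable[OF assms]])
    show "integrable lborel (\<lambda>t. F * poisson_kernel y (x - t))"
      by (rule integrable_mult_right[OF lborel_integrable_reflect[OF poisson_kernel_integral(1)[OF y]]])
    show "norm (of_real (poisson_kernel y (x - t)) * u t) \<le> F * poisson_kernel y (x - t)" for t
      using mult_right_mono[OF F[of t] poisson_kernel_nonneg[of y "x - t"]] poisson_kernel_nonneg[of y "x - t"]
      by (simp add: norm_mult mult.commute)
  qed
  also have "\<dots> = F" using lborel_integral_reflect[of "poisson_kernel y" x] poisson_kernel_integral(2)[OF y] by simp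
  finally show ?thesis .
qed

text \<open>
  The extension of a bounded function flattens at infinity. The Poisson profile is the cube of the
  boundary kernel up to a factor, so that \<open>riesz_kernel_horizontal_bound\<close> also controls its
  horizontal differences.
\<close>

lemma poisson_ext_horizontal_limit:
  fixes u :: "real \<Rightarrow> complex"
  assumes [measurable]: "u \<in> borel_measurable borel" and F: "\<And>t. norm (u t) \<le> F"
  shows "(\<lambda>n. poisson_ext u x (real (Suc n)) - poisson_ext u x' (real (Suc n))) \<longlonglongrightarrow> 0"
proof -
  define G where "G t = 2 * \<bar>x - x'\<bar> * sqrt (2 + 2 * (x - x')\<^sup>2) * (((x - t)\<^sup>2 + 1) powr (-3/4) + ((x' - t)\<^sup>2 + 1) powr (-3/4))" for t
  have Gi: "integrable lborel G"
    unfolding G_def by (intro integrable_mult_right Bochner_Integration.integrable_add profile_shift_integrable)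
  have F0: "F \<ge> 0" using norm_ge_zero F by (rule order_trans)
  have G0: "G t \<ge> 0" for t by (simp add: G_def)
  have kb: "\<bar>poisson_kernel Y (x - t) - poisson_kernel Y (x' - t)\<bar> \<le> 3 * poisson_const * Y powr (-1/2) * G t" if Y: "Y \<ge> 1" for Y t
  proof -
    define p where "p v = riesz_kernel t v Y" for v
    have pY: "p v \<le> Y powr (-1/2)" "p v \<ge> 0" for v
    proof -
      have "((v - t)\<^sup>2 + Y\<^sup>2) powr (-1/4) \<le> (Y\<^sup>2) powr (-1/4)" using Y by (intro powr_mono2') auto
      also have "\<dots> = (Y powr 2) powr (-1/4)" using Y by simp
      also have "\<dots> = Y powr (-1/2)" unfolding powr_powr by simp
      finally show "p v \<le> Y powr (-1/2)" by (simp add: p_def riesz_kernel_def)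
    qed (simp add: p_def)
    have p3: "poisson_profile Y (v - t) = Y powr (1/2) * p v ^ 3" for v
    proof -
      have "p v ^ 3 = p v powr 3" using Y by (simp add: p_def riesz_kernel_def add_nonneg_pos)
      also have "\<dots> = ((v - t)\<^sup>2 + Y\<^sup>2) powr (-3/4)" by (simp add: p_def riesz_kernel_def powr_powr)
      finally show ?thesis by (simp add: poisson_profile_def)
    qed
    have "\<bar>p x ^ 3 - p x' ^ 3\<bar> = \<bar>p x - p x'\<bar> * \<bar>p x ^ 2 + p x * p x' + p x' ^ 2\<bar>"
      by (simp add: abs_mult[symmetric] power2_eq_square power3_eq_cube algebra_simps)
    also have "\<dots> \<le> G t * (3 * (Y powr (-1/2) * Y powr (-1/2)))"
    proof (intro mult_mono)
      show "\<bar>p x - p x'\<bar> \<le> G t" unfolding p_def G_def by (rule riesz_kernel_horizontal_bound[OF Y])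
      have "p a * p b \<le> Y powr (-1/2) * Y powr (-1/2)" for a b using pY by (intro mult_mono) auto
      from this[of x x] this[of x x'] this[of x' x'] show "\<bar>p x ^ 2 + p x * p x' + p x' ^ 2\<bar> \<le> 3 * (Y powr (-1/2) * Y powr (-1/2))"
        using pY(2)[of x] pY(2)[of x'] by (simp add: power2_eq_square)
    qed (auto simp: G0)
    finally have "Y powr (1/2) * \<bar>p x ^ 3 - p x' ^ 3\<bar> \<le> Y powr (1/2) * (G t * (3 * (Y powr (-1/2) * Y powr (-1/2))))"
      by (intro mult_left_mono) auto
    also have "\<dots> = 3 * (Y powr (1/2) * Y powr (-1/2)) * Y powr (-1/2) * G t" by (simp only: mult_ac)
    also have "Y powr (1/2) * Y powr (-1/2) = 1" using Y by (simp flip: powr_add)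
    finally have "poisson_const * (Y powr (1/2) * \<bar>p x ^ 3 - p x' ^ 3\<bar>) \<le> poisson_const * (3 * 1 * Y powr (-1/2) * G t)"
      using poisson_const_pos by (intro mult_left_mono) auto
    moreover have "\<bar>poisson_kernel Y (x - t) - poisson_kernel Y (x' - t)\<bar> = poisson_const * (Y powr (1/2) * \<bar>p x ^ 3 - p x' ^ 3\<bar>)"
      unfolding poisson_kernel_poisson_profile p3 using poisson_const_pos by (simp add: right_diff_distrib[symmetric] abs_mult)
    ultimately show ?thesis by simp
  qed
  have b: "norm (poisson_ext u x Y - poisson_ext u x' Y) \<le> 3 * poisson_const * F * (LBINT t. G t) * Y powr (-1/2)" if Y: "Y \<ge> 1" for Y
  proof -
    note i = poisson_ext_integrable[OF assms(1) F, of Y]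
    have "poisson_ext u x Y - poisson_ext u x' Y = (LBINT t. of_real (poisson_kernel Y (x - t)) * u t - of_real (poisson_kernel Y (x' - t)) * u t)"
      unfolding poisson_ext_def using Y by (intro Bochner_Integration.integral_diff[symmetric] i) auto
    also have "norm \<dots> \<le> (LBINT t. norm (of_real (poisson_kernel Y (x - t)) * u t - of_real (poisson_kernel Y (x' - t)) * u t))"
      by (rule integral_norm_bound)
    also have "\<dots> \<le> (LBINT t. 3 * poisson_const * F * Y powr (-1/2) * G t)"
    proof (rule integral_mono)
      show "integrable lborel (\<lambda>t. norm (of_real (poisson_kernel Y (x - t)) * u t - of_real (poisson_kernel Y (x' - t)) * u t))"
        using Y by (intro integrable_norm Bochner_Integration.integrable_diff i) auto
      show "integrable lborel (\<lambda>t. 3 * poisson_const * F * Y powr (-1/2) * G t)" by (rule integrable_mult_right[OF Gi])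
      fix t
      have "norm (of_real (poisson_kernel Y (x - t)) * u t - of_real (poisson_kernel Y (x' - t)) * u t) = \<bar>poisson_kernel Y (x - t) - poisson_kernel Y (x' - t)\<bar> * norm (u t)"
        by (simp add: left_diff_distrib[symmetric] norm_mult flip: of_real_diff)
      also have "\<dots> \<le> (3 * poisson_const * Y powr (-1/2) * G t) * F"
        using kb[OF Y] F poisson_const_pos G0 by (intro mult_mono) auto
      finally show "norm (of_real (poisson_kernel Y (x - t)) * u t - of_real (poisson_kernel Y (x' - t)) * u t) \<le> 3 * poisson_const * F * Y powr (-1/2) * G t"
        by (simp only: mult_ac)
    qed
    finally show ?thesis by (simp add: mult_ac)
  qed
  have "(\<lambda>n. 3 * poisson_const * F * (LBINT t. G t) * real (Suc n) powr (-1/2)) \<longlonglongrightarrow> 3 * poisson_const * F * (LBINT t. G t) * 0"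
    by (intro tendsto_mult tendsto_const tendsto_neg_powr filterlim_compose[OF filterlim_real_sequentially filterlim_Suc]) auto
  then have z: "(\<lambda>n. 3 * poisson_const * F * (LBINT t. G t) * real (Suc n) powr (-1/2)) \<longlonglongrightarrow> 0" by simp
  show ?thesis
    by (rule Lim_null_comparison[OF _ z]) (use b in \<open>auto intro!: always_eventually\<close>)
qed

text \<open>
  Dominated convergence with the majorant of \<open>riesz_kernel_horizontal_bound\<close>.
\<close>

lemma potential_horizontal_limit:
  fixes f :: "real \<Rightarrow> complex"
  assumes [measurable]: "f \<in> borel_measurable borel" and F: "\<And>t. norm (f t) \<le> F"
  shows "(\<lambda>n. LBINT t. of_real (riesz_kernel t x (real (Suc n)) - riesz_kernel t x' (real (Suc n))) * f t) \<longlonglongrightarrow> 0"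
proof -
  define G where "G t = 2 * \<bar>x - x'\<bar> * sqrt (2 + 2 * (x - x')\<^sup>2) * (((x - t)\<^sup>2 + 1) powr (-3/4) + ((x' - t)\<^sup>2 + 1) powr (-3/4))" for t
  have Gi: "integrable lborel G"
    unfolding G_def by (intro integrable_mult_right Bochner_Integration.integrable_add profile_shift_integrable)
  have lim: "(\<lambda>n. riesz_kernel t v (real (Suc n))) \<longlonglongrightarrow> 0" for t v
  proof (rule Lim_null_comparison)
    show "(\<lambda>n. real (Suc n) powr (-1/2)) \<longlonglongrightarrow> 0"
      by (intro tendsto_neg_powr filterlim_compose[OF filterlim_real_sequentially filterlim_Suc]) auto
    show "\<forall>\<^sub>F n in sequentially. norm (riesz_kernel t v (real (Suc n))) \<le> real (Suc n) powr (-1/2)"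
    proof (rule always_eventually, rule allI)
      fix n
      have "((v - t)\<^sup>2 + (real (Suc n))\<^sup>2) powr (-1/4) \<le> ((real (Suc n))\<^sup>2) powr (-1/4)" by (intro powr_mono2') auto
      also have "\<dots> = (real (Suc n) powr 2) powr (-1/4)" by simp
      also have "\<dots> = real (Suc n) powr (-1/2)" unfolding powr_powr by simp
      finally show "norm (riesz_kernel t v (real (Suc n))) \<le> real (Suc n) powr (-1/2)" by (simp add: riesz_kernel_def)
    qed
  qed
  have "(\<lambda>n. LBINT t. of_real (riesz_kernel t x (real (Suc n)) - riesz_kernel t x' (real (Suc n))) * f t) \<longlonglongrightarrow> (LBINT t::real. 0 :: complex)"
  proof (rule integral_dominated_convergence[where w = "\<lambda>t. F * G t"])
    show "integrable lborel (\<lambda>t. F * G t)" by (rule integrable_mult_right[OF Gi])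
    show "AE t in lborel. (\<lambda>n. of_real (riesz_kernel t x (real (Suc n)) - riesz_kernel t x' (real (Suc n))) * f t) \<longlonglongrightarrow> 0"
    proof (rule AE_I2)
      fix t
      have "(\<lambda>n. of_real (riesz_kernel t x (real (Suc n)) - riesz_kernel t x' (real (Suc n))) * f t) \<longlonglongrightarrow> of_real (0 - 0) * f t"
        by (intro tendsto_mult tendsto_of_real tendsto_diff lim tendsto_const)
      then show "(\<lambda>n. of_real (riesz_kernel t x (real (Suc n)) - riesz_kernel t x' (real (Suc n))) * f t) \<longlonglongrightarrow> 0" by simp
    qed
    show "AE t in lborel. norm (of_real (riesz_kernel t x (real (Suc n)) - riesz_kernel t x' (real (Suc n))) * f t) \<le> F * G t" for n
    proof (rule AE_I2)
      fix t
      have "norm (of_real (riesz_kernel t x (real (Suc n)) - riesz_kernel t x' (real (Suc n))) * f t) = \<bar>riesz_kernel t x (real (Suc n)) - riesz_kernel t x' (real (Suc n))\<bar> * norm (f t)"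
        by (simp add: norm_mult flip: of_real_diff)
      also have "\<dots> \<le> G t * F"
        unfolding G_def by (intro mult_mono riesz_kernel_horizontal_bound F) auto
      finally show "norm (of_real (riesz_kernel t x (real (Suc n)) - riesz_kernel t x' (real (Suc n))) * f t) \<le> F * G t" by (simp add: mult.commute)
    qed
  qed measurable
  then show ?thesis by simp
qed

text \<open>
  By \<open>vertical_representation\<close> the defect between the two sides does not change when
  both points are moved up to a common height, and at infinite height it vanishes.
\<close>

lemma full_representation:
  fixes u f0 :: "real \<Rightarrow> complex"
  assumes meas [measurable]: "u \<in> borel_measurable borel" "f0 \<in> borel_measurable borel"
    and F: "\<And>t. norm (u t) \<le> F" "\<And>t. norm (f0 t) \<le> F"
    and eq: "\<And>x s. s > 0 \<Longrightarrow> (LBINT t. u t * of_real (frac_heat s (t - x))) = (LBINT t. f0 t * of_real (heat_kernel s (t - x)))"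
    and y: "0 < y" "0 < y'"
  shows "poisson_ext u x y - poisson_ext u x' y' = (LBINT t. of_real (riesz_kernel t x y - riesz_kernel t x' y') * (of_real neumann_const * f0 t))"
proof -
  define f where "f t = of_real neumann_const * f0 t" for t
  have [measurable]: "f \<in> borel_measurable borel" unfolding f_def by measurable
  have fF: "norm (f t) \<le> \<bar>neumann_const\<bar> * F" for t
    unfolding f_def norm_mult using F(2) by (intro mult_mono) auto
  note pin = potential_integrable[OF \<open>f \<in> borel_measurable borel\<close> fF]
  define D where "D = poisson_ext u x y - poisson_ext u x' y' - (LBINT t. of_real (riesz_kernel t x y - riesz_kernel t x' y') * f t)"
  (* Both points are lifted to the common height Y. *)
  have step: "poisson_ext u x y - poisson_ext u x' y' - (LBINT t. of_real (riesz_kernel t x y - riesz_kernel t x' y') * f t)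
     = poisson_ext u x Y - poisson_ext u x' Y - (LBINT t. of_real (riesz_kernel t x Y - riesz_kernel t x' Y) * f t)" if Y: "Y \<ge> y" "Y \<ge> y'" for Y
  proof -
    have 1: "poisson_ext u x y - poisson_ext u x Y = (LBINT t. of_real (riesz_kernel t x y - riesz_kernel t x Y) * f t)"
      unfolding f_def by (rule vertical_representation[OF meas F eq y(1) Y(1)])
    have 2: "poisson_ext u x' y' - poisson_ext u x' Y = (LBINT t. of_real (riesz_kernel t x' y' - riesz_kernel t x' Y) * f t)"
      unfolding f_def by (rule vertical_representation[OF meas F eq y(2) Y(2)])
    have "(LBINT t. of_real (riesz_kernel t x y - riesz_kernel t x' y') * f t) = (LBINT t. of_real (riesz_kernel t x y - riesz_kernel t x Y) * f t
       - of_real (riesz_kernel t x' y' - riesz_kernel t x' Y) * f t + of_real (riesz_kernel t x Y - riesz_kernel t x' Y) * f t)"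
      by (intro Bochner_Integration.integral_cong) (auto simp: algebra_simps)
    also have "\<dots> = (LBINT t. of_real (riesz_kernel t x y - riesz_kernel t x Y) * f t) - (LBINT t. of_real (riesz_kernel t x' y' - riesz_kernel t x' Y) * f t)
       + (LBINT t. of_real (riesz_kernel t x Y - riesz_kernel t x' Y) * f t)"
      using y Y by (subst Bochner_Integration.integral_add; (subst Bochner_Integration.integral_diff)?)
        (auto intro!: pin Bochner_Integration.integrable_diff simp del: of_real_diff)
    finally show ?thesis unfolding 1[symmetric] 2[symmetric] by simp
  qed
  obtain N :: nat where N: "real N \<ge> y" "real N \<ge> y'" using real_arch_simple[of "max y y'"] by auto
  have "(\<lambda>n. (poisson_ext u x (real (Suc n)) - poisson_ext u x' (real (Suc n))) - (LBINT t. of_real (riesz_kernel t x (real (Suc n)) - riesz_kernel t x' (real (Suc n))) * f t)) \<longlonglongrightarrow> 0 - 0"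
    by (intro tendsto_diff poisson_ext_horizontal_limit[OF meas(1) F(1)] potential_horizontal_limit[OF _ fF]) measurable
  moreover have "\<forall>\<^sub>F n in sequentially. (poisson_ext u x (real (Suc n)) - poisson_ext u x' (real (Suc n))) - (LBINT t. of_real (riesz_kernel t x (real (Suc n)) - riesz_kernel t x' (real (Suc n))) * f t) = D"
    using eventually_ge_at_top[of N]
  proof eventually_elim
    case (elim n)
    then have "real (Suc n) \<ge> y" "real (Suc n) \<ge> y'" using N by (auto intro: order_trans)
    from step[OF this] show ?case by (simp add: D_def)
  qed
  ultimately have "(\<lambda>n::nat. D) \<longlonglongrightarrow> 0 - 0" by (rule Lim_transform_eventually)
  then have "D = 0" by (simp add: LIMSEQ_const_iff)
  then show ?thesis by (simp add: D_def f_def)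
qed

section \<open>Boundary values\<close>

text \<open>
  The densities \<open>F\<close> and \<open>F + D\<close>, cut off to a bounded interval, define
  finite measures that agree on half lines and therefore coincide.
\<close>

lemma AE_zero_if_interval_integrals_zero_real:
  fixes D :: "real \<Rightarrow> real"
  assumes [measurable]: "D \<in> borel_measurable borel" and F: "\<And>x. \<bar>D x\<bar> \<le> F"
    and z: "\<And>a b. a \<le> b \<Longrightarrow> (LBINT x. indicator {a..b} x * D x) = 0"
  shows "AE x in lborel. D x = 0"
proof -
  have F0: "F \<ge> 0" using abs_ge_zero F by (rule order_trans)
  have *: "AE x in lborel. x \<in> {- real n..real n} \<longrightarrow> D x = 0" for n :: nat
  proof -
    let ?I = "{- real n..real n}"
    let ?p = "\<lambda>x. ennreal (indicator ?I x * (F + D x))"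
    let ?q = "\<lambda>x. ennreal (indicator ?I x * F)"
    have FD: "0 \<le> F + D x" for x using F[of x] by linarith
    have FDle: "\<bar>F + D x\<bar> \<le> 2 * F" for x using F[of x] F0 by linarith
    have ii: "integrable lborel (\<lambda>x. indicator {c..real n} x * (F + D x))" "integrable lborel (\<lambda>x. indicator {c..real n} x * F)"
      "integrable lborel (\<lambda>x. indicator {c..real n} x * D x)" for c
    proof -
      show "integrable lborel (\<lambda>x. indicator {c..real n} x * (F + D x))"
        using set_integrable_bounded_Icc[of "\<lambda>x. F + D x" c "real n" "2 * F"] FDle by (simp add: set_integrable_def)
      show "integrable lborel (\<lambda>x. indicator {c..real n} x * F)" 
        using set_integrable_const_Icc[of c "real n" F] by (simp add: set_integrable_def)
      show "integrable lborel (\<lambda>x. indicator {c..real n} x * D x)"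
        using set_integrable_bounded_Icc[of D c "real n" F] F by (auto simp: set_integrable_def)
    qed
    (* Half lines generate the Borel sets, and all measures involved are finite. *)
    have half: "emeasure (density lborel ?p) {x<..} = emeasure (density lborel ?q) {x<..}"
      "emeasure (density lborel ?p) {x<..} < \<infinity>" for x
    proof -
      define c where "c = max x (- real n)"
      have pc: "emeasure (density lborel ?p) {x<..} = ennreal (LBINT v. indicator {c..real n} v * (F + D v))"
      proof -
        have "emeasure (density lborel ?p) {x<..} = (\<integral>\<^sup>+v. ?p v * indicator {x<..} v \<partial>lborel)"
          by (rule emeasure_density) auto
        also have "\<dots> = (\<integral>\<^sup>+v. ennreal (indicator {c..real n} v * (F + D v)) \<partial>lborel)"
          by (rule nn_integral_cong_AE, use AE_lborel_singleton[of x] in eventually_elim) (auto simp: indicator_def c_def)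
        also have "\<dots> = ennreal (LBINT v. indicator {c..real n} v * (F + D v))"
          by (rule nn_integral_eq_integral[OF ii(1)]) (use FD in auto)
        finally show ?thesis .
      qed
      have qc: "emeasure (density lborel ?q) {x<..} = ennreal (LBINT v. indicator {c..real n} v * F)"
      proof -
        have "emeasure (density lborel ?q) {x<..} = (\<integral>\<^sup>+v. ?q v * indicator {x<..} v \<partial>lborel)"
          by (rule emeasure_density) auto
        also have "\<dots> = (\<integral>\<^sup>+v. ennreal (indicator {c..real n} v * F) \<partial>lborel)"
          by (rule nn_integral_cong_AE, use AE_lborel_singleton[of x] in eventually_elim) (auto simp: indicator_def c_def)
        also have "\<dots> = ennreal (LBINT v. indicator {c..real n} v * F)"
          by (rule nn_integral_eq_integral[OF ii(2)]) (use F0 in auto)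
        finally show ?thesis .
      qed
      have "(LBINT v. indicator {c..real n} v * (F + D v)) = (LBINT v. indicator {c..real n} v * F) + (LBINT v. indicator {c..real n} v * D v)"
        unfolding distrib_left by (rule Bochner_Integration.integral_add[OF ii(2,3)])
      moreover have "(LBINT v. indicator {c..real n} v * D v) = 0"
        using z[of c "real n"] by (cases "c \<le> real n") auto
      ultimately show "emeasure (density lborel ?p) {x<..} = emeasure (density lborel ?q) {x<..}" unfolding pc qc by simp
      show "emeasure (density lborel ?p) {x<..} < \<infinity>" unfolding pc by simp
    qed
    have "density lborel ?p = density lborel ?q"
      by (rule measure_eqI_lessThan) (use half in auto)
    then have "AE x in lborel. ?p x = ?q x"
      by (intro sigma_finite_measure.density_unique[OF sigma_finite_lborel]) auto
    then show ?thesis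
    proof eventually_elim
      case (elim x)
      then show ?case using FD[of x] F0 by (auto simp: indicator_def)
    qed
  qed
  then have "AE x in lborel. \<forall>n::nat. x \<in> {- real n..real n} \<longrightarrow> D x = 0" by (subst AE_all_countable) auto
  then show ?thesis
  proof eventually_elim
    case (elim x)
    obtain n :: nat where "\<bar>x\<bar> \<le> real n" using real_arch_simple by blast
    then show ?case using elim by (auto simp: abs_le_iff)
  qed
qed

lemma AE_zero_if_interval_integrals_zero:
  fixes D :: "real \<Rightarrow> complex"
  assumes [measurable]: "D \<in> borel_measurable borel" and F: "\<And>x. norm (D x) \<le> F"
    and z: "\<And>a b. a \<le> b \<Longrightarrow> (LBINT x. indicator {a..b} x *\<^sub>R D x) = 0"
  shows "AE x in lborel. D x = 0"
proof -
  have i: "integrable lborel (\<lambda>x. indicator {a..b} x *\<^sub>R D x)" for a b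
    using set_integrable_bounded_Icc[of D a b F] F by (simp add: set_integrable_def)
  have "AE x in lborel. Re (D x) = 0"
  proof (rule AE_zero_if_interval_integrals_zero_real)
    show "\<bar>Re (D x)\<bar> \<le> F" for x using abs_Re_le_cmod F by (rule order_trans)
    show "(LBINT x. indicator {a..b} x * Re (D x)) = 0" if "a \<le> b" for a b
      using integral_Re[OF i[of a b]] z[OF that] by simp
  qed measurable
  moreover have "AE x in lborel. Im (D x) = 0"
  proof (rule AE_zero_if_interval_integrals_zero_real)
    show "\<bar>Im (D x)\<bar> \<le> F" for x using abs_Im_le_cmod F by (rule order_trans)
    show "(LBINT x. indicator {a..b} x * Im (D x)) = 0" if "a \<le> b" for a b
      using integral_Im[OF i[of a b]] z[OF that] by simp
  qed measurable
  ultimately show ?thesis by eventually_elim (simp add: complex_eq_iff)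
qed

lemma poisson_ext_substituted:
  assumes y: "y > 0"
  shows "poisson_ext u x y = (LBINT s. of_real (poisson_kernel 1 s) * u (x - y * s))"
proof -
  have k: "y * poisson_kernel y (x - (x + (- y) * s)) = poisson_kernel 1 s" for s
  proof -
    have "poisson_profile y (y * s) = y powr (1/2) * ((y powr 2) * (s\<^sup>2 + 1)) powr (-3/4)"
      using y by (simp add: poisson_profile_def power_mult_distrib algebra_simps)
    also have "\<dots> = (y powr (1/2) * y powr (-3/2)) * (s\<^sup>2 + 1) powr (-3/4)"
      by (simp add: powr_mult powr_powr)
    also have "y powr (1/2) * y powr (-3/2) = 1 / y"
    proof -
      have "y powr (1/2) * y powr (-3/2) = y powr (1/2 + -3/2)" by (rule powr_add[symmetric])
      also have "\<dots> = y powr (-1)" by simp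
      also have "\<dots> = 1 / y" using y by (simp only: powr_minus_divide powr_one)
      finally show ?thesis .
    qed
    finally have "y * poisson_profile y (y * s) = poisson_profile 1 s" using y by (simp add: poisson_profile_def)
    then show ?thesis by (simp add: poisson_kernel_poisson_profile)
  qed
  have "poisson_ext u x y = \<bar>- y\<bar> *\<^sub>R (LBINT s. of_real (poisson_kernel y (x - (x + (- y) * s))) * u (x + (- y) * s))"
    unfolding poisson_ext_def using y by (intro lborel_integral_real_affine) auto
  also have "\<dots> = (LBINT s. \<bar>- y\<bar> *\<^sub>R (of_real (poisson_kernel y (x - (x + (- y) * s))) * u (x + (- y) * s)))"
    by (rule integral_scaleR_right[symmetric])
  also have "\<dots> = (LBINT s. of_real (y * poisson_kernel y (x - (x + (- y) * s))) * u (x + (- y) * s))"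
    using y by (simp add: scaleR_conv_of_real mult.assoc)
  finally show ?thesis unfolding k by simp
qed

text \<open>
  Weak convergence to the boundary values. The translations in the Poisson integral are moved from
  \<open>u\<close> to the indicator function of the interval, where continuity is obvious;
  pointwise convergence of the extension is thus avoided.
\<close>

lemma poisson_ext_interval_limit:
  fixes u :: "real \<Rightarrow> complex"
  assumes [measurable]: "u \<in> borel_measurable borel" and F: "\<And>t. norm (u t) \<le> F" and ab: "a \<le> b"
    and Y: "\<And>n. 0 < Y n" "\<And>n. Y n \<le> 1" "Y \<longlonglongrightarrow> 0"
  shows "(\<lambda>n. LBINT x. indicator {a..b} x *\<^sub>R poisson_ext u x (Y n)) \<longlonglongrightarrow> (LBINT x. indicator {a..b} x *\<^sub>R u x)"
proof -
  have F0: "F \<ge> 0" using norm_ge_zero F by (rule order_trans)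
  note k = poisson_kernel_integral[of 1, simplified]
  define \<Phi> where "\<Phi> n s = (LBINT x. indicator {a..b} (x + Y n * s) *\<^sub>R u x)" for n s
  have ind_int: "integrable lborel (\<lambda>x. F * indicator {c..d} x)" for c d :: real by (rule integrable_const_Icc)
  have swap: "(LBINT x. indicator {a..b} x *\<^sub>R poisson_ext u x (Y n)) = (LBINT s. of_real (poisson_kernel 1 s) * \<Phi> n s)" for n
  proof -
    define f where "f x s = indicator {a..b} x *\<^sub>R (of_real (poisson_kernel 1 s) * u (x - Y n * s))" for x s
    have nf: "norm (f x s) \<le> indicator {a..b} x * F * poisson_kernel 1 s" for x s
      using mult_left_mono[OF F, of "poisson_kernel 1 s"] poisson_kernel_nonneg[of 1 s]
      by (auto simp: f_def norm_mult indicator_def mult.commute)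
    have fm: "(\<lambda>(x, s). f x s) \<in> borel_measurable (lborel \<Otimes>\<^sub>M lborel)" unfolding f_def by measurable
    have fi: "integrable lborel (f x)" for x
    proof (rule Bochner_Integration.integrable_bound[OF integrable_mult_right[OF k(1), of "indicator {a..b} x * F"]])
      show "AE s in lborel. norm (f x s) \<le> norm (indicator {a..b} x * F * poisson_kernel 1 s)"
        using nf F0 poisson_kernel_nonneg by (intro AE_I2) (simp add: abs_mult)
      show "f x \<in> borel_measurable lborel" unfolding f_def by measurable
    qed
    have fn: "integrable lborel (\<lambda>x. LBINT s. norm (f x s))"
    proof (rule Bochner_Integration.integrable_bound[OF ind_int[of a b]])
      show "(\<lambda>x. LBINT s. norm (f x s)) \<in> borel_measurable lborel" unfolding f_def by measurable
      show "AE x in lborel. norm (LBINT s. norm (f x s)) \<le> norm (F * indicator {a..b} x)"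
      proof (rule AE_I2)
        fix x
        have "(LBINT s. norm (f x s)) \<le> (LBINT s. indicator {a..b} x * F * poisson_kernel 1 s)"
          by (intro integral_mono integrable_norm fi integrable_mult_right k nf)
        also have "\<dots> = F * indicator {a..b} x" using k(2) by simp
        finally have "(LBINT s. norm (f x s)) \<le> F * indicator {a..b} x" .
        moreover have "0 \<le> (LBINT s. norm (f x s))" by (intro Bochner_Integration.integral_nonneg) auto
        ultimately show "norm (LBINT s. norm (f x s)) \<le> norm (F * indicator {a..b} x)" by simp
      qed
    qed
    have "(LBINT x. indicator {a..b} x *\<^sub>R poisson_ext u x (Y n)) = (LBINT x. LBINT s. f x s)"
      unfolding poisson_ext_substituted[OF Y(1)] f_def by simp
    also have "\<dots> = (LBINT s. LBINT x. f x s)" by (rule lborel_swap(1)[OF fm AE_I2[OF fi] fn])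
    also have "\<dots> = (LBINT s. of_real (poisson_kernel 1 s) * \<Phi> n s)"
    proof (intro Bochner_Integration.integral_cong refl)
      fix s
      have "(LBINT x. f x s) = (LBINT x. of_real (poisson_kernel 1 s) * (indicator {a..b} x *\<^sub>R u (x - Y n * s)))"
        unfolding f_def by (intro Bochner_Integration.integral_cong) auto
      also have "\<dots> = of_real (poisson_kernel 1 s) * (LBINT x. indicator {a..b} x *\<^sub>R u (x - Y n * s))"
        by (rule integral_mult_right_zero)
      also have "(LBINT x. indicator {a..b} x *\<^sub>R u (x - Y n * s)) = \<Phi> n s"
        unfolding \<Phi>_def
        using lborel_integral_real_affine[of 1 "\<lambda>x. indicator {a..b} x *\<^sub>R u (x - Y n * s)" "Y n * s"] by (simp add: add.commute)
      finally show "(LBINT x. f x s) = of_real (poisson_kernel 1 s) * \<Phi> n s" .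
    qed
    finally show ?thesis .
  qed
  have \<Phi>m [measurable]: "\<Phi> n \<in> borel_measurable borel" for n unfolding \<Phi>_def by measurable
  have \<Phi>b: "norm (\<Phi> n s) \<le> F * (b - a)" for n s
  proof -
    have e: "indicator {a..b} (x + Y n * s) = (indicator {a - Y n * s..b - Y n * s} x :: real)" for x
      by (auto simp: indicator_def)
    have "norm (\<Phi> n s) \<le> (LBINT x. norm (indicator {a..b} (x + Y n * s) *\<^sub>R u x))" unfolding \<Phi>_def by (rule integral_norm_bound)
    also have "\<dots> \<le> (LBINT x. F * indicator {a - Y n * s..b - Y n * s} x)"
    proof (rule integral_mono)
      show "integrable lborel (\<lambda>x. norm (indicator {a..b} (x + Y n * s) *\<^sub>R u x))"
        unfolding e using set_integrable_bounded_Icc[of u "a - Y n * s" "b - Y n * s" F] F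
        by (intro integrable_norm) (simp add: set_integrable_def)
    qed (use F ind_int in \<open>auto simp: e indicator_def\<close>)
    also have "\<dots> = F * (b - a)" using ab by simp
    finally show ?thesis .
  qed
  (* The shifted indicator functions converge except at the two end points. *)
  have \<Phi>lim: "(\<lambda>n. \<Phi> n s) \<longlonglongrightarrow> (LBINT x. indicator {a..b} x *\<^sub>R u x)" for s
    unfolding \<Phi>_def
  proof (rule integral_dominated_convergence[where w = "\<lambda>x. F * indicator {a - \<bar>s\<bar>..b + \<bar>s\<bar>} x"])
    show "integrable lborel (\<lambda>x. F * indicator {a - \<bar>s\<bar>..b + \<bar>s\<bar>} x)" by (rule ind_int)
    show "AE x in lborel. (\<lambda>n. indicator {a..b} (x + Y n * s) *\<^sub>R u x) \<longlonglongrightarrow> indicator {a..b} x *\<^sub>R u x"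
      using AE_lborel_singleton[of a] AE_lborel_singleton[of b]
    proof eventually_elim
      case (elim x)
      have lim: "(\<lambda>n. x + Y n * s) \<longlonglongrightarrow> x"
      proof -
        have "(\<lambda>n. x + Y n * s) \<longlonglongrightarrow> x + 0 * s" by (intro tendsto_intros Y)
        then show ?thesis by simp
      qed
      have "\<forall>\<^sub>F n in sequentially. indicator {a..b} (x + Y n * s) *\<^sub>R u x = indicator {a..b} x *\<^sub>R u x"
      proof -
        consider "x < a" | "x > b" | "a < x" "x < b" using elim by linarith
        then show ?thesis
        proof cases
          case 1
          show ?thesis using order_tendstoD(2)[OF lim 1] by eventually_elim (use 1 in auto)
        next
          case 2
          show ?thesis using order_tendstoD(1)[OF lim 2] by eventually_elim (use 2 in auto)
        next
          case 3
          show ?thesis using order_tendstoD(1)[OF lim 3(1)] order_tendstoD(2)[OF lim 3(2)]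
            by eventually_elim (use 3 in auto)
        qed
      qed
      then show ?case by (rule tendsto_eventually)
    qed
    show "AE x in lborel. norm (indicator {a..b} (x + Y n * s) *\<^sub>R u x) \<le> F * indicator {a - \<bar>s\<bar>..b + \<bar>s\<bar>} x" for n
    proof (rule AE_I2)
      fix x
      have "\<bar>Y n * s\<bar> \<le> 1 * \<bar>s\<bar>" unfolding abs_mult using Y(1,2)[of n] by (intro mult_right_mono) auto
      then have "x \<in> {a - \<bar>s\<bar>..b + \<bar>s\<bar>}" if "x + Y n * s \<in> {a..b}" using that by auto
      then show "norm (indicator {a..b} (x + Y n * s) *\<^sub>R u x) \<le> F * indicator {a - \<bar>s\<bar>..b + \<bar>s\<bar>} x"
        using F[of x] F0 by (cases "x + Y n * s \<in> {a..b}") auto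
    qed
  qed measurable
  define L where "L = (LBINT x. indicator {a..b} x *\<^sub>R u x)"
  have "(\<lambda>n. LBINT s. of_real (poisson_kernel 1 s) * \<Phi> n s) \<longlonglongrightarrow> (LBINT s. of_real (poisson_kernel 1 s) * L)"
  proof (rule integral_dominated_convergence[where w = "\<lambda>s. F * (b - a) * poisson_kernel 1 s"])
    show "integrable lborel (\<lambda>s. F * (b - a) * poisson_kernel 1 s)" by (rule integrable_mult_right[OF k(1)])
    show "AE s in lborel. (\<lambda>n. of_real (poisson_kernel 1 s) * \<Phi> n s) \<longlonglongrightarrow> of_real (poisson_kernel 1 s) * L"
      by (intro AE_I2 tendsto_mult tendsto_const) (use \<Phi>lim in \<open>simp add: L_def\<close>)
    show "AE s in lborel. norm (of_real (poisson_kernel 1 s) * \<Phi> n s) \<le> F * (b - a) * poisson_kernel 1 s" for n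
      using mult_left_mono[OF \<Phi>b poisson_kernel_nonneg] poisson_kernel_nonneg
      by (intro AE_I2) (simp add: norm_mult mult.commute)
  qed measurable
  also have "(LBINT s. of_real (poisson_kernel 1 s) * L) = L"
    using k by (simp add: integral_complex_of_real)
  finally show ?thesis unfolding swap L_def .
qed

text \<open>
  The kernel increases as the height decreases, so the difference with height zero is an
  integrable majorant.
\<close>

lemma potential_boundary_limit:
  fixes f :: "real \<Rightarrow> complex"
  assumes [measurable]: "f \<in> borel_measurable borel" and F: "\<And>t. norm (f t) \<le> F"
    and Y: "\<And>n. 0 < Y n" "\<And>n. Y n \<le> 1" "Y \<longlonglongrightarrow> 0"
  shows "(\<lambda>n. potential c f x (Y n)) \<longlonglongrightarrow> potential c f x 0"
  unfolding potential_def
proof (intro tendsto_add tendsto_const integral_dominated_convergence)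
  define w where "w t = F * (\<bar>riesz_kernel t x 0 - riesz_kernel t x 1\<bar> + \<bar>riesz_kernel t x 1 - riesz_kernel t 0 1\<bar>)" for t
  have F0: "F \<ge> 0" using norm_ge_zero F by (rule order_trans)
  show "integrable lborel w" unfolding w_def
    by (intro integrable_mult_right Bochner_Integration.integrable_add integrable_abs riesz_kernel_diff_integrable) auto
  show "AE t in lborel. (\<lambda>n. of_real (riesz_kernel t x (Y n) - riesz_kernel t 0 1) * f t) \<longlonglongrightarrow> of_real (riesz_kernel t x 0 - riesz_kernel t 0 1) * f t"
    using AE_lborel_singleton[of x]
  proof eventually_elim
    case (elim t)
    have "(\<lambda>n. ((x - t)\<^sup>2 + (Y n)\<^sup>2) powr (-1/4)) \<longlonglongrightarrow> ((x - t)\<^sup>2 + 0\<^sup>2) powr (-1/4)"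
      using elim by (intro tendsto_powr tendsto_add tendsto_const tendsto_power Y) auto
    then have "(\<lambda>n. riesz_kernel t x (Y n)) \<longlonglongrightarrow> riesz_kernel t x 0" by (simp add: riesz_kernel_def)
    then show ?case by (intro tendsto_mult tendsto_of_real tendsto_diff tendsto_const)
  qed
  show "AE t in lborel. norm (of_real (riesz_kernel t x (Y n) - riesz_kernel t 0 1) * f t) \<le> w t" for n
    using AE_lborel_singleton[of x]
  proof eventually_elim
    case (elim t)
    have "riesz_kernel t x (Y n) \<le> riesz_kernel t x 0" "riesz_kernel t x 1 \<le> riesz_kernel t x (Y n)"
      using elim Y(1,2)[of n] by (auto intro!: riesz_kernel_antimono)
    then have "\<bar>riesz_kernel t x (Y n) - riesz_kernel t 0 1\<bar> \<le> \<bar>riesz_kernel t x 0 - riesz_kernel t x 1\<bar> + \<bar>riesz_kernel t x 1 - riesz_kernel t 0 1\<bar>" by linarith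
    then have "\<bar>riesz_kernel t x (Y n) - riesz_kernel t 0 1\<bar> * norm (f t) \<le> (\<bar>riesz_kernel t x 0 - riesz_kernel t x 1\<bar> + \<bar>riesz_kernel t x 1 - riesz_kernel t 0 1\<bar>) * F"
      using F[of t] by (intro mult_mono) auto
    then show ?case by (simp add: w_def norm_mult mult.commute flip: of_real_diff)
  qed
qed measurable

text \<open>
  The extension converges weakly to \<open>u\<close> and, being a potential, pointwise to the
  potential at height zero.
\<close>

lemma boundary_trace:
  fixes u f0 :: "real \<Rightarrow> complex"
  assumes meas [measurable]: "u \<in> borel_measurable borel" "f0 \<in> borel_measurable borel"
    and F: "\<And>t. norm (u t) \<le> F" "\<And>t. norm (f0 t) \<le> F"
    and eq: "\<And>x s. s > 0 \<Longrightarrow> (LBINT t. u t * of_real (frac_heat s (t - x))) = (LBINT t. f0 t * of_real (heat_kernel s (t - x)))"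
  defines "f \<equiv> \<lambda>t. of_real neumann_const * f0 t" and "c \<equiv> poisson_ext u 0 1"
  shows "\<And>x y. y > 0 \<Longrightarrow> poisson_ext u x y = potential c f x y" and "AE x in lborel. u x = potential c f x 0"
proof -
  have [measurable]: "f \<in> borel_measurable borel" unfolding f_def by measurable
  have fF: "norm (f t) \<le> \<bar>neumann_const\<bar> * F" for t
    unfolding f_def norm_mult using F(2) by (intro mult_mono) auto
  have F0: "F \<ge> 0" using norm_ge_zero F(1) by (rule order_trans)
  show pp: "poisson_ext u x y = potential c f x y" if y: "y > 0" for x y
  proof -
    have "poisson_ext u x y - poisson_ext u 0 1 = (LBINT t. of_real (riesz_kernel t x y - riesz_kernel t 0 1) * f t)"
      unfolding f_def by (rule full_representation[OF meas F eq y]) auto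
    then show ?thesis by (simp add: potential_def c_def algebra_simps)
  qed
  define Y where "Y n = 1 / real (Suc n)" for n
  have Y: "0 < Y n" "Y n \<le> 1" "Y \<longlonglongrightarrow> 0" for n
    using LIMSEQ_inverse_real_of_nat by (auto simp: Y_def[abs_def] inverse_eq_divide)
  have lim: "(\<lambda>n. poisson_ext u x (Y n)) \<longlonglongrightarrow> potential c f x 0" for x
    unfolding pp[OF Y(1)] by (rule potential_boundary_limit[OF _ fF Y]) measurable
  have pF: "norm (potential c f x 0) \<le> F" for x
    by (rule Lim_norm_ubound[OF _ lim]) (auto intro!: always_eventually poisson_ext_bounded[OF meas(1) F(1)] Y)
  have "AE x in lborel. u x - potential c f x 0 = 0"
  proof (rule AE_zero_if_interval_integrals_zero)
    show "norm (u x - potential c f x 0) \<le> F + F" for x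
      using F(1)[of x] pF[of x] by (intro order_trans[OF norm_triangle_ineq4] add_mono)
    fix a b :: real assume ab: "a \<le> b"
    have 1: "(\<lambda>n. LBINT x. indicator {a..b} x *\<^sub>R poisson_ext u x (Y n)) \<longlonglongrightarrow> (LBINT x. indicator {a..b} x *\<^sub>R u x)"
      by (rule poisson_ext_interval_limit[OF meas(1) F(1) ab Y])
    have "(\<lambda>n. LBINT x. indicator {a..b} x *\<^sub>R poisson_ext u x (Y n)) \<longlonglongrightarrow> (LBINT x. indicator {a..b} x *\<^sub>R potential c f x 0)"
    proof (rule integral_dominated_convergence[where w = "\<lambda>x. F * indicator {a..b} x"])
      show "integrable lborel (\<lambda>x. F * indicator {a..b} x)" by (rule integrable_const_Icc)
      show "(\<lambda>x. indicator {a..b} x *\<^sub>R poisson_ext u x (Y n)) \<in> borel_measurable lborel" for n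
        unfolding poisson_ext_def by measurable
      show "AE x in lborel. (\<lambda>n. indicator {a..b} x *\<^sub>R poisson_ext u x (Y n)) \<longlonglongrightarrow> indicator {a..b} x *\<^sub>R potential c f x 0"
        by (intro AE_I2 tendsto_scaleR tendsto_const lim)
      show "AE x in lborel. norm (indicator {a..b} x *\<^sub>R poisson_ext u x (Y n)) \<le> F * indicator {a..b} x" for n
        using poisson_ext_bounded[OF meas(1) F(1) Y(1)] by (intro AE_I2) (auto simp: indicator_def)
    qed measurable
    then have e: "(LBINT x. indicator {a..b} x *\<^sub>R u x) = (LBINT x. indicator {a..b} x *\<^sub>R potential c f x 0)"
      by (rule LIMSEQ_unique[OF 1])
    have i: "integrable lborel (\<lambda>x. indicator {a..b} x *\<^sub>R u x)" "integrable lborel (\<lambda>x. indicator {a..b} x *\<^sub>R potential c f x 0)"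
      using set_integrable_bounded_Icc[of u a b F] set_integrable_bounded_Icc[of "\<lambda>x. potential c f x 0" a b F] F(1) pF
      by (auto simp: set_integrable_def)
    show "(LBINT x. indicator {a..b} x *\<^sub>R (u x - potential c f x 0)) = 0"
      unfolding scaleR_diff_right Bochner_Integration.integral_diff[OF i] e by simp
  qed measurable
  then show "AE x in lborel. u x = potential c f x 0" by eventually_elim simp
qed

section \<open>Scaling and representatives\<close>

text \<open>
  The kernel is homogeneous of degree \<open>-1/2\<close>, so potentials are preserved by
  dilations. The factor \<open>sqrt R\<close> that the density acquires produces the factor
  \<open>\<rho>\<^sup>2\<close> in the exponent of the main estimate.
\<close>

lemma potential_scale:
  fixes f :: "real \<Rightarrow> complex"
  assumes [measurable]: "f \<in> borel_measurable borel" and F: "\<And>t. norm (f t) \<le> F" and R: "R > 0" and y: "y \<ge> 0"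
  shows "potential (potential c f 0 R) (\<lambda>t. of_real (sqrt R) * f (R * t)) x y = potential c f (R * x) (R * y)"
proof -
  note pin = potential_integrable[OF assms(1) F]
  have e: "of_real (riesz_kernel (0 + R * s) (R * x) (R * y) - riesz_kernel (0 + R * s) 0 R) * f (0 + R * s)
     = of_real (R powr (-1/2)) * (of_real (riesz_kernel s x y - riesz_kernel s 0 1) * f (R * s))" for s
  proof -
    have a: "riesz_kernel (0 + R * s) (R * x) (R * y) = R powr (-1/2) * riesz_kernel s x y" using riesz_kernel_scale[OF R, of s x y] by simp
    have b: "riesz_kernel (0 + R * s) 0 R = R powr (-1/2) * riesz_kernel s 0 1" using riesz_kernel_scale[OF R, of s 0 1] by simp
    show ?thesis unfolding a b by (simp only: right_diff_distrib[symmetric] of_real_mult mult.assoc add_0)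
  qed
  have "(LBINT t. of_real (riesz_kernel t (R * x) (R * y) - riesz_kernel t 0 R) * f t) = R *\<^sub>R (LBINT s. of_real (R powr (-1/2)) * (of_real (riesz_kernel s x y - riesz_kernel s 0 1) * f (R * s)))"
    using lborel_integral_real_affine[of R "\<lambda>t. of_real (riesz_kernel t (R * x) (R * y) - riesz_kernel t 0 R) * f t" 0] R unfolding e by simp
  also have "\<dots> = (LBINT s. of_real (riesz_kernel s x y - riesz_kernel s 0 1) * (of_real (sqrt R) * f (R * s)))"
  proof -
    have "R * R powr (-1/2) = R powr (1 + -1/2)" using R by (simp only: powr_add powr_one)
    then have "sqrt R = R * R powr (-1/2)" using R by (simp add: powr_half_sqrt)
    then have "(LBINT s. of_real (riesz_kernel s x y - riesz_kernel s 0 1) * (of_real (sqrt R) * f (R * s))) = (LBINT s. of_real (R * R powr (-1/2)) * (of_real (riesz_kernel s x y - riesz_kernel s 0 1) * f (R * s)))"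
      by (simp only: mult_ac)
    also have "\<dots> = of_real (R * R powr (-1/2)) * (LBINT s. of_real (riesz_kernel s x y - riesz_kernel s 0 1) * f (R * s))"
      by (rule integral_mult_right_zero)
    finally show ?thesis by (simp only: integral_mult_right_zero scaleR_conv_of_real of_real_mult mult.assoc)
  qed
  finally have S: "(LBINT t. of_real (riesz_kernel t (R * x) (R * y) - riesz_kernel t 0 R) * f t) = (LBINT s. of_real (riesz_kernel s x y - riesz_kernel s 0 1) * (of_real (sqrt R) * f (R * s)))" .
  have "(LBINT t. of_real (riesz_kernel t (R * x) (R * y) - riesz_kernel t 0 1) * f t) = (LBINT t. of_real (riesz_kernel t (R * x) (R * y) - riesz_kernel t 0 R) * f t + of_real (riesz_kernel t 0 R - riesz_kernel t 0 1) * f t)"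
    by (intro Bochner_Integration.integral_cong) (auto simp: algebra_simps)
  also have "\<dots> = (LBINT t. of_real (riesz_kernel t (R * x) (R * y) - riesz_kernel t 0 R) * f t) + (LBINT t. of_real (riesz_kernel t 0 R - riesz_kernel t 0 1) * f t)"
    using R y by (intro Bochner_Integration.integral_add pin) auto
  finally show ?thesis unfolding potential_def S by simp
qed

text \<open>
  Changing \<open>u\<close> on a null set makes it Borel measurable and bounded everywhere; no
  integral below notices the change.
\<close>

lemma borel_bounded_representative:
  fixes u :: "real \<Rightarrow> complex"
  assumes "in_Linf u"
  obtains u' F where "u' \<in> borel_measurable borel" "\<And>t. norm (u' t) \<le> F" "AE t in lborel. u t = u' t"
proof -
  have m: "u \<in> borel_measurable (completion lborel)" using assms by (simp add: in_Linf_def)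
  have "(\<lambda>t. Re (u t)) \<in> borel_measurable (completion lborel)" "(\<lambda>t. Im (u t)) \<in> borel_measurable (completion lborel)"
    using m by measurable
  then obtain r i where r [measurable]: "r \<in> borel_measurable lborel" "AE t in lborel. Re (u t) = r t"
    and i [measurable]: "i \<in> borel_measurable lborel" "AE t in lborel. Im (u t) = i t"
    using completion_ex_borel_measurable_real[of "\<lambda>t. Re (u t)" lborel] completion_ex_borel_measurable_real[of "\<lambda>t. Im (u t)" lborel] by auto
  define e where "e = esssup lebesgue (\<lambda>t. ereal (norm (u t)))"
  have e: "e < \<infinity>" using assms by (simp add: in_Linf_def e_def)
  define F where "F = max 0 (real_of_ereal e)"
  have "AE t in lebesgue. ereal (norm (u t)) \<le> e" unfolding e_def by (rule esssup_AE)
  then have "AE t in lborel. ereal (norm (u t)) \<le> e" by (simp only: AE_completion_iff)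
  then have bF: "AE t in lborel. norm (u t) \<le> F"
  proof eventually_elim
    case (elim t)
    then show ?case using e by (cases e) (auto simp: F_def)
  qed
  define u' where "u' t = (if norm (Complex (r t) (i t)) \<le> F then Complex (r t) (i t) else 0)" for t
  show ?thesis
  proof (rule that[of u' F])
    have "(\<lambda>t. Complex (r t) (i t)) = (\<lambda>t. of_real (r t) + \<i> * of_real (i t))" by (simp add: complex_eq_iff fun_eq_iff)
    then have [measurable]: "(\<lambda>t. Complex (r t) (i t)) \<in> borel_measurable borel" by simp
    show "u' \<in> borel_measurable borel" unfolding u'_def[abs_def] by measurable
    show "norm (u' t) \<le> F" for t by (auto simp: u'_def F_def)
    show "AE t in lborel. u t = u' t" using r(2) i(2) bF
    proof eventually_elim
      case (elim t)
      then have "u t = Complex (r t) (i t)" by (simp add: complex_eq_iff)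
      with elim(3) show ?case by (simp add: u'_def)
    qed
  qed
qed

lemma borel_bounded_representative_real:
  fixes V :: "real \<Rightarrow> real"
  assumes "in_Linf V"
  obtains V' F where "V' \<in> borel_measurable borel" "\<And>t. \<bar>V' t\<bar> \<le> F" "AE t in lborel. V t = V' t"
proof -
  have m: "V \<in> borel_measurable (completion lborel)" using assms by (simp add: in_Linf_def)
  then obtain r where r [measurable]: "r \<in> borel_measurable lborel" "AE t in lborel. V t = r t"
    using completion_ex_borel_measurable_real[of V lborel] by auto
  define e where "e = esssup lebesgue (\<lambda>t. ereal (norm (V t)))"
  have e: "e < \<infinity>" using assms by (simp add: in_Linf_def e_def)
  define F where "F = max 0 (real_of_ereal e)"
  have "AE t in lebesgue. ereal (norm (V t)) \<le> e" unfolding e_def by (rule esssup_AE)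
  then have "AE t in lborel. ereal (norm (V t)) \<le> e" by (simp only: AE_completion_iff)
  then have bF: "AE t in lborel. norm (V t) \<le> F"
  proof eventually_elim
    case (elim t)
    then show ?case using e by (cases e) (auto simp: F_def)
  qed
  define V' where "V' t = (if \<bar>r t\<bar> \<le> F then r t else 0)" for t
  show ?thesis
  proof (rule that[of V' F])
    show "V' \<in> borel_measurable borel" unfolding V'_def[abs_def] by measurable
    show "\<bar>V' t\<bar> \<le> F" for t by (auto simp: V'_def F_def)
    show "AE t in lborel. V t = V' t" using r(2) bF
      by eventually_elim (auto simp: V'_def)
  qed
qed

lemma lebesgue_integral_representative:
  fixes g g' :: "real \<Rightarrow> 'a::{banach, second_countable_topology}"
  assumes "g \<in> borel_measurable lebesgue" and g' [measurable]: "g' \<in> borel_measurable borel" and "AE t in lborel. g t = g' t"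
  shows "(LINT t|lebesgue. g t) = (LBINT t. g' t)"
proof -
  have "(LINT t|lebesgue. g t) = (LINT t|lebesgue. g' t)"
    by (rule integral_cong_AE[OF assms(1) _ AE_completion[OF assms(3)]]) (simp add: measurable_completion)
  also have "\<dots> = (LBINT t. g' t)" by (rule integral_completion) simp
  finally show ?thesis .
qed

lemma cs_extension_poisson_ext:
  assumes m: "u \<in> borel_measurable lebesgue" and u' [measurable]: "u' \<in> borel_measurable borel" and ae: "AE t in lborel. u t = u' t"
  shows "cs_extension u x y = poisson_ext u' x y"
proof -
  obtain N where N: "N \<in> null_sets lborel" "{t. u t \<noteq> u' t} \<subseteq> N"
    using ae by (auto elim!: AE_E simp: null_sets_def)
  then have [measurable]: "N \<in> sets borel" by auto
  have "AE t in lborel. t \<notin> N" using N(1) by (rule AE_not_in)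
  then have "AE h in lborel. x + (-1) * h \<notin> N" by (intro AE_borel_affine) auto
  then have ae': "AE h in lborel. u (x - h) = u' (x - h)" by eventually_elim (use N in auto)
  have "cs_extension u x y = (LINT h|lebesgue. of_real (poisson_kernel y h) * u' (x - h))"
  proof -
    have mu': "(\<lambda>h. of_real (poisson_kernel y h) * u' (x - h)) \<in> borel_measurable lebesgue"
      by (intro measurable_completion) measurable
    have ae2: "AE h in lebesgue. of_real (poisson_kernel y h) * u (x - h) = of_real (poisson_kernel y h) * u' (x - h)"
      using AE_completion[OF ae'] by eventually_elim simp
    have "(\<lambda>h. x + (\<Sum>j\<in>Basis. (-1 * (h \<bullet> j)) *\<^sub>R j)) \<in> lebesgue \<rightarrow>\<^sub>M (lebesgue :: real measure)"
      by (rule lebesgue_affine_measurable) simp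
    then have "(\<lambda>h. x - h) \<in> lebesgue \<rightarrow>\<^sub>M lebesgue" by simp
    from measurable_compose[OF this m] have ux: "(\<lambda>h. u (x - h)) \<in> borel_measurable lebesgue" .
    have "(\<lambda>h. complex_of_real (poisson_kernel y h)) \<in> borel_measurable lebesgue"
      by (intro measurable_completion) measurable
    from borel_measurable_times[OF this ux]
    have "(\<lambda>h. of_real (poisson_kernel y h) * u (x - h)) \<in> borel_measurable lebesgue" .
    then show ?thesis unfolding cs_extension_def using ae2 mu'
      by (intro integral_cong_AE)
  qed
  also have "\<dots> = (LBINT h. of_real (poisson_kernel y h) * u' (x - h))" by (rule integral_completion) measurable
  also have "\<dots> = poisson_ext u' x y"
    unfolding poisson_ext_def using lborel_integral_reflect[of "\<lambda>t. of_real (poisson_kernel y (x - t)) * u' t" x] by simp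
  finally show ?thesis .
qed

section \<open>Reduction to unit scale\<close>

text \<open>
  In the variable \<open>z\<close> with \<open>y = z\<^sup>2 / 2\<close> the curve of the
  statement is the half circle of radius \<open>\<rho>\<^sup>2 / 2\<close>.
\<close>

lemma circle_integral_poisson_ext:
  assumes m: "u \<in> borel_measurable lebesgue" and u' [measurable]: "u' \<in> borel_measurable borel" and ae: "AE t in lborel. u t = u' t"
  shows "(LINT \<phi>:{0<..<pi}|lebesgue. (cmod (sq_lift (cs_extension u) (\<rho>\<^sup>2 / 2 * cos \<phi>) (\<rho> * sqrt (sin \<phi>))))\<^sup>2 * sin \<phi> powr (1/2))
     = (LBINT \<phi>:{0..pi}. (norm (poisson_ext u' (\<rho>\<^sup>2 / 2 * cos \<phi>) (\<rho>\<^sup>2 / 2 * sin \<phi>)))\<^sup>2 * sin_weight \<phi>)"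
proof -
  have "indicator {0<..<pi} \<phi> *\<^sub>R ((cmod (sq_lift (cs_extension u) (\<rho>\<^sup>2 / 2 * cos \<phi>) (\<rho> * sqrt (sin \<phi>))))\<^sup>2 * sin \<phi> powr (1/2))
    = indicator {0..pi} \<phi> *\<^sub>R ((norm (poisson_ext u' (\<rho>\<^sup>2 / 2 * cos \<phi>) (\<rho>\<^sup>2 / 2 * sin \<phi>)))\<^sup>2 * sin_weight \<phi>)" for \<phi>
  proof (cases "\<phi> \<in> {0<..<pi}")
    case True
    then have "sin \<phi> > 0" by (intro sin_gt_zero) auto
    then have "(\<rho> * sqrt (sin \<phi>))\<^sup>2 / 2 = \<rho>\<^sup>2 / 2 * sin \<phi>" by (simp add: power_mult_distrib)
    then show ?thesis using True unfolding sq_lift_def cs_extension_poisson_ext[OF m u' ae] sin_weight_def by simp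
  next
    case False
    then show ?thesis by (cases "\<phi> \<in> {0..pi}") (auto simp: indicator_def)
  qed
  moreover have "(LINT \<phi>|lebesgue. indicator {0..pi} \<phi> *\<^sub>R ((norm (poisson_ext u' (\<rho>\<^sup>2 / 2 * cos \<phi>) (\<rho>\<^sup>2 / 2 * sin \<phi>)))\<^sup>2 * sin_weight \<phi>))
     = (LBINT \<phi>. indicator {0..pi} \<phi> *\<^sub>R ((norm (poisson_ext u' (\<rho>\<^sup>2 / 2 * cos \<phi>) (\<rho>\<^sup>2 / 2 * sin \<phi>)))\<^sup>2 * sin_weight \<phi>))"
    unfolding poisson_ext_def by (rule integral_completion) measurable
  ultimately show ?thesis unfolding set_lebesgue_integral_def by simp
qed

lemma integral_annulus_scale:
  fixes u' :: "real \<Rightarrow> complex"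
  assumes m: "u \<in> borel_measurable lebesgue" and u' [measurable]: "u' \<in> borel_measurable borel" and ae: "AE t in lborel. u t = u' t"
    and \<rho>: "\<rho> > 0"
  shows "(LINT x:boundary_annulus 20 \<rho>|lebesgue. (cmod (u x))\<^sup>2 / \<bar>x\<bar>) = (LBINT x:unit_annulus. (norm (u' (\<rho>\<^sup>2 / 2 * x)))\<^sup>2 / \<bar>x\<bar>)"
proof -
  define R where "R = \<rho>\<^sup>2 / 2"
  have R: "R > 0" using \<rho> by (simp add: R_def)
  have BA [measurable]: "boundary_annulus 20 \<rho> \<in> sets borel" unfolding boundary_annulus_def by measurable
  have BAl: "boundary_annulus 20 \<rho> \<in> sets lebesgue" using BA by simp
  have mem: "R * x \<in> boundary_annulus 20 \<rho> \<longleftrightarrow> x \<in> unit_annulus" for x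
    using R by (auto simp: boundary_annulus_def unit_annulus_def R_def[symmetric] abs_mult)
  have "(LINT x:boundary_annulus 20 \<rho>|lebesgue. (cmod (u x))\<^sup>2 / \<bar>x\<bar>) = (LBINT x. indicator (boundary_annulus 20 \<rho>) x *\<^sub>R ((norm (u' x))\<^sup>2 / \<bar>x\<bar>))"
    unfolding set_lebesgue_integral_def
  proof (rule lebesgue_integral_representative)
    show "(\<lambda>x. indicator (boundary_annulus 20 \<rho>) x *\<^sub>R ((cmod (u x))\<^sup>2 / \<bar>x\<bar>)) \<in> borel_measurable lebesgue"
    proof -
      have "(\<lambda>x::real. \<bar>x\<bar>) \<in> borel_measurable lebesgue" by (intro measurable_completion) measurable
      then show ?thesis using m BAl by measurable
    qed
    show "AE t in lborel. indicator (boundary_annulus 20 \<rho>) t *\<^sub>R ((cmod (u t))\<^sup>2 / \<bar>t\<bar>) = indicator (boundary_annulus 20 \<rho>) t *\<^sub>R ((norm (u' t))\<^sup>2 / \<bar>t\<bar>)"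
      using ae by eventually_elim simp
  qed measurable
  also have "\<dots> = \<bar>R\<bar> *\<^sub>R (LBINT x. indicator (boundary_annulus 20 \<rho>) (0 + R * x) *\<^sub>R ((norm (u' (0 + R * x)))\<^sup>2 / \<bar>0 + R * x\<bar>))"
    using R by (intro lborel_integral_real_affine) auto
  also have "\<dots> = (LBINT x. R * (indicator (boundary_annulus 20 \<rho>) (0 + R * x) *\<^sub>R ((norm (u' (0 + R * x)))\<^sup>2 / \<bar>0 + R * x\<bar>)))"
    using R by (simp only: integral_mult_right_zero real_scaleR_def abs_of_pos)
  also have "\<dots> = (LBINT x:unit_annulus. (norm (u' (R * x)))\<^sup>2 / \<bar>x\<bar>)"
    unfolding set_lebesgue_integral_def
    using R by (intro Bochner_Integration.integral_cong) (auto simp: indicator_def mem abs_mult)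
  finally show ?thesis by (simp only: R_def)
qed

text \<open>
  Cauchy--Schwarz in the form \<open>2 * v \<le> l * v\<^sup>2 / \<bar>x\<bar> + \<bar>x\<bar> /
  l\<close> with an optimal choice of \<open>l\<close>; on the annulus
  \<open>\<bar>x\<bar>\<close> is at most \<open>exp 42\<close>.
\<close>

lemma annulus_L1_from_weighted_L2:
  fixes g :: "real \<Rightarrow> complex"
  assumes [measurable]: "g \<in> borel_measurable borel" and F: "\<And>t. norm (g t) \<le> F"
    and e: "(LBINT x:unit_annulus. (norm (g x))\<^sup>2 / \<bar>x\<bar>) \<le> e\<^sup>2" "e > 0"
  shows "(\<integral>\<^sup>+x\<in>unit_annulus. ennreal (norm (g x)) \<partial>lborel) \<le> ennreal (2 * exp 42 * e)"
proof -
  define L where "L = exp (42 :: real)"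
  have L: "L > 0" by (simp add: L_def)
  have annL: "\<bar>x\<bar> < L" "\<bar>x\<bar> > exp (-40)" "\<bar>x\<bar> > 0" if "x \<in> unit_annulus" for x
    using that less_trans[OF exp_gt_zero, of "-40" "\<bar>x\<bar>"] by (auto simp: unit_annulus_def L_def)
  have i1: "integrable lborel (\<lambda>x. indicator unit_annulus x * ((norm (g x))\<^sup>2 / \<bar>x\<bar>))"
  proof (rule Bochner_Integration.integrable_bound[OF integrable_const_Icc[of "F\<^sup>2 / exp (-40)" "-L" L]])
    show "AE x in lborel. norm (indicator unit_annulus x * ((norm (g x))\<^sup>2 / \<bar>x\<bar>)) \<le> norm (F\<^sup>2 / exp (-40) * indicator {-L..L} x)"
    proof (rule AE_I2)
      fix x
      show "norm (indicator unit_annulus x * ((norm (g x))\<^sup>2 / \<bar>x\<bar>)) \<le> norm (F\<^sup>2 / exp (-40) * indicator {-L..L} x)"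
      proof (cases "x \<in> unit_annulus")
        case True
        have "(norm (g x))\<^sup>2 / \<bar>x\<bar> \<le> F\<^sup>2 / exp (-40)"
          using annL[OF True] F[of x] by (intro frac_le power_mono) auto
        moreover have "x \<in> {-L..L}" using annL(1)[OF True] by auto
        ultimately show ?thesis using True by simp
      qed simp
    qed
  qed measurable
  (* With this value the two terms become L * e / 2 and L * e. *)
  define l where "l = L / e"
  have l: "l > 0" using L e by (simp add: l_def)
  have pt: "indicator unit_annulus x * norm (g x) \<le> l / 2 * (indicator unit_annulus x * ((norm (g x))\<^sup>2 / \<bar>x\<bar>)) + L / (2 * l) * indicator {-L..L} x" for x
  proof (cases "x \<in> unit_annulus")
    case True
    note a = annL[OF True]
    define v where "v = norm (g x)"
    have "2 * v \<le> l * (v\<^sup>2 / \<bar>x\<bar>) + \<bar>x\<bar> / l"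
    proof -
      have "0 \<le> (l * v - \<bar>x\<bar>)\<^sup>2 / (l * \<bar>x\<bar>)" using l by simp
      also have "\<dots> = l * (v\<^sup>2 / \<bar>x\<bar>) + \<bar>x\<bar> / l - 2 * v"
        using l a(3) by (simp add: power2_eq_square field_simps)
      finally show ?thesis by simp
    qed
    also have "\<dots> \<le> l * (v\<^sup>2 / \<bar>x\<bar>) + L / l" using a(1) l by (intro add_left_mono divide_right_mono) auto
    finally have v: "2 * v \<le> l * (v\<^sup>2 / \<bar>x\<bar>) + L / l" .
    have "v \<le> (l * (v\<^sup>2 / \<bar>x\<bar>) + L / l) / 2" using v by (simp only: le_divide_eq_numeral1 mult.commute[of v])
    also have "\<dots> = l / 2 * (v\<^sup>2 / \<bar>x\<bar>) + L / (2 * l)" by (simp add: add_divide_distrib)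
    finally have "v \<le> l / 2 * (v\<^sup>2 / \<bar>x\<bar>) + L / (2 * l)" .
    moreover have "x \<in> {-L..L}" using a(1) by auto
    ultimately show ?thesis using True by (simp add: v_def)
  next
    case False
    then show ?thesis using l L by simp
  qed
  have i2: "integrable lborel (\<lambda>x. L / (2 * l) * indicator {-L..L} x)" by (rule integrable_const_Icc)
  have i3: "(LBINT x. L / (2 * l) * indicator {-L..L} x) = L / (2 * l) * (2 * L)"
    unfolding integral_mult_right_zero using L by simp
  have "(\<integral>\<^sup>+x\<in>unit_annulus. ennreal (norm (g x)) \<partial>lborel) = (\<integral>\<^sup>+x. ennreal (indicator unit_annulus x * norm (g x)) \<partial>lborel)"
    by (intro nn_integral_cong) (auto simp: indicator_def)
  also have "\<dots> \<le> (\<integral>\<^sup>+x. ennreal (l / 2 * (indicator unit_annulus x * ((norm (g x))\<^sup>2 / \<bar>x\<bar>)) + L / (2 * l) * indicator {-L..L} x) \<partial>lborel)"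
    by (intro nn_integral_mono ennreal_leI pt)
  also have "\<dots> = ennreal (LBINT x. l / 2 * (indicator unit_annulus x * ((norm (g x))\<^sup>2 / \<bar>x\<bar>)) + L / (2 * l) * indicator {-L..L} x)"
    using l L by (intro nn_integral_eq_integral Bochner_Integration.integrable_add integrable_mult_right i1 i2)
      (auto intro!: AE_I2 add_nonneg_nonneg mult_nonneg_nonneg)
  also have "(LBINT x. l / 2 * (indicator unit_annulus x * ((norm (g x))\<^sup>2 / \<bar>x\<bar>)) + L / (2 * l) * indicator {-L..L} x)
     = l / 2 * (LBINT x:unit_annulus. (norm (g x))\<^sup>2 / \<bar>x\<bar>) + L / (2 * l) * (2 * L)"
    unfolding Bochner_Integration.integral_add[OF integrable_mult_right[OF i1] i2] i3
    by (simp only: set_lebesgue_integral_def real_scaleR_def integral_mult_right_zero)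
  also have "\<dots> \<le> l / 2 * e\<^sup>2 + L / (2 * l) * (2 * L)" using l e by (intro add_right_mono mult_left_mono) auto
  also have "\<dots> \<le> 2 * exp 42 * e" using L e(2) by (simp add: l_def L_def[symmetric] power2_eq_square field_simps)
  finally show ?thesis by (simp add: ennreal_leI)
qed

lemma Linf_norm_bound:
  fixes V :: "real \<Rightarrow> real"
  assumes V: "in_Linf V" and A: "A \<in> sets lebesgue"
  shows "AE x in lborel. x \<in> A \<longrightarrow> \<bar>V x\<bar> \<le> Linf_norm A V"
proof -
  define e where "e = esssup (lebesgue_on A) (\<lambda>x. ereal (norm (V x)))"
  have m: "(\<lambda>x. ereal (norm (V x))) \<in> borel_measurable lebesgue"
    using V unfolding in_Linf_def by (intro borel_measurable_ereal borel_measurable_norm) auto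
  have "e \<le> esssup lebesgue (\<lambda>x. ereal (norm (V x)))"
    unfolding e_def
  proof (rule esssup_I)
    show "(\<lambda>x. ereal (norm (V x))) \<in> borel_measurable (lebesgue_on A)" using m by (rule measurable_restrict_space1)
    have "AE x in lebesgue. ereal (norm (V x)) \<le> esssup lebesgue (\<lambda>x. ereal (norm (V x)))" by (rule esssup_AE)
    then show "AE x in lebesgue_on A. ereal (norm (V x)) \<le> esssup lebesgue (\<lambda>x. ereal (norm (V x)))"
      using A by (subst AE_restrict_space_iff) auto
  qed
  also have "\<dots> < \<infinity>" using V by (simp add: in_Linf_def)
  finally have e: "e < \<infinity>" .
  have "AE x in lebesgue_on A. ereal (norm (V x)) \<le> e" unfolding e_def by (rule esssup_AE)
  then have "AE x in lebesgue. x \<in> A \<longrightarrow> ereal (norm (V x)) \<le> e"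
    using A by (subst (asm) AE_restrict_space_iff) auto
  then have "AE x in lborel. x \<in> A \<longrightarrow> ereal (norm (V x)) \<le> e" by (simp only: AE_completion_iff)
  then show ?thesis
  proof eventually_elim
    case (elim x)
    then show ?case using e unfolding Linf_norm_def e_def[symmetric] by (cases e) auto
  qed
qed

text \<open>
  The extension is a potential, and a dilation by \<open>R = \<rho>\<^sup>2 / 2\<close> brings the
  half circle to radius one. The data bound of \<open>unit_scale_estimate\<close> is a multiple
  of \<open>(1 + sqrt R * \<parallel>V\<parallel>) * sqrt J\<close>, where \<open>J\<close> is
  the integral of the statement, so the exponent is \<open>1/2\<close>; the first factor is at
  most exponential in \<open>R * \<parallel>V\<parallel>\<^sup>2\<close>.
\<close>

theorem corollary12p1:
  shows "\<exists>d>1. \<exists>C>0. \<exists>\<theta>\<in>{0<..<1}.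
    \<forall>(V::real \<Rightarrow> real) (u::real \<Rightarrow> complex).
      in_Linf V \<and> in_Linf u \<and> in_Hs_loc (1/4) u \<and> distributional_solution V u \<longrightarrow>
      (\<forall>\<rho>>0.
        H_fun \<rho> (sq_lift (cs_extension u))
          \<le> C * exp (C * (1 + \<rho>\<^sup>2 * (Linf_norm (boundary_annulus d \<rho>) V)\<^sup>2))
              * M_fun d \<rho> (sq_lift (cs_extension u)) powr (2 * (1 - \<theta>))
              * (LINT x:boundary_annulus d \<rho>|lebesgue. (cmod (u x))\<^sup>2 / \<bar>x\<bar>) powr \<theta>)"
proof -
  obtain C0 where C0: "C0 > 0" and est: "\<forall>(f :: real \<Rightarrow> complex) c F B0 M \<delta>.
     f \<in> borel_measurable borel \<longrightarrow> (\<forall>t. norm (f t) \<le> F) \<longrightarrow>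
     (\<forall>x y. y > 0 \<longrightarrow> norm (potential c f x y) \<le> B0) \<longrightarrow> M > 0 \<longrightarrow> \<delta> > 0 \<longrightarrow>
     (\<forall>r. exp (-40) < r \<longrightarrow> r < exp 42 \<longrightarrow> (LBINT \<phi>:{0..pi}. (norm (potential c f (r * cos \<phi>) (r * sin \<phi>)))\<^sup>2 * sin_weight \<phi>) \<le> M\<^sup>2) \<longrightarrow>
     (\<integral>\<^sup>+x\<in>unit_annulus. ennreal (norm (potential c f x 0)) \<partial>lborel) \<le> ennreal \<delta> \<longrightarrow>
     (\<integral>\<^sup>+x\<in>unit_annulus. ennreal (norm (f x)) \<partial>lborel) \<le> ennreal \<delta> \<longrightarrow>
     (LBINT \<phi>:{0..pi}. (norm (potential c f (cos \<phi>) (sin \<phi>)))\<^sup>2 * sin_weight \<phi>) \<le> C0 * M * \<delta>"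
    using unit_scale_estimate by (elim exE conjE) (rule that)
  define C where "C = C0 * (2 * exp 42) + \<bar>neumann_const\<bar> + 1"
  have C: "C > 0" using C0 by (simp add: C_def add_pos_pos add_nonneg_pos)
  have main: "H_fun \<rho> (sq_lift (cs_extension u))
          \<le> C * exp (C * (1 + \<rho>\<^sup>2 * (Linf_norm (boundary_annulus 20 \<rho>) V)\<^sup>2))
              * M_fun 20 \<rho> (sq_lift (cs_extension u)) powr (2 * (1 - 1/2))
              * (LINT x:boundary_annulus 20 \<rho>|lebesgue. (cmod (u x))\<^sup>2 / \<bar>x\<bar>) powr (1/2)"
    if V: "in_Linf V" and u: "in_Linf u" and sol: "distributional_solution V u" and \<rho>: "\<rho> > 0" for V u \<rho>
  proof -
    obtain u' Fu where u' [measurable]: "u' \<in> borel_measurable borel" and u'F: "\<And>t. norm (u' t) \<le> Fu" and u'ae: "AE t in lborel. u t = u' t"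
      using borel_bounded_representative[OF u] by metis
    obtain V' Fv where V' [measurable]: "V' \<in> borel_measurable borel" and V'F: "\<And>t. \<bar>V' t\<bar> \<le> Fv" and V'ae: "AE t in lborel. V t = V' t"
      using borel_bounded_representative_real[OF V] by metis
    have um: "u \<in> borel_measurable lebesgue" and Vm: "V \<in> borel_measurable lebesgue" using u V by (auto simp: in_Linf_def)
    have Fu0: "Fu \<ge> 0" using norm_ge_zero u'F by (rule order_trans)
    have Fv0: "Fv \<ge> 0" using abs_ge_zero V'F by (rule order_trans)
    define f0 where "f0 t = - (of_real (V' t) * u' t)" for t
    define F where "F = Fu + Fv * Fu"
    have [measurable]: "f0 \<in> borel_measurable borel" unfolding f0_def by measurable
    have f0F: "norm (f0 t) \<le> F" for t
    proof -
      have "norm (f0 t) \<le> Fv * Fu" unfolding f0_def norm_minus_cancel norm_mult using V'F u'F Fv0 by (intro mult_mono) auto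
      then show ?thesis using Fu0 by (simp add: F_def)
    qed
    have uF: "norm (u' t) \<le> F" for t using u'F[of t] Fu0 Fv0 by (simp add: F_def add_increasing2)
    have eq: "(LBINT t. u' t * of_real (frac_heat s (t - x))) = (LBINT t. f0 t * of_real (heat_kernel s (t - x)))" if s: "s > 0" for x s
    proof -
      have "(\<lambda>t. complex_of_real (frac_heat s (t - x))) \<in> borel_measurable lebesgue" "(\<lambda>t. complex_of_real (heat_kernel s (t - x))) \<in> borel_measurable lebesgue"
        by (intro measurable_completion; measurable)+
      note lm = this
      have "(LINT t|lebesgue. u t * of_real (frac_heat s (t - x))) = (LBINT t. u' t * of_real (frac_heat s (t - x)))"
      proof (rule lebesgue_integral_representative)
        show "AE t in lborel. u t * of_real (frac_heat s (t - x)) = u' t * of_real (frac_heat s (t - x))" using u'ae by eventually_elim simp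
        show "(\<lambda>t. u t * of_real (frac_heat s (t - x))) \<in> borel_measurable lebesgue" using um lm(1) by (rule borel_measurable_times)
      qed measurable
      moreover have "(LINT t|lebesgue. of_real (V t) * u t * of_real (heat_kernel s (t - x))) = (LBINT t. of_real (V' t) * u' t * of_real (heat_kernel s (t - x)))"
      proof (rule lebesgue_integral_representative)
        show "AE t in lborel. of_real (V t) * u t * of_real (heat_kernel s (t - x)) = of_real (V' t) * u' t * of_real (heat_kernel s (t - x))"
          using u'ae V'ae by eventually_elim simp
        show "(\<lambda>t. of_real (V t) * u t * of_real (heat_kernel s (t - x))) \<in> borel_measurable lebesgue"
        proof -
          have "(\<lambda>t. complex_of_real (V t)) \<in> borel_measurable lebesgue"
            by (rule measurable_compose[OF Vm]) measurable
          then show ?thesis using um lm(2) by (intro borel_measurable_times)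
        qed
      qed measurable
      moreover have "(LBINT t. f0 t * of_real (heat_kernel s (t - x))) = - (LBINT t. of_real (V' t) * u' t * of_real (heat_kernel s (t - x)))"
        unfolding f0_def by simp
      ultimately show ?thesis using distributional_solution_heat_kernel[OF sol s, of x] by simp
    qed
    define f where "f t = of_real neumann_const * f0 t" for t
    define c where "c = poisson_ext u' 0 1"
    note tr = boundary_trace[OF u' \<open>f0 \<in> borel_measurable borel\<close> uF f0F eq, folded f_def c_def]
    have [measurable]: "f \<in> borel_measurable borel" unfolding f_def by measurable
    have fF: "norm (f t) \<le> \<bar>neumann_const\<bar> * F" for t
      unfolding f_def norm_mult using f0F by (intro mult_mono) auto
    define R where "R = \<rho>\<^sup>2 / 2"
    have R: "R > 0" using \<rho> by (simp add: R_def)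
    (* The rescaled potential, whose half circle of radius one is the one of the statement. *)
    define cR where "cR = potential c f 0 R"
    define fR where "fR t = of_real (sqrt R) * f (R * t)" for t
    have [measurable]: "fR \<in> borel_measurable borel" unfolding fR_def by measurable
    have fRF: "norm (fR t) \<le> sqrt R * (\<bar>neumann_const\<bar> * F)" for t
      unfolding fR_def norm_mult using fF R by (intro mult_mono) auto
    have sc: "potential cR fR x y = potential c f (R * x) (R * y)" if "y \<ge> 0" for x y
      unfolding cR_def fR_def by (rule potential_scale[OF _ fF R that]) measurable
    have scp: "potential cR fR x y = poisson_ext u' (R * x) (R * y)" if "y > 0" for x y
      using sc[of y x] tr(1)[of "R * y" "R * x"] that R by simp
    define Q where "Q r = (LBINT \<phi>:{0..pi}. (norm (potential cR fR (r * cos \<phi>) (r * sin \<phi>)))\<^sup>2 * sin_weight \<phi>)" for r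
    have Qp: "Q r = (LBINT \<phi>:{0..pi}. (norm (poisson_ext u' (R * r * cos \<phi>) (R * r * sin \<phi>)))\<^sup>2 * sin_weight \<phi>)" if r: "r > 0" for r
      unfolding Q_def set_lebesgue_integral_def
    proof (intro Bochner_Integration.integral_cong refl)
      fix \<phi> :: real
      show "indicator {0..pi} \<phi> *\<^sub>R ((norm (potential cR fR (r * cos \<phi>) (r * sin \<phi>)))\<^sup>2 * sin_weight \<phi>) = indicator {0..pi} \<phi> *\<^sub>R ((norm (poisson_ext u' (R * r * cos \<phi>) (R * r * sin \<phi>)))\<^sup>2 * sin_weight \<phi>)"
      proof (cases "\<phi> \<in> {0<..<pi}")
        case True
        then have "sin \<phi> > 0" by (intro sin_gt_zero) auto
        then show ?thesis using r scp[of "r * sin \<phi>" "r * cos \<phi>"] by (simp add: mult.assoc)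
      next
        case False
        then show ?thesis by (cases "\<phi> \<in> {0..pi}") (auto simp: indicator_def)
      qed
    qed
    have potb: "norm (potential cR fR x y) \<le> F" if "y > 0" for x y
      unfolding scp[OF that] using that R by (intro poisson_ext_bounded u' uF) auto
    have Qb: "0 \<le> Q r" "Q r \<le> F\<^sup>2 * pi" if r: "r > 0" for r
    proof -
      show "0 \<le> Q r" unfolding Q_def set_lebesgue_integral_def by (intro Bochner_Integration.integral_nonneg) auto
      show "Q r \<le> F\<^sup>2 * pi" unfolding Q_def
      proof (rule sin_weight_integral_le(1))
        fix \<phi> assume \<phi>: "\<phi> \<in> {0..pi}"
        show "(norm (potential cR fR (r * cos \<phi>) (r * sin \<phi>)))\<^sup>2 * sin_weight \<phi> \<le> F\<^sup>2"
        proof (cases "\<phi> = 0 \<or> \<phi> = pi")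
          case False
          then have "sin \<phi> > 0" using \<phi> by (intro sin_gt_zero) auto
          then have "(norm (potential cR fR (r * cos \<phi>) (r * sin \<phi>)))\<^sup>2 * sin_weight \<phi> \<le> F\<^sup>2 * 1"
            using r by (intro mult_mono power_mono potb sin_weight_le_1 \<phi>) auto
          then show ?thesis by simp
        qed auto
      qed auto
    qed
    have H: "H_fun \<rho> (sq_lift (cs_extension u)) = Q 1"
      unfolding H_fun_def circle_integral_poisson_ext[OF um u' u'ae] Qp[OF zero_less_one] R_def by simp
    have ang: "angular_norm (\<lambda>\<phi>. sq_lift (cs_extension u) (\<rho>\<^sup>2 * exp (2 * \<tau>) / 2 * cos \<phi>) (\<rho> * exp \<tau> * sqrt (sin \<phi>))) = sqrt (Q (exp (2 * \<tau>)))" for \<tau>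
    proof -
      have "(\<rho> * exp \<tau>)\<^sup>2 = \<rho>\<^sup>2 * exp (2 * \<tau>)" by (simp only: power_mult_distrib exp_double)
      then show ?thesis
        unfolding angular_norm_def using circle_integral_poisson_ext[OF um u' u'ae, of "\<rho> * exp \<tau>"] Qp[of "exp (2 * \<tau>)"] by (simp add: R_def)
    qed
    define M where "M = M_fun 20 \<rho> (sq_lift (cs_extension u))"
    have Mdef: "M = (SUP \<tau>\<in>{-20<..<1 + 20}. sqrt (Q (exp (2 * \<tau>))))" unfolding M_def M_fun_def ang ..
    have bdd: "bdd_above ((\<lambda>\<tau>. sqrt (Q (exp (2 * \<tau>)))) ` {-20<..<1 + 20})"
      using Qb by (intro bdd_aboveI2[where M = "sqrt (F\<^sup>2 * pi)"] real_sqrt_le_mono) auto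
    (* The radii are exp (2 * tau) with tau in the interval of the supremum; the supremum is finite
       because the extension is bounded. *)
    have sqQ: "sqrt (Q r) \<le> M" if r: "exp (-40) < r" "r < exp 42" for r
    proof -
      have r0: "r > 0" using less_trans[OF exp_gt_zero r(1)] .
      define \<tau> where "\<tau> = ln r / 2"
      have "exp (-40) < exp (ln r)" "exp (ln r) < exp 42" using r r0 by simp_all
      then have "ln r > -40" "ln r < 42" by (simp_all only: exp_less_cancel_iff)
      then have "\<tau> \<in> {-20<..<1 + 20}" by (auto simp: \<tau>_def)
      then have "sqrt (Q (exp (2 * \<tau>))) \<le> M" unfolding Mdef by (intro cSUP_upper bdd)
      then show ?thesis using r0 by (simp add: \<tau>_def)
    qed
    have M0: "M \<ge> 0" using sqQ[of 1] Qb(1)[of 1] by (intro order_trans[OF _ sqQ[of 1]]) auto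
    have QM: "Q r \<le> M\<^sup>2" if r: "exp (-40) < r" "r < exp 42" for r
    proof -
      have r0: "r > 0" using less_trans[OF exp_gt_zero r(1)] .
      have "(sqrt (Q r))\<^sup>2 \<le> M\<^sup>2" using sqQ[OF r] Qb(1)[OF r0] by (intro power_mono) auto
      then show ?thesis using Qb(1)[OF r0] by simp
    qed
    define J where "J = (LINT x:boundary_annulus 20 \<rho>|lebesgue. (cmod (u x))\<^sup>2 / \<bar>x\<bar>)"
    have J: "J = (LBINT x:unit_annulus. (norm (u' (R * x)))\<^sup>2 / \<bar>x\<bar>)"
      unfolding J_def R_def by (rule integral_annulus_scale[OF um u' u'ae \<rho>])
    have J0: "J \<ge> 0" unfolding J set_lebesgue_integral_def by (intro Bochner_Integration.integral_nonneg) auto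
    define Vn where "Vn = Linf_norm (boundary_annulus 20 \<rho>) V"
    (* The norm is an essential supremum converted to a real number; passing to the positive part
       avoids a discussion of its sign. *)
    define Vp where "Vp = max 0 Vn"
    have BA [measurable]: "boundary_annulus 20 \<rho> \<in> sets borel" unfolding boundary_annulus_def by measurable
    have mem: "R * x \<in> boundary_annulus 20 \<rho> \<longleftrightarrow> x \<in> unit_annulus" for x
      using R by (auto simp: boundary_annulus_def unit_annulus_def R_def[symmetric] abs_mult)
    have "AE x in lborel. x \<in> boundary_annulus 20 \<rho> \<longrightarrow> \<bar>V' x\<bar> \<le> Vp"
      using Linf_norm_bound[OF V, of "boundary_annulus 20 \<rho>"] V'ae BA
      by (auto simp: Vp_def Vn_def elim: AE_mp)
    then have "AE x in lborel. 0 + R * x \<in> boundary_annulus 20 \<rho> \<longrightarrow> \<bar>V' (0 + R * x)\<bar> \<le> Vp"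
      using R by (intro AE_borel_affine) auto
    then have Vae: "AE x in lborel. x \<in> unit_annulus \<longrightarrow> \<bar>V' (R * x)\<bar> \<le> Vp" by (simp add: mem)
    have "AE x in lborel. u' (0 + R * x) = potential c f (0 + R * x) 0"
      using R tr(2) by (intro AE_borel_affine) auto
    then have uae: "AE x in lborel. potential cR fR x 0 = u' (R * x)" by (simp add: sc eq_commute)
    define A where "A = (1 + sqrt R * \<bar>neumann_const\<bar> * Vp) * (2 * exp 42)"
    have z0: "sqrt R * \<bar>neumann_const\<bar> * Vp \<ge> 0" using R by (simp add: Vp_def)
    have A0: "A > 0" using z0 by (simp add: A_def add_pos_nonneg)
    (* The estimate at unit scale needs positive bounds, but the growth M and the data J may vanish;
       hence the additional epsilon, which tends to zero afterwards. *)
    have step: "Q 1 \<le> C0 * (M + \<epsilon>) * (A * (sqrt J + \<epsilon>))" if \<epsilon>: "\<epsilon> > 0" for \<epsilon>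
    proof -
      define e where "e = sqrt J + \<epsilon>"
      have e: "e > 0" using \<epsilon> J0 by (simp add: e_def add_nonneg_pos)
      have "J = (sqrt J)\<^sup>2" using J0 by simp
      also have "\<dots> \<le> e\<^sup>2" using J0 \<epsilon> by (intro power_mono) (auto simp: e_def)
      finally have Je: "J \<le> e\<^sup>2" .
      have L1: "(\<integral>\<^sup>+x\<in>unit_annulus. ennreal (norm (u' (R * x))) \<partial>lborel) \<le> ennreal (2 * exp 42 * e)"
        by (rule annulus_L1_from_weighted_L2[where F = Fu]) (use u'F Je e J in auto)
      have D: "(\<integral>\<^sup>+x\<in>unit_annulus. ennreal (norm (potential cR fR x 0)) \<partial>lborel) \<le> ennreal (A * e)"
      proof -
        have "(\<integral>\<^sup>+x\<in>unit_annulus. ennreal (norm (potential cR fR x 0)) \<partial>lborel) = (\<integral>\<^sup>+x\<in>unit_annulus. ennreal (norm (u' (R * x))) \<partial>lborel)"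
          by (rule nn_integral_cong_AE) (use uae in eventually_elim, simp)
        also have "\<dots> \<le> ennreal (2 * exp 42 * e)" by (rule L1)
        also have "\<dots> \<le> ennreal (A * e)"
          unfolding A_def using z0 e by (intro ennreal_leI mult_right_mono) (auto simp: distrib_right)
        finally show ?thesis .
      qed
      have N: "(\<integral>\<^sup>+x\<in>unit_annulus. ennreal (norm (fR x)) \<partial>lborel) \<le> ennreal (A * e)"
      proof -
        have "(\<integral>\<^sup>+x\<in>unit_annulus. ennreal (norm (fR x)) \<partial>lborel) \<le> (\<integral>\<^sup>+x. ennreal (sqrt R * \<bar>neumann_const\<bar> * Vp) * (ennreal (norm (u' (R * x))) * indicator unit_annulus x) \<partial>lborel)"
        proof (rule nn_integral_mono_AE, use Vae in eventually_elim)
          case (elim x)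
          show ?case
          proof (cases "x \<in> unit_annulus")
            case True
            have "norm (fR x) = sqrt R * \<bar>neumann_const\<bar> * \<bar>V' (R * x)\<bar> * norm (u' (R * x))"
              using R by (simp add: fR_def f_def f0_def norm_mult)
            also have "\<dots> \<le> sqrt R * \<bar>neumann_const\<bar> * Vp * norm (u' (R * x))"
              using elim True R by (intro mult_right_mono mult_left_mono) auto
            finally show ?thesis using True z0 by (simp add: ennreal_leI flip: ennreal_mult)
          qed simp
        qed
        also have "\<dots> = ennreal (sqrt R * \<bar>neumann_const\<bar> * Vp) * (\<integral>\<^sup>+x\<in>unit_annulus. ennreal (norm (u' (R * x))) \<partial>lborel)"
          by (rule nn_integral_cmult) measurable
        also have "\<dots> \<le> ennreal (sqrt R * \<bar>neumann_const\<bar> * Vp) * ennreal (2 * exp 42 * e)" by (intro mult_left_mono L1) auto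
        also have "\<dots> = ennreal (sqrt R * \<bar>neumann_const\<bar> * Vp * (2 * exp 42 * e))" using z0 e by (simp add: ennreal_mult)
        also have "\<dots> \<le> ennreal (A * e)"
          unfolding A_def using z0 e by (intro ennreal_leI) (simp add: distrib_right)
        finally show ?thesis .
      qed
      have "(LBINT \<phi>:{0..pi}. (norm (potential cR fR (cos \<phi>) (sin \<phi>)))\<^sup>2 * sin_weight \<phi>) \<le> C0 * (M + \<epsilon>) * (A * e)"
      proof (rule est[rule_format, of fR "sqrt R * (\<bar>neumann_const\<bar> * F)" cR F])
        show "(LBINT \<phi>:{0..pi}. (norm (potential cR fR (r * cos \<phi>) (r * sin \<phi>)))\<^sup>2 * sin_weight \<phi>) \<le> (M + \<epsilon>)\<^sup>2" if "exp (-40) < r" "r < exp 42" for r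
        proof -
          have "M\<^sup>2 \<le> (M + \<epsilon>)\<^sup>2" using M0 \<epsilon> by (intro power_mono) auto
          then show ?thesis using QM[OF that] by (simp add: Q_def)
        qed
      qed (use fRF potb M0 \<epsilon> A0 e D N in auto)
      then show ?thesis by (simp add: Q_def e_def)
    qed
    have Q1: "Q 1 \<le> C0 * M * (A * sqrt J)"
    proof (rule LIMSEQ_le_const)
      have "(\<lambda>n. C0 * (M + 1 / real (Suc n)) * (A * (sqrt J + 1 / real (Suc n)))) \<longlonglongrightarrow> C0 * (M + 0) * (A * (sqrt J + 0))"
        using LIMSEQ_inverse_real_of_nat by (intro tendsto_intros) (auto simp: inverse_eq_divide)
      then show "(\<lambda>n. C0 * (M + 1 / real (Suc n)) * (A * (sqrt J + 1 / real (Suc n)))) \<longlonglongrightarrow> C0 * M * (A * sqrt J)" by simp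
      show "\<exists>N. \<forall>n\<ge>N. Q 1 \<le> C0 * (M + 1 / real (Suc n)) * (A * (sqrt J + 1 / real (Suc n)))"
        using step by auto
    qed
    have Vsq: "Vp\<^sup>2 \<le> Vn\<^sup>2" unfolding Vp_def by (auto simp: max_def)
    define X where "X = 1 + \<rho>\<^sup>2 * Vn\<^sup>2"
    have X: "X \<ge> 1" by (simp add: X_def)
    (* From a \<le> 1 + a^2, a linear dependence on the norm of V is dominated by X. *)
    have zX: "sqrt R * \<bar>neumann_const\<bar> * Vp \<le> C * X"
    proof -
      have "sqrt R * Vp \<le> 1 + (sqrt R * Vp)\<^sup>2"
      proof -
        have "0 \<le> sqrt R * Vp" using R by (simp add: Vp_def)
        then show ?thesis using sum_squares_bound[of "sqrt R * Vp" 1] unfolding mult_1_right power_one by linarith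
      qed
      also have "(sqrt R * Vp)\<^sup>2 = R * Vp\<^sup>2" using R by (simp add: power_mult_distrib)
      also have "R * Vp\<^sup>2 \<le> \<rho>\<^sup>2 * Vn\<^sup>2" using Vsq by (intro mult_mono) (auto simp: R_def)
      finally have "sqrt R * Vp \<le> X" by (simp add: X_def)
      then have "\<bar>neumann_const\<bar> * (sqrt R * Vp) \<le> C * X"
        using R C0 X by (intro mult_mono) (auto simp: C_def Vp_def)
      then show ?thesis by (simp add: mult_ac)
    qed
    have "1 + sqrt R * \<bar>neumann_const\<bar> * Vp \<le> exp (sqrt R * \<bar>neumann_const\<bar> * Vp)" by (rule exp_ge_add_one_self)
    also have "\<dots> \<le> exp (C * X)" using zX by simp
    finally have ex: "1 + sqrt R * \<bar>neumann_const\<bar> * Vp \<le> exp (C * X)" .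
    have "Q 1 \<le> (C0 * (2 * exp 42)) * (1 + sqrt R * \<bar>neumann_const\<bar> * Vp) * M * sqrt J"
      using Q1 by (simp only: A_def mult_ac)
    also have "\<dots> \<le> C * exp (C * X) * M * sqrt J"
      using C0 ex z0 M0 J0 by (intro mult_right_mono mult_mono) (auto simp: C_def)
    also have "M = M powr (2 * (1 - 1/2))" using M0 by simp
    also have "sqrt J = J powr (1/2)" using J0 by (simp add: powr_half_sqrt)
    finally show ?thesis unfolding H X_def Vn_def J_def M_def .
  qed
  show ?thesis
    by (rule exI[of _ 20], rule conjI, simp, rule exI[of _ C], rule conjI, rule C, rule bexI[of _ "1/2"]) (use main in auto)
qed

end
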